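(* Let $X$ be a smooth manifold of dimension $2n$. If $2n\geq 10$, then every almost complex structure on $X$ is homotopic (through almost complex structures) to a maximally non-integrable one. If $2n\geq 6$, then every almost complex structure on $X$ is homotopic (through almost complex structures) to an everywhere non-integrable one.
   Context: An almost complex structure on a smooth $2n$-manifold $X$ is a section $J$ of $\operatorname{End}(TX)$ with $J^2=-1$. Let $T^{1,0}X$, $T^{0,1}X$ be the $\pm i$-eigenbundles of $J$ in $TX\otimes\mathbb{C}$, $A^{1,0}_X$, $A^{0,1}_X$ their duals, $A^{p,q}_X=\Lambda^pA^{1,0}_X\otimes\Lambda^qA^{0,1}_X$. The Nijenhuis tensor of $J$ is the complex bundle map $N_J:A^{1,0}_X\to A^{0,2}_X$, $N_J(\alpha)=\mathrm{pr}^{0,2}(d\alpha)$. $J$ is called maximally non-integrable if $N_J$ has maximal complex rank $\min\{n,\binom n2\}$ at every point $x\in X$, and everywhere non-integrable if $(N_J)_x\neq 0$ for every $x\in X$. *)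

theory Defs
  imports "HOL-Analysis.Analysis" "HOL-Library.Function_Algebras"
begin

section \<open>Smooth manifolds\<close>

text \<open>Only used for open sets \<open>S\<close>.\<close>

fun Ck_on :: "nat \<Rightarrow> 'e::euclidean_space set \<Rightarrow> ('e \<Rightarrow> 'f::real_normed_vector) \<Rightarrow> bool" where
  "Ck_on 0 S f \<longleftrightarrow> continuous_on S f"
| "Ck_on (Suc k) S f \<longleftrightarrow>
     (\<forall>x\<in>S. f differentiable (at x)) \<and> (\<forall>v. Ck_on k S (\<lambda>x. frechet_derivative f (at x) v))"

definition smooth_on :: "'e::euclidean_space set \<Rightarrow> ('e \<Rightarrow> 'f::real_normed_vector) \<Rightarrow> bool" where
  "smooth_on S f \<longleftrightarrow> (\<forall>k. Ck_on k S f)"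

type_synonym ('a, 'e) chart = "'a set \<times> ('a \<Rightarrow> 'e)"

definition is_chart :: "'a topology \<Rightarrow> ('a, 'e::euclidean_space) chart \<Rightarrow> bool" where
  "is_chart X = (\<lambda>(U, \<phi>). openin X U \<and> open (\<phi> ` U) \<and>
     homeomorphic_map (subtopology X U) (top_of_set (\<phi> ` U)) \<phi>)"

text \<open>The atlas is not required to be maximal; everything below depends on it only through the
  smooth functions, hence only through the maximal atlas that it generates.\<close>

definition smooth_manifold :: "'a topology \<Rightarrow> ('a, 'e::euclidean_space) chart set \<Rightarrow> bool" where
  "smooth_manifold X A \<longleftrightarrow>
     Hausdorff_space X \<and> second_countable X \<and>
     (\<forall>c\<in>A. is_chart X c) \<and> (\<Union>(U, \<phi>)\<in>A. U) = topspace X \<and>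
     (\<forall>(U, \<phi>)\<in>A. \<forall>(V, \<psi>)\<in>A. smooth_on (\<phi> ` (U \<inter> V)) (\<psi> \<circ> inv_into U \<phi>))"

text \<open>Values of functions, vector fields and forms at points outside \<open>topspace X\<close> are irrelevant.\<close>

definition smooth_fun :: "('a, 'e::euclidean_space) chart set \<Rightarrow> ('a \<Rightarrow> 'f::real_normed_vector) \<Rightarrow> bool"
  where "smooth_fun A f \<longleftrightarrow> (\<forall>(U, \<phi>)\<in>A. smooth_on (\<phi> ` U) (f \<circ> inv_into U \<phi>))"


section \<open>Tangent vectors and vector fields\<close>

text \<open>A tangent vector at \<open>p\<close> is a derivation at \<open>p\<close> of the algebra of smooth real functions. It is
  set to zero on non-smooth arguments, so that equality of tangent vectors is equality of HOL
  functions. Vector space operations are pointwise.\<close>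

type_synonym 'a tangent = "('a \<Rightarrow> real) \<Rightarrow> real"

definition tangent_space :: "('a, 'e::euclidean_space) chart set \<Rightarrow> 'a \<Rightarrow> 'a tangent set" where
  "tangent_space A p = {v.
     (\<forall>f g a b. smooth_fun A f \<longrightarrow> smooth_fun A g \<longrightarrow>
        v (\<lambda>x. a * f x + b * g x) = a * v f + b * v g) \<and>
     (\<forall>f g. smooth_fun A f \<longrightarrow> smooth_fun A g \<longrightarrow>
        v (\<lambda>x. f x * g x) = f p * v g + g p * v f) \<and>
     (\<forall>f. \<not> smooth_fun A f \<longrightarrow> v f = 0)}"

text \<open>An element \<open>v + iw\<close> of the complexified tangent space is the complex valued derivation
  \<open>f \<mapsto> v f + i w f\<close>.\<close>

type_synonym 'a ctangent = "('a \<Rightarrow> real) \<Rightarrow> complex"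

definition ctangent_space :: "('a, 'e::euclidean_space) chart set \<Rightarrow> 'a \<Rightarrow> 'a ctangent set" where
  "ctangent_space A p = {v. (\<lambda>f. Re (v f)) \<in> tangent_space A p \<and> (\<lambda>f. Im (v f)) \<in> tangent_space A p}"

definition vector_field ::
  "'a topology \<Rightarrow> ('a, 'e::euclidean_space) chart set \<Rightarrow> ('a \<Rightarrow> 'a tangent) \<Rightarrow> bool" where
  "vector_field X A V \<longleftrightarrow>
     (\<forall>p\<in>topspace X. V p \<in> tangent_space A p) \<and>
     (\<forall>f. smooth_fun A f \<longrightarrow> smooth_fun A (\<lambda>p. V p f))"

definition cvector_field ::
  "'a topology \<Rightarrow> ('a, 'e::euclidean_space) chart set \<Rightarrow> ('a \<Rightarrow> 'a ctangent) \<Rightarrow> bool" where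
  "cvector_field X A V \<longleftrightarrow>
     (\<forall>p\<in>topspace X. V p \<in> ctangent_space A p) \<and>
     (\<forall>f. smooth_fun A f \<longrightarrow> smooth_fun A (\<lambda>p. V p f))"

text \<open>The action of a complex tangent vector on complex valued functions.\<close>

definition cderiv :: "'a ctangent \<Rightarrow> ('a \<Rightarrow> complex) \<Rightarrow> complex" where
  "cderiv v g = v (\<lambda>x. Re (g x)) + \<i> * v (\<lambda>x. Im (g x))"

definition lie_bracket :: "('a \<Rightarrow> 'a ctangent) \<Rightarrow> ('a \<Rightarrow> 'a ctangent) \<Rightarrow> 'a \<Rightarrow> 'a ctangent" where
  "lie_bracket V W p f = cderiv (V p) (\<lambda>x. W x f) - cderiv (W p) (\<lambda>x. V x f)"


section \<open>Complex forms\<close>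

type_synonym 'a form1 = "'a ctangent \<Rightarrow> complex"
type_synonym 'a form2 = "'a ctangent \<Rightarrow> 'a ctangent \<Rightarrow> complex"

text \<open>The complex dual of the complexified tangent space; zero off that space, again so that
  equality is equality of HOL functions.\<close>

definition ccotangent_space :: "('a, 'e::euclidean_space) chart set \<Rightarrow> 'a \<Rightarrow> 'a form1 set" where
  "ccotangent_space A p = {\<alpha>.
     (\<forall>v\<in>ctangent_space A p. \<forall>w\<in>ctangent_space A p. \<forall>a b.
        \<alpha> (\<lambda>f. a * v f + b * w f) = a * \<alpha> v + b * \<alpha> w) \<and>
     (\<forall>v. v \<notin> ctangent_space A p \<longrightarrow> \<alpha> v = 0)}"

definition cform1 ::
  "'a topology \<Rightarrow> ('a, 'e::euclidean_space) chart set \<Rightarrow> ('a \<Rightarrow> 'a form1) \<Rightarrow> bool" where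
  "cform1 X A \<alpha> \<longleftrightarrow>
     (\<forall>p\<in>topspace X. \<alpha> p \<in> ccotangent_space A p) \<and>
     (\<forall>V. cvector_field X A V \<longrightarrow> smooth_fun A (\<lambda>p. \<alpha> p (V p)))"

text \<open>\<open>d\<alpha>(V,W) = V(\<alpha>(W)) - W(\<alpha>(V)) - \<alpha>([V,W])\<close>; the value at \<open>p\<close> is the same for all vector
  fields \<open>V\<close>, \<open>W\<close> extending the given vectors \<open>v\<close>, \<open>w\<close> at \<open>p\<close>.\<close>

definition ext_deriv ::
  "'a topology \<Rightarrow> ('a, 'e::euclidean_space) chart set \<Rightarrow> ('a \<Rightarrow> 'a form1) \<Rightarrow> 'a \<Rightarrow> 'a form2" where
  "ext_deriv X A \<alpha> p v w =
     (if v \<in> ctangent_space A p \<and> w \<in> ctangent_space A p then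
        (THE c. \<forall>V W. cvector_field X A V \<longrightarrow> cvector_field X A W \<longrightarrow> V p = v \<longrightarrow> W p = w \<longrightarrow>
           c = cderiv v (\<lambda>x. \<alpha> x (W x)) - cderiv w (\<lambda>x. \<alpha> x (V x)) - \<alpha> p (lie_bracket V W p))
      else 0)"


section \<open>Almost complex structures\<close>

text \<open>A section \<open>J\<close> of \<open>End(TX)\<close> is smooth iff it maps smooth vector fields to smooth ones.\<close>

definition almost_complex_structure ::
  "'a topology \<Rightarrow> ('a, 'e::euclidean_space) chart set \<Rightarrow> ('a \<Rightarrow> 'a tangent \<Rightarrow> 'a tangent) \<Rightarrow> bool" where
  "almost_complex_structure X A J \<longleftrightarrow>
     (\<forall>p\<in>topspace X.
        (\<forall>v\<in>tangent_space A p. J p v \<in> tangent_space A p) \<and>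
        (\<forall>v\<in>tangent_space A p. \<forall>w\<in>tangent_space A p. \<forall>a b.
           J p (\<lambda>f. a * v f + b * w f) = (\<lambda>f. a * J p v f + b * J p w f)) \<and>
        (\<forall>v\<in>tangent_space A p. J p (J p v) = - v)) \<and>
     (\<forall>V. vector_field X A V \<longrightarrow> vector_field X A (\<lambda>p. J p (V p)))"

text \<open>A homotopy is a section of \<open>End(TX)\<close> over \<open>[0,1] \<times> X\<close> that is jointly continuous and is a
  (smooth) almost complex structure at every time. Joint continuity is tested on smooth vector
  fields and smooth functions; since these include local frames and coordinates cut off by bump
  functions, this is continuity of the matrix entries of \<open>J\<^sub>t\<close> in charts.\<close>

definition homotopic_acs ::
  "'a topology \<Rightarrow> ('a, 'e::euclidean_space) chart set \<Rightarrow>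
   ('a \<Rightarrow> 'a tangent \<Rightarrow> 'a tangent) \<Rightarrow> ('a \<Rightarrow> 'a tangent \<Rightarrow> 'a tangent) \<Rightarrow> bool" where
  "homotopic_acs X A J J' \<longleftrightarrow>
     (\<exists>H :: real \<Rightarrow> 'a \<Rightarrow> 'a tangent \<Rightarrow> 'a tangent.
        (\<forall>t\<in>{0..1}. almost_complex_structure X A (H t)) \<and>
        (\<forall>V f. vector_field X A V \<longrightarrow> smooth_fun A f \<longrightarrow>
           continuous_map (prod_topology (top_of_set {0..1}) X) euclideanreal
             (\<lambda>(t, p). H t p (V p) f)) \<and>
        (\<forall>p\<in>topspace X. \<forall>v\<in>tangent_space A p. H 0 p v = J p v \<and> H 1 p v = J' p v))"


section \<open>The Nijenhuis tensor\<close>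

text \<open>Complex linear extension of a real linear endomorphism \<open>j\<close> of a tangent space.\<close>

definition cext :: "('a tangent \<Rightarrow> 'a tangent) \<Rightarrow> 'a ctangent \<Rightarrow> 'a ctangent" where
  "cext j v = (\<lambda>f. complex_of_real (j (\<lambda>g. Re (v g)) f) + \<i> * complex_of_real (j (\<lambda>g. Im (v g)) f))"

definition T10 :: "('a, 'e::euclidean_space) chart set \<Rightarrow> ('a \<Rightarrow> 'a tangent \<Rightarrow> 'a tangent) \<Rightarrow>
    'a \<Rightarrow> 'a ctangent set" where
  "T10 A J p = {v \<in> ctangent_space A p. cext (J p) v = (\<lambda>f. \<i> * v f)}"

definition T01 :: "('a, 'e::euclidean_space) chart set \<Rightarrow> ('a \<Rightarrow> 'a tangent \<Rightarrow> 'a tangent) \<Rightarrow>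
    'a \<Rightarrow> 'a ctangent set" where
  "T01 A J p = {v \<in> ctangent_space A p. cext (J p) v = (\<lambda>f. - \<i> * v f)}"

text \<open>The duals of \<open>T\<^sup>1\<^sup>,\<^sup>0\<close> and \<open>T\<^sup>0\<^sup>,\<^sup>1\<close> are realised inside the complexified cotangent space by
  extending by zero on the complementary eigenspace. Accordingly \<open>A\<^sup>0\<^sup>,\<^sup>2 = \<Lambda>\<^sup>2 A\<^sup>0\<^sup>,\<^sup>1\<close> consists of the
  alternating 2-forms that vanish as soon as one argument is in \<open>T\<^sup>1\<^sup>,\<^sup>0\<close>.\<close>

definition A10 :: "('a, 'e::euclidean_space) chart set \<Rightarrow> ('a \<Rightarrow> 'a tangent \<Rightarrow> 'a tangent) \<Rightarrow>
    'a \<Rightarrow> 'a form1 set" where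
  "A10 A J p = {\<alpha> \<in> ccotangent_space A p. \<forall>v\<in>T01 A J p. \<alpha> v = 0}"

definition A02 :: "('a, 'e::euclidean_space) chart set \<Rightarrow> ('a \<Rightarrow> 'a tangent \<Rightarrow> 'a tangent) \<Rightarrow>
    'a \<Rightarrow> 'a form2 set" where
  "A02 A J p = {\<omega>.
     (\<forall>v. \<omega> v \<in> ccotangent_space A p) \<and> (\<forall>w. (\<lambda>v. \<omega> v w) \<in> ccotangent_space A p) \<and>
     (\<forall>v. \<omega> v v = 0) \<and> (\<forall>v\<in>T10 A J p. \<forall>w. \<omega> v w = 0)}"

text \<open>The projection of 2-forms onto \<open>A\<^sup>0\<^sup>,\<^sup>2\<close> along \<open>A\<^sup>2\<^sup>,\<^sup>0 \<oplus> A\<^sup>1\<^sup>,\<^sup>1\<close>: the two complementary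
  summands are exactly the forms vanishing on \<open>T\<^sup>0\<^sup>,\<^sup>1 \<times> T\<^sup>0\<^sup>,\<^sup>1\<close>.\<close>

definition pr02 :: "('a, 'e::euclidean_space) chart set \<Rightarrow> ('a \<Rightarrow> 'a tangent \<Rightarrow> 'a tangent) \<Rightarrow>
    'a \<Rightarrow> 'a form2 \<Rightarrow> 'a form2" where
  "pr02 A J p \<omega> = (THE \<eta>. \<eta> \<in> A02 A J p \<and> (\<forall>v\<in>T01 A J p. \<forall>w\<in>T01 A J p. \<eta> v w = \<omega> v w))"

text \<open>The value of \<open>N\<^sub>J\<close> on \<open>a \<in> A\<^sup>1\<^sup>,\<^sup>0\<^sub>p\<close> is \<open>pr\<^sup>0\<^sup>,\<^sup>2(d\<alpha>)\<close> at \<open>p\<close> for any smooth section \<open>\<alpha>\<close> of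
  \<open>A\<^sup>1\<^sup>,\<^sup>0\<close> with \<open>\<alpha>(p) = a\<close>; by tensoriality it does not depend on \<open>\<alpha>\<close>.\<close>

definition nijenhuis :: "'a topology \<Rightarrow> ('a, 'e::euclidean_space) chart set \<Rightarrow>
    ('a \<Rightarrow> 'a tangent \<Rightarrow> 'a tangent) \<Rightarrow> 'a \<Rightarrow> 'a form1 \<Rightarrow> 'a form2" where
  "nijenhuis X A J p a =
     (THE \<omega>. \<forall>\<alpha>. cform1 X A \<alpha> \<longrightarrow> (\<forall>x\<in>topspace X. \<alpha> x \<in> A10 A J x) \<longrightarrow> \<alpha> p = a \<longrightarrow>
        \<omega> = pr02 A J p (ext_deriv X A \<alpha> p))"

abbreviation form2_scale :: "complex \<Rightarrow> 'a form2 \<Rightarrow> 'a form2" where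
  "form2_scale \<equiv> \<lambda>c \<omega> v w. c * \<omega> v w"

lemma vector_space_form2: "vector_space (form2_scale :: complex \<Rightarrow> 'a form2 \<Rightarrow> 'a form2)"
  by unfold_locales (auto simp: fun_eq_iff algebra_simps)

definition nijenhuis_rank :: "'a topology \<Rightarrow> ('a, 'e::euclidean_space) chart set \<Rightarrow>
    ('a \<Rightarrow> 'a tangent \<Rightarrow> 'a tangent) \<Rightarrow> 'a \<Rightarrow> nat" where
  "nijenhuis_rank X A J p = vector_space.dim form2_scale (nijenhuis X A J p ` A10 A J p)"

text \<open>Here \<open>n\<close> is the complex dimension, i.e. half the dimension of the manifold.\<close>

definition maximally_non_integrable :: "nat \<Rightarrow> 'a topology \<Rightarrow> ('a, 'e::euclidean_space) chart set \<Rightarrow>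
    ('a \<Rightarrow> 'a tangent \<Rightarrow> 'a tangent) \<Rightarrow> bool" where
  "maximally_non_integrable n X A J \<longleftrightarrow>
     (\<forall>p\<in>topspace X. nijenhuis_rank X A J p = min n (n choose 2))"

definition everywhere_non_integrable :: "'a topology \<Rightarrow> ('a, 'e::euclidean_space) chart set \<Rightarrow>
    ('a \<Rightarrow> 'a tangent \<Rightarrow> 'a tangent) \<Rightarrow> bool" where
  "everywhere_non_integrable X A J \<longleftrightarrow>
     (\<forall>p\<in>topspace X. \<exists>\<alpha>\<in>A10 A J p. nijenhuis X A J p \<alpha> \<noteq> 0)"

end

theory Submission
  imports Defs
begin

text \<open>
  The theorem is a transversality statement for 1-jets of almost complex structures. The Nijenhuis tensor at a point is a
  linear function of the first derivatives of the structure, and the values to be avoided have large codimension: a complex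
  linear map from \<open>\<complex>\<^sup>n\<close> to a space of dimension \<open>n choose 2\<close> fails to be injective in real codimension
  \<open>2 ((n choose 2) - n + 1)\<close>, which exceeds \<open>2 n\<close> for \<open>n \<ge> 5\<close>, and it vanishes in real codimension \<open>2 n (n choose 2)\<close>,
  which exceeds \<open>2 n\<close> for \<open>n \<ge> 3\<close>. A generic small perturbation therefore avoids them at all points of a \<open>2 n\<close>-manifold,
  and nearby structures are homotopic. For \<open>n \<ge> 5\<close> the maximal rank \<open>min n (n choose 2)\<close> is \<open>n\<close>, so it means injectivity.

  The local form is obtained as follows. Near a point, compare the structure with the constant structure \<open>J0\<close> that it
  defines there, and write it as \<open>(1 + K) J0 (1 + K)\<^sup>-\<^sup>1\<close> with \<open>K\<close> antilinear (\<open>cay\<close>). The vectors of type (0,1) are then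
  \<open>W\<^sub>u = (1 + K) (u + \<i> J0 u)\<close>, and \<open>[W\<^sub>u, W\<^sub>w] = \<tau> - \<i> J0 \<tau>\<close> for an explicit vector \<open>\<tau>\<close>, the \<open>torsion\<close>, which is alternating and
  antilinear in \<open>u\<close> and \<open>w\<close>. For a (1,0)-covector \<open>a\<close> the Nijenhuis tensor is \<open>N(a)(W\<^sub>u, W\<^sub>w) = - a([W\<^sub>u, W\<^sub>w])\<close>
  (\<open>nijenhuis_eq\<close>). Hence it is nonzero as soon as one value of \<open>\<tau>\<close> is (\<open>nijenhuis_nonzero\<close>), and it is injective if
  the values of \<open>\<tau>\<close> span the complex vector space defined by \<open>J0\<close> (\<open>nijenhuis_rank\<close>).

  Now add to \<open>K\<close> the map \<open>x \<mapsto> S(x - x0, \<cdot>)\<close>, where \<open>S\<close> is alternating and antilinear in both arguments, with prescribed values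
  \<open>s\<^sub>i\<close> on finitely many pairs of basis vectors. On a small ball this changes the corresponding values of \<open>\<tau>\<close> by \<open>4 s\<^sub>i\<close> and an
  error that is linear in \<open>s\<close> and small against \<open>s\<close> (\<open>frame_torsion_pert\<close>). So for each point \<open>x\<close> of the ball and each value
  \<open>z\<close> to be avoided, at most one parameter produces \<open>z\<close> at \<open>x\<close>, and it is a Lipschitz function of \<open>(x, z)\<close>. If the values to
  be avoided have codimension above \<open>2 n\<close>, the bad parameters have measure zero (\<open>negligible_bad_parameters\<close>). The two
  conditions are obtained from \<open>2 n\<close> pairs, where the families that fail to span have codimension \<open>2 n + 2\<close>
  (\<open>thin_degenerate\<close>), and from two pairs, where the origin has codimension \<open>4 n\<close>.

  Cut off by a bump function, the perturbations can be carried out one ball after the other along an exhaustion by compact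
  sets. Being non-degenerate on a compact ball is an open condition, so what has been achieved survives later small
  perturbations, and near each point only finitely many of them matter (\<open>generic_perturbation\<close>). The result stays so
  close to the given structure that the path \<open>(1 + tK) J (1 + tK)\<^sup>-\<^sup>1\<close>, with \<open>K\<close> now the Cayley transform relative to \<open>J\<close>
  itself, is a homotopy between the two (\<open>homotopic_of_near\<close>).

  The charts enter through the identification of abstract tangent vectors, which are derivations, with directional
  derivatives (\<open>tangent_is_tvec\<close>), and through the resulting matrix description of almost complex structures
  (\<open>acs_Jmat\<close>, \<open>acsI\<close>).
\<close>

section \<open>Calculus of smooth functions\<close>

lemma Ck_on_subset: "Ck_on k S f \<Longrightarrow> T \<subseteq> S \<Longrightarrow> Ck_on k T f"
  by (induction k arbitrary: f) (auto intro: continuous_on_subset)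

lemma Ck_on_cong:
  assumes "open S" "\<And>x. x \<in> S \<Longrightarrow> f x = g x" "Ck_on k S f"
  shows "Ck_on k S g"
  using assms(2,3)
proof (induction k arbitrary: f g)
  case 0
  then show ?case using continuous_on_cong[of S S f g] by auto
next
  case (Suc k)
  have ev: "\<forall>\<^sub>F y in nhds x. f y = g y" if "x \<in> S" for x
    using eventually_nhds_in_open[OF \<open>open S\<close> that] by eventually_elim (use Suc.prems in auto)
  have hd: "(g has_derivative frechet_derivative f (at x)) (at x)" if "x \<in> S" for x
  proof -
    have "(f has_derivative frechet_derivative f (at x)) (at x)"
      using Suc.prems(2) that by (auto simp: frechet_derivative_works)
    then show ?thesis
      using has_derivative_transform_within_open[OF _ \<open>open S\<close> that] Suc.prems(1) by blast
  qed
  then have "frechet_derivative g (at x) = frechet_derivative f (at x)" if "x \<in> S" for x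
    using that frechet_derivative_at by metis
  then show ?case
    using Suc.IH[of "\<lambda>x. frechet_derivative f (at x) v" "\<lambda>x. frechet_derivative g (at x) v" for v] Suc.prems hd
    unfolding Ck_on.simps by (metis differentiable_def)
qed

lemma Ck_on_SucI:
  assumes "open S" "\<And>x. x \<in> S \<Longrightarrow> (f has_derivative f' x) (at x)" "\<And>v. Ck_on k S (\<lambda>x. f' x v)"
  shows "Ck_on (Suc k) S f"
proof -
  have "f' x = frechet_derivative f (at x)" if "x \<in> S" for x
    using frechet_derivative_at assms(2) that by metis
  then have "Ck_on k S (\<lambda>x. frechet_derivative f (at x) v)" for v
    using Ck_on_cong[OF assms(1) _ assms(3)[of v], of "\<lambda>x. frechet_derivative f (at x) v"] by auto
  then show ?thesis using assms(2) by (auto simp: differentiable_def)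
qed

lemma Ck_on_SucD: "Ck_on (Suc k) S f \<Longrightarrow> Ck_on k S f"
  by (induction k arbitrary: f)
    (auto intro!: continuous_at_imp_continuous_on differentiable_imp_continuous_within)

lemma Ck_on_has_derivative:
  "Ck_on (Suc k) S f \<Longrightarrow> x \<in> S \<Longrightarrow> (f has_derivative frechet_derivative f (at x)) (at x)"
  by (auto simp: frechet_derivative_works)

lemma Ck_on_local:
  assumes "\<And>x. x \<in> S \<Longrightarrow> \<exists>T. open T \<and> x \<in> T \<and> Ck_on k T f"
  shows "Ck_on k S f"
  using assms
proof (induction k arbitrary: f)
  case 0
  have "continuous (at x) f" if "x \<in> S" for x
    using 0[OF that] by (auto simp: continuous_on_eq_continuous_at)
  then show ?case by (auto intro: continuous_at_imp_continuous_on)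
next
  case (Suc k)
  have "f differentiable (at x)" if "x \<in> S" for x
    using Suc.prems[OF that] by auto
  moreover have "Ck_on k S (\<lambda>x. frechet_derivative f (at x) v)" for v
  proof (rule Suc.IH)
    show "\<exists>T. open T \<and> x \<in> T \<and> Ck_on k T (\<lambda>x. frechet_derivative f (at x) v)" if "x \<in> S" for x
      using Suc.prems[OF that] by auto
  qed
  ultimately show ?case by simp
qed

lemma Ck_on_const: "open S \<Longrightarrow> Ck_on k S (\<lambda>x. c)"
proof (induction k arbitrary: c)
  case (Suc k)
  show ?case by (rule Ck_on_SucI[where f' = "\<lambda>x v. 0"]) (use Suc in auto)
qed simp

lemma Ck_on_linear:
  assumes "open S" "bounded_linear f" shows "Ck_on k S f"
proof (cases k)
  case 0 then show ?thesis using assms by (simp add: linear_continuous_on)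
next
  case (Suc k)
  show ?thesis unfolding Suc
    by (rule Ck_on_SucI[where f' = "\<lambda>x. f"])
      (use assms in \<open>auto intro: Ck_on_const bounded_linear_imp_has_derivative\<close>)
qed

lemma Ck_on_add:
  assumes "open S" "Ck_on k S f" "Ck_on k S g" shows "Ck_on k S (\<lambda>x. f x + g x)"
  using assms(2,3)
proof (induction k arbitrary: f g)
  case 0 then show ?case by (auto intro: continuous_intros)
next
  case (Suc k)
  show ?case
    by (rule Ck_on_SucI[where f' = "\<lambda>x v. frechet_derivative f (at x) v + frechet_derivative g (at x) v"])
      (use assms(1) Suc in \<open>auto intro!: has_derivative_add Ck_on_has_derivative\<close>)
qed

lemma Ck_on_sum:
  assumes "open S" "\<And>i. i \<in> I \<Longrightarrow> Ck_on k S (f i)" shows "Ck_on k S (\<lambda>x. \<Sum>i\<in>I. f i x)"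
  using assms(2) by (induction I rule: infinite_finite_induct)
    (auto intro: Ck_on_const Ck_on_add assms(1))

text \<open>Products: every bounded bilinear operation preserves \<open>C\<^sup>k\<close>. This covers scalar
  multiplication, composition and application of linear maps.\<close>

lemma Ck_on_bilinear:
  assumes "bounded_bilinear B" "open S" "Ck_on k S f" "Ck_on k S g"
  shows "Ck_on k S (\<lambda>x. B (f x) (g x))"
  using assms(3,4)
proof (induction k arbitrary: f g)
  case 0 then show ?case using bounded_bilinear.continuous_on[OF assms(1)] by auto
next
  case (Suc k)
  show ?case
  proof (rule Ck_on_SucI[where f' = "\<lambda>x v. B (f x) (frechet_derivative g (at x) v) + B (frechet_derivative f (at x) v) (g x)"])
    show "((\<lambda>x. B (f x) (g x)) has_derivative (\<lambda>v. B (f x) (frechet_derivative g (at x) v)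
       + B (frechet_derivative f (at x) v) (g x))) (at x)" if "x \<in> S" for x
      using bounded_bilinear.FDERIV[OF assms(1) Ck_on_has_derivative[OF Suc.prems(1) that]
        Ck_on_has_derivative[OF Suc.prems(2) that]] .
    show "Ck_on k S (\<lambda>x. B (f x) (frechet_derivative g (at x) v) + B (frechet_derivative f (at x) v) (g x))" for v
      using Suc.prems Ck_on_SucD[OF Suc.prems(1)] Ck_on_SucD[OF Suc.prems(2)]
      by (intro Ck_on_add[OF assms(2)] Suc.IH) auto
  qed (rule assms(2))
qed

lemma Ck_on_linear_comp:
  assumes "bounded_linear h" "open S" "Ck_on k S f" shows "Ck_on k S (\<lambda>x. h (f x))"
  using assms(3)
proof (induction k arbitrary: f)
  case 0 then show ?case using bounded_linear.continuous_on[OF assms(1)] by auto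
next
  case (Suc k)
  show ?case
    by (rule Ck_on_SucI[where f' = "\<lambda>x v. h (frechet_derivative f (at x) v)"])
     (use Suc assms in \<open>auto intro!: bounded_linear.has_derivative[OF assms(1)] Ck_on_has_derivative\<close>)
qed

lemma frechet_derivative_Basis:
  assumes "f differentiable (at x)"
  shows "frechet_derivative f (at x) v = (\<Sum>b\<in>Basis. (v \<bullet> b) *\<^sub>R frechet_derivative f (at x) b)"
proof -
  interpret linear "frechet_derivative f (at x)" using linear_frechet_derivative[OF assms] .
  have "frechet_derivative f (at x) v = frechet_derivative f (at x) (\<Sum>b\<in>Basis. (v \<bullet> b) *\<^sub>R b)"
    by (simp add: euclidean_representation)
  then show ?thesis by (simp add: sum scale)
qed

text \<open>By the chain rule the derivative of a composition involves \<open>h'\<close> composed with \<open>f\<close>, so the induction is on \<open>k\<close>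
  with \<open>h\<close> arbitrary. Expanding in a basis turns the chain rule into sums and products of functions already treated.\<close>

lemma Ck_on_compose:
  fixes f :: "'e::euclidean_space \<Rightarrow> 'g::euclidean_space" and h :: "'g \<Rightarrow> 'f::real_normed_vector"
  assumes "open S" "open T" "f ` S \<subseteq> T" "Ck_on k S f" "Ck_on k T h"
  shows "Ck_on k S (\<lambda>x. h (f x))"
  using assms(4,5)
proof (induction k arbitrary: h)
  case 0 then show ?case using continuous_on_compose2[of T h S f] assms(3) by auto
next
  case (Suc k)
  let ?g = "\<lambda>x v. \<Sum>b\<in>Basis. (frechet_derivative f (at x) v \<bullet> b) *\<^sub>R frechet_derivative h (at (f x)) b"
  show ?case
  proof (rule Ck_on_SucI[where f' = ?g])
    show "((\<lambda>x. h (f x)) has_derivative ?g x) (at x)" if "x \<in> S" for x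
    proof -
      have fx: "f x \<in> T" using that assms(3) by auto
      have "frechet_derivative h (at (f x)) w = (\<Sum>b\<in>Basis. (w \<bullet> b) *\<^sub>R frechet_derivative h (at (f x)) b)" for w
        by (rule frechet_derivative_Basis) (use Suc.prems(2) fx in simp)
      then show ?thesis
        by (intro has_derivative_eq_rhs[OF has_derivative_compose[OF Ck_on_has_derivative[OF Suc.prems(1) that]
            Ck_on_has_derivative[OF Suc.prems(2) fx]]] ext)
    qed
    show "Ck_on k S (\<lambda>x. ?g x v)" for v
    proof (intro Ck_on_sum Ck_on_bilinear[OF bounded_bilinear_scaleR] assms(1))
      fix b :: 'g assume "b \<in> Basis"
      show "Ck_on k S (\<lambda>x. frechet_derivative f (at x) v \<bullet> b)"
        by (rule Ck_on_linear_comp[OF bounded_linear_inner_left assms(1)]) (use Suc.prems in simp)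
      show "Ck_on k S (\<lambda>x. frechet_derivative h (at (f x)) b)"
        by (rule Suc.IH[OF Ck_on_SucD[OF Suc.prems(1)]]) (use Suc.prems in simp)
    qed
  qed (rule assms(1))
qed

lemma Ck_on_inverse:
  fixes g :: "'e::euclidean_space \<Rightarrow> real"
  assumes "open S" "Ck_on k S g" "\<And>x. x \<in> S \<Longrightarrow> g x \<noteq> 0" shows "Ck_on k S (\<lambda>x. inverse (g x))"
  using assms(2)
proof (induction k)
  case 0 then show ?case using assms(3) by (auto intro: continuous_intros)
next
  case (Suc k)
  show ?case
  proof (rule Ck_on_SucI[where f' = "\<lambda>x v. - (inverse (g x) * frechet_derivative g (at x) v * inverse (g x))"])
    show "((\<lambda>x. inverse (g x)) has_derivative
        (\<lambda>v. - (inverse (g x) * frechet_derivative g (at x) v * inverse (g x)))) (at x)" if "x \<in> S" for x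
      using Deriv.has_derivative_inverse[OF assms(3)[OF that] Ck_on_has_derivative[OF Suc.prems that]] .
    show "Ck_on k S (\<lambda>x. - (inverse (g x) * frechet_derivative g (at x) v * inverse (g x)))" for v
      using Suc.prems Suc.IH[OF Ck_on_SucD[OF Suc.prems]]
      by (intro Ck_on_linear_comp[OF bounded_linear_minus[OF bounded_linear_ident]]
          Ck_on_bilinear[OF bounded_bilinear_mult] assms(1)) auto
  qed (rule assms(1))
qed

lemma smooth_on_subset: "smooth_on S f \<Longrightarrow> T \<subseteq> S \<Longrightarrow> smooth_on T f"
  and smooth_on_cong: "open S \<Longrightarrow> (\<And>x. x \<in> S \<Longrightarrow> f x = g x) \<Longrightarrow> smooth_on S f \<Longrightarrow> smooth_on S g"
  and smooth_on_const: "open S \<Longrightarrow> smooth_on S (\<lambda>x. c)"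
  and smooth_on_linear: "open S \<Longrightarrow> bounded_linear f' \<Longrightarrow> smooth_on S f'"
  and smooth_on_add: "open S \<Longrightarrow> smooth_on S f \<Longrightarrow> smooth_on S g \<Longrightarrow> smooth_on S (\<lambda>x. f x + g x)"
  and smooth_on_sum: "open S \<Longrightarrow> (\<And>i. i \<in> I \<Longrightarrow> smooth_on S (F i)) \<Longrightarrow> smooth_on S (\<lambda>x. \<Sum>i\<in>I. F i x)"
  and smooth_on_linear_comp: "bounded_linear l \<Longrightarrow> open S \<Longrightarrow> smooth_on S f \<Longrightarrow> smooth_on S (\<lambda>x. l (f x))"
  for f g :: "'e::euclidean_space \<Rightarrow> 'f::real_normed_vector" and l :: "'f \<Rightarrow> 'g::real_normed_vector"
  unfolding smooth_on_def
  by (blast intro: Ck_on_subset, blast intro: Ck_on_cong, blast intro: Ck_on_const, blast intro: Ck_on_linear,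
      blast intro: Ck_on_add, blast intro: Ck_on_sum, blast intro: Ck_on_linear_comp)

lemma smooth_on_bilinear: "bounded_bilinear B \<Longrightarrow> open S \<Longrightarrow> smooth_on S f \<Longrightarrow> smooth_on S g \<Longrightarrow>
   smooth_on S (\<lambda>x. B (f x) (g x))"
  unfolding smooth_on_def using Ck_on_bilinear by blast

lemmas smooth_on_mult = smooth_on_bilinear[OF bounded_bilinear_mult]
  and smooth_on_scaleR = smooth_on_bilinear[OF bounded_bilinear_scaleR]
  and smooth_on_inner_left = smooth_on_linear_comp[OF bounded_linear_inner_left]

lemma smooth_on_uminus: "open S \<Longrightarrow> smooth_on S f \<Longrightarrow> smooth_on S (\<lambda>x. - f x)"
  using smooth_on_linear_comp[OF bounded_linear_minus[OF bounded_linear_ident]] by auto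

lemma smooth_on_diff:
  "open S \<Longrightarrow> smooth_on S f \<Longrightarrow> smooth_on S g \<Longrightarrow> smooth_on S (\<lambda>x. f x - g x)"
  using smooth_on_add[of S f "\<lambda>x. - g x"] smooth_on_uminus by auto

lemma smooth_on_id: "open S \<Longrightarrow> smooth_on S (\<lambda>x. x)"
  using smooth_on_linear[OF _ bounded_linear_ident] .

lemma smooth_on_compose:
  fixes f :: "'e::euclidean_space \<Rightarrow> 'g::euclidean_space"
  shows "open S \<Longrightarrow> open T \<Longrightarrow> f ` S \<subseteq> T \<Longrightarrow> smooth_on S f \<Longrightarrow> smooth_on T h \<Longrightarrow> smooth_on S (\<lambda>x. h (f x))"
  unfolding smooth_on_def using Ck_on_compose by blast

lemma smooth_on_inverse:
  fixes g :: "'e::euclidean_space \<Rightarrow> real"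
  shows "open S \<Longrightarrow> smooth_on S g \<Longrightarrow> (\<And>x. x \<in> S \<Longrightarrow> g x \<noteq> 0) \<Longrightarrow> smooth_on S (\<lambda>x. inverse (g x))"
  unfolding smooth_on_def using Ck_on_inverse by blast

lemma smooth_on_local:
  assumes "\<And>x. x \<in> S \<Longrightarrow> \<exists>T. open T \<and> x \<in> T \<and> smooth_on T f" shows "smooth_on S f"
  unfolding smooth_on_def
proof (intro allI Ck_on_local)
  show "\<exists>T. open T \<and> x \<in> T \<and> Ck_on k T f" if "x \<in> S" for k x
    using assms[OF that] by (auto simp: smooth_on_def)
qed

lemma smooth_on_imp_continuous_on: "smooth_on S f \<Longrightarrow> continuous_on S f"
  unfolding smooth_on_def by (metis Ck_on.simps(1))

lemma smooth_on_has_derivative: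
  "smooth_on S f \<Longrightarrow> x \<in> S \<Longrightarrow> (f has_derivative frechet_derivative f (at x)) (at x)"
  unfolding smooth_on_def by (rule Ck_on_has_derivative) (rule spec)

lemma smooth_on_frechet_derivative:
  "smooth_on S f \<Longrightarrow> smooth_on S (\<lambda>x. frechet_derivative f (at x) v)"
  unfolding smooth_on_def by (metis Ck_on.simps(2))

lemma smooth_on_Pair:
  fixes f :: "'e::euclidean_space \<Rightarrow> 'f::euclidean_space" and g :: "'e \<Rightarrow> 'g::euclidean_space"
  assumes "open S" "smooth_on S f" "smooth_on S g"
  shows "smooth_on S (\<lambda>x. (f x, g x))"
proof -
  have "smooth_on S (\<lambda>x. (f x, 0) + (0, g x))"
    by (intro smooth_on_add smooth_on_linear_comp[of "\<lambda>x. (x, 0)"] smooth_on_linear_comp[of "\<lambda>x. (0, x)"] assms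
       bounded_linear_Pair bounded_linear_ident bounded_linear_zero)
  then show ?thesis by simp
qed

lemma smooth_on_componentwise:
  fixes f :: "'e::euclidean_space \<Rightarrow> 'f::euclidean_space"
  assumes "open S" "\<And>b. b \<in> Basis \<Longrightarrow> smooth_on S (\<lambda>x. f x \<bullet> b)" shows "smooth_on S f"
proof -
  have "smooth_on S (\<lambda>x. \<Sum>b\<in>Basis. (f x \<bullet> b) *\<^sub>R b)"
    by (intro smooth_on_sum smooth_on_scaleR smooth_on_const assms)
  then show ?thesis by (simp add: euclidean_representation)
qed

lemma smooth_on_blinfun:
  fixes M :: "'e::euclidean_space \<Rightarrow> 'f::euclidean_space \<Rightarrow>\<^sub>L 'g::real_normed_vector"
  assumes "open S" "\<And>b. b \<in> Basis \<Longrightarrow> smooth_on S (\<lambda>x. M x b)" shows "smooth_on S M"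
proof -
  have "M x = (\<Sum>b\<in>Basis. blinfun_scaleR_left (M x b) o\<^sub>L blinfun_inner_left b)" for x
  proof (rule blinfun_eqI)
    fix v :: 'f
    have "blinfun_apply (M x) v = blinfun_apply (M x) (\<Sum>b\<in>Basis. (v \<bullet> b) *\<^sub>R b)" by (simp add: euclidean_representation)
    also have "\<dots> = (\<Sum>b\<in>Basis. (v \<bullet> b) *\<^sub>R M x b)" by (simp add: blinfun.sum_right blinfun.scaleR_right)
    finally show "M x v = (\<Sum>b\<in>Basis. blinfun_scaleR_left (M x b) o\<^sub>L blinfun_inner_left b) v"
      by (simp add: blinfun.sum_left inner_commute)
  qed
  moreover have "smooth_on S (\<lambda>x. \<Sum>b\<in>Basis. blinfun_scaleR_left (M x b) o\<^sub>L blinfun_inner_left b)"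
    by (intro smooth_on_sum smooth_on_bilinear[OF bounded_bilinear_blinfun_compose] smooth_on_const
        smooth_on_linear_comp[OF bounded_linear_blinfun_scaleR_left] assms)
  ultimately show ?thesis by presburger
qed

lemma smooth_on_blinfun_apply: 
  "open S \<Longrightarrow> smooth_on S M \<Longrightarrow> smooth_on S f \<Longrightarrow> smooth_on S (\<lambda>x. blinfun_apply (M x) (f x))"
  using smooth_on_bilinear[OF bounded_bilinear_blinfun_apply] by blast

lemma smooth_on_blinfun_compose: 
  "open S \<Longrightarrow> smooth_on S M \<Longrightarrow> smooth_on S N \<Longrightarrow> smooth_on S (\<lambda>x. M x o\<^sub>L N x)"
  using smooth_on_bilinear[OF bounded_bilinear_blinfun_compose] by blast

subsection \<open>Inversion of linear maps\<close>

text \<open>A bilinear product with a factor that vanishes at \<open>x\<close> is differentiable at \<open>x\<close> even if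
  the other factor is only continuous. This is what turns continuity of inversion into
  differentiability.\<close>

lemma has_derivative_bilinear_vanishing:
  fixes f :: "'a::real_normed_vector \<Rightarrow> 'b::real_normed_vector" and g :: "'a \<Rightarrow> 'c::real_normed_vector"
  assumes "bounded_bilinear B" "isCont f x" "(g has_derivative g') (at x)" "g x = 0"
  shows "((\<lambda>y. B (f y) (g y)) has_derivative (\<lambda>v. B (f x) (g' v))) (at x)"
proof -
  interpret B: bounded_bilinear B by fact
  obtain K where K: "K > 0" "\<And>a b. norm (B a b) \<le> norm a * norm b * K" using B.pos_bounded by blast
  have bl: "bounded_linear g'" using assms(3) has_derivative_bounded_linear by blast
  have "((\<lambda>y. B (f y - f x) (g y)) has_derivative (\<lambda>v. 0)) (at x)"
    unfolding has_derivative_at_alt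
  proof (intro conjI allI impI)
    fix e :: real assume e: "e > 0"
    let ?L = "1 + onorm g'"
    have L: "?L > 0" using onorm_pos_le[OF bl] by linarith
    obtain d1 where d1: "d1 > 0" "\<And>y. norm (y - x) < d1 \<Longrightarrow> norm (g y - g x - g' (y - x)) \<le> 1 * norm (y - x)"
      using assms(3)[unfolded has_derivative_at_alt] by (meson zero_less_one)
    obtain d2 where d2: "d2 > 0" "\<And>y. norm (y - x) < d2 \<Longrightarrow> norm (f y - f x) < e / (?L * K)"
      using assms(2) e L K unfolding continuous_at_eps_delta dist_norm
      by (metis divide_pos_pos mult_pos_pos)
    show "\<exists>d>0. \<forall>y. norm (y - x) < d \<longrightarrow>
        norm (B (f y - f x) (g y) - B (f x - f x) (g x) - 0) \<le> e * norm (y - x)"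
    proof (intro exI conjI allI impI)
      show "min d1 d2 > 0" using d1 d2 by simp
      fix y assume y: "norm (y - x) < min d1 d2"
      have "norm (g y) \<le> norm (g y - g x - g' (y - x)) + norm (g' (y - x))"
        using norm_triangle_ineq[of "g y - g x - g' (y - x)" "g' (y - x)"] assms(4) by simp
      also have "\<dots> \<le> ?L * norm (y - x)"
        using d1(2)[of y] onorm[OF bl, of "y - x"] y by (simp add: algebra_simps)
      finally have gy: "norm (g y) \<le> ?L * norm (y - x)" .
      have "norm (B (f y - f x) (g y)) \<le> norm (f y - f x) * norm (g y) * K" by (rule K)
      also have "\<dots> \<le> e / (?L * K) * (?L * norm (y - x)) * K"
        using d2(2)[of y] y gy K L e by (intro mult_mono) auto
      also have "\<dots> = e * norm (y - x)" using K less_imp_neq[OF L] by simp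
      finally show "norm (B (f y - f x) (g y) - B (f x - f x) (g x) - 0) \<le> e * norm (y - x)"
        by (simp add: B.zero_left)
    qed
  qed simp
  from has_derivative_add[OF this bounded_linear.has_derivative[OF B.bounded_linear_right assms(3), of "f x"]]
  show ?thesis by (simp add: B.diff_left)
qed

lemma blinfun_inverse_continuous:
  fixes M N :: "'e::real_normed_vector \<Rightarrow> 'f::real_normed_vector \<Rightarrow>\<^sub>L 'f"
  assumes "open S" "x \<in> S" "isCont M x"
    and "\<And>y. y \<in> S \<Longrightarrow> N y o\<^sub>L M y = id_blinfun" "\<And>y. y \<in> S \<Longrightarrow> M y o\<^sub>L N y = id_blinfun"
  shows "isCont N x"
proof -
  have eq: "N y - N x = N y o\<^sub>L (M x - M y) o\<^sub>L N x" if "y \<in> S" for y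
  proof (rule blinfun_eqI)
    fix v
    have "N y (M y (N x v)) = N x v" "M x (N x v) = v"
      using assms(2,4,5) that by (metis blinfun_apply_blinfun_compose id_blinfun.rep_eq id_apply)+
    then show "(N y - N x) v = (N y o\<^sub>L (M x - M y) o\<^sub>L N x) v"
      by (simp add: blinfun.diff_left blinfun.diff_right)
  qed
  let ?n = "norm (N x)" and ?d = "\<lambda>y. norm (M x - M y)"
  have d0: "(?d \<longlongrightarrow> 0) (at x)"
    using tendsto_norm_zero[OF LIM_zero[OF assms(3)[unfolded isCont_def]]] by (simp add: norm_minus_commute)
  have "\<forall>\<^sub>F y in at x. ?d y * ?n < 1 / 2"
    using order_tendstoD(2)[OF tendsto_mult_right[OF d0, of ?n], of "1 / 2"] by simp
  moreover have "\<forall>\<^sub>F y in at x. y \<in> S" using assms(1,2) eventually_at_in_open' by blast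
  ultimately have bd: "\<forall>\<^sub>F y in at x. norm (N y - N x) \<le> ?d y * (2 * ?n * ?n)"
  proof eventually_elim
    case (elim y)
    have "norm (N y - N x) \<le> norm (N y o\<^sub>L (M x - M y)) * ?n"
      unfolding eq[OF elim(2)] by (rule norm_blinfun_compose)
    also have "\<dots> \<le> norm (N y) * ?d y * ?n"
      by (intro mult_right_mono norm_blinfun_compose) auto
    finally have 1: "norm (N y - N x) \<le> norm (N y) * (?d y * ?n)" by (simp add: mult.assoc)
    have "norm (N y) \<le> ?n + norm (N y - N x)" using norm_triangle_sub by blast
    also have "\<dots> \<le> ?n + norm (N y) * (1/2)"
      using 1 mult_left_mono[of "?d y * ?n" "1/2" "norm (N y)"] elim(1) by simp
    finally have "norm (N y) \<le> 2 * ?n" by simp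
    then have "norm (N y) * (?d y * ?n) \<le> 2 * ?n * (?d y * ?n)" by (intro mult_right_mono) auto
    then show ?case using 1 by (simp add: algebra_simps)
  qed
  have "((\<lambda>y. N y - N x) \<longlongrightarrow> 0) (at x)"
    by (rule Lim_null_comparison[OF bd]) (use tendsto_mult_right[OF d0, of "2 * ?n * ?n"] in simp)
  then show ?thesis unfolding isCont_def by (simp add: LIM_zero_iff)
qed

text \<open>The derivative of \<open>N = M\<^sup>-\<^sup>1\<close> is \<open>- N M' N\<close>, so each degree of smoothness of \<open>N\<close> follows from the previous one.
  The first derivative comes from \<open>N y = N x + N y (M x - M y) N x\<close>, whose last product has a factor vanishing at \<open>x\<close>.\<close>

lemma Ck_on_blinfun_inverse:
  fixes M N :: "'e::euclidean_space \<Rightarrow> 'f::real_normed_vector \<Rightarrow>\<^sub>L 'f"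
  assumes "open S" "Ck_on k S M"
    and inv: "\<And>y. y \<in> S \<Longrightarrow> N y o\<^sub>L M y = id_blinfun" "\<And>y. y \<in> S \<Longrightarrow> M y o\<^sub>L N y = id_blinfun"
  shows "Ck_on k S N"
  using assms(2)
proof (induction k)
  case 0
  show ?case
    using blinfun_inverse_continuous[OF assms(1) _ _ inv] 0 assms(1)
    by (auto simp: continuous_on_eq_continuous_at)
next
  case (Suc k)
  let ?C = "(o\<^sub>L) :: ('f \<Rightarrow>\<^sub>L 'f) \<Rightarrow> ('f \<Rightarrow>\<^sub>L 'f) \<Rightarrow> ('f \<Rightarrow>\<^sub>L 'f)"
  note bc = bounded_bilinear_blinfun_compose
  show ?case
  proof (rule Ck_on_SucI[where f' = "\<lambda>x v. N x o\<^sub>L (- frechet_derivative M (at x) v o\<^sub>L N x)"])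
    fix x assume x: "x \<in> S"
    have hM: "(M has_derivative frechet_derivative M (at x)) (at x)"
      by (rule Ck_on_has_derivative[OF Suc.prems x])
    have cN: "isCont N x"
      by (rule blinfun_inverse_continuous[OF assms(1) x has_derivative_continuous[OF hM] inv])
    have hg: "((\<lambda>y. (M x - M y) o\<^sub>L N x) has_derivative (\<lambda>v. - frechet_derivative M (at x) v o\<^sub>L N x)) (at x)"
      by (rule has_derivative_eq_rhs[OF bounded_linear.has_derivative[OF bounded_bilinear.bounded_linear_left[OF bc]
            has_derivative_diff[OF has_derivative_const hM]]]) simp
    have "((\<lambda>y. N x + (N y o\<^sub>L ((M x - M y) o\<^sub>L N x))) has_derivative
        (\<lambda>v. 0 + (N x o\<^sub>L (- frechet_derivative M (at x) v o\<^sub>L N x)))) (at x)"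
      by (intro has_derivative_add has_derivative_const has_derivative_bilinear_vanishing[OF bc cN hg]) simp
    moreover have "N x + (N y o\<^sub>L ((M x - M y) o\<^sub>L N x)) = N y" if "y \<in> S" for y
    proof (rule blinfun_eqI)
      fix v
      have "N y (M y (N x v)) = N x v" "M x (N x v) = v"
        using x inv that by (metis blinfun_apply_blinfun_compose id_blinfun.rep_eq id_apply)+
      then show "(N x + (N y o\<^sub>L ((M x - M y) o\<^sub>L N x))) v = N y v"
        by (simp add: blinfun.diff_left blinfun.diff_right blinfun.add_left)
    qed
    ultimately show "(N has_derivative (\<lambda>v. N x o\<^sub>L (- frechet_derivative M (at x) v o\<^sub>L N x))) (at x)"
      by (auto intro: has_derivative_transform_within_open[OF _ assms(1) x])
  next
    fix v
    have N: "Ck_on k S N" using Suc.IH[OF Ck_on_SucD[OF Suc.prems]] .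
    have "Ck_on k S (\<lambda>x. - frechet_derivative M (at x) v)"
      by (rule Ck_on_linear_comp[OF bounded_linear_minus[OF bounded_linear_ident] assms(1)]) (use Suc.prems in simp)
    then show "Ck_on k S (\<lambda>x. N x o\<^sub>L (- frechet_derivative M (at x) v o\<^sub>L N x))"
      by (intro Ck_on_bilinear[OF bc] assms(1) N)
  qed (rule assms(1))
qed

definition blinfun_inv :: "('f::real_normed_vector \<Rightarrow>\<^sub>L 'f) \<Rightarrow> 'f \<Rightarrow>\<^sub>L 'f" where
  "blinfun_inv M = (SOME N. N o\<^sub>L M = id_blinfun \<and> M o\<^sub>L N = id_blinfun)"

definition blinfun_invertible :: "('f::real_normed_vector \<Rightarrow>\<^sub>L 'f) \<Rightarrow> bool" where
  "blinfun_invertible M \<longleftrightarrow> (\<exists>N. N o\<^sub>L M = id_blinfun \<and> M o\<^sub>L N = id_blinfun)"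

lemma blinfun_inv:
  assumes "blinfun_invertible M"
  shows "blinfun_inv M o\<^sub>L M = id_blinfun" "M o\<^sub>L blinfun_inv M = id_blinfun"
    "blinfun_inv M (M v) = v" "M (blinfun_inv M v) = v"
proof -
  show 1: "blinfun_inv M o\<^sub>L M = id_blinfun" "M o\<^sub>L blinfun_inv M = id_blinfun"
    using someI_ex[OF assms[unfolded blinfun_invertible_def]] by (auto simp: blinfun_inv_def)
  show "blinfun_inv M (M v) = v" "M (blinfun_inv M v) = v"
    using arg_cong[OF 1(1), of "\<lambda>N. blinfun_apply N v"] arg_cong[OF 1(2), of "\<lambda>N. blinfun_apply N v"] by auto
qed

lemma blinfun_invertibleI_injective:
  fixes M :: "'f::euclidean_space \<Rightarrow>\<^sub>L 'f"
  assumes "\<And>v. M v = 0 \<Longrightarrow> v = 0"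
  shows "blinfun_invertible M"
proof -
  have lin: "linear (blinfun_apply M)" by (simp add: blinfun.bounded_linear_right bounded_linear.linear)
  then have "inj (blinfun_apply M)" using assms linear_injective_0 by blast
  then obtain g where g: "linear g" "\<And>x. g (M x) = x" "\<And>x. M (g x) = x"
    using linear_injective_isomorphism[OF lin] by blast
  have "Blinfun g o\<^sub>L M = id_blinfun \<and> M o\<^sub>L Blinfun g = id_blinfun"
    using g by (auto intro!: blinfun_eqI simp: bounded_linear_Blinfun_apply linear_conv_bounded_linear)
  then show ?thesis unfolding blinfun_invertible_def by blast
qed

lemma blinfun_invertible_injective: "blinfun_invertible M \<Longrightarrow> M v = 0 \<Longrightarrow> v = 0"
  by (metis blinfun_inv(3) blinfun.zero_right)

lemma blinfun_invertible_one_plus: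
  fixes A :: "'f::euclidean_space \<Rightarrow>\<^sub>L 'f"
  assumes "norm A < 1" shows "blinfun_invertible (id_blinfun + A)"
proof (rule blinfun_invertibleI_injective)
  fix v assume "(id_blinfun + A) v = 0"
  then have "v = - A v" by (simp add: blinfun.add_left eq_neg_iff_add_eq_0)
  then have "norm v = norm (A v)" using norm_minus_cancel by metis
  also have "\<dots> \<le> norm A * norm v" by (rule norm_blinfun)
  finally have "(1 - norm A) * norm v \<le> 0" by (simp add: algebra_simps)
  then show "v = 0" using assms by (simp add: mult_le_0_iff)
qed

lemma smooth_on_blinfun_inv:
  fixes M :: "'e::euclidean_space \<Rightarrow> 'f::real_normed_vector \<Rightarrow>\<^sub>L 'f"
  assumes "open S" "smooth_on S M" "\<And>x. x \<in> S \<Longrightarrow> blinfun_invertible (M x)"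
  shows "smooth_on S (\<lambda>x. blinfun_inv (M x))"
  unfolding smooth_on_def
proof
  show "Ck_on k S (\<lambda>x. blinfun_inv (M x))" for k
    by (rule Ck_on_blinfun_inverse[where M = M])
      (use assms in \<open>auto simp: smooth_on_def intro: blinfun_inv\<close>)
qed

subsection \<open>Hadamard's lemma\<close>

lemma Ck_on_imp_continuous_on: "Ck_on k S f \<Longrightarrow> continuous_on S f"
  by (induction k) (auto dest: Ck_on_SucD simp del: Ck_on.simps(2))

text \<open>Differentiating under the integral sign produces a factor \<open>t\<close> at each step; this is why all weights \<open>t ^ m\<close> are
  treated together.\<close>

lemma Ck_on_radial_average:
  fixes h :: "'e::euclidean_space \<Rightarrow> real"
  assumes "Ck_on k (ball x0 R) h"
  shows "Ck_on k (ball x0 R) (\<lambda>x. integral (cbox 0 1) (\<lambda>t. t ^ m * h (x0 + t *\<^sub>R (x - x0))))"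
  using assms
proof (induction k arbitrary: h m)
  have in_ball: "x0 + t *\<^sub>R (x - x0) \<in> ball x0 R" if "x \<in> ball x0 R" "t \<in> cbox 0 (1::real)" for x t
  proof -
    have "norm (t *\<^sub>R (x - x0)) \<le> 1 * norm (x - x0)"
      unfolding norm_scaleR using that by (intro mult_right_mono) auto
    then show ?thesis using that by (auto simp: dist_norm norm_minus_commute)
  qed
  have cont: "continuous_on (ball x0 R \<times> cbox 0 1) (\<lambda>(x, t). t ^ m * h (x0 + t *\<^sub>R (x - x0)))"
    if "continuous_on (ball x0 R) h" for h :: "'e \<Rightarrow> real" and m
  proof -
    have "continuous_on (ball x0 R \<times> cbox 0 1) (\<lambda>p. h (x0 + snd p *\<^sub>R (fst p - x0)))"
      by (rule continuous_on_compose2[OF that]) (use in_ball in \<open>auto intro!: continuous_intros\<close>)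
    then show ?thesis by (auto simp: split_beta intro!: continuous_intros)
  qed
  {
    case 0
    show ?case using integral_continuous_on_param[OF cont] 0 by simp
  next
    case (Suc k)
    let ?D = "\<lambda>b x. frechet_derivative h (at x) b"
    let ?fx = "\<lambda>x t. \<Sum>b\<in>Basis. (t ^ Suc m * ?D b (x0 + t *\<^sub>R (x - x0))) *\<^sub>R blinfun_inner_left b"
    have cD: "continuous_on (ball x0 R) (?D b)" for b
      using Suc.prems by (auto intro: Ck_on_imp_continuous_on)
    have ch: "continuous_on (ball x0 R) h"
      using Suc.prems by (auto intro!: continuous_at_imp_continuous_on differentiable_imp_continuous_within)
    have int: "(\<lambda>t. t ^ m * g (x0 + t *\<^sub>R (x - x0))) integrable_on cbox 0 1"
      if "x \<in> ball x0 R" "continuous_on (ball x0 R) g" for g :: "'e \<Rightarrow> real" and x m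
    proof (rule integrable_continuous)
      show "continuous_on (cbox 0 1) (\<lambda>t. t ^ m * g (x0 + t *\<^sub>R (x - x0)))"
        by (intro continuous_intros continuous_on_compose2[OF that(2)]) (use that(1) in_ball in auto)
    qed
    show ?case
    proof (rule Ck_on_SucI[where f' = "\<lambda>x v. \<Sum>b\<in>Basis. (v \<bullet> b) *
        integral (cbox 0 1) (\<lambda>t. t ^ Suc m * ?D b (x0 + t *\<^sub>R (x - x0)))"])
      fix x assume x: "x \<in> ball x0 R"
      have "((\<lambda>x. integral (cbox 0 1) (\<lambda>t. t ^ m * h (x0 + t *\<^sub>R (x - x0)))) has_derivative
          blinfun_apply (integral (cbox 0 1) (?fx x))) (at x within ball x0 R)"
      proof (rule leibniz_rule)
        fix y and t :: real assume y: "y \<in> ball x0 R" and t: "t \<in> cbox 0 1"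
        have hd: "(h has_derivative frechet_derivative h (at (x0 + t *\<^sub>R (y - x0)))) (at (x0 + t *\<^sub>R (y - x0)))"
          using Ck_on_has_derivative[OF Suc.prems in_ball[OF y t]] .
        have "((\<lambda>x. t ^ m * h (x0 + t *\<^sub>R (x - x0))) has_derivative
            (\<lambda>v. t ^ m * frechet_derivative h (at (x0 + t *\<^sub>R (y - x0))) (t *\<^sub>R v))) (at y)"
          by (rule has_derivative_mult_right[OF has_derivative_compose[where f = "\<lambda>y. x0 + t *\<^sub>R (y - x0)", OF _ hd]])
            (auto intro!: derivative_eq_intros)
        moreover have "(\<lambda>v. t ^ m * frechet_derivative h (at (x0 + t *\<^sub>R (y - x0))) (t *\<^sub>R v)) = blinfun_apply (?fx y t)"
        proof (rule ext)
          fix v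
          let ?y = "x0 + t *\<^sub>R (y - x0)"
          have "h differentiable (at ?y)" using hd unfolding differentiable_def by blast
          from frechet_derivative_Basis[OF this, of "t *\<^sub>R v"]
          show "t ^ m * frechet_derivative h (at ?y) (t *\<^sub>R v) = blinfun_apply (?fx y t) v"
            by (simp add: blinfun.sum_left blinfun.scaleR_left sum_distrib_left inner_commute mult_ac)
        qed
        ultimately show "((\<lambda>x. t ^ m * h (x0 + t *\<^sub>R (x - x0))) has_derivative blinfun_apply (?fx y t))
            (at y within ball x0 R)" using has_derivative_at_withinI by metis
      next
        show "continuous_on (ball x0 R \<times> cbox 0 1) (\<lambda>(x, t). ?fx x t)"
          using cont[OF cD, where m = "Suc m"] unfolding split_beta
          by (intro continuous_on_sum continuous_on_scaleR continuous_on_const) auto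
      qed (use x int[OF _ ch] in auto)
      moreover have "integral (cbox 0 1) (?fx x) v = (\<Sum>b\<in>Basis. (v \<bullet> b) *
        integral (cbox 0 1) (\<lambda>t. t ^ Suc m * ?D b (x0 + t *\<^sub>R (x - x0))))" for v
      proof -
        have i: "(\<lambda>t. (t ^ Suc m * ?D b (x0 + t *\<^sub>R (x - x0))) *\<^sub>R blinfun_inner_left b) integrable_on cbox 0 1" for b
          using integrable_linear[OF int[OF x cD, where m = "Suc m"], of "\<lambda>r. r *\<^sub>R blinfun_inner_left b"]
          by (simp add: o_def bounded_linear_scaleR_left)
        have "integral (cbox 0 1) (?fx x) v = integral (cbox 0 1) (\<lambda>t. ?fx x t v)"
          by (rule blinfun_apply_integral) (rule integrable_sum, use i in auto)
        also have "\<dots> = integral (cbox 0 1) (\<lambda>t. \<Sum>b\<in>Basis. (v \<bullet> b) * (t ^ Suc m * ?D b (x0 + t *\<^sub>R (x - x0))))"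
          by (simp add: blinfun.sum_left blinfun.scaleR_left inner_commute mult.commute)
        also have "\<dots> = (\<Sum>b\<in>Basis. integral (cbox 0 1) (\<lambda>t. (v \<bullet> b) * (t ^ Suc m * ?D b (x0 + t *\<^sub>R (x - x0)))))"
          by (rule integral_sum) (use int[OF x cD, where m = "Suc m"] in \<open>auto intro!: integrable_on_mult_right simp del: power_Suc\<close>)
        finally show ?thesis by simp
      qed
      ultimately show "((\<lambda>x. integral (cbox 0 1) (\<lambda>t. t ^ m * h (x0 + t *\<^sub>R (x - x0)))) has_derivative
          (\<lambda>v. \<Sum>b\<in>Basis. (v \<bullet> b) * integral (cbox 0 1) (\<lambda>t. t ^ Suc m * ?D b (x0 + t *\<^sub>R (x - x0))))) (at x)"
        unfolding at_within_open[OF x open_ball] by (rule has_derivative_eq_rhs[OF _ ext])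
    next
      fix v
      show "Ck_on k (ball x0 R) (\<lambda>x. \<Sum>b\<in>Basis. (v \<bullet> b) *
        integral (cbox 0 1) (\<lambda>t. t ^ Suc m * ?D b (x0 + t *\<^sub>R (x - x0))))"
        by (intro Ck_on_sum Ck_on_bilinear[OF bounded_bilinear_mult] Ck_on_const Suc.IH open_ball)
          (use Suc.prems in simp)
    qed simp
  }
qed

text \<open>Write \<open>f x - f x0\<close> as the integral of its derivative along the segment.\<close>

lemma hadamard:
  fixes f :: "'e::euclidean_space \<Rightarrow> real"
  assumes "smooth_on (ball x0 R) f" "R > 0"
  obtains g where "\<And>b. smooth_on (ball x0 R) (g b)"
    "\<And>b. g b x0 = frechet_derivative f (at x0) b"
    "\<And>x. x \<in> ball x0 R \<Longrightarrow> f x = f x0 + (\<Sum>b\<in>Basis. ((x - x0) \<bullet> b) * g b x)"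
proof
  let ?D = "\<lambda>b x. frechet_derivative f (at x) b"
  let ?g = "\<lambda>b x. integral (cbox 0 1) (\<lambda>t::real. t ^ 0 * ?D b (x0 + t *\<^sub>R (x - x0)))"
  show "smooth_on (ball x0 R) (?g b)" for b
    using Ck_on_radial_average[of _ x0 R "?D b" 0] smooth_on_frechet_derivative[OF assms(1), of b]
    unfolding smooth_on_def by blast
  show "?g b x0 = ?D b x0" for b by simp
  fix x assume x: "x \<in> ball x0 R"
  have in_ball: "x0 + t *\<^sub>R (x - x0) \<in> ball x0 R" if "t \<in> cbox 0 (1::real)" for t
  proof -
    have "norm (t *\<^sub>R (x - x0)) \<le> 1 * norm (x - x0)"
      unfolding norm_scaleR using that by (intro mult_right_mono) auto
    then show ?thesis using x by (auto simp: dist_norm norm_minus_commute)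
  qed
  have "((\<lambda>t. \<Sum>b\<in>Basis. ((x - x0) \<bullet> b) * ?D b (x0 + t *\<^sub>R (x - x0))) has_integral
      f (x0 + 1 *\<^sub>R (x - x0)) - f (x0 + 0 *\<^sub>R (x - x0))) {0..1}"
  proof (rule fundamental_theorem_of_calculus)
    fix t :: real assume t: "t \<in> {0..1}"
    have hd: "(f has_derivative frechet_derivative f (at (x0 + t *\<^sub>R (x - x0)))) (at (x0 + t *\<^sub>R (x - x0)))"
      using smooth_on_has_derivative[OF assms(1) in_ball] t by simp
    have "((\<lambda>t. f (x0 + t *\<^sub>R (x - x0))) has_derivative
        (\<lambda>s. frechet_derivative f (at (x0 + t *\<^sub>R (x - x0))) (s *\<^sub>R (x - x0)))) (at t)"
      by (rule has_derivative_compose[where f = "\<lambda>t. x0 + t *\<^sub>R (x - x0)", OF _ hd]) (auto intro!: derivative_eq_intros)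
    moreover have "frechet_derivative f (at (x0 + t *\<^sub>R (x - x0))) (s *\<^sub>R (x - x0)) =
       s *\<^sub>R (\<Sum>b\<in>Basis. ((x - x0) \<bullet> b) * ?D b (x0 + t *\<^sub>R (x - x0)))" for s
    proof -
      let ?y = "x0 + t *\<^sub>R (x - x0)"
      have "f differentiable (at ?y)" using hd unfolding differentiable_def by blast
      from frechet_derivative_Basis[OF this, of "s *\<^sub>R (x - x0)"] show ?thesis
        by (simp add: sum_distrib_left mult.assoc)
    qed
    ultimately show "((\<lambda>t. f (x0 + t *\<^sub>R (x - x0))) has_vector_derivative
       (\<Sum>b\<in>Basis. ((x - x0) \<bullet> b) * ?D b (x0 + t *\<^sub>R (x - x0)))) (at t within {0..1})"
      unfolding has_vector_derivative_def by (simp add: has_derivative_at_withinI)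
  qed simp
  then have "f x - f x0 = integral {0..1} (\<lambda>t. \<Sum>b\<in>Basis. ((x - x0) \<bullet> b) * ?D b (x0 + t *\<^sub>R (x - x0)))"
    by (simp add: integral_unique)
  also have "\<dots> = (\<Sum>b\<in>Basis. integral {0..1} (\<lambda>t. ((x - x0) \<bullet> b) * ?D b (x0 + t *\<^sub>R (x - x0))))"
  proof (rule integral_sum)
    fix b :: 'e
    have "continuous_on {0..1} (\<lambda>t. ?D b (x0 + t *\<^sub>R (x - x0)))"
      by (rule continuous_on_compose2[OF smooth_on_imp_continuous_on[OF smooth_on_frechet_derivative[OF assms(1), of b]]])
        (use in_ball in \<open>auto intro!: continuous_intros\<close>)
    then show "(\<lambda>t. ((x - x0) \<bullet> b) * ?D b (x0 + t *\<^sub>R (x - x0))) integrable_on {0..1}"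
      by (intro integrable_on_mult_right integrable_continuous_real)
  qed simp
  finally show "f x = f x0 + (\<Sum>b\<in>Basis. ((x - x0) \<bullet> b) * ?g b x)" by simp
qed

subsection \<open>Bump functions\<close>

text \<open>The derivative of \<open>t\<^sup>-\<^sup>m exp (- 1/t)\<close> is a combination of functions of the same kind with exponents \<open>m + 1\<close> and
  \<open>m + 2\<close>, so smoothness of the whole family is proved at once.\<close>

definition flat :: "nat \<Rightarrow> real \<Rightarrow> real" where
  "flat m t = (if t > 0 then (1 / t) ^ m * exp (- (1 / t)) else 0)"

text \<open>The bound by a multiple of \<open>t\<^sup>2\<close> gives differentiability at \<open>0\<close>. It compares \<open>u ^ (m + 2)\<close> with \<open>exp u\<close> for \<open>u = 1 / t\<close>.\<close>

lemma flat_le: "\<bar>flat m t\<bar> \<le> fact (m + 2) * t\<^sup>2"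
proof (cases "t > 0")
  case True
  define u where "u = 1 / t"
  have u: "u > 0" "t = 1 / u" using True by (auto simp: u_def)
  have "(\<Sum>n\<in>{m + 2}. u ^ n /\<^sub>R fact n) \<le> (\<Sum>n. u ^ n /\<^sub>R fact n)"
    by (rule sum_le_suminf[OF summable_exp_generic]) (use u in auto)
  then have "u ^ (m + 2) / fact (m + 2) \<le> exp u"
    by (simp only: exp_def sum.insert finite.emptyI empty_iff sum.empty add_0_right if_False not_False_eq_True
        real_scaleR_def divide_inverse mult.commute)
  then have "u ^ (m + 2) \<le> fact (m + 2) * exp u"
    by (simp only: pos_divide_le_eq fact_gt_zero mult.commute)
  then have "u ^ m * exp (- u) \<le> fact (m + 2) * (1 / u)\<^sup>2"
    using u(1) by (simp add: exp_minus field_simps power2_eq_square)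
  then show ?thesis using True u by (simp add: flat_def)
qed (simp add: flat_def)

lemma flat_has_derivative:
  "(flat m has_derivative (\<lambda>v. v * (flat (m + 2) t - m * flat (m + 1) t))) (at t)"
proof -
  consider "t > 0" | "t < 0" | "t = 0" by linarith
  then show ?thesis
  proof cases
    case 1
    have "((\<lambda>t. (1 / t) ^ m * exp (- (1 / t))) has_real_derivative
        flat (m + 2) t - m * flat (m + 1) t) (at t)"
    proof -
      have d: "((\<lambda>t. 1 / t) has_real_derivative - (1 / t\<^sup>2)) (at t)"
        using 1 by (auto intro!: derivative_eq_intros simp: power2_eq_square)
      show ?thesis
      proof (cases m)
        case 0
        then show ?thesis using 1 DERIV_fun_exp[OF DERIV_minus[OF d]] by (simp add: flat_def power2_eq_square mult.commute)
      next
        case (Suc n)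
        show ?thesis unfolding Suc
          by (rule DERIV_cong[OF DERIV_mult[OF DERIV_power_Suc[OF d] DERIV_fun_exp[OF DERIV_minus[OF d]]]])
            (use 1 in \<open>simp add: flat_def field_simps power2_eq_square\<close>)
      qed
    qed
    then have "(flat m has_real_derivative flat (m + 2) t - m * flat (m + 1) t) (at t)"
      by (rule DERIV_cong_ev[THEN iffD1, rotated -1])
        (use 1 in \<open>auto simp: flat_def intro!: eventually_mono[OF eventually_nhds_in_open[of "{0<..}"]]\<close>)
    then show ?thesis by (simp add: has_field_derivative_def mult.commute[of _ "flat _ _ - _"])
  next
    case 2
    then have "(flat m has_derivative (\<lambda>v. 0)) (at t)"
      by (intro has_derivative_transform_within_open[OF has_derivative_const[of 0], of "{..<0}"])
        (auto simp: flat_def)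
    then show ?thesis using 2 by (simp add: flat_def)
  next
    case 3
    have "(flat m has_derivative (\<lambda>v. 0)) (at 0)"
      unfolding has_derivative_at_alt
    proof (intro conjI allI impI)
      fix e :: real assume e: "e > 0"
      obtain F :: real where F: "F > 0" "F = fact (m + 2)" by (metis fact_gt_zero)
      show "\<exists>d>0. \<forall>y. norm (y - 0) < d \<longrightarrow> norm (flat m y - flat m 0 - 0) \<le> e * norm (y - 0)"
      proof (intro exI[of _ "e / F"] conjI allI impI)
        fix y :: real assume y: "norm (y - 0) < e / F"
        have "\<bar>flat m y\<bar> \<le> F * \<bar>y\<bar> * \<bar>y\<bar>"
          using flat_le[of m y, folded F(2)] by (simp add: power2_eq_square mult.assoc)
        also have "\<dots> \<le> e * \<bar>y\<bar>"
          by (rule mult_right_mono) (use y F(1) in \<open>simp_all add: field_simps\<close>)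
        finally show "norm (flat m y - flat m 0 - 0) \<le> e * norm (y - 0)" by (simp add: flat_def)
      qed (use e F(1) in simp)
    qed simp
    then show ?thesis using 3 by (simp add: flat_def)
  qed
qed

lemma smooth_on_flat: "smooth_on UNIV (flat m)"
proof -
  have "Ck_on k UNIV (flat m)" for k
  proof (induction k arbitrary: m)
    case 0
    then show ?case
      using flat_has_derivative has_derivative_continuous by (fastforce simp: continuous_on_eq_continuous_at)
  next
    case (Suc k)
    have "Ck_on k UNIV (\<lambda>x. v * (flat (m + 2) x + (- real m) * flat (m + 1) x))" for v
      by (intro Ck_on_bilinear[OF bounded_bilinear_mult] Ck_on_add Ck_on_const Suc.IH open_UNIV)
    then show ?case
      by (intro Ck_on_SucI[OF _ flat_has_derivative]) (auto simp: algebra_simps)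
  qed
  then show ?thesis by (simp add: smooth_on_def)
qed

lemma smooth_bump:
  fixes x0 :: "'e::euclidean_space"
  assumes "0 < r" "r < R"
  obtains \<rho> :: "'e \<Rightarrow> real" where "smooth_on UNIV \<rho>" "\<And>x. 0 \<le> \<rho> x" "\<And>x. \<rho> x \<le> 1"
    "\<And>x. x \<in> cball x0 r \<Longrightarrow> \<rho> x = 1" "\<And>x. x \<notin> ball x0 R \<Longrightarrow> \<rho> x = 0"
proof
  let ?q = "\<lambda>x. (x - x0) \<bullet> (x - x0)"
  let ?f = "\<lambda>x. flat 0 (R\<^sup>2 - ?q x)" and ?g = "\<lambda>x. flat 0 (?q x - r\<^sup>2)"
  have q: "?q x = (dist x0 x)\<^sup>2" for x
    by (simp add: dist_norm norm_minus_commute[of x0] power2_norm_eq_inner)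
  have nn: "flat 0 t \<ge> 0" "flat 0 t > 0 \<longleftrightarrow> t > 0" for t by (auto simp: flat_def)
  have pos: "?f x + ?g x > 0" for x
  proof (cases "dist x0 x < R")
    case True
    then have "?f x > 0" unfolding nn q using assms by (simp add: power_strict_mono)
    then show ?thesis using nn(1) by (simp add: add_pos_nonneg)
  next
    case False
    then have "r < dist x0 x" using assms by simp
    then have "?g x > 0" unfolding nn q using assms by (simp add: power_strict_mono)
    then show ?thesis using nn(1) by (simp add: add_nonneg_pos)
  qed
  have sq: "smooth_on UNIV ?q"
    by (intro smooth_on_bilinear[OF bounded_bilinear_inner] smooth_on_diff smooth_on_id smooth_on_const open_UNIV)
  have sf: "smooth_on UNIV ?f"
    by (rule smooth_on_compose[OF _ _ _ _ smooth_on_flat])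
      (auto intro!: smooth_on_diff smooth_on_const sq)
  have sg: "smooth_on UNIV ?g"
    by (rule smooth_on_compose[OF _ _ _ _ smooth_on_flat])
      (auto intro!: smooth_on_diff smooth_on_const sq)
  let ?c = "\<lambda>x. ?f x * inverse (?f x + ?g x)"
  show "smooth_on UNIV ?c"
    using pos by (intro smooth_on_mult smooth_on_inverse smooth_on_add sf sg open_UNIV) (metis less_irrefl)
  show "0 \<le> ?c x" for x using nn(1) pos[of x] by (simp add: zero_le_mult_iff)
  show "?c x \<le> 1" for x using nn(1)[of "?q x - r\<^sup>2"] pos[of x] by (simp add: field_simps)
  show "?c x = 1" if "x \<in> cball x0 r" for x
  proof -
    have "?q x \<le> r\<^sup>2" unfolding q using that assms by (simp add: power_mono)
    then have "?g x = 0" by (simp add: flat_def)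
    then show ?thesis using pos[of x] by simp
  qed
  show "?c x = 0" if "x \<notin> ball x0 R" for x
  proof -
    have "R\<^sup>2 \<le> ?q x" unfolding q using that assms by (simp add: power_mono)
    then show ?thesis by (simp add: flat_def)
  qed
qed

lemma smooth_bump_ball:
  fixes x0 :: "'e::euclidean_space"
  assumes "0 < r" "r < R"
  obtains \<rho> :: "'e \<Rightarrow> real" where "smooth_on UNIV \<rho>"
    "\<And>x. x \<in> cball x0 r \<Longrightarrow> \<rho> x = 1" "\<And>x. x \<notin> ball x0 R \<Longrightarrow> \<rho> x = 0"
  by (rule smooth_bump[OF assms, of x0]) (rule that)

subsection \<open>Lipschitz bounds\<close>

lemma smooth_on_Lipschitz:
  fixes f :: "'e::euclidean_space \<Rightarrow> 'f::real_normed_vector"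
  assumes "open S" "smooth_on S f" "K \<subseteq> S" "compact K" "convex K"
  obtains L where "\<And>x y. x \<in> K \<Longrightarrow> y \<in> K \<Longrightarrow> norm (f x - f y) \<le> L * norm (x - y)"
proof -
  let ?D = "\<lambda>x. \<Sum>b\<in>Basis. norm (frechet_derivative f (at x) b)"
  have "continuous_on K ?D"
    using smooth_on_imp_continuous_on[OF smooth_on_frechet_derivative[OF assms(2)]] assms(3)
    by (auto intro!: continuous_intros intro: continuous_on_subset)
  then have "bounded (?D ` K)" using assms(4) compact_continuous_image compact_imp_bounded by blast
  then obtain L where L: "\<And>x. x \<in> K \<Longrightarrow> ?D x \<le> L"
    unfolding bounded_iff by (metis abs_le_D1 imageI real_norm_def)
  show ?thesis
  proof
    fix x y assume "x \<in> K" "y \<in> K"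
    then show "norm (f x - f y) \<le> L * norm (x - y)"
    proof (rule differentiable_bound[OF assms(5), rotated -2])
      fix z assume z: "z \<in> K"
      show d: "(f has_derivative frechet_derivative f (at z)) (at z within K)"
        using smooth_on_has_derivative[OF assms(2)] z assms(3) by (blast intro: has_derivative_at_withinI)
      show "onorm (frechet_derivative f (at z)) \<le> L"
      proof (rule onorm_le)
        fix v
        have "f differentiable (at z)"
          using smooth_on_has_derivative[OF assms(2)] z assms(3) unfolding differentiable_def by blast
        then have "norm (frechet_derivative f (at z) v) \<le> (\<Sum>b\<in>Basis. norm ((v \<bullet> b) *\<^sub>R frechet_derivative f (at z) b))"
          by (simp add: frechet_derivative_Basis sum_norm_le norm_sum)
        also have "\<dots> \<le> (\<Sum>b\<in>Basis. norm v * norm (frechet_derivative f (at z) b))"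
          by (intro sum_mono) (auto intro: mult_right_mono Basis_le_norm)
        also have "\<dots> = norm v * ?D z" by (simp add: sum_distrib_left)
        also have "\<dots> \<le> L * norm v" using mult_left_mono[OF L[OF z] norm_ge_zero[of v]] by (simp add: mult.commute)
        finally show "norm (frechet_derivative f (at z) v) \<le> L * norm v" .
      qed
    qed
  qed
qed

section \<open>Manifolds in charts\<close>

definition cimg :: "('a, 'e) chart \<Rightarrow> 'e set" where "cimg c = snd c ` fst c"

definition cinv :: "('a, 'e) chart \<Rightarrow> 'e \<Rightarrow> 'a" where "cinv c = inv_into (fst c) (snd c)"

definition cut :: "('a, 'e) chart \<Rightarrow> ('e \<Rightarrow> real) \<Rightarrow> ('e \<Rightarrow> 'f::real_normed_vector) \<Rightarrow> 'a \<Rightarrow> 'f" where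
  "cut c \<rho> h p = (if p \<in> fst c then \<rho> (snd c p) *\<^sub>R h (snd c p) else 0)"

text \<open>The directional derivative along \<open>u\<close> in the chart \<open>c\<close>. It is zero on functions that are not smooth because elements of
  \<^const>\<open>tangent_space\<close> are.\<close>

definition tvec :: "('a, 'e::euclidean_space) chart set \<Rightarrow> ('a, 'e) chart \<Rightarrow> 'a \<Rightarrow> 'e \<Rightarrow> 'a tangent" where
  "tvec A c p u = (\<lambda>f. if smooth_fun A f then frechet_derivative (f \<circ> cinv c) (at (snd c p)) u else 0)"

locale smooth_mfd =
  fixes X :: "'a topology" and A :: "('a, 'e::euclidean_space) chart set"
  assumes mfd: "smooth_manifold X A"
begin

lemma hausdorff: "Hausdorff_space X" and second_countable: "second_countable X"
  using mfd by (simp_all add: smooth_manifold_def)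

lemma chart:
  assumes "c \<in> A"
  shows "openin X (fst c)" "open (cimg c)"
    "homeomorphic_map (subtopology X (fst c)) (top_of_set (cimg c)) (snd c)"
proof -
  have "is_chart X c" using mfd assms by (simp add: smooth_manifold_def)
  then show "openin X (fst c)" "open (cimg c)"
    "homeomorphic_map (subtopology X (fst c)) (top_of_set (cimg c)) (snd c)"
    by (simp_all add: is_chart_def cimg_def split_beta)
qed

lemma chart_cover: assumes "p \<in> topspace X" shows "\<exists>c\<in>A. p \<in> fst c"
proof -
  have "topspace X = (\<Union>c\<in>A. fst c)" using mfd by (simp add: smooth_manifold_def split_beta)
  then show ?thesis using assms by auto
qed

lemma transition:
  assumes "c \<in> A" "d \<in> A" shows "smooth_on (snd c ` (fst c \<inter> fst d)) (snd d \<circ> cinv c)"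
  using mfd assms unfolding smooth_manifold_def cinv_def
  by (auto simp: split_beta)

lemma chart_sub: "c \<in> A \<Longrightarrow> p \<in> fst c \<Longrightarrow> p \<in> topspace X"
  using chart(1) openin_subset by blast

lemma chart_inj: "c \<in> A \<Longrightarrow> inj_on (snd c) (fst c)"
  using homeomorphic_imp_injective_map[OF chart(3)] chart(1)[THEN openin_subset]
  by (auto simp: topspace_subtopology Int_absorb1)

lemma cinv_cmap [simp]: "c \<in> A \<Longrightarrow> p \<in> fst c \<Longrightarrow> cinv c (snd c p) = p"
  unfolding cinv_def by (simp add: chart_inj)

lemma cmap_cinv [simp]: "x \<in> cimg c \<Longrightarrow> snd c (cinv c x) = x"
  and cinv_in [simp]: "x \<in> cimg c \<Longrightarrow> cinv c x \<in> fst c"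
  unfolding cinv_def cimg_def by (auto simp: f_inv_into_f inv_into_into)

lemma cmap_in [simp]: "p \<in> fst c \<Longrightarrow> snd c p \<in> cimg c"
  unfolding cimg_def by auto

lemma openin_pullback:
  assumes "c \<in> A" "open T" shows "openin X {p \<in> fst c. snd c p \<in> T}"
proof -
  have "continuous_map (subtopology X (fst c)) (top_of_set (cimg c)) (snd c)"
    using homeomorphic_imp_continuous_map[OF chart(3)[OF assms(1)]] .
  then have "continuous_map (subtopology X (fst c)) euclidean (snd c)"
    using continuous_map_in_subtopology by blast
  then have "openin (subtopology X (fst c)) {p \<in> topspace (subtopology X (fst c)). snd c p \<in> T}"
    by (rule openin_continuous_map_preimage) (use assms(2) in simp)
  moreover have "topspace (subtopology X (fst c)) = fst c"
    using chart(1)[OF assms(1), THEN openin_subset] by (auto simp: topspace_subtopology)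
  ultimately show ?thesis using openin_trans_full[OF _ chart(1)[OF assms(1)]] by metis
qed

lemma open_image:
  assumes "c \<in> A" "openin X W" shows "open (snd c ` (fst c \<inter> W))"
proof -
  have "openin (subtopology X (fst c)) (fst c \<inter> W)"
    using assms(2) by (metis Int_commute openin_subtopology_Int)
  then have "openin (top_of_set (cimg c)) (snd c ` (fst c \<inter> W))"
    using homeomorphic_imp_open_map[OF chart(3)[OF assms(1)]] unfolding open_map_def by blast
  then show ?thesis using chart(2)[OF assms(1)] openin_open_trans by blast
qed

lemma compactin_cinv:
  assumes "c \<in> A" "compact K" "K \<subseteq> cimg c" shows "compactin X (cinv c ` K)"
proof -
  have "homeomorphic_maps (subtopology X (fst c)) (top_of_set (cimg c)) (snd c) (cinv c)"
  proof -
    obtain g where g: "homeomorphic_maps (subtopology X (fst c)) (top_of_set (cimg c)) (snd c) g"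
      using chart(3)[OF assms(1)] homeomorphic_map_maps by blast
    moreover have "g x = cinv c x" if "x \<in> cimg c" for x
    proof -
      have "g x \<in> fst c" "snd c (g x) = x"
        using g that unfolding homeomorphic_maps_def continuous_map_def by (auto simp: Pi_iff)
      then show ?thesis using assms(1) cinv_cmap by metis
    qed
    ultimately show ?thesis by (auto intro: homeomorphic_maps_eq)
  qed
  then have "continuous_map (top_of_set (cimg c)) (subtopology X (fst c)) (cinv c)"
    unfolding homeomorphic_maps_def by blast
  moreover have "compactin (top_of_set (cimg c)) K"
    using assms(2,3) by (simp add: compactin_subtopology)
  ultimately have "compactin (subtopology X (fst c)) (cinv c ` K)" using image_compactin by blast
  then show ?thesis by (simp add: compactin_subtopology)
qed

lemma closedin_cinv: "c \<in> A \<Longrightarrow> compact K \<Longrightarrow> K \<subseteq> cimg c \<Longrightarrow> closedin X (cinv c ` K)"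
  using compactin_cinv compactin_imp_closedin hausdorff by blast

lemma mem_cinv_image: "c \<in> A \<Longrightarrow> K \<subseteq> cimg c \<Longrightarrow> p \<in> cinv c ` K \<longleftrightarrow> p \<in> fst c \<and> snd c p \<in> K"
  by (auto simp: subset_iff intro: image_eqI[of _ _ "snd c p"])

lemma smooth_funD: "smooth_fun A f \<Longrightarrow> c \<in> A \<Longrightarrow> smooth_on (cimg c) (f \<circ> cinv c)"
  unfolding smooth_fun_def cimg_def cinv_def by auto

lemma smooth_funI: "(\<And>c. c \<in> A \<Longrightarrow> smooth_on (cimg c) (f \<circ> cinv c)) \<Longrightarrow> smooth_fun A f"
  unfolding smooth_fun_def cimg_def cinv_def by auto

lemma smooth_on_change_chart:
  assumes "c \<in> A" "d \<in> A" "open T" "T \<subseteq> cimg c" "smooth_on T (f \<circ> cinv c)"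
  shows "smooth_on (snd d ` (fst d \<inter> cinv c ` T)) (f \<circ> cinv d)"
proof -
  let ?W = "snd d ` (fst d \<inter> cinv c ` T)"
  have "cinv c ` T = {p \<in> fst c. snd c p \<in> T}" using mem_cinv_image[OF assms(1,4)] by blast
  then have W: "openin X (cinv c ` T)" using openin_pullback[OF assms(1,3)] by simp
  have o: "open ?W" by (rule open_image[OF assms(2) W])
  have "smooth_on ?W (\<lambda>x. (f \<circ> cinv c) ((snd c \<circ> cinv d) x))"
  proof (rule smooth_on_compose[OF o assms(3) _ _ assms(5)])
    show "smooth_on ?W (snd c \<circ> cinv d)"
      by (rule smooth_on_subset[OF transition[OF assms(2,1)]]) (use assms(4) in auto)
    show "(snd c \<circ> cinv d) ` ?W \<subseteq> T" using assms(2,4) by auto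
  qed
  then show ?thesis
    by (rule smooth_on_cong[OF o, rotated]) (use assms(1,2,4) in auto)
qed

lemma smooth_fun_localI:
  assumes "\<And>p. p \<in> topspace X \<Longrightarrow> \<exists>c\<in>A. \<exists>T. p \<in> fst c \<and> open T \<and> snd c p \<in> T \<and> T \<subseteq> cimg c \<and> smooth_on T (f \<circ> cinv c)"
  shows "smooth_fun A f"
proof (intro smooth_funI smooth_on_local)
  fix d x assume d: "d \<in> A" and x: "x \<in> cimg d"
  obtain c T where c: "c \<in> A" "cinv d x \<in> fst c" "open T" "snd c (cinv d x) \<in> T" "T \<subseteq> cimg c" "smooth_on T (f \<circ> cinv c)"
    using assms[OF chart_sub[OF d cinv_in[OF x]]] by blast
  let ?W = "snd d ` (fst d \<inter> cinv c ` T)"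
  have "cinv c ` T = {p \<in> fst c. snd c p \<in> T}" using mem_cinv_image[OF c(1,5)] by blast
  then have "openin X (cinv c ` T)" using openin_pullback[OF c(1,3)] by simp
  then have "open ?W" by (rule open_image[OF d])
  moreover have "x \<in> ?W"
    using c x by (intro image_eqI[of _ _ "cinv d x"]) (auto simp: mem_cinv_image)
  ultimately show "\<exists>T. open T \<and> x \<in> T \<and> smooth_on T (f \<circ> cinv d)"
    using smooth_on_change_chart[OF c(1) d c(3,5,6)] by blast
qed

lemma smooth_fun_local:
  assumes "\<And>p. p \<in> topspace X \<Longrightarrow> \<exists>W g. openin X W \<and> p \<in> W \<and> smooth_fun A g \<and> (\<forall>q\<in>W. f q = g q)"
  shows "smooth_fun A f"
proof (rule smooth_fun_localI)
  fix p assume p: "p \<in> topspace X"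
  obtain c where c: "c \<in> A" "p \<in> fst c" using chart_cover[OF p] by blast
  obtain W g where W: "openin X W" "p \<in> W" "smooth_fun A g" "\<forall>q\<in>W. f q = g q" using assms[OF p] by blast
  have T: "open (snd c ` (fst c \<inter> W))" by (rule open_image[OF c(1) W(1)])
  have "smooth_on (snd c ` (fst c \<inter> W)) (f \<circ> cinv c)"
    by (rule smooth_on_cong[OF T _ smooth_on_subset[OF smooth_funD[OF W(3) c(1)]]])
      (use W(4) c in \<open>auto simp: cimg_def\<close>)
  then show "\<exists>c\<in>A. \<exists>T. p \<in> fst c \<and> open T \<and> snd c p \<in> T \<and> T \<subseteq> cimg c \<and> smooth_on T (f \<circ> cinv c)"
    using c W T by (intro bexI[OF _ c(1)] exI[of _ "snd c ` (fst c \<inter> W)"]) (auto simp: cimg_def)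
qed

lemma smooth_fun_cong: "smooth_fun A g \<Longrightarrow> (\<And>p. p \<in> topspace X \<Longrightarrow> f p = g p) \<Longrightarrow> smooth_fun A f"
  by (rule smooth_fun_local) blast

lemma smooth_fun_const: "smooth_fun A (\<lambda>x. k)"
  by (rule smooth_funI) (auto simp: o_def intro: smooth_on_const chart)

lemma smooth_fun_add: "smooth_fun A f \<Longrightarrow> smooth_fun A g \<Longrightarrow> smooth_fun A (\<lambda>x. f x + g x)"
  by (rule smooth_funI) (use smooth_on_add[OF chart(2) smooth_funD smooth_funD] in \<open>simp add: o_def\<close>)

lemma smooth_fun_bilinear:
  "bounded_bilinear B \<Longrightarrow> smooth_fun A f \<Longrightarrow> smooth_fun A g \<Longrightarrow> smooth_fun A (\<lambda>x. B (f x) (g x))"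
  by (rule smooth_funI) (use smooth_on_bilinear[OF _ chart(2) smooth_funD smooth_funD] in \<open>simp add: o_def\<close>)

lemma smooth_fun_linear:
  "bounded_linear l \<Longrightarrow> smooth_fun A f \<Longrightarrow> smooth_fun A (\<lambda>x. l (f x))"
  by (rule smooth_funI) (use smooth_on_linear_comp[OF _ chart(2) smooth_funD] in \<open>simp add: o_def\<close>)

lemmas smooth_fun_mult = smooth_fun_bilinear[OF bounded_bilinear_mult]

lemma smooth_fun_diff:
  "smooth_fun A f \<Longrightarrow> smooth_fun A g \<Longrightarrow> smooth_fun A (\<lambda>x. f x - g x)"
  using smooth_fun_add[of f "\<lambda>x. - g x"] smooth_fun_linear[OF bounded_linear_minus[OF bounded_linear_ident], of g] by auto

lemma smooth_fun_sum: "(\<And>i. i \<in> I \<Longrightarrow> smooth_fun A (f i)) \<Longrightarrow> smooth_fun A (\<lambda>x. \<Sum>i\<in>I. f i x)"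
  by (induction I rule: infinite_finite_induct) (auto intro: smooth_fun_add smooth_fun_const)

text \<open>Off the support of \<open>\<rho>\<close> the function is zero. That support is compact in the chart, hence closed in the manifold by the
  Hausdorff property, so zero holds on a neighbourhood of every point outside.\<close>

lemma smooth_fun_cut:
  assumes "c \<in> A" "cball x0 R \<subseteq> T" "T \<subseteq> cimg c" "open T" "smooth_on UNIV \<rho>"
    "\<And>x. x \<notin> ball x0 R \<Longrightarrow> \<rho> x = 0" "smooth_on T h"
  shows "smooth_fun A (cut c \<rho> h)"
proof (rule smooth_fun_localI)
  fix p assume p: "p \<in> topspace X"
  show "\<exists>c'\<in>A. \<exists>T. p \<in> fst c' \<and> open T \<and> snd c' p \<in> T \<and> T \<subseteq> cimg c' \<and> smooth_on T (cut c \<rho> h \<circ> cinv c')"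
  proof (cases "p \<in> fst c \<and> snd c p \<in> T")
    case True
    have "smooth_on T (\<lambda>x. \<rho> x *\<^sub>R h x)"
      by (intro smooth_on_scaleR smooth_on_subset[OF assms(5)] assms) auto
    then have "smooth_on T (cut c \<rho> h \<circ> cinv c)"
      by (rule smooth_on_cong[OF assms(4), rotated]) (use assms(1,3) in \<open>auto simp: cut_def\<close>)
    then show ?thesis using True assms by blast
  next
    case False
    let ?K = "cinv c ` cball x0 R"
    have cl: "closedin X ?K" using assms by (intro closedin_cinv) auto
    have nK: "p \<notin> ?K" using False assms mem_cinv_image[of c "cball x0 R"] by blast
    obtain d where d: "d \<in> A" "p \<in> fst d" using chart_cover[OF p] by blast
    let ?T = "snd d ` (fst d \<inter> (topspace X - ?K))"
    have o: "open ?T" using open_image[OF d(1)] cl by (auto simp: closedin_def)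
    have "smooth_on ?T (cut c \<rho> h \<circ> cinv d)"
    proof (rule smooth_on_cong[OF o _ smooth_on_const[OF o]])
      fix x assume "x \<in> ?T"
      then obtain q where q: "q \<in> fst d" "q \<notin> ?K" "x = snd d q" by auto
      then have "q \<notin> fst c \<or> snd c q \<notin> cball x0 R" using mem_cinv_image[of c "cball x0 R"] assms by blast
      then show "0 = (cut c \<rho> h \<circ> cinv d) x" using q d assms(6)[of "snd c q"] by (auto simp: cut_def)
    qed
    then show ?thesis using d p nK o by (intro bexI[OF _ d(1)] exI[of _ ?T]) (auto simp: cimg_def)
  qed
qed

lemma chart_ball:
  assumes "c \<in> A" "p \<in> fst c" "openin X W" "p \<in> W"
  obtains R where "R > 0" "cball (snd c p) R \<subseteq> cimg c" "\<And>q. q \<in> fst c \<Longrightarrow> snd c q \<in> cball (snd c p) R \<Longrightarrow> q \<in> W"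
proof -
  have "open (snd c ` (fst c \<inter> W))" using open_image assms by blast
  then obtain R where R: "R > 0" "cball (snd c p) R \<subseteq> snd c ` (fst c \<inter> W)"
    using open_contains_cball[of "snd c ` (fst c \<inter> W)"] assms by blast
  have "q \<in> W" if "q \<in> fst c" "snd c q \<in> cball (snd c p) R" for q
    using R(2) that chart_inj[OF assms(1)] by (auto dest!: subsetD inj_onD)
  then show thesis using R that unfolding cimg_def by blast
qed

lemma ex_bump:
  assumes "p \<in> topspace X" "openin X W" "p \<in> W"
  obtains \<beta> :: "'a \<Rightarrow> real" and V where "smooth_fun A \<beta>" "openin X V" "p \<in> V" "\<And>q. q \<in> V \<Longrightarrow> \<beta> q = 1" "\<And>q. q \<notin> W \<Longrightarrow> \<beta> q = 0"
proof -
  obtain c where c: "c \<in> A" "p \<in> fst c" using chart_cover[OF assms(1)] by blast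
  obtain R where R: "R > 0" "cball (snd c p) R \<subseteq> cimg c" "\<And>q. q \<in> fst c \<Longrightarrow> snd c q \<in> cball (snd c p) R \<Longrightarrow> q \<in> W"
    using chart_ball[OF c assms(2,3)] by blast
  obtain \<rho> :: "'e \<Rightarrow> real" where \<rho>: "smooth_on UNIV \<rho>" "\<And>x. x \<in> cball (snd c p) (R/2) \<Longrightarrow> \<rho> x = 1"
    "\<And>x. x \<notin> ball (snd c p) R \<Longrightarrow> \<rho> x = 0"
    by (rule smooth_bump_ball[of "R/2" R "snd c p"]) (use R(1) in \<open>simp, simp, blast\<close>)
  let ?V = "{q \<in> fst c. snd c q \<in> ball (snd c p) (R/2)}"
  show thesis
  proof
    show "smooth_fun A (cut c \<rho> (\<lambda>x. 1::real))"
      using smooth_fun_cut[OF c(1) R(2) order_refl _ \<rho>(1,3)] chart(2)[OF c(1)] smooth_on_const by blast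
    show "openin X ?V" by (rule openin_pullback[OF c(1) open_ball])
    show "p \<in> ?V" using c R by auto
    show "cut c \<rho> (\<lambda>x. 1::real) q = 1" if "q \<in> ?V" for q using that \<rho>(2)[of "snd c q"] by (auto simp: cut_def)
    show "cut c \<rho> (\<lambda>x. 1::real) q = 0" if "q \<notin> W" for q
    proof -
      have "q \<notin> fst c \<or> snd c q \<notin> ball (snd c p) R" using that R(3)[of q] by auto
      then show ?thesis using \<rho>(3) by (auto simp: cut_def)
    qed
  qed
qed

subsection \<open>Tangent vectors are directional derivatives\<close>

lemma tangent_lin:
  assumes "v \<in> tangent_space A p" "smooth_fun A f" "smooth_fun A g"
  shows "v (\<lambda>x. a * f x + b * g x) = a * v f + b * v g"
    "v (\<lambda>x. f x * g x) = f p * v g + g p * v f" "v (\<lambda>x. f x + g x) = v f + v g"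
    "v (\<lambda>x. f x - g x) = v f - v g" "v (\<lambda>x. k) = 0"
proof -
  have *: "v (\<lambda>x. a * f x + b * g x) = a * v f + b * v g" if "smooth_fun A f" "smooth_fun A g" for a b f g
    using assms(1) that unfolding tangent_space_def by blast
  show "v (\<lambda>x. a * f x + b * g x) = a * v f + b * v g" by (rule *[OF assms(2,3)])
  show "v (\<lambda>x. f x * g x) = f p * v g + g p * v f" using assms unfolding tangent_space_def by blast
  show "v (\<lambda>x. f x + g x) = v f + v g" using *[OF assms(2,3), of 1 1] by simp
  show "v (\<lambda>x. f x - g x) = v f - v g" using *[OF assms(2,3), of 1 "-1"] by simp
  have "v (\<lambda>x. 1 * 1) = 1 * v (\<lambda>x. 1) + 1 * v (\<lambda>x. 1)"
    using assms(1) smooth_fun_const[of "1::real"] unfolding tangent_space_def by blast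
  then have "v (\<lambda>x. 1) = 0" by simp
  then show "v (\<lambda>x. k) = 0"
    using *[OF smooth_fun_const[of "1::real"] smooth_fun_const[of "1::real"], of k 0] by simp
qed

lemma tangent_sum:
  assumes "v \<in> tangent_space A p" "\<And>i. i \<in> I \<Longrightarrow> smooth_fun A (f i)"
  shows "v (\<lambda>x. \<Sum>i\<in>I. f i x) = (\<Sum>i\<in>I. v (f i))"
  using assms(2)
  by (induction I rule: infinite_finite_induct)
    (auto simp: tangent_lin(3)[OF assms(1)] smooth_fun_sum tangent_lin(5)[OF assms(1) smooth_fun_const smooth_fun_const])

text \<open>With a bump \<open>\<beta>\<close> supported in \<open>W\<close> and equal to \<open>1\<close> at \<open>p\<close>, the product rule applied to \<open>\<beta> (f - g) = 0\<close> gives the claim.\<close>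

lemma tangent_local:
  assumes v: "v \<in> tangent_space A p" and "p \<in> topspace X" "smooth_fun A f" "smooth_fun A g"
    and W: "openin X W" "p \<in> W" "\<And>q. q \<in> W \<Longrightarrow> f q = g q"
  shows "v f = v g"
proof -
  obtain \<beta> :: "'a \<Rightarrow> real" and V where b: "smooth_fun A \<beta>" "p \<in> V" "\<And>q. q \<in> V \<Longrightarrow> \<beta> q = 1" "\<And>q. q \<notin> W \<Longrightarrow> \<beta> q = 0"
    using ex_bump[OF assms(2) W(1,2)] by metis
  have d: "smooth_fun A (\<lambda>x. f x - g x)" by (intro smooth_fun_diff assms)
  have "(\<lambda>x. (f x - g x) * \<beta> x) = (\<lambda>x. 0)" using W(3) b(4) by fastforce
  then have "(f p - g p) * v \<beta> + \<beta> p * v (\<lambda>x. f x - g x) = 0"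
    using tangent_lin(2)[OF v d b(1)] tangent_lin(5)[OF v d d, of 0] by simp
  then show ?thesis using W b tangent_lin(4)[OF v assms(3,4)] by simp
qed

lemma smooth_fun_has_derivative:
  "smooth_fun A f \<Longrightarrow> c \<in> A \<Longrightarrow> p \<in> fst c \<Longrightarrow>
    ((f \<circ> cinv c) has_derivative frechet_derivative (f \<circ> cinv c) (at (snd c p))) (at (snd c p))"
  using smooth_on_has_derivative smooth_funD cmap_in by metis

lemma tvec_smooth: "smooth_fun A f \<Longrightarrow> tvec A c p u f = frechet_derivative (f \<circ> cinv c) (at (snd c p)) u"
  by (simp add: tvec_def)

lemma tvec_eqI:
  "smooth_fun A f \<Longrightarrow> ((f \<circ> cinv c) has_derivative D) (at (snd c p)) \<Longrightarrow> tvec A c p u f = D u"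
  by (simp add: tvec_def frechet_derivative_at[symmetric])

lemma tvec_linear:
  assumes "c \<in> A" "p \<in> fst c"
  shows "tvec A c p (a *\<^sub>R u + b *\<^sub>R w) = (\<lambda>f. a * tvec A c p u f + b * tvec A c p w f)"
proof (rule ext)
  fix f
  show "tvec A c p (a *\<^sub>R u + b *\<^sub>R w) f = a * tvec A c p u f + b * tvec A c p w f"
  proof (cases "smooth_fun A f")
    case True
    interpret linear "frechet_derivative (f \<circ> cinv c) (at (snd c p))"
      using smooth_fun_has_derivative[OF True assms] has_derivative_linear by blast
    show ?thesis using True by (simp add: tvec_def add scale)
  qed (simp add: tvec_def)
qed

lemma tvec_in:
  assumes "c \<in> A" "p \<in> fst c" shows "tvec A c p u \<in> tangent_space A p"
proof -
  note D = smooth_fun_has_derivative[OF _ assms]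
  have 1: "tvec A c p u (\<lambda>x. a * f x + b * g x) = a * tvec A c p u f + b * tvec A c p u g"
    if "smooth_fun A f" "smooth_fun A g" for f g :: "'a \<Rightarrow> real" and a b
  proof -
    have s: "smooth_fun A (\<lambda>x. a * f x + b * g x)" by (intro smooth_fun_add smooth_fun_mult smooth_fun_const that)
    show ?thesis
      using tvec_eqI[OF s, of c "\<lambda>u. a * frechet_derivative (f \<circ> cinv c) (at (snd c p)) u + b * frechet_derivative (g \<circ> cinv c) (at (snd c p)) u"]
        has_derivative_add[OF has_derivative_mult_right[OF D[OF that(1)], of a] has_derivative_mult_right[OF D[OF that(2)], of b]]
      by (simp add: tvec_smooth that o_def)
  qed
  have 2: "tvec A c p u (\<lambda>x. f x * g x) = f p * tvec A c p u g + g p * tvec A c p u f"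
    if "smooth_fun A f" "smooth_fun A g" for f g :: "'a \<Rightarrow> real"
  proof -
    have s: "smooth_fun A (\<lambda>x. f x * g x)" by (intro smooth_fun_mult that)
    show ?thesis
      using tvec_eqI[OF s, of c "\<lambda>u. f p * frechet_derivative (g \<circ> cinv c) (at (snd c p)) u + frechet_derivative (f \<circ> cinv c) (at (snd c p)) u * g p"]
        has_derivative_mult[OF D[OF that(1)] D[OF that(2)]] assms
      by (simp add: tvec_smooth that o_def)
  qed
  show ?thesis using 1 2 unfolding tangent_space_def by (auto simp: tvec_def)
qed

text \<open>By Hadamard's lemma a smooth function is, near \<open>p\<close>, its value at \<open>p\<close> plus a combination of
  products of coordinates vanishing at \<open>p\<close> with smooth functions; a derivation therefore only
  sees its values on the coordinates.\<close>

lemma tangent_is_tvec: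
  assumes c: "c \<in> A" "p \<in> fst c" and v: "v \<in> tangent_space A p"
  obtains u where "v = tvec A c p u"
proof -
  let ?x0 = "snd c p"
  have pX: "p \<in> topspace X" using chart_sub c by blast
  obtain R where R: "R > 0" "cball ?x0 R \<subseteq> cimg c"
    by (rule chart_ball[OF c openin_topspace pX]) (rule that)
  obtain \<rho> :: "'e \<Rightarrow> real" where \<rho>: "smooth_on UNIV \<rho>" "\<And>x. x \<in> cball ?x0 (R/4) \<Longrightarrow> \<rho> x = 1"
    "\<And>x. x \<notin> ball ?x0 (R/2) \<Longrightarrow> \<rho> x = 0"
    by (rule smooth_bump_ball[of "R/4" "R/2" ?x0]) (use R(1) in \<open>simp, simp, blast\<close>)
  have cutS: "smooth_fun A (cut c \<rho> h)" if "smooth_on (ball ?x0 R) h" for h :: "'e \<Rightarrow> real"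
    by (rule smooth_fun_cut[of c ?x0 "R/2", OF c(1) _ _ open_ball \<rho>(1) _ that]) (use R \<rho>(3) in auto)
  let ?W = "{q \<in> fst c. snd c q \<in> ball ?x0 (R/4)}"
  have W: "openin X ?W" "p \<in> ?W" using openin_pullback[OF c(1) open_ball[of ?x0 "R/4"]] c R by auto
  have cutW: "cut c \<rho> h q = h (snd c q)" if "q \<in> ?W" for h :: "'e \<Rightarrow> real" and q
    using that \<rho>(2)[of "snd c q"] by (auto simp: cut_def)
  let ?X = "\<lambda>b. cut c \<rho> (\<lambda>x. (x - ?x0) \<bullet> b)"
  have sX: "smooth_fun A (?X b)" for b
    by (intro cutS smooth_on_inner_left smooth_on_diff smooth_on_id smooth_on_const open_ball)
  let ?u = "\<Sum>b\<in>Basis. v (?X b) *\<^sub>R b"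
  have "v f = tvec A c p ?u f" for f
  proof (cases "smooth_fun A f")
    case True
    have sf: "smooth_on (ball ?x0 R) (f \<circ> cinv c)"
      by (rule smooth_on_subset[OF smooth_funD[OF True c(1)]]) (use R in auto)
    obtain g where g: "\<And>b. smooth_on (ball ?x0 R) (g b)"
      "\<And>b. g b ?x0 = frechet_derivative (f \<circ> cinv c) (at ?x0) b"
      "\<And>x. x \<in> ball ?x0 R \<Longrightarrow> (f \<circ> cinv c) x = (f \<circ> cinv c) ?x0 + (\<Sum>b\<in>Basis. ((x - ?x0) \<bullet> b) * g b x)"
      by (rule hadamard[OF sf R(1)]) (rule that)
    let ?F = "\<lambda>q. f p + (\<Sum>b\<in>Basis. ?X b q * cut c \<rho> (g b) q)"
    have s1: "smooth_fun A (\<lambda>q. \<Sum>b\<in>Basis. ?X b q * cut c \<rho> (g b) q)"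
      by (intro smooth_fun_sum smooth_fun_mult sX cutS g)
    have sF: "smooth_fun A ?F" by (intro smooth_fun_add smooth_fun_const s1)
    have "v f = v ?F"
    proof (rule tangent_local[OF v pX True sF W])
      fix q assume q: "q \<in> ?W"
      then show "f q = ?F q" using g(3)[of "snd c q"] c R by (simp add: cutW[OF q])
    qed
    also have "\<dots> = (\<Sum>b\<in>Basis. v (\<lambda>q. ?X b q * cut c \<rho> (g b) q))"
      by (subst tangent_lin(3)[OF v smooth_fun_const s1], subst tangent_lin(5)[OF v s1 s1],
          subst tangent_sum[OF v]) (auto intro!: smooth_fun_mult sX cutS g)
    also have "\<dots> = (\<Sum>b\<in>Basis. v (?X b) * frechet_derivative (f \<circ> cinv c) (at ?x0) b)"
      by (rule sum.cong) (simp_all add: tangent_lin(2)[OF v sX cutS[OF g(1)]] cutW[OF W(2)] g(2))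
    also have "\<dots> = frechet_derivative (f \<circ> cinv c) (at ?x0) ?u"
    proof -
      interpret linear "frechet_derivative (f \<circ> cinv c) (at ?x0)"
        using smooth_fun_has_derivative[OF True c] has_derivative_linear by blast
      show ?thesis by (simp add: sum scale)
    qed
    finally show ?thesis using True by (simp add: tvec_smooth)
  next
    case False
    then show ?thesis using v by (simp add: tvec_def tangent_space_def)
  qed
  then show thesis using that by blast
qed

text \<open>Chart coordinates are functions on the manifold only after being cut off; near \<open>p\<close> nothing is lost.\<close>

lemma coordinate_function:
  assumes c: "c \<in> A" "p \<in> fst c"
  obtains F W where "\<And>b. smooth_fun A (F b)" "openin X W" "p \<in> W" "W \<subseteq> fst c" "\<And>q b. q \<in> W \<Longrightarrow> F b q = snd c q \<bullet> b"
    "\<And>q b u. q \<in> W \<Longrightarrow> tvec A c q u (F b) = u \<bullet> b"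
proof -
  let ?x0 = "snd c p"
  obtain R where R: "R > 0" "cball ?x0 R \<subseteq> cimg c"
    by (rule chart_ball[OF c openin_topspace chart_sub[OF c]]) (rule that)
  obtain \<rho> :: "'e \<Rightarrow> real" where \<rho>: "smooth_on UNIV \<rho>" "\<And>x. x \<in> cball ?x0 (R/2) \<Longrightarrow> \<rho> x = 1"
    "\<And>x. x \<notin> ball ?x0 R \<Longrightarrow> \<rho> x = 0"
    by (rule smooth_bump_ball[of "R/2" R ?x0]) (use R(1) in \<open>simp, simp, blast\<close>)
  let ?W = "{q \<in> fst c. snd c q \<in> ball ?x0 (R/2)}" and ?F = "\<lambda>b. cut c \<rho> (\<lambda>x. x \<bullet> b)"
  have s: "smooth_fun A (?F b)" for b
    using chart(2)[OF c(1)]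
    by (intro smooth_fun_cut[OF c(1) R(2) order_refl _ \<rho>(1,3)] smooth_on_inner_left smooth_on_id)
  show thesis
  proof
    show "smooth_fun A (?F b)" for b by (rule s)
    show "openin X ?W" "p \<in> ?W" "?W \<subseteq> fst c" using openin_pullback[OF c(1) open_ball[of ?x0 "R/2"]] c R by auto
    show F: "?F b q = snd c q \<bullet> b" if "q \<in> ?W" for q b
      using that \<rho>(2)[of "snd c q"] by (auto simp: cut_def)
    show "tvec A c q u (?F b) = u \<bullet> b" if "q \<in> ?W" for q b u
    proof (rule tvec_eqI[OF s])
      show "((?F b \<circ> cinv c) has_derivative (\<lambda>u. u \<bullet> b)) (at (snd c q))"
        by (rule has_derivative_transform_within_open[OF bounded_linear.has_derivative[OF bounded_linear_inner_left has_derivative_ident] open_ball[of ?x0 "R/2"]])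
          (use that R \<rho>(2) in \<open>auto simp: cut_def subset_iff\<close>)
    qed
  qed
qed

lemma tvec_inj:
  assumes "c \<in> A" "p \<in> fst c" "tvec A c p u = tvec A c p w" shows "u = w"
  using coordinate_function[OF assms(1,2)] assms(3) euclidean_eqI by metis

definition tcoord :: "('a, 'e) chart \<Rightarrow> 'a \<Rightarrow> 'a tangent \<Rightarrow> 'e" where
  "tcoord c p v = (THE u. v = tvec A c p u)"

lemma tcoord_tvec [simp]: "c \<in> A \<Longrightarrow> p \<in> fst c \<Longrightarrow> tcoord c p (tvec A c p u) = u"
  unfolding tcoord_def using tvec_inj by blast

lemma tvec_tcoord: "c \<in> A \<Longrightarrow> p \<in> fst c \<Longrightarrow> v \<in> tangent_space A p \<Longrightarrow> tvec A c p (tcoord c p v) = v"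
  using tangent_is_tvec tcoord_tvec by metis

lemma tangent_space_combination:
  assumes "p \<in> topspace X" "v \<in> tangent_space A p" "w \<in> tangent_space A p"
  shows "(\<lambda>f. a * v f + b * w f) \<in> tangent_space A p"
proof -
  obtain c where c: "c \<in> A" "p \<in> fst c" using chart_cover[OF assms(1)] by blast
  show ?thesis
    using tvec_linear[OF c, of a "tcoord c p v" b "tcoord c p w"] tvec_in[OF c]
    by (metis (no_types) tvec_tcoord[OF c] assms(2,3))
qed

lemma tcoord_linear:
  assumes c: "c \<in> A" "p \<in> fst c" and "v \<in> tangent_space A p" "w \<in> tangent_space A p"
  shows "tcoord c p (\<lambda>f. a * v f + b * w f) = a *\<^sub>R tcoord c p v + b *\<^sub>R tcoord c p w"
  using tvec_linear[OF c, of a "tcoord c p v" b "tcoord c p w"] tcoord_tvec[OF c]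
  by (metis (no_types) tvec_tcoord[OF c] assms(3,4))

subsection \<open>Vector fields in charts\<close>

text \<open>The coordinates of a field are its values on cut-off coordinate functions.\<close>

lemma vector_field_coord_smooth:
  assumes "vector_field X A V" "c \<in> A"
  shows "smooth_on (cimg c) (\<lambda>x. tcoord c (cinv c x) (V (cinv c x)))"
proof (rule smooth_on_componentwise[OF chart(2)[OF assms(2)]], rule smooth_on_local)
  fix b :: 'e and x assume x: "x \<in> cimg c"
  note c = assms(2) cinv_in[OF x]
  obtain F W where F: "\<And>b. smooth_fun A (F b)" "openin X W" "cinv c x \<in> W" "W \<subseteq> fst c"
      "\<And>q b u. q \<in> W \<Longrightarrow> tvec A c q u (F b) = u \<bullet> b"
    using coordinate_function[OF c] by metis
  let ?T = "snd c ` (fst c \<inter> W)"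
  have T: "open ?T" by (rule open_image[OF c(1) F(2)])
  have "smooth_on ?T ((\<lambda>p. V p (F b)) \<circ> cinv c)"
    by (rule smooth_on_subset[OF smooth_funD[OF _ c(1)]])
      (use assms(1) F(1) in \<open>auto simp: vector_field_def cimg_def\<close>)
  then have "smooth_on ?T (\<lambda>x. tcoord c (cinv c x) (V (cinv c x)) \<bullet> b)"
  proof (rule smooth_on_cong[OF T, rotated])
    fix y assume "y \<in> ?T"
    then obtain q where q: "q \<in> W" "q \<in> fst c" "y = snd c q" by auto
    have "V q \<in> tangent_space A q" using assms(1) chart_sub[OF c(1) q(2)] by (auto simp: vector_field_def)
    then show "((\<lambda>p. V p (F b)) \<circ> cinv c) y = tcoord c (cinv c y) (V (cinv c y)) \<bullet> b"
      using q c F(5)[OF q(1), of "tcoord c q (V q)" b] tvec_tcoord[OF c(1) q(2)] by simp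
  qed
  then show "\<exists>T. open T \<and> x \<in> T \<and> smooth_on T (\<lambda>x. tcoord c (cinv c x) (V (cinv c x)) \<bullet> b)"
    using T F(3) x by (intro exI[of _ ?T]) (auto intro!: image_eqI[of _ _ "cinv c x"])
qed

lemma tvec_apply_Basis:
  assumes "c \<in> A" "p \<in> fst c" "smooth_fun A f"
  shows "tvec A c p u f = (\<Sum>b\<in>Basis. (u \<bullet> b) * frechet_derivative (f \<circ> cinv c) (at (snd c p)) b)"
  using frechet_derivative_Basis[of "f \<circ> cinv c" "snd c p" u] smooth_fun_has_derivative[OF assms(3,1,2)] assms(3)
  by (auto simp: tvec_smooth differentiable_def)

lemma vector_fieldI:
  assumes "\<And>p. p \<in> topspace X \<Longrightarrow> V p \<in> tangent_space A p"
    and "\<And>p. p \<in> topspace X \<Longrightarrow> \<exists>c\<in>A. \<exists>T. p \<in> fst c \<and> open T \<and> snd c p \<in> T \<and> T \<subseteq> cimg c \<and>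
           smooth_on T (\<lambda>x. tcoord c (cinv c x) (V (cinv c x)))"
  shows "vector_field X A V"
  unfolding vector_field_def
proof (intro conjI ballI allI impI assms(1))
  fix f :: "'a \<Rightarrow> real" assume f: "smooth_fun A f"
  show "smooth_fun A (\<lambda>p. V p f)"
  proof (rule smooth_fun_localI)
    fix p assume p: "p \<in> topspace X"
    obtain c T where c: "c \<in> A" "p \<in> fst c" "open T" "snd c p \<in> T" "T \<subseteq> cimg c"
      "smooth_on T (\<lambda>x. tcoord c (cinv c x) (V (cinv c x)))" using assms(2)[OF p] by blast
    have "smooth_on T (\<lambda>x. \<Sum>b\<in>Basis. (tcoord c (cinv c x) (V (cinv c x)) \<bullet> b) * frechet_derivative (f \<circ> cinv c) (at x) b)"
      using c smooth_on_subset[OF smooth_on_frechet_derivative[OF smooth_funD[OF f c(1)]] c(5)]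
      by (intro smooth_on_sum smooth_on_mult smooth_on_inner_left) auto
    then have "smooth_on T ((\<lambda>p. V p f) \<circ> cinv c)"
    proof (rule smooth_on_cong[OF c(3), rotated])
      fix x assume x: "x \<in> T"
      then have "x \<in> cimg c" using c by auto
      then show "(\<Sum>b\<in>Basis. (tcoord c (cinv c x) (V (cinv c x)) \<bullet> b) * frechet_derivative (f \<circ> cinv c) (at x) b) =
          ((\<lambda>p. V p f) \<circ> cinv c) x"
        using tvec_apply_Basis[OF c(1) cinv_in f, of x "tcoord c (cinv c x) (V (cinv c x))"]
          tvec_tcoord[OF c(1) cinv_in assms(1), of x] chart_sub[OF c(1) cinv_in] by simp
    qed
    then show "\<exists>c\<in>A. \<exists>T. p \<in> fst c \<and> open T \<and> snd c p \<in> T \<and> T \<subseteq> cimg c \<and> smooth_on T ((\<lambda>p. V p f) \<circ> cinv c)"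
      using c by blast
  qed
qed

lemma tangent_space_zero: "(\<lambda>f. 0) \<in> tangent_space A p"
  by (simp add: tangent_space_def)

definition cutfield :: "('a, 'e) chart \<Rightarrow> ('e \<Rightarrow> real) \<Rightarrow> ('e \<Rightarrow> 'e) \<Rightarrow> 'a \<Rightarrow> 'a tangent" where
  "cutfield c \<rho> Y p = (if p \<in> fst c then tvec A c p (\<rho> (snd c p) *\<^sub>R Y (snd c p)) else (\<lambda>f. 0))"

lemma vector_field_cutfield:
  assumes "c \<in> A" "cball x0 R \<subseteq> T" "T \<subseteq> cimg c" "open T" "smooth_on UNIV \<rho>"
    "\<And>x. x \<notin> ball x0 R \<Longrightarrow> \<rho> x = 0" "smooth_on T Y"
  shows "vector_field X A (cutfield c \<rho> Y)"
  unfolding vector_field_def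
proof (intro conjI ballI allI impI)
  show "cutfield c \<rho> Y p \<in> tangent_space A p" if "p \<in> topspace X" for p
    using tvec_in[OF assms(1)] tangent_space_zero by (simp add: cutfield_def)
  fix f :: "'a \<Rightarrow> real" assume f: "smooth_fun A f"
  let ?h = "\<lambda>x. \<Sum>b\<in>Basis. (Y x \<bullet> b) * frechet_derivative (f \<circ> cinv c) (at x) b"
  have sh: "smooth_on T ?h"
    using smooth_on_subset[OF smooth_on_frechet_derivative[OF smooth_funD[OF f assms(1)]] assms(3)]
    by (intro smooth_on_sum smooth_on_mult smooth_on_inner_left assms) auto
  have "smooth_fun A (cut c \<rho> ?h)" by (rule smooth_fun_cut[OF assms(1-5) _ sh]) (rule assms(6))
  moreover have "cutfield c \<rho> Y p f = cut c \<rho> ?h p" for p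
    using tvec_apply_Basis[OF assms(1) _ f] by (simp add: cutfield_def cut_def sum_distrib_left mult.assoc)
  ultimately show "smooth_fun A (\<lambda>p. cutfield c \<rho> Y p f)" by presburger
qed

end

section \<open>Almost complex structures as matrix fields\<close>

definition Jmat :: "('a, 'e::euclidean_space) chart set \<Rightarrow> ('a, 'e) chart \<Rightarrow> ('a \<Rightarrow> 'a tangent \<Rightarrow> 'a tangent) \<Rightarrow> 'e \<Rightarrow> 'e \<Rightarrow>\<^sub>L 'e" where
  "Jmat A c J x = Blinfun (\<lambda>u. THE w. J (cinv c x) (tvec A c (cinv c x) u) = tvec A c (cinv c x) w)"

definition trans_deriv :: "('a, 'e::euclidean_space) chart \<Rightarrow> ('a, 'e) chart \<Rightarrow> 'e \<Rightarrow> 'e \<Rightarrow>\<^sub>L 'e" where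
  "trans_deriv c d x = Blinfun (frechet_derivative (snd d \<circ> cinv c) (at x))"

context smooth_mfd
begin

lemma JmatI:
  fixes M :: "'e \<Rightarrow>\<^sub>L 'e"
  assumes "c \<in> A" "x \<in> cimg c" "\<And>u. J (cinv c x) (tvec A c (cinv c x) u) = tvec A c (cinv c x) (M u)"
  shows "Jmat A c J x = M"
proof -
  have "(THE w. J (cinv c x) (tvec A c (cinv c x) u) = tvec A c (cinv c x) w) = M u" for u
    using assms(3)[of u] tvec_inj[OF assms(1) cinv_in[OF assms(2)]] by auto
  then show ?thesis by (simp add: Jmat_def blinfun_apply_inverse)
qed

lemma Jmat_cong: "J (cinv c x) = J' (cinv c x) \<Longrightarrow> Jmat A c J x = Jmat A c J' x"
  by (simp add: Jmat_def)

lemma acs_tangent: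
  assumes "almost_complex_structure X A J" "p \<in> topspace X" "v \<in> tangent_space A p"
  shows "J p v \<in> tangent_space A p"
    "w \<in> tangent_space A p \<Longrightarrow> J p (\<lambda>f. a * v f + b * w f) = (\<lambda>f. a * J p v f + b * J p w f)"
    "J p (J p v) = - v"
  using assms unfolding almost_complex_structure_def by blast+

lemma acs_Jmat:
  assumes J: "almost_complex_structure X A J" and c: "c \<in> A" "p \<in> fst c"
  shows "J p (tvec A c p u) = tvec A c p (Jmat A c J (snd c p) u)"
proof -
  have pX: "p \<in> topspace X" by (rule chart_sub[OF c])
  note t = tvec_in[OF c]
  let ?M = "\<lambda>u. tcoord c p (J p (tvec A c p u))"
  have "linear ?M"
  proof
    show "?M (u + w) = ?M u + ?M w" for u w
      using tvec_linear[OF c, of 1 u 1 w] acs_tangent(2)[OF J pX t t, of 1 u 1 w]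
        tcoord_linear[OF c acs_tangent(1)[OF J pX t] acs_tangent(1)[OF J pX t], of 1 u 1 w] by simp
    show "?M (r *\<^sub>R u) = r *\<^sub>R ?M u" for r u
      using tvec_linear[OF c, of r u 0 u] acs_tangent(2)[OF J pX t t, of r u 0 u]
        tcoord_linear[OF c acs_tangent(1)[OF J pX t] acs_tangent(1)[OF J pX t], of r u 0 u] by simp
  qed
  then have bl: "blinfun_apply (Blinfun ?M) = ?M"
    by (intro bounded_linear_Blinfun_apply) (simp add: linear_conv_bounded_linear)
  have *: "J p (tvec A c p u) = tvec A c p (?M u)" for u
    using tvec_tcoord[OF c acs_tangent(1)[OF J pX t]] by simp
  have "Jmat A c J (snd c p) = Blinfun ?M"
    by (rule JmatI) (use c * bl in auto)
  then show ?thesis using * bl by simp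
qed

lemma acs_Jmat_sq:
  assumes J: "almost_complex_structure X A J" and c: "c \<in> A" "x \<in> cimg c"
  shows "Jmat A c J x (Jmat A c J x u) = - u"
proof -
  let ?p = "cinv c x"
  have p: "?p \<in> fst c" "snd c ?p = x" using c by auto
  have "tvec A c ?p (Jmat A c J x (Jmat A c J x u)) = - tvec A c ?p u"
    using acs_Jmat[OF J c(1) p(1)] acs_tangent(3)[OF J chart_sub[OF c(1) p(1)] tvec_in[OF c(1) p(1)]] p(2) by metis
  also have "\<dots> = tvec A c ?p (- u)"
    using tvec_linear[OF c(1) p(1), of "-1" u 0 u] by (simp add: fun_eq_iff)
  finally show ?thesis using tvec_inj[OF c(1) p(1)] by blast
qed

text \<open>Apply \<open>J\<close> to a cut-off constant field and read off coordinates.\<close>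

lemma acs_Jmat_smooth:
  assumes J: "almost_complex_structure X A J" and c: "c \<in> A"
  shows "smooth_on (cimg c) (Jmat A c J)"
proof (rule smooth_on_blinfun[OF chart(2)[OF c]], rule smooth_on_local)
  fix b :: 'e and x assume x: "x \<in> cimg c"
  obtain R where R: "R > 0" "cball x R \<subseteq> cimg c" using chart(2)[OF c] x open_contains_cball by blast
  obtain \<rho> :: "'e \<Rightarrow> real" where \<rho>: "smooth_on UNIV \<rho>" "\<And>y. y \<in> cball x (R/2) \<Longrightarrow> \<rho> y = 1"
    "\<And>y. y \<notin> ball x R \<Longrightarrow> \<rho> y = 0"
    by (rule smooth_bump_ball[of "R/2" R x]) (use R(1) in \<open>simp, simp, blast\<close>)
  let ?V = "cutfield c \<rho> (\<lambda>_. b)"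
  have "vector_field X A ?V"
    by (rule vector_field_cutfield[OF c R(2) order_refl chart(2)[OF c] \<rho>(1) _ smooth_on_const[OF chart(2)[OF c]]]) (rule \<rho>(3))
  then have V: "vector_field X A (\<lambda>p. J p (?V p))" using J unfolding almost_complex_structure_def by blast
  have sub: "ball x (R/2) \<subseteq> cimg c" using R by (auto simp: subset_iff)
  have "smooth_on (ball x (R/2)) (\<lambda>y. Jmat A c J y b)"
  proof (rule smooth_on_cong[OF open_ball _ smooth_on_subset[OF vector_field_coord_smooth[OF V c] sub]])
    fix y assume y: "y \<in> ball x (R/2)"
    then have y': "y \<in> cimg c" using sub by blast
    have "?V (cinv c y) = tvec A c (cinv c y) b" using y y' \<rho>(2)[of y] by (simp add: cutfield_def)
    then show "tcoord c (cinv c y) (J (cinv c y) (?V (cinv c y))) = Jmat A c J y b"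
      using acs_Jmat[OF J c cinv_in[OF y'], of b] y' c by simp
  qed
  then show "\<exists>T. open T \<and> x \<in> T \<and> smooth_on T (\<lambda>y. Jmat A c J y b)"
    using R(1) by (intro exI[of _ "ball x (R/2)"]) auto
qed

text \<open>One chart near each point is enough, since a vector field is smooth as soon as its coordinates in some chart around
  each point are.\<close>

lemma acsI:
  assumes "\<And>p. p \<in> topspace X \<Longrightarrow> \<exists>c\<in>A. \<exists>T M. p \<in> fst c \<and> open T \<and> snd c p \<in> T \<and> T \<subseteq> cimg c \<and> smooth_on T M \<and>
     (\<forall>x\<in>T. \<forall>u. blinfun_apply (M x) (blinfun_apply (M x) u) = - u \<and>
        J (cinv c x) (tvec A c (cinv c x) u) = tvec A c (cinv c x) (blinfun_apply (M x) u))"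
  shows "almost_complex_structure X A J"
proof -
  have main: "J p v \<in> tangent_space A p"
    "w \<in> tangent_space A p \<Longrightarrow> J p (\<lambda>f. a * v f + b * w f) = (\<lambda>f. a * J p v f + b * J p w f)"
    "J p (J p v) = - v" if p: "p \<in> topspace X" and v: "v \<in> tangent_space A p" for p v w a b
  proof -
    obtain c T M where c: "c \<in> A" "p \<in> fst c" "snd c p \<in> T"
      and M: "\<forall>x\<in>T. \<forall>u. blinfun_apply (M x) (blinfun_apply (M x) u) = - u \<and>
        J (cinv c x) (tvec A c (cinv c x) u) = tvec A c (cinv c x) (blinfun_apply (M x) u)"
      using assms[OF p] by metis
    let ?M = "blinfun_apply (M (snd c p))"
    have M': "?M (?M u) = - u" "J p (tvec A c p u) = tvec A c p (?M u)" for u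
      using M[rule_format, OF c(3), of u] c by auto
    have v': "v = tvec A c p (tcoord c p v)" using tvec_tcoord[OF c(1,2) v] by simp
    have Jv: "J p v = tvec A c p (?M (tcoord c p v))" if "v \<in> tangent_space A p" for v
      using M'(2)[of "tcoord c p v"] tvec_tcoord[OF c(1,2) that] by simp
    show "J p v \<in> tangent_space A p" using Jv[OF v] tvec_in[OF c(1,2)] by simp
    show "J p (J p v) = - v"
    proof -
      have "J p (J p v) = tvec A c p (- tcoord c p v)" using Jv[OF v] M' by simp
      also have "\<dots> = - tvec A c p (tcoord c p v)"
        using tvec_linear[OF c(1,2), of "-1" "tcoord c p v" 0 0] by (simp add: fun_eq_iff)
      finally show ?thesis using v' by simp
    qed
    show "J p (\<lambda>f. a * v f + b * w f) = (\<lambda>f. a * J p v f + b * J p w f)" if w: "w \<in> tangent_space A p"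
      unfolding Jv[OF tangent_space_combination[OF p v w]] Jv[OF v] Jv[OF w] tcoord_linear[OF c(1,2) v w]
      using tvec_linear[OF c(1,2), of a "?M (tcoord c p v)" b "?M (tcoord c p w)"]
      by (simp add: blinfun.add_right blinfun.scaleR_right)
  qed
  have "vector_field X A (\<lambda>p. J p (V p))" if V: "vector_field X A V" for V
  proof (rule vector_fieldI)
    have Vt: "V p \<in> tangent_space A p" if "p \<in> topspace X" for p using V that by (simp add: vector_field_def)
    show "J p (V p) \<in> tangent_space A p" if "p \<in> topspace X" for p using main(1)[OF that Vt[OF that]] .
    fix p assume p: "p \<in> topspace X"
    obtain c T M where c: "c \<in> A" "p \<in> fst c" "open T" "snd c p \<in> T" "T \<subseteq> cimg c" "smooth_on T M"
      and M: "\<forall>x\<in>T. \<forall>u. blinfun_apply (M x) (blinfun_apply (M x) u) = - u \<and>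
        J (cinv c x) (tvec A c (cinv c x) u) = tvec A c (cinv c x) (blinfun_apply (M x) u)"
      using assms[OF p] by metis
    have "smooth_on T (\<lambda>x. M x (tcoord c (cinv c x) (V (cinv c x))))"
      by (rule smooth_on_blinfun_apply[OF c(3,6) smooth_on_subset[OF vector_field_coord_smooth[OF V c(1)] c(5)]])
    then have "smooth_on T (\<lambda>x. tcoord c (cinv c x) (J (cinv c x) (V (cinv c x))))"
    proof (rule smooth_on_cong[OF c(3), rotated])
      fix x assume x: "x \<in> T"
      then have q: "cinv c x \<in> fst c" using c(5) by auto
      have "J (cinv c x) (V (cinv c x)) = tvec A c (cinv c x) (M x (tcoord c (cinv c x) (V (cinv c x))))"
        using M[rule_format, OF x, of "tcoord c (cinv c x) (V (cinv c x))"]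
          tvec_tcoord[OF c(1) q Vt[OF chart_sub[OF c(1) q]]] by simp
      then show "M x (tcoord c (cinv c x) (V (cinv c x))) = tcoord c (cinv c x) (J (cinv c x) (V (cinv c x)))"
        using tcoord_tvec[OF c(1) q] by simp
    qed
    then show "\<exists>c\<in>A. \<exists>T. p \<in> fst c \<and> open T \<and> snd c p \<in> T \<and> T \<subseteq> cimg c \<and>
           smooth_on T (\<lambda>x. tcoord c (cinv c x) (J (cinv c x) (V (cinv c x))))" using c by blast
  qed
  then show ?thesis using main unfolding almost_complex_structure_def by blast
qed

lemma acs_local:
  assumes "\<And>p. p \<in> topspace X \<Longrightarrow> \<exists>W J'. openin X W \<and> p \<in> W \<and> almost_complex_structure X A J' \<and> (\<forall>q\<in>W. J q = J' q)"
  shows "almost_complex_structure X A J"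
proof (rule acsI)
  fix p assume p: "p \<in> topspace X"
  obtain W J' where W: "openin X W" "p \<in> W" "almost_complex_structure X A J'" "\<forall>q\<in>W. J q = J' q"
    using assms[OF p] by blast
  obtain c where c: "c \<in> A" "p \<in> fst c" using chart_cover[OF p] by blast
  let ?T = "snd c ` (fst c \<inter> W)"
  have T: "open ?T" "?T \<subseteq> cimg c" using open_image[OF c(1) W(1)] by (auto simp: cimg_def)
  have "Jmat A c J' x (Jmat A c J' x u) = - u \<and>
      J (cinv c x) (tvec A c (cinv c x) u) = tvec A c (cinv c x) (Jmat A c J' x u)" if "x \<in> ?T" for x u
  proof -
    have x: "x \<in> cimg c" using that T by blast
    have "cinv c x \<in> W" using that c by auto
    then show ?thesis using acs_Jmat_sq[OF W(3) c(1) x, of u] acs_Jmat[OF W(3) c(1) cinv_in[OF x], of u] W(4) x by simp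
  qed
  then show "\<exists>c\<in>A. \<exists>T M. p \<in> fst c \<and> open T \<and> snd c p \<in> T \<and> T \<subseteq> cimg c \<and> smooth_on T M \<and>
     (\<forall>x\<in>T. \<forall>u. blinfun_apply (M x) (blinfun_apply (M x) u) = - u \<and>
        J (cinv c x) (tvec A c (cinv c x) u) = tvec A c (cinv c x) (blinfun_apply (M x) u))"
    using c W(2) T smooth_on_subset[OF acs_Jmat_smooth[OF W(3) c(1)] T(2)]
    by (intro bexI[OF _ c(1)] exI[of _ ?T] exI[of _ "Jmat A c J'"]) auto
qed

subsection \<open>Change of chart\<close>

lemma overlap_open: "c \<in> A \<Longrightarrow> d \<in> A \<Longrightarrow> open (snd c ` (fst c \<inter> fst d))"
  using open_image chart(1) by blast

lemma trans_deriv_works: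
  assumes "c \<in> A" "d \<in> A" "p \<in> fst c" "p \<in> fst d"
  shows "((snd d \<circ> cinv c) has_derivative blinfun_apply (trans_deriv c d (snd c p))) (at (snd c p))"
proof -
  have "((snd d \<circ> cinv c) has_derivative frechet_derivative (snd d \<circ> cinv c) (at (snd c p))) (at (snd c p))"
    by (rule smooth_on_has_derivative[OF transition[OF assms(1,2)]]) (use assms in auto)
  then show ?thesis unfolding trans_deriv_def
    by (simp add: bounded_linear_Blinfun_apply has_derivative_bounded_linear)
qed

lemma trans_deriv_smooth:
  assumes "c \<in> A" "d \<in> A" shows "smooth_on (snd c ` (fst c \<inter> fst d)) (trans_deriv c d)"
proof (rule smooth_on_blinfun[OF overlap_open[OF assms]])
  fix b :: 'e
  show "smooth_on (snd c ` (fst c \<inter> fst d)) (\<lambda>x. trans_deriv c d x b)"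
  proof (rule smooth_on_cong[OF overlap_open[OF assms] _ smooth_on_frechet_derivative[OF transition[OF assms], of b]])
    fix x assume "x \<in> snd c ` (fst c \<inter> fst d)"
    then obtain p where p: "p \<in> fst c" "p \<in> fst d" "x = snd c p" by auto
    show "frechet_derivative (snd d \<circ> cinv c) (at x) b = trans_deriv c d x b"
      using frechet_derivative_at[OF trans_deriv_works[OF assms p(1,2)]] p(3) by simp
  qed
qed

lemma tvec_change:
  assumes "c \<in> A" "d \<in> A" "p \<in> fst c" "p \<in> fst d"
  shows "tvec A d p (trans_deriv c d (snd c p) u) = tvec A c p u"
proof (rule ext)
  fix f
  show "tvec A d p (trans_deriv c d (snd c p) u) f = tvec A c p u f"
  proof (cases "smooth_fun A f")
    case True
    have "(((f \<circ> cinv d) \<circ> (snd d \<circ> cinv c)) has_derivative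
      (frechet_derivative (f \<circ> cinv d) (at (snd d p)) \<circ> blinfun_apply (trans_deriv c d (snd c p)))) (at (snd c p))"
      by (rule diff_chain_at[OF trans_deriv_works[OF assms]])
        (use smooth_fun_has_derivative[OF True assms(2,4)] assms in simp)
    then have "((f \<circ> cinv c) has_derivative
      (frechet_derivative (f \<circ> cinv d) (at (snd d p)) \<circ> blinfun_apply (trans_deriv c d (snd c p)))) (at (snd c p))"
      by (rule has_derivative_transform_within_open[OF _ overlap_open[OF assms(1,2)]]) (use assms in auto)
    then show ?thesis using tvec_eqI[OF True] True by (simp add: tvec_smooth)
  qed (simp add: tvec_def)
qed

lemma Jmat_change:
  assumes J: "almost_complex_structure X A J" and cd: "c \<in> A" "d \<in> A" "p \<in> fst c" "p \<in> fst d"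
  shows "Jmat A d J (snd d p) = trans_deriv c d (snd c p) o\<^sub>L Jmat A c J (snd c p) o\<^sub>L trans_deriv d c (snd d p)"
proof (rule blinfun_eqI)
  fix u
  have "tvec A d p (Jmat A d J (snd d p) u) = J p (tvec A c p (trans_deriv d c (snd d p) u))"
    using acs_Jmat[OF J cd(2,4)] tvec_change[OF cd(2,1,4,3)] by simp
  also have "\<dots> = tvec A d p (trans_deriv c d (snd c p) (Jmat A c J (snd c p) (trans_deriv d c (snd d p) u)))"
    using acs_Jmat[OF J cd(1,3)] tvec_change[OF cd] by simp
  finally show "Jmat A d J (snd d p) u = (trans_deriv c d (snd c p) o\<^sub>L Jmat A c J (snd c p) o\<^sub>L trans_deriv d c (snd d p)) u"
    using tvec_inj[OF cd(2,4)] by simp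
qed

text \<open>Where the two charts overlap, the matrices are conjugate by the derivative of the transition map, which is independent
  of the parameter. Everywhere else in \<open>d\<close> the family is constant: a compact part of \<open>c\<close> is closed in the manifold.\<close>

lemma family_smooth_all_charts:
  fixes F :: "'s::euclidean_space \<Rightarrow> 'a \<Rightarrow> 'a tangent \<Rightarrow> 'a tangent"
  assumes S: "open S" and F: "\<And>s. s \<in> S \<Longrightarrow> almost_complex_structure X A (F s)" and J: "almost_complex_structure X A J"
    and c: "c \<in> A" "compact K" "K \<subseteq> cimg c"
    and sm: "smooth_on (S \<times> cimg c) (\<lambda>(s, x). Jmat A c (F s) x)"
    and off: "\<And>s p. s \<in> S \<Longrightarrow> p \<notin> cinv c ` K \<Longrightarrow> F s p = J p" and d: "d \<in> A"
  shows "smooth_on (S \<times> cimg d) (\<lambda>(s, y). Jmat A d (F s) y)"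
proof (rule smooth_on_local, safe)
  fix s y assume s: "s \<in> S" and y: "y \<in> cimg d"
  let ?p = "cinv d y"
  show "\<exists>T. open T \<and> (s, y) \<in> T \<and> smooth_on T (\<lambda>(s, y). Jmat A d (F s) y)"
  proof (cases "?p \<in> fst c")
    case True
    let ?O = "snd d ` (fst d \<inter> fst c)" and ?\<sigma> = "snd c \<circ> cinv d"
    have O: "open ?O" by (rule overlap_open[OF d c(1)])
    have oSO: "open (S \<times> ?O)" by (intro open_Times S O)
    have s1: "smooth_on (S \<times> ?O) (\<lambda>z. ?\<sigma> (snd z))"
      by (rule smooth_on_compose[OF oSO O _ smooth_on_linear[OF oSO bounded_linear_snd] transition[OF d c(1)]]) auto
    have s2: "smooth_on (S \<times> ?O) (\<lambda>z. trans_deriv d c (snd z))"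
      by (rule smooth_on_compose[OF oSO O _ smooth_on_linear[OF oSO bounded_linear_snd] trans_deriv_smooth[OF d c(1)]]) auto
    have s3: "smooth_on (S \<times> ?O) (\<lambda>z. trans_deriv c d (?\<sigma> (snd z)))"
      by (rule smooth_on_compose[OF oSO overlap_open[OF c(1) d] _ s1 trans_deriv_smooth[OF c(1) d]]) (use d in auto)
    have s4: "smooth_on (S \<times> ?O) (\<lambda>z. (\<lambda>(s, x). Jmat A c (F s) x) (fst z, ?\<sigma> (snd z)))"
      by (rule smooth_on_compose[OF oSO _ _ smooth_on_Pair[OF oSO smooth_on_linear[OF oSO bounded_linear_fst] s1] sm])
        (use d S chart(2)[OF c(1)] in \<open>auto intro!: open_Times\<close>)
    have "smooth_on (S \<times> ?O) (\<lambda>z. trans_deriv c d (?\<sigma> (snd z)) o\<^sub>L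
        (\<lambda>(s, x). Jmat A c (F s) x) (fst z, ?\<sigma> (snd z)) o\<^sub>L trans_deriv d c (snd z))"
      by (intro smooth_on_blinfun_compose oSO s2 s3 s4)
    then have "smooth_on (S \<times> ?O) (\<lambda>(s, y). Jmat A d (F s) y)"
    proof (rule smooth_on_cong[OF oSO, rotated])
      fix z assume "z \<in> S \<times> ?O"
      then obtain q where q: "fst z \<in> S" "q \<in> fst d" "q \<in> fst c" "snd z = snd d q" by auto
      show "trans_deriv c d (?\<sigma> (snd z)) o\<^sub>L (\<lambda>(s, x). Jmat A c (F s) x) (fst z, ?\<sigma> (snd z)) o\<^sub>L trans_deriv d c (snd z)
          = (\<lambda>(s, y). Jmat A d (F s) y) z"
        using Jmat_change[OF F[OF q(1)] c(1) d q(3,2)] q d by (simp add: split_beta)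
    qed
    moreover have "(s, y) \<in> S \<times> ?O" using s y True by (auto intro!: image_eqI[of _ _ ?p])
    ultimately show ?thesis using oSO by blast
  next
    case False
    let ?W = "topspace X - cinv c ` K"
    let ?O = "snd d ` (fst d \<inter> ?W)"
    have "openin X ?W" using closedin_cinv[OF c] by (simp add: closedin_def)
    then have O: "open ?O" by (rule open_image[OF d])
    have oSO: "open (S \<times> ?O)" by (intro open_Times S O)
    have "smooth_on (S \<times> ?O) (\<lambda>z. Jmat A d J (snd z))"
      by (rule smooth_on_compose[OF oSO chart(2)[OF d] _ smooth_on_linear[OF oSO bounded_linear_snd] acs_Jmat_smooth[OF J d]])
        (auto simp: cimg_def)
    then have "smooth_on (S \<times> ?O) (\<lambda>(s, y). Jmat A d (F s) y)"
      by (rule smooth_on_cong[OF oSO, rotated]) (use off d in \<open>auto intro!: Jmat_cong\<close>)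
    moreover have "(s, y) \<in> S \<times> ?O"
      using s y False mem_cinv_image[OF c(1,3)] chart_sub[OF d] by (auto intro!: image_eqI[of _ _ ?p])
    ultimately show ?thesis using oSO by blast
  qed
qed

definition replace_acs :: "('a, 'e) chart \<Rightarrow> 'e set \<Rightarrow> ('e \<Rightarrow> 'e \<Rightarrow>\<^sub>L 'e) \<Rightarrow> ('a \<Rightarrow> 'a tangent \<Rightarrow> 'a tangent) \<Rightarrow> 'a \<Rightarrow> 'a tangent \<Rightarrow> 'a tangent"
  where "replace_acs c K M J p v =
    (if p \<in> cinv c ` K then tvec A c p (M (snd c p) (tcoord c p v)) else J p v)"

lemma replace_acs_off: "p \<notin> cinv c ` K \<Longrightarrow> replace_acs c K M J p = J p"
  by (simp add: replace_acs_def fun_eq_iff)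

text \<open>The new structure has matrix \<open>M\<close> on the whole chart, by the agreement off \<open>K\<close>, and equals \<open>J\<close> on the complement
  of \<open>cinv c ` K\<close>, which is open. So it is smooth near every point.\<close>

lemma replace_acs:
  fixes M :: "'e \<Rightarrow> 'e \<Rightarrow>\<^sub>L 'e"
  assumes J: "almost_complex_structure X A J" and c: "c \<in> A" "compact K" "K \<subseteq> cimg c"
    and M: "smooth_on (cimg c) M" "\<And>x u. x \<in> cimg c \<Longrightarrow> M x (M x u) = - u"
    and off: "\<And>x. x \<in> cimg c \<Longrightarrow> x \<notin> K \<Longrightarrow> M x = Jmat A c J x"
  shows "almost_complex_structure X A (replace_acs c K M J)"
    "\<And>x. x \<in> cimg c \<Longrightarrow> Jmat A c (replace_acs c K M J) x = M x"
proof -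
  have app: "replace_acs c K M J (cinv c x) (tvec A c (cinv c x) u) = tvec A c (cinv c x) (M x u)" if x: "x \<in> cimg c" for x u
  proof (cases "x \<in> K")
    case True
    then show ?thesis using x c by (simp add: replace_acs_def)
  next
    case False
    then have "cinv c x \<notin> cinv c ` K" using mem_cinv_image[OF c(1,3)] x by simp
    then show ?thesis using acs_Jmat[OF J c(1) cinv_in[OF x]] off[OF x False] x by (simp add: replace_acs_off)
  qed
  show "Jmat A c (replace_acs c K M J) x = M x" if "x \<in> cimg c" for x
    by (rule JmatI) (use c(1) that app in auto)
  show "almost_complex_structure X A (replace_acs c K M J)"
  proof (rule acsI)
    fix p assume p: "p \<in> topspace X"
    show "\<exists>c'\<in>A. \<exists>T M'. p \<in> fst c' \<and> open T \<and> snd c' p \<in> T \<and> T \<subseteq> cimg c' \<and> smooth_on T M' \<and>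
     (\<forall>x\<in>T. \<forall>u. blinfun_apply (M' x) (blinfun_apply (M' x) u) = - u \<and>
        replace_acs c K M J (cinv c' x) (tvec A c' (cinv c' x) u) = tvec A c' (cinv c' x) (blinfun_apply (M' x) u))"
    proof (cases "p \<in> fst c")
      case True
      then show ?thesis using c M app chart(2)[OF c(1)]
        by (intro bexI[OF _ c(1)] exI[of _ "cimg c"] exI[of _ M]) auto
    next
      case False
      obtain d where d: "d \<in> A" "p \<in> fst d" using chart_cover[OF p] by blast
      let ?W = "topspace X - cinv c ` K"
      let ?O = "snd d ` (fst d \<inter> ?W)"
      have "openin X ?W" using closedin_cinv[OF c] by (simp add: closedin_def)
      then have O: "open ?O" "?O \<subseteq> cimg d" using open_image[OF d(1)] by (auto simp: cimg_def)
      have pW: "p \<in> ?W" using False p mem_cinv_image[OF c(1,3)] by blast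
      have "Jmat A d J x (Jmat A d J x u) = - u \<and>
        replace_acs c K M J (cinv d x) (tvec A d (cinv d x) u) = tvec A d (cinv d x) (Jmat A d J x u)" if "x \<in> ?O" for x u
      proof -
        have x: "x \<in> cimg d" using that O by blast
        have "cinv d x \<notin> cinv c ` K" using that d by auto
        then show ?thesis using acs_Jmat_sq[OF J d(1) x, of u] acs_Jmat[OF J d(1) cinv_in[OF x], of u] x
          by (simp add: replace_acs_off)
      qed
      then show ?thesis using d pW O smooth_on_subset[OF acs_Jmat_smooth[OF J d(1)] O(2)]
        by (intro bexI[OF _ d(1)] exI[of _ ?O] exI[of _ "Jmat A d J"]) auto
    qed
  qed
qed

end

section \<open>The Nijenhuis tensor in a chart\<close>

definition ctvec :: "('a, 'e::euclidean_space) chart set \<Rightarrow> ('a, 'e) chart \<Rightarrow> 'a \<Rightarrow> 'e \<Rightarrow> 'e \<Rightarrow> 'a ctangent" where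
  "ctvec A c p u w = (\<lambda>f. Complex (tvec A c p u f) (tvec A c p w f))"

definition fmat :: "('a, 'e::euclidean_space) chart set \<Rightarrow> ('a, 'e) chart \<Rightarrow> ('a \<Rightarrow> 'a form1) \<Rightarrow> 'e \<Rightarrow> 'e \<Rightarrow>\<^sub>L complex" where
  "fmat A c \<alpha> x = Blinfun (\<lambda>u. \<alpha> (cinv c x) (ctvec A c (cinv c x) u 0))"

text \<open>Complex bilinear extension of a real bilinear map.\<close>

definition cbil :: "('e \<Rightarrow> 'e \<Rightarrow> complex) \<Rightarrow> 'e \<Rightarrow> 'e \<Rightarrow> 'e \<Rightarrow> 'e \<Rightarrow> complex" where
  "cbil B v1 v2 w1 w2 = B v1 w1 - B v2 w2 + \<i> * (B v2 w1 + B v1 w2)"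

definition real_bracket :: "('a \<Rightarrow> 'a tangent) \<Rightarrow> ('a \<Rightarrow> 'a tangent) \<Rightarrow> 'a \<Rightarrow> 'a tangent" where
  "real_bracket V W p f = V p (\<lambda>x. W x f) - W p (\<lambda>x. V x f)"

lemma has_derivative_blinfun_frechet:
  assumes "smooth_on S M" "x \<in> S"
  shows "((\<lambda>y. blinfun_apply (M y) u) has_derivative (\<lambda>v. frechet_derivative M (at x) v u)) (at x)"
  using bounded_linear.has_derivative[OF blinfun.bounded_linear_left smooth_on_has_derivative[OF assms]] .

context smooth_mfd
begin

lemma tvec_add: "c \<in> A \<Longrightarrow> p \<in> fst c \<Longrightarrow> tvec A c p (u + w) f = tvec A c p u f + tvec A c p w f"
  and tvec_scaleR: "c \<in> A \<Longrightarrow> p \<in> fst c \<Longrightarrow> tvec A c p (r *\<^sub>R u) f = r * tvec A c p u f"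
  and tvec_diff: "c \<in> A \<Longrightarrow> p \<in> fst c \<Longrightarrow> tvec A c p (u - w) f = tvec A c p u f - tvec A c p w f"
  and tvec_minus: "c \<in> A \<Longrightarrow> p \<in> fst c \<Longrightarrow> tvec A c p (- u) f = - tvec A c p u f"
  and tvec_zero: "c \<in> A \<Longrightarrow> p \<in> fst c \<Longrightarrow> tvec A c p 0 f = 0"
  using tvec_linear[of c p 1 u 1 w] tvec_linear[of c p r u 0 u] tvec_linear[of c p 1 u "-1" w]
    tvec_linear[of c p "-1" u 0 u] tvec_linear[of c p 0 u 0 u]
  by (auto simp: fun_eq_iff)

lemma ctvec_in: "c \<in> A \<Longrightarrow> p \<in> fst c \<Longrightarrow> ctvec A c p u w \<in> ctangent_space A p"
  using tvec_in by (auto simp: ctvec_def ctangent_space_def)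

lemma ctvec_ex:
  assumes "c \<in> A" "p \<in> fst c" "v \<in> ctangent_space A p"
  obtains u w where "v = ctvec A c p u w" "u = tcoord c p (\<lambda>f. Re (v f))" "w = tcoord c p (\<lambda>f. Im (v f))"
proof
  show "v = ctvec A c p (tcoord c p (\<lambda>f. Re (v f))) (tcoord c p (\<lambda>f. Im (v f)))"
    using assms tvec_tcoord by (auto simp: ctvec_def ctangent_space_def fun_eq_iff complex_eq_iff)
qed auto

lemma ctvec_Re_Im [simp]:
  "(\<lambda>f. Re (ctvec A c p u w f)) = tvec A c p u" "(\<lambda>f. Im (ctvec A c p u w f)) = tvec A c p w"
  by (auto simp: ctvec_def)

lemma ctvec_inj: "c \<in> A \<Longrightarrow> p \<in> fst c \<Longrightarrow> ctvec A c p u w = ctvec A c p u' w' \<longleftrightarrow> u = u' \<and> w = w'"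
  using ctvec_Re_Im tvec_inj by metis

lemma ctvec_combination:
  assumes "c \<in> A" "p \<in> fst c"
  shows "(\<lambda>f. a * ctvec A c p u1 w1 f + b * ctvec A c p u2 w2 f) =
    ctvec A c p (Re a *\<^sub>R u1 - Im a *\<^sub>R w1 + Re b *\<^sub>R u2 - Im b *\<^sub>R w2) (Re a *\<^sub>R w1 + Im a *\<^sub>R u1 + Re b *\<^sub>R w2 + Im b *\<^sub>R u2)"
  by (rule ext) (simp add: ctvec_def complex_eq_iff tvec_add[OF assms] tvec_scaleR[OF assms] tvec_diff[OF assms])

lemma ctangent_combination:
  assumes "p \<in> topspace X" "v \<in> ctangent_space A p" "w \<in> ctangent_space A p"
  shows "(\<lambda>f. a * v f + b * w f) \<in> ctangent_space A p"
proof -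
  obtain c where c: "c \<in> A" "p \<in> fst c" using chart_cover[OF assms(1)] by blast
  obtain u1 w1 where "v = ctvec A c p u1 w1" by (rule ctvec_ex[OF c assms(2)])
  moreover obtain u2 w2 where "w = ctvec A c p u2 w2" by (rule ctvec_ex[OF c assms(3)])
  ultimately show ?thesis using ctvec_combination[OF c] ctvec_in[OF c] by simp
qed

lemma form_combination:
  assumes "\<alpha> \<in> ccotangent_space A p" "v \<in> ctangent_space A p" "w \<in> ctangent_space A p"
  shows "\<alpha> (\<lambda>f. a * v f + b * w f) = a * \<alpha> v + b * \<alpha> w"
  using assms unfolding ccotangent_space_def by blast

lemma form_ctvec:
  assumes c: "c \<in> A" "p \<in> fst c" and \<alpha>: "\<alpha> \<in> ccotangent_space A p"
  shows "\<alpha> (ctvec A c p u w) = \<alpha> (ctvec A c p u 0) + \<i> * \<alpha> (ctvec A c p w 0)"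
  using form_combination[OF \<alpha> ctvec_in[OF c] ctvec_in[OF c], of 1 u 0 "\<i>" w 0] ctvec_combination[OF c, of 1 u 0 "\<i>" w 0]
  by simp

lemma form_real_linear:
  assumes c: "c \<in> A" "p \<in> fst c" and \<alpha>: "\<alpha> \<in> ccotangent_space A p"
  shows "bounded_linear (\<lambda>u. \<alpha> (ctvec A c p u 0))"
  unfolding linear_conv_bounded_linear[symmetric]
proof
  show "\<alpha> (ctvec A c p (u + w) 0) = \<alpha> (ctvec A c p u 0) + \<alpha> (ctvec A c p w 0)" for u w
    using form_combination[OF \<alpha> ctvec_in[OF c] ctvec_in[OF c], of 1 u 0 1 w 0] ctvec_combination[OF c, of 1 u 0 1 w 0] by simp
  show "\<alpha> (ctvec A c p (r *\<^sub>R u) 0) = r *\<^sub>R \<alpha> (ctvec A c p u 0)" for r u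
    using form_combination[OF \<alpha> ctvec_in[OF c] ctvec_in[OF c], of "of_real r" u 0 0 u 0]
      ctvec_combination[OF c, of "of_real r" u 0 0 u 0] by (simp add: scaleR_conv_of_real)
qed

lemma fmat_apply:
  assumes c: "c \<in> A" "p \<in> fst c" and \<alpha>: "\<alpha> p \<in> ccotangent_space A p"
  shows "fmat A c \<alpha> (snd c p) u = \<alpha> p (ctvec A c p u 0)" "\<alpha> p (ctvec A c p u w) = fmat A c \<alpha> (snd c p) u + \<i> * fmat A c \<alpha> (snd c p) w"
proof -
  show 1: "fmat A c \<alpha> (snd c p) u = \<alpha> p (ctvec A c p u 0)" for u
    using form_real_linear[OF c \<alpha>] c by (simp add: fmat_def bounded_linear_Blinfun_apply)
  show "\<alpha> p (ctvec A c p u w) = fmat A c \<alpha> (snd c p) u + \<i> * fmat A c \<alpha> (snd c p) w"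
    using form_ctvec[OF c \<alpha>, of u w] by (simp add: 1)
qed

lemma cvector_field_iff:
  "cvector_field X A V \<longleftrightarrow> vector_field X A (\<lambda>p f. Re (V p f)) \<and> vector_field X A (\<lambda>p f. Im (V p f))"
proof -
  have "smooth_fun A (\<lambda>p. V p f) \<longleftrightarrow> smooth_fun A (\<lambda>p. Re (V p f)) \<and> smooth_fun A (\<lambda>p. Im (V p f))" for f
  proof
    assume "smooth_fun A (\<lambda>p. V p f)"
    then show "smooth_fun A (\<lambda>p. Re (V p f)) \<and> smooth_fun A (\<lambda>p. Im (V p f))"
      using smooth_fun_linear[OF bounded_linear_Re] smooth_fun_linear[OF bounded_linear_Im] by blast
  next
    assume a: "smooth_fun A (\<lambda>p. Re (V p f)) \<and> smooth_fun A (\<lambda>p. Im (V p f))"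
    have "smooth_fun A (\<lambda>p. of_real (Re (V p f)) + \<i> * of_real (Im (V p f)))"
      by (intro smooth_fun_add smooth_fun_mult smooth_fun_const smooth_fun_linear[OF bounded_linear_of_real])
        (use a in auto)
    then show "smooth_fun A (\<lambda>p. V p f)" by (simp add: complex_eq[symmetric])
  qed
  then show ?thesis unfolding cvector_field_def vector_field_def ctangent_space_def by auto
qed

lemma vector_field_zero: "vector_field X A (\<lambda>p f. 0)"
  by (simp add: vector_field_def smooth_fun_const tangent_space_zero)

lemma extend_vector:
  assumes c: "c \<in> A" "p \<in> fst c"
  obtains V W where "vector_field X A V" "openin X W" "p \<in> W" "W \<subseteq> fst c" "\<And>q. q \<in> W \<Longrightarrow> V q = tvec A c q u"
proof -
  obtain R where R: "R > 0" "cball (snd c p) R \<subseteq> cimg c"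
    using chart(2)[OF c(1)] cmap_in[OF c(2)] open_contains_cball by blast
  obtain \<rho> :: "'e \<Rightarrow> real" where \<rho>: "smooth_on UNIV \<rho>" "\<And>y. y \<in> cball (snd c p) (R/2) \<Longrightarrow> \<rho> y = 1"
    "\<And>y. y \<notin> ball (snd c p) R \<Longrightarrow> \<rho> y = 0"
    by (rule smooth_bump_ball[of "R/2" R "snd c p"]) (use R(1) in \<open>simp, simp, blast\<close>)
  let ?W = "{q \<in> fst c. snd c q \<in> ball (snd c p) (R/2)}"
  show thesis
  proof
    show "vector_field X A (cutfield c \<rho> (\<lambda>_. u))"
      by (rule vector_field_cutfield[OF c(1) R(2) order_refl chart(2)[OF c(1)] \<rho>(1) _ smooth_on_const[OF chart(2)[OF c(1)]]]) (rule \<rho>(3))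
    show "openin X ?W" by (rule openin_pullback[OF c(1) open_ball])
    show "p \<in> ?W" "?W \<subseteq> fst c" using c R by auto
    show "cutfield c \<rho> (\<lambda>_. u) q = tvec A c q u" if "q \<in> ?W" for q
      using that \<rho>(2)[of "snd c q"] by (simp add: cutfield_def)
  qed
qed

lemma extend_vector_at:
  assumes c: "c \<in> A" "p \<in> fst c"
  obtains V where "vector_field X A V" "V p = tvec A c p u"
proof -
  obtain V W where "vector_field X A V" "openin X W" "p \<in> W" "W \<subseteq> fst c" "\<And>q. q \<in> W \<Longrightarrow> V q = tvec A c q u"
    by (rule extend_vector[OF c, of u]) (rule that)
  then show thesis using that by blast
qed

lemma cvector_field_Complex:
  "vector_field X A V \<Longrightarrow> vector_field X A W \<Longrightarrow> cvector_field X A (\<lambda>p f. Complex (V p f) (W p f))"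
  by (simp add: cvector_field_iff)

lemma fmat_smooth:
  assumes \<alpha>: "cform1 X A \<alpha>" and c: "c \<in> A" shows "smooth_on (cimg c) (fmat A c \<alpha>)"
proof (rule smooth_on_blinfun[OF chart(2)[OF c]], rule smooth_on_local)
  fix b :: 'e and x assume x: "x \<in> cimg c"
  obtain V W where V: "vector_field X A V" "openin X W" "cinv c x \<in> W" "W \<subseteq> fst c" "\<And>q. q \<in> W \<Longrightarrow> V q = tvec A c q b"
    by (rule extend_vector[OF c cinv_in[OF x], of b]) (rule that)
  have "cvector_field X A (\<lambda>p f. Complex (V p f) 0)"
    using cvector_field_Complex[OF V(1) vector_field_zero] .
  then have s: "smooth_fun A (\<lambda>p. \<alpha> p (\<lambda>f. Complex (V p f) 0))" using \<alpha> unfolding cform1_def by blast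
  let ?T = "snd c ` (fst c \<inter> W)"
  have T: "open ?T" by (rule open_image[OF c V(2)])
  have "smooth_on ?T (\<lambda>y. fmat A c \<alpha> y b)"
  proof (rule smooth_on_cong[OF T _ smooth_on_subset[OF smooth_funD[OF s c]]])
    show "?T \<subseteq> cimg c" by (auto simp: cimg_def)
    fix y assume "y \<in> ?T"
    then obtain q where q: "q \<in> fst c" "q \<in> W" "y = snd c q" by auto
    have "\<alpha> q \<in> ccotangent_space A q" using \<alpha> chart_sub[OF c q(1)] unfolding cform1_def by blast
    then show "((\<lambda>p. \<alpha> p (\<lambda>f. Complex (V p f) 0)) \<circ> cinv c) y = fmat A c \<alpha> y b"
      using fmat_apply(1)[OF c q(1)] q V(5)[OF q(2)] c by (simp add: ctvec_def tvec_zero)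
  qed
  then show "\<exists>T. open T \<and> x \<in> T \<and> smooth_on T (\<lambda>y. fmat A c \<alpha> y b)"
    using T V(3) x by (intro exI[of _ ?T]) (auto intro!: image_eqI[of _ _ "cinv c x"])
qed

subsection \<open>Brackets and the exterior derivative\<close>

definition vcoord :: "('a, 'e) chart \<Rightarrow> ('a \<Rightarrow> 'a tangent) \<Rightarrow> 'e \<Rightarrow> 'e" where
  "vcoord c V x = tcoord c (cinv c x) (V (cinv c x))"

lemma vcoord_smooth: "vector_field X A V \<Longrightarrow> c \<in> A \<Longrightarrow> smooth_on (cimg c) (vcoord c V)"
  using vector_field_coord_smooth unfolding vcoord_def by blast

lemma tvec_vcoord: "vector_field X A V \<Longrightarrow> c \<in> A \<Longrightarrow> p \<in> fst c \<Longrightarrow> tvec A c p (vcoord c V (snd c p)) = V p"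
  using tvec_tcoord chart_sub unfolding vcoord_def vector_field_def by auto

lemma vector_field_in: "vector_field X A V \<Longrightarrow> p \<in> topspace X \<Longrightarrow> V p \<in> tangent_space A p"
  and vector_field_smooth: "vector_field X A V \<Longrightarrow> smooth_fun A f \<Longrightarrow> smooth_fun A (\<lambda>p. V p f)"
  unfolding vector_field_def by blast+

text \<open>That the bracket is again a derivation is pure algebra. Its components are then found by
  applying it to coordinates, whose second derivatives vanish.\<close>

lemma real_bracket_in:
  assumes V: "vector_field X A V" and W: "vector_field X A W" and p: "p \<in> topspace X"
  shows "real_bracket V W p \<in> tangent_space A p"
proof -
  have half_lin: "V p (\<lambda>x. W x (\<lambda>x. a * f x + b * g x)) = a * V p (\<lambda>x. W x f) + b * V p (\<lambda>x. W x g)"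
    and half_prod: "V p (\<lambda>x. W x (\<lambda>x. f x * g x)) = f p * V p (\<lambda>x. W x g) + W p g * V p f + (g p * V p (\<lambda>x. W x f) + W p f * V p g)"
    if V: "vector_field X A V" and W: "vector_field X A W" and f: "smooth_fun A f" and g: "smooth_fun A g" for V W f g a b
  proof -
    note Vp = vector_field_in[OF V p] and Wx = vector_field_in[OF W]
    note sWf = vector_field_smooth[OF W f] and sWg = vector_field_smooth[OF W g]
    have "V p (\<lambda>x. W x (\<lambda>x. a * f x + b * g x)) = V p (\<lambda>x. a * W x f + b * W x g)"
      by (rule tangent_local[OF Vp p _ _ openin_topspace p])
        (auto intro!: vector_field_smooth[OF W] smooth_fun_add smooth_fun_mult smooth_fun_const f g sWf sWg
          simp: tangent_lin(1)[OF Wx f g])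
    also have "\<dots> = a * V p (\<lambda>x. W x f) + b * V p (\<lambda>x. W x g)" by (rule tangent_lin(1)[OF Vp sWf sWg])
    finally show "V p (\<lambda>x. W x (\<lambda>x. a * f x + b * g x)) = a * V p (\<lambda>x. W x f) + b * V p (\<lambda>x. W x g)" .
    have "V p (\<lambda>x. W x (\<lambda>x. f x * g x)) = V p (\<lambda>x. f x * W x g + g x * W x f)"
      by (rule tangent_local[OF Vp p _ _ openin_topspace p])
        (auto intro!: vector_field_smooth[OF W] smooth_fun_add smooth_fun_mult f g sWf sWg
          simp: tangent_lin(2)[OF Wx f g])
    also have "\<dots> = V p (\<lambda>x. f x * W x g) + V p (\<lambda>x. g x * W x f)"
      by (rule tangent_lin(3)[OF Vp]) (intro smooth_fun_mult f g sWf sWg)+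
    also have "\<dots> = f p * V p (\<lambda>x. W x g) + W p g * V p f + (g p * V p (\<lambda>x. W x f) + W p f * V p g)"
      by (simp add: tangent_lin(2)[OF Vp f sWg] tangent_lin(2)[OF Vp g sWf])
    finally show "V p (\<lambda>x. W x (\<lambda>x. f x * g x)) = f p * V p (\<lambda>x. W x g) + W p g * V p f + (g p * V p (\<lambda>x. W x f) + W p f * V p g)" .
  qed
  have zero: "V p (\<lambda>x. W x f) = 0"
    if V: "vector_field X A V" and W: "vector_field X A W" and f: "\<not> smooth_fun A f" for V W f
  proof -
    have 0: "W x f = 0" if "x \<in> topspace X" for x
      using vector_field_in[OF W that] f unfolding tangent_space_def by blast
    have "smooth_fun A (\<lambda>x. W x f)" by (rule smooth_fun_cong[OF smooth_fun_const 0])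
    then have "V p (\<lambda>x. W x f) = V p (\<lambda>x. 0)"
      by (rule tangent_local[OF vector_field_in[OF V p] p _ smooth_fun_const openin_topspace p 0])
    then show ?thesis
      using tangent_lin(5)[OF vector_field_in[OF V p] smooth_fun_const smooth_fun_const, of 0] by simp
  qed
  show ?thesis
    unfolding tangent_space_def real_bracket_def
    by (auto simp: half_lin[OF V W] half_lin[OF W V] half_prod[OF V W] half_prod[OF W V] zero[OF V W] zero[OF W V] algebra_simps)
qed

lemma real_bracket_coord:
  assumes V: "vector_field X A V" and W: "vector_field X A W" and c: "c \<in> A" "p \<in> fst c"
  defines "x \<equiv> snd c p"
  shows "real_bracket V W p = tvec A c p (frechet_derivative (vcoord c W) (at x) (vcoord c V x) -
      frechet_derivative (vcoord c V) (at x) (vcoord c W x))"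
proof -
  note pX = chart_sub[OF c]
  obtain F O' where F: "\<And>b. smooth_fun A (F b)" "openin X O'" "p \<in> O'" "O' \<subseteq> fst c"
      "\<And>q b u. q \<in> O' \<Longrightarrow> tvec A c q u (F b) = u \<bullet> b"
    by (rule coordinate_function[OF c]) (rule that)
  have half: "V p (\<lambda>x. W x (F b)) = frechet_derivative (vcoord c W) (at x) (vcoord c V x) \<bullet> b"
    if V: "vector_field X A V" and W: "vector_field X A W" for V W b
  proof -
    let ?T = "snd c ` (fst c \<inter> O')"
    have T: "open ?T" "x \<in> ?T" using open_image[OF c(1) F(2)] F(3,4) by (auto simp: x_def)
    have hd: "(vcoord c W has_derivative frechet_derivative (vcoord c W) (at x)) (at x)"
      by (rule smooth_on_has_derivative[OF vcoord_smooth[OF W c(1)]]) (use c in \<open>simp add: x_def\<close>)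
    have "((\<lambda>y. vcoord c W y \<bullet> b) has_derivative (\<lambda>u. frechet_derivative (vcoord c W) (at x) u \<bullet> b)) (at x)"
      by (rule bounded_linear.has_derivative[OF bounded_linear_inner_left hd])
    then have "(((\<lambda>x. W x (F b)) \<circ> cinv c) has_derivative (\<lambda>u. frechet_derivative (vcoord c W) (at x) u \<bullet> b)) (at x)"
    proof (rule has_derivative_transform_within_open[OF _ T])
      fix y assume "y \<in> ?T"
      then obtain q where q: "q \<in> fst c" "q \<in> O'" "y = snd c q" by auto
      show "vcoord c W y \<bullet> b = ((\<lambda>x. W x (F b)) \<circ> cinv c) y"
        using F(5)[OF q(2), of "vcoord c W y" b] tvec_vcoord[OF W c(1) q(1)] q c by simp
    qed
    from tvec_eqI[OF vector_field_smooth[OF W F(1)] this[unfolded x_def], of "vcoord c V x"]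
    show ?thesis using tvec_vcoord[OF V c] by (simp add: x_def)
  qed
  obtain u where u: "real_bracket V W p = tvec A c p u" by (rule tangent_is_tvec[OF c real_bracket_in[OF V W pX]])
  have "u \<bullet> b = (frechet_derivative (vcoord c W) (at x) (vcoord c V x) -
      frechet_derivative (vcoord c V) (at x) (vcoord c W x)) \<bullet> b" for b
    using arg_cong[OF u, of "\<lambda>v. v (F b)"] half[OF V W, of b] half[OF W V, of b] F(5)[OF F(3), of u b]
    by (simp add: real_bracket_def inner_diff_left)
  then show ?thesis using u euclidean_eqI by metis
qed

lemma cderiv_ctvec:
  fixes g :: "'a \<Rightarrow> complex"
  assumes c: "c \<in> A" "p \<in> fst c" and g: "smooth_fun A g" "((g \<circ> cinv c) has_derivative D) (at (snd c p))"
  shows "cderiv (ctvec A c p u w) g = D u + \<i> * D w"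
proof -
  have Re: "tvec A c p u (\<lambda>x. Re (g x)) = Re (D u)" for u
    by (rule tvec_eqI[OF smooth_fun_linear[OF bounded_linear_Re g(1)]])
      (use bounded_linear.has_derivative[OF bounded_linear_Re g(2)] in \<open>simp add: o_def\<close>)
  have Im: "tvec A c p u (\<lambda>x. Im (g x)) = Im (D u)" for u
    by (rule tvec_eqI[OF smooth_fun_linear[OF bounded_linear_Im g(1)]])
      (use bounded_linear.has_derivative[OF bounded_linear_Im g(2)] in \<open>simp add: o_def\<close>)
  show ?thesis by (simp add: cderiv_def ctvec_def Re Im complex_eq_iff)
qed

text \<open>The complex bracket splits into four real brackets.\<close>

lemma lie_bracket_ctvec:
  assumes V: "cvector_field X A V" and W: "cvector_field X A W" and c: "c \<in> A" "p \<in> fst c"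
  defines "x \<equiv> snd c p" and "V1 \<equiv> vcoord c (\<lambda>p f. Re (V p f))" and "V2 \<equiv> vcoord c (\<lambda>p f. Im (V p f))"
    and "W1 \<equiv> vcoord c (\<lambda>p f. Re (W p f))" and "W2 \<equiv> vcoord c (\<lambda>p f. Im (W p f))"
  shows "lie_bracket V W p = ctvec A c p
    ((frechet_derivative W1 (at x) (V1 x) - frechet_derivative V1 (at x) (W1 x)) -
     (frechet_derivative W2 (at x) (V2 x) - frechet_derivative V2 (at x) (W2 x)))
    ((frechet_derivative W1 (at x) (V2 x) - frechet_derivative V2 (at x) (W1 x)) +
     (frechet_derivative W2 (at x) (V1 x) - frechet_derivative V1 (at x) (W2 x)))"
proof -
  note V' = V[unfolded cvector_field_iff] and W' = W[unfolded cvector_field_iff]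
  note rb = real_bracket_coord[OF _ _ c, folded x_def]
  have "lie_bracket V W p f = Complex
     (real_bracket (\<lambda>p f. Re (V p f)) (\<lambda>p f. Re (W p f)) p f - real_bracket (\<lambda>p f. Im (V p f)) (\<lambda>p f. Im (W p f)) p f)
     (real_bracket (\<lambda>p f. Im (V p f)) (\<lambda>p f. Re (W p f)) p f + real_bracket (\<lambda>p f. Re (V p f)) (\<lambda>p f. Im (W p f)) p f)" for f
    by (simp add: lie_bracket_def cderiv_def real_bracket_def complex_eq_iff)
  then show ?thesis
    using rb[of "\<lambda>p f. Re (V p f)" "\<lambda>p f. Re (W p f)"] rb[of "\<lambda>p f. Im (V p f)" "\<lambda>p f. Im (W p f)"]
      rb[of "\<lambda>p f. Im (V p f)" "\<lambda>p f. Re (W p f)"] rb[of "\<lambda>p f. Re (V p f)" "\<lambda>p f. Im (W p f)"] V' W'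
    by (simp add: fun_eq_iff ctvec_def tvec_add[OF c] tvec_diff[OF c] V1_def V2_def W1_def W2_def)
qed

definition dform :: "('a, 'e) chart \<Rightarrow> ('a \<Rightarrow> 'a form1) \<Rightarrow> 'e \<Rightarrow> 'e \<Rightarrow> 'e \<Rightarrow> complex" where
  "dform c \<alpha> x \<xi> \<eta> = frechet_derivative (fmat A c \<alpha>) (at x) \<xi> \<eta> - frechet_derivative (fmat A c \<alpha>) (at x) \<eta> \<xi>"

text \<open>For any extensions of the two vectors, the derivatives of the extending fields cancel against the bracket in the formula
  that defines \<open>d\<alpha>\<close>. What is left is the antisymmetrised derivative of the matrix of \<open>\<alpha>\<close>, which depends only on the
  vectors themselves.\<close>

lemma ext_deriv_ctvec:
  assumes \<alpha>: "cform1 X A \<alpha>" and c: "c \<in> A" "p \<in> fst c"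
  shows "ext_deriv X A \<alpha> p (ctvec A c p v1 v2) (ctvec A c p w1 w2) = cbil (dform c \<alpha> (snd c p)) v1 v2 w1 w2"
proof -
  let ?v = "ctvec A c p v1 v2" and ?w = "ctvec A c p w1 w2" and ?x = "snd c p"
  let ?a = "fmat A c \<alpha>" and ?D = "\<lambda>f. frechet_derivative f (at (snd c p))"
  have x: "?x \<in> cimg c" using c by simp
  have ap: "\<alpha> q \<in> ccotangent_space A q" if "q \<in> fst c" for q
    using \<alpha> chart_sub[OF c(1) that] unfolding cform1_def by blast
  have half: "cderiv (ctvec A c p v1 v2) (\<lambda>x. \<alpha> x (W x)) =
      ?D ?a v1 (W1 ?x) + ?a ?x (?D W1 v1) + \<i> * (?D ?a v1 (W2 ?x) + ?a ?x (?D W2 v1)) +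
      \<i> * (?D ?a v2 (W1 ?x) + ?a ?x (?D W1 v2) + \<i> * (?D ?a v2 (W2 ?x) + ?a ?x (?D W2 v2)))"
    if W: "cvector_field X A W" and W1: "W1 = vcoord c (\<lambda>p f. Re (W p f))" and W2: "W2 = vcoord c (\<lambda>p f. Im (W p f))"
    for W W1 W2 v1 v2
  proof -
    note W' = W[unfolded cvector_field_iff]
    have s: "smooth_on (cimg c) W1" "smooth_on (cimg c) W2"
      unfolding W1 W2 using vcoord_smooth[OF _ c(1)] W' by blast+
    note bb = bounded_bilinear.FDERIV[OF bounded_bilinear_blinfun_apply smooth_on_has_derivative[OF fmat_smooth[OF \<alpha> c(1)] x] smooth_on_has_derivative[OF _ x]]
    have hd: "((\<lambda>y. ?a y (W1 y) + \<i> * ?a y (W2 y)) has_derivative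
        (\<lambda>u. ?a ?x (?D W1 u) + ?D ?a u (W1 ?x) + \<i> * (?a ?x (?D W2 u) + ?D ?a u (W2 ?x)))) (at ?x)"
      by (intro has_derivative_add has_derivative_mult_right bb s)
    have eq: "?a y (W1 y) + \<i> * ?a y (W2 y) = ((\<lambda>x. \<alpha> x (W x)) \<circ> cinv c) y" if "y \<in> cimg c" for y
    proof -
      let ?q = "cinv c y"
      have q: "?q \<in> fst c" "snd c ?q = y" using that by auto
      have "W ?q = ctvec A c ?q (W1 y) (W2 y)"
        using tvec_vcoord[OF conjunct1[OF W'] c(1) q(1)] tvec_vcoord[OF conjunct2[OF W'] c(1) q(1)] q(2)
        by (simp add: ctvec_def W1 W2)
      then show ?thesis using fmat_apply(2)[where \<alpha> = \<alpha>, OF c(1) q(1) ap[OF q(1)]] q(2) by simp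
    qed
    have sm: "smooth_fun A (\<lambda>x. \<alpha> x (W x))" using \<alpha> W unfolding cform1_def by blast
    have "(((\<lambda>x. \<alpha> x (W x)) \<circ> cinv c) has_derivative
        (\<lambda>u. ?a ?x (?D W1 u) + ?D ?a u (W1 ?x) + \<i> * (?a ?x (?D W2 u) + ?D ?a u (W2 ?x)))) (at ?x)"
      by (rule has_derivative_transform_within_open[OF hd chart(2)[OF c(1)] x eq])
    from cderiv_ctvec[OF c sm this] show ?thesis by (simp add: algebra_simps)
  qed
  have main: "cderiv ?v (\<lambda>x. \<alpha> x (W x)) - cderiv ?w (\<lambda>x. \<alpha> x (V x)) - \<alpha> p (lie_bracket V W p)
      = cbil (dform c \<alpha> ?x) v1 v2 w1 w2"
    if V: "cvector_field X A V" and W: "cvector_field X A W" and Vp: "V p = ?v" and Wp: "W p = ?w" for V W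
  proof -
    define V1 V2 W1 W2 where "V1 = vcoord c (\<lambda>p f. Re (V p f))" and "V2 = vcoord c (\<lambda>p f. Im (V p f))"
      and "W1 = vcoord c (\<lambda>p f. Re (W p f))" and "W2 = vcoord c (\<lambda>p f. Im (W p f))"
    have val: "V1 ?x = v1" "V2 ?x = v2" "W1 ?x = w1" "W2 ?x = w2"
      using Vp Wp c by (auto simp: V1_def V2_def W1_def W2_def vcoord_def)
    show ?thesis
      unfolding half[OF W W1_def W2_def] half[OF V V1_def V2_def] lie_bracket_ctvec[OF V W c, folded V1_def V2_def W1_def W2_def]
        fmat_apply(2)[where \<alpha> = \<alpha>, OF c ap[OF c(2)]] val cbil_def dform_def
      by (simp add: blinfun.diff_right blinfun.add_right algebra_simps)
  qed
  obtain V1 where V1: "vector_field X A V1" "V1 p = tvec A c p v1" by (rule extend_vector_at[OF c]) (rule that)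
  obtain V2 where V2: "vector_field X A V2" "V2 p = tvec A c p v2" by (rule extend_vector_at[OF c]) (rule that)
  obtain W1 where W1: "vector_field X A W1" "W1 p = tvec A c p w1" by (rule extend_vector_at[OF c]) (rule that)
  obtain W2 where W2: "vector_field X A W2" "W2 p = tvec A c p w2" by (rule extend_vector_at[OF c]) (rule that)
  let ?V = "\<lambda>p f. Complex (V1 p f) (V2 p f)" and ?W = "\<lambda>p f. Complex (W1 p f) (W2 p f)"
  have VW: "cvector_field X A ?V" "cvector_field X A ?W" "?V p = ?v" "?W p = ?w"
    using cvector_field_Complex V1 V2 W1 W2 by (auto simp: ctvec_def)
  show ?thesis
    unfolding ext_deriv_def
  proof (simp only: ctvec_in[OF c] simp_thms if_True, rule the_equality)
    show "\<forall>V W. cvector_field X A V \<longrightarrow> cvector_field X A W \<longrightarrow> V p = ?v \<longrightarrow> W p = ?w \<longrightarrow>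
      cbil (dform c \<alpha> ?x) v1 v2 w1 w2 = cderiv ?v (\<lambda>x. \<alpha> x (W x)) - cderiv ?w (\<lambda>x. \<alpha> x (V x)) - \<alpha> p (lie_bracket V W p)"
      using main by simp
    fix k assume k: "\<forall>V W. cvector_field X A V \<longrightarrow> cvector_field X A W \<longrightarrow> V p = ?v \<longrightarrow> W p = ?w \<longrightarrow>
      k = cderiv ?v (\<lambda>x. \<alpha> x (W x)) - cderiv ?w (\<lambda>x. \<alpha> x (V x)) - \<alpha> p (lie_bracket V W p)"
    show "k = cbil (dform c \<alpha> ?x) v1 v2 w1 w2"
      using k[rule_format, OF VW] main[OF VW] by simp
  qed
qed

end

subsection \<open>Complex bases\<close>

text \<open>Choose vectors \<open>\<epsilon>\<^sub>k\<close> one after the other outside the span of the previous \<open>\<epsilon>\<close> and \<open>M \<epsilon>\<close>; that span is invariant under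
  \<open>M\<close>, so the new pair is again independent of it. The \<open>\<zeta>\<^sub>k\<close> are the dual complex coordinates.\<close>

lemma complex_basis:
  fixes M :: "'e::euclidean_space \<Rightarrow>\<^sub>L 'e"
  assumes M: "\<And>u. M (M u) = - u" and n: "DIM('e) = 2 * n"
  obtains \<zeta> :: "nat \<Rightarrow> 'e \<Rightarrow>\<^sub>L complex" and \<epsilon> :: "nat \<Rightarrow> 'e" where
    "\<And>k u. \<zeta> k (M u) = \<i> * \<zeta> k u"
    "\<And>k l. k < n \<Longrightarrow> l < n \<Longrightarrow> \<zeta> k (\<epsilon> l) = (if k = l then 1 else 0)"
    "\<And>u. u = (\<Sum>k<n. Re (\<zeta> k u) *\<^sub>R \<epsilon> k + Im (\<zeta> k u) *\<^sub>R M (\<epsilon> k))"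
proof -
  define S where "S \<epsilon> m = \<epsilon> ` {..<m} \<union> (\<lambda>k. blinfun_apply M (\<epsilon> k)) ` {..<m}" for \<epsilon> :: "nat \<Rightarrow> 'e" and m :: nat
  have linM: "linear (blinfun_apply M)" by (simp add: blinfun.bounded_linear_right bounded_linear.linear)
  have inv: "M u \<in> span (S \<epsilon> m)" if "u \<in> span (S \<epsilon> m)" for u \<epsilon> m
  proof -
    have "M ` S \<epsilon> m \<subseteq> span (S \<epsilon> m)"
    proof -
      have "- \<epsilon> k \<in> span (S \<epsilon> m)" "M (\<epsilon> k) \<in> span (S \<epsilon> m)" if "k < m" for k
      proof -
        have "\<epsilon> k \<in> S \<epsilon> m" "M (\<epsilon> k) \<in> S \<epsilon> m" using that by (auto simp: S_def)
        then show "- \<epsilon> k \<in> span (S \<epsilon> m)" "M (\<epsilon> k) \<in> span (S \<epsilon> m)" by (auto intro: span_neg span_base)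
      qed
      then show ?thesis by (auto simp: S_def M)
    qed
    then have "span (M ` S \<epsilon> m) \<subseteq> span (S \<epsilon> m)" by (metis span_minimal subspace_span)
    then show ?thesis using that linear_span_image[OF linM] by blast
  qed
  have ex: "\<exists>\<epsilon>. independent (S \<epsilon> m) \<and> card (S \<epsilon> m) = 2 * m" if "m \<le> n" for m
    using that
  proof (induction m)
    case 0
    show ?case by (simp add: S_def independent_empty)
  next
    case (Suc m)
    then obtain \<epsilon> where \<epsilon>: "independent (S \<epsilon> m)" "card (S \<epsilon> m) = 2 * m" by auto
    have "dim (span (S \<epsilon> m)) < DIM('e)" using \<epsilon> Suc.prems n by (simp add: dim_eq_card_independent)
    then have "span (S \<epsilon> m) \<noteq> UNIV" using dim_UNIV by (metis less_irrefl)
    then obtain v where v: "v \<notin> span (S \<epsilon> m)" by blast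
    let ?S' = "insert v (S \<epsilon> m)"
    have i1: "independent ?S'" using v \<epsilon>(1) by (metis independent_insert span_base)
    have Mv: "M v \<notin> span ?S'"
    proof
      assume "M v \<in> span ?S'"
      then obtain a where a: "M v - a *\<^sub>R v \<in> span (S \<epsilon> m)" using span_breakdown_eq by blast
      have "M (M v - a *\<^sub>R v) \<in> span (S \<epsilon> m)" using inv[OF a] .
      then have "- v - a *\<^sub>R M v \<in> span (S \<epsilon> m)" by (simp add: blinfun.diff_right blinfun.scaleR_right M)
      then have "(- v - a *\<^sub>R M v) + a *\<^sub>R (M v - a *\<^sub>R v) \<in> span (S \<epsilon> m)" using a by (intro span_add span_scale)
      then have "(- (1 + a * a)) *\<^sub>R v \<in> span (S \<epsilon> m)" by (simp add: algebra_simps)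
      then have "(1 / (- (1 + a * a))) *\<^sub>R (- (1 + a * a)) *\<^sub>R v \<in> span (S \<epsilon> m)" by (rule span_scale)
      moreover have "1 + a * a > 0" by (simp add: add_pos_nonneg)
      ultimately show False using v by simp
    qed
    then have i2: "independent (insert (M v) ?S')" using i1 by (metis independent_insert span_base)
    let ?\<epsilon> = "\<epsilon>(m := v)"
    have "\<epsilon>(m := v) ` {..<m} = \<epsilon> ` {..<m}" "(\<lambda>k. M (?\<epsilon> k)) ` {..<m} = (\<lambda>k. M (\<epsilon> k)) ` {..<m}" by auto
    then have S': "S ?\<epsilon> (Suc m) = insert (M v) ?S'"
      unfolding S_def lessThan_Suc by auto
    have "finite (S \<epsilon> m)" by (simp add: S_def)
    moreover have "v \<notin> S \<epsilon> m" "M v \<notin> ?S'" using v Mv span_base by blast+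
    ultimately have "card (insert (M v) ?S') = 2 * Suc m" using \<epsilon>(2) by simp
    then show ?case using i2 S' by metis
  qed
  then obtain \<epsilon> where \<epsilon>: "independent (S \<epsilon> n)" "card (S \<epsilon> n) = 2 * n" by auto
  have fin: "finite (S \<epsilon> n)" by (simp add: S_def)
  have sp: "span (S \<epsilon> n) = UNIV"
    using \<epsilon> n by (metis card_eq_dim dim_UNIV fin subset_UNIV top.extremum_uniqueI)
  have cU: "card (\<epsilon> ` {..<n}) + card ((\<lambda>k. M (\<epsilon> k)) ` {..<n}) \<ge> 2 * n"
    using \<epsilon>(2) card_Un_le[of "\<epsilon> ` {..<n}" "(\<lambda>k. M (\<epsilon> k)) ` {..<n}"] by (simp add: S_def)
  have c1: "card (\<epsilon> ` {..<n}) \<le> n" "card ((\<lambda>k. M (\<epsilon> k)) ` {..<n}) \<le> n"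
    using card_image_le[of "{..<n}"] by (metis card_lessThan finite_lessThan)+
  have inj: "inj_on \<epsilon> {..<n}" by (rule eq_card_imp_inj_on) (use cU c1 in auto)
  have disj: "\<epsilon> l \<noteq> M (\<epsilon> k)" if "k < n" "l < n" for k l
  proof
    assume e: "\<epsilon> l = M (\<epsilon> k)"
    have "card (\<epsilon> ` {..<n} \<union> (\<lambda>k. M (\<epsilon> k)) ` {..<n}) + card (\<epsilon> ` {..<n} \<inter> (\<lambda>k. M (\<epsilon> k)) ` {..<n}) \<le> n + n"
      using c1 by (subst card_Un_Int[symmetric]) auto
    then have "card (\<epsilon> ` {..<n} \<inter> (\<lambda>k. M (\<epsilon> k)) ` {..<n}) = 0" using \<epsilon>(2) by (simp add: S_def)
    then have "\<epsilon> ` {..<n} \<inter> (\<lambda>k. M (\<epsilon> k)) ` {..<n} = {}" by simp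
    then show False using e that by blast
  qed
  have "\<exists>g. linear g \<and> (\<forall>v\<in>S \<epsilon> n. g v = (if v = \<epsilon> k then 1 else 0 :: real))" for k
    using linear_independent_extend[OF \<epsilon>(1), of "\<lambda>v. if v = \<epsilon> k then 1 else 0"] by blast
  then obtain g where g: "\<And>k. linear (g k)" "\<And>k v. v \<in> S \<epsilon> n \<Longrightarrow> g k v = (if v = \<epsilon> k then 1 else 0 :: real)"
    using choice[of "\<lambda>k g. linear g \<and> (\<forall>v\<in>S \<epsilon> n. g v = (if v = \<epsilon> k then 1 else 0 :: real))"] by blast
  define \<zeta> where "\<zeta> k = Blinfun (\<lambda>u. Complex (g k u) (- g k (M u)))" for k
  have \<zeta>: "\<zeta> k u = Complex (g k u) (- g k (M u))" for k u
  proof -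
    interpret linear "g k" by (rule g)
    have "linear (\<lambda>u. Complex (g k u) (- g k (M u)))"
      by standard (auto simp: complex_eq_iff add scale blinfun.add_right blinfun.scaleR_right)
    then show ?thesis unfolding \<zeta>_def by (simp add: bounded_linear_Blinfun_apply linear_conv_bounded_linear)
  qed
  have gm: "g k (- u) = - g k u" for k u using linear_neg[OF g(1)] by blast
  have z1: "\<zeta> k (M u) = \<i> * \<zeta> k u" for k u
    unfolding \<zeta> by (simp add: complex_eq_iff M gm)
  have z2: "\<zeta> k (\<epsilon> l) = (if k = l then 1 else 0)" if "k < n" "l < n" for k l
  proof -
    have "\<epsilon> l = \<epsilon> k \<longleftrightarrow> k = l" using inj that by (auto dest: inj_onD)
    moreover have "M (\<epsilon> l) \<noteq> \<epsilon> k" using disj[OF that(2,1)] by metis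
    moreover have "\<epsilon> l \<in> S \<epsilon> n" "M (\<epsilon> l) \<in> S \<epsilon> n" using that by (auto simp: S_def)
    ultimately show ?thesis unfolding \<zeta> using g(2) by (auto simp: complex_eq_iff)
  qed
  have z3: "u = (\<Sum>k<n. Re (\<zeta> k u) *\<^sub>R \<epsilon> k + Im (\<zeta> k u) *\<^sub>R M (\<epsilon> k))" for u
  proof -
    have l: "linear (\<lambda>u. \<Sum>k<n. Re (\<zeta> k u) *\<^sub>R \<epsilon> k + Im (\<zeta> k u) *\<^sub>R M (\<epsilon> k))"
      by standard (simp_all add: blinfun.add_right blinfun.scaleR_right scaleR_add_left sum.distrib
          scaleR_sum_right scaleR_add_right)
    have "u = (\<Sum>k<n. Re (\<zeta> k u) *\<^sub>R \<epsilon> k + Im (\<zeta> k u) *\<^sub>R M (\<epsilon> k))" if "u \<in> S \<epsilon> n" for u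
    proof -
      have "\<epsilon> l = (\<Sum>k<n. Re (\<zeta> k (\<epsilon> l)) *\<^sub>R \<epsilon> k + Im (\<zeta> k (\<epsilon> l)) *\<^sub>R M (\<epsilon> k))"
        "M (\<epsilon> l) = (\<Sum>k<n. Re (\<zeta> k (M (\<epsilon> l))) *\<^sub>R \<epsilon> k + Im (\<zeta> k (M (\<epsilon> l))) *\<^sub>R M (\<epsilon> k))" if "l < n" for l
      proof -
        have "(\<Sum>k<n. Re (\<zeta> k (\<epsilon> l)) *\<^sub>R \<epsilon> k + Im (\<zeta> k (\<epsilon> l)) *\<^sub>R M (\<epsilon> k)) = (\<Sum>k<n. if k = l then \<epsilon> k else 0)"
          by (rule sum.cong) (use that z2 in auto)
        then show "\<epsilon> l = (\<Sum>k<n. Re (\<zeta> k (\<epsilon> l)) *\<^sub>R \<epsilon> k + Im (\<zeta> k (\<epsilon> l)) *\<^sub>R M (\<epsilon> k))" using that by simp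
        have "(\<Sum>k<n. Re (\<zeta> k (M (\<epsilon> l))) *\<^sub>R \<epsilon> k + Im (\<zeta> k (M (\<epsilon> l))) *\<^sub>R M (\<epsilon> k)) = (\<Sum>k<n. if k = l then M (\<epsilon> k) else 0)"
          by (rule sum.cong) (use that z2 z1 in auto)
        then show "M (\<epsilon> l) = (\<Sum>k<n. Re (\<zeta> k (M (\<epsilon> l))) *\<^sub>R \<epsilon> k + Im (\<zeta> k (M (\<epsilon> l))) *\<^sub>R M (\<epsilon> k))" using that by simp
      qed
      then show ?thesis using that unfolding S_def by fast
    qed
    then show ?thesis using linear_eq_on_span[OF linear_id[unfolded id_def] l, of "S \<epsilon> n" u] sp by blast
  qed
  show thesis using that z1 z2 z3 by blast
qed

subsection \<open>The torsion of a graph\<close>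

text \<open>Let \<open>J0\<close> be a constant structure on the model space and \<open>K x\<close> antilinear for it. The
  (0,1)-space of the structure \<open>(1 + K x) J0 (1 + K x)\<^sup>-\<^sup>1\<close> is the graph spanned by the fields
  \<open>W\<^sub>u = (1 + K)(u + \<i> J0 u)\<close>, and \<open>[W\<^sub>u, W\<^sub>w] = \<tau> - \<i> J0 \<tau>\<close> with \<open>\<tau> = torsion J0 K x u w\<close>.\<close>

definition torsion :: "('e::euclidean_space \<Rightarrow>\<^sub>L 'e) \<Rightarrow> ('e \<Rightarrow> 'e \<Rightarrow>\<^sub>L 'e) \<Rightarrow> 'e \<Rightarrow> 'e \<Rightarrow> 'e \<Rightarrow> 'e" where
  "torsion J0 K x u w =
     blinfun_apply (frechet_derivative K (at x) (u + K x u)) w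
     - blinfun_apply (frechet_derivative K (at x) (J0 u + K x (J0 u))) (J0 w)
     - (blinfun_apply (frechet_derivative K (at x) (w + K x w)) u
     - blinfun_apply (frechet_derivative K (at x) (J0 w + K x (J0 w))) (J0 u))"

text \<open>\<open>M\<close> is the structure \<open>(1 + K) J0 (1 + K)\<^sup>-\<^sup>1\<close>, described without the inverse.\<close>

locale graph_rep =
  fixes J0 :: "'e::euclidean_space \<Rightarrow>\<^sub>L 'e" and K M :: "'e \<Rightarrow> 'e \<Rightarrow>\<^sub>L 'e" and T :: "'e set"
  assumes T: "open T" and K_smooth: "smooth_on T K" and J0_sq: "J0 (J0 u) = - u"
    and K_anti: "x \<in> T \<Longrightarrow> K x (J0 u) = - J0 (K x u)"
    and M_K: "x \<in> T \<Longrightarrow> M x (u + K x u) = J0 u + K x (J0 u)"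
    and K_inj: "x \<in> T \<Longrightarrow> u + K x u = 0 \<Longrightarrow> u = 0"
begin

abbreviation "DK x \<equiv> frechet_derivative K (at x)"

lemma DK_linear: "x \<in> T \<Longrightarrow> linear (DK x)"
  using smooth_on_has_derivative[OF K_smooth] has_derivative_linear by blast

lemma DK_simps:
  assumes "x \<in> T"
  shows "DK x (a + b) = DK x a + DK x b" "DK x (a - b) = DK x a - DK x b" "DK x (r *\<^sub>R a) = r *\<^sub>R DK x a"
    "DK x (- a) = - DK x a" "DK x 0 = 0"
  using DK_linear[OF assms] by (simp_all add: linear_add linear_diff linear_scale linear_neg linear_0)

lemma DK_anti:
  assumes "x \<in> T" shows "DK x \<xi> (J0 u) = - J0 (DK x \<xi> u)"
proof -
  have 1: "((\<lambda>y. K y (J0 u)) has_derivative (\<lambda>v. DK x v (J0 u))) (at x)"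
    by (rule has_derivative_blinfun_frechet[OF K_smooth assms])
  have "((\<lambda>y. - J0 (K y u)) has_derivative (\<lambda>v. - J0 (DK x v u))) (at x)"
    by (intro has_derivative_minus bounded_linear.has_derivative[OF blinfun.bounded_linear_right]
        has_derivative_blinfun_frechet[OF K_smooth assms])
  then have 2: "((\<lambda>y. K y (J0 u)) has_derivative (\<lambda>v. - J0 (DK x v u))) (at x)"
    by (rule has_derivative_transform_within_open[OF _ T assms]) (simp add: K_anti)
  show ?thesis using has_derivative_unique[OF 1 2] by (simp add: fun_eq_iff)
qed

lemma torsion_swap: "torsion J0 K x w u = - torsion J0 K x u w"
  by (simp add: torsion_def)

lemma torsion_linear:
  assumes "x \<in> T"
  shows "torsion J0 K x (a *\<^sub>R u + b *\<^sub>R u') w = a *\<^sub>R torsion J0 K x u w + b *\<^sub>R torsion J0 K x u' w"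
proof -
  have "(a *\<^sub>R u + b *\<^sub>R u') + K x (a *\<^sub>R u + b *\<^sub>R u') = a *\<^sub>R (u + K x u) + b *\<^sub>R (u' + K x u')"
    "J0 (a *\<^sub>R u + b *\<^sub>R u') + K x (J0 (a *\<^sub>R u + b *\<^sub>R u')) = a *\<^sub>R (J0 u + K x (J0 u)) + b *\<^sub>R (J0 u' + K x (J0 u'))"
    by (simp_all add: blinfun.add_right blinfun.scaleR_right scaleR_add_right)
  then show ?thesis unfolding torsion_def
    by (simp add: DK_simps[OF assms] blinfun.add_right blinfun.scaleR_right blinfun.add_left blinfun.scaleR_left
        scaleR_add_right scaleR_diff_right algebra_simps)
qed

lemma torsion_antilinear:
  assumes "x \<in> T" shows "torsion J0 K x (J0 u) w = - J0 (torsion J0 K x u w)"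
  unfolding torsion_def
  by (simp add: J0_sq DK_anti[OF assms] K_anti[OF assms] DK_simps[OF assms] blinfun.add_right blinfun.diff_right
      blinfun.minus_right blinfun.minus_left blinfun.add_left blinfun.diff_left)

lemma M_J0_inj:
  assumes "x \<in> T" "M x z + J0 z = 0" shows "z = 0"
proof -
  have "blinfun_invertible (id_blinfun + K x)"
    by (rule blinfun_invertibleI_injective, rule K_inj[OF assms(1)]) (simp only: blinfun.add_left id_blinfun.rep_eq id_apply)
  then obtain y where y: "z = y + K x y"
    using blinfun_inv(4) by (metis blinfun.add_left id_blinfun.rep_eq id_apply)
  have "M x z + J0 z = 2 *\<^sub>R J0 y"
    using M_K[OF assms(1), of y] by (simp add: y blinfun.add_right K_anti[OF assms(1)] scaleR_2)
  then have "J0 y = 0" using assms(2) by simp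
  then have "J0 (J0 y) = 0" by simp
  then show ?thesis using J0_sq[of y] y by simp
qed

lemma M_J0_surj: assumes "x \<in> T" obtains y where "z = M x y + J0 y"
proof -
  have "blinfun_invertible (M x + J0)"
    by (rule blinfun_invertibleI_injective, rule M_J0_inj[OF assms]) (simp only: blinfun.add_left)
  then show thesis using that[of "blinfun_inv (M x + J0) z"] blinfun_inv(4) by (metis blinfun.add_left)
qed

end

subsection \<open>Evaluation of the Nijenhuis tensor\<close>

context smooth_mfd
begin

lemma cext_ctvec:
  assumes J: "almost_complex_structure X A J" and c: "c \<in> A" "p \<in> fst c"
  shows "cext (J p) (ctvec A c p u w) = ctvec A c p (Jmat A c J (snd c p) u) (Jmat A c J (snd c p) w)"
  using acs_Jmat[OF J c] by (simp add: cext_def ctvec_def complex_eq_iff fun_eq_iff)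

lemma T01_ctvec:
  assumes J: "almost_complex_structure X A J" and c: "c \<in> A" "p \<in> fst c"
  shows "ctvec A c p u w \<in> T01 A J p \<longleftrightarrow> w = Jmat A c J (snd c p) u"
    "ctvec A c p u w \<in> T10 A J p \<longleftrightarrow> w = - Jmat A c J (snd c p) u"
proof -
  let ?M = "Jmat A c J (snd c p)"
  have sq: "?M (?M u) = - u" for u by (rule acs_Jmat_sq[OF J c(1)]) (use c in simp)
  have i: "(\<lambda>f. \<i> * ctvec A c p u w f) = ctvec A c p (- w) u" "(\<lambda>f. - \<i> * ctvec A c p u w f) = ctvec A c p w (- u)"
    by (auto simp: ctvec_def complex_eq_iff tvec_minus[OF c])
  have "?M u = w \<and> ?M w = - u \<longleftrightarrow> w = ?M u" using sq by auto
  then show "ctvec A c p u w \<in> T01 A J p \<longleftrightarrow> w = ?M u"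
    unfolding T01_def mem_Collect_eq cext_ctvec[OF J c] i ctvec_inj[OF c] using ctvec_in[OF c] by simp
  have "?M u = - w \<and> ?M w = u \<longleftrightarrow> w = - ?M u"
    using sq[of u] by (auto simp: blinfun.minus_right)
  then show "ctvec A c p u w \<in> T10 A J p \<longleftrightarrow> w = - ?M u"
    unfolding T10_def mem_Collect_eq cext_ctvec[OF J c] i ctvec_inj[OF c] using ctvec_in[OF c] by simp
qed

lemma A10_iff:
  assumes J: "almost_complex_structure X A J" and c: "c \<in> A" "p \<in> fst c" and a: "a \<in> ccotangent_space A p"
  shows "a \<in> A10 A J p \<longleftrightarrow> (\<forall>u. a (ctvec A c p (Jmat A c J (snd c p) u) 0) = \<i> * a (ctvec A c p u 0))"
proof -
  let ?M = "Jmat A c J (snd c p)"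
  have "a \<in> A10 A J p \<longleftrightarrow> (\<forall>u. a (ctvec A c p u (?M u)) = 0)"
  proof
    show "\<forall>u. a (ctvec A c p u (?M u)) = 0" if "a \<in> A10 A J p"
      using that T01_ctvec(1)[OF J c] unfolding A10_def by blast
    show "a \<in> A10 A J p" if h: "\<forall>u. a (ctvec A c p u (?M u)) = 0"
      unfolding A10_def
    proof (intro CollectI conjI a ballI)
      fix v assume v: "v \<in> T01 A J p"
      then have "v \<in> ctangent_space A p" by (simp add: T01_def)
      then obtain u w where "v = ctvec A c p u w" by (rule ctvec_ex[OF c])
      then show "a v = 0" using v h T01_ctvec(1)[OF J c] by simp
    qed
  qed
  also have "\<dots> \<longleftrightarrow> (\<forall>u. a (ctvec A c p (?M u) 0) = \<i> * a (ctvec A c p u 0))"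
  proof -
    have "a (ctvec A c p u (?M u)) = 0 \<longleftrightarrow> a (ctvec A c p (?M u) 0) = \<i> * a (ctvec A c p u 0)" for u
      unfolding form_ctvec[OF c a, of u "?M u"] by (auto simp: complex_eq_iff)
    then show ?thesis by simp
  qed
  finally show ?thesis .
qed

text \<open>A section \<open>\<alpha>\<close> of type (1,0) kills the fields \<open>W\<^sub>u\<close>, so \<open>d\<alpha>(W\<^sub>u, W\<^sub>w) = - \<alpha>([W\<^sub>u, W\<^sub>w])\<close>. In matrices: \<open>\<alpha>\<close> being of
  type (1,0) means that \<open>w \<mapsto> \<alpha>((1 + K) w)\<close> is complex linear for \<open>J0\<close>, and then so is its derivative \<open>L\<close>; hence \<open>L\<close> drops
  out and only the terms with the derivative of \<open>K\<close> survive.\<close>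

lemma ext_deriv_on_T01:
  assumes J: "almost_complex_structure X A J" and c: "c \<in> A" "p \<in> fst c"
    and T: "snd c p \<in> T" "T \<subseteq> cimg c" and g: "graph_rep J0 K (Jmat A c J) T"
    and \<alpha>: "cform1 X A \<alpha>" "\<And>x. x \<in> topspace X \<Longrightarrow> \<alpha> x \<in> A10 A J x"
  defines "x \<equiv> snd c p"
  shows "ext_deriv X A \<alpha> p (ctvec A c p (u + K x u) (J0 u + K x (J0 u))) (ctvec A c p (w + K x w) (J0 w + K x (J0 w))) =
     - \<alpha> p (ctvec A c p (torsion J0 K x u w) (- J0 (torsion J0 K x u w)))"
proof -
  interpret g: graph_rep J0 K "Jmat A c J" T by fact
  let ?a = "fmat A c \<alpha>" let ?D = "frechet_derivative ?a (at x)"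
  have x: "x \<in> T" using T by (simp add: x_def)
  have sa: "smooth_on T ?a" by (rule smooth_on_subset[OF fmat_smooth[OF \<alpha>(1) c(1)] T(2)])
  have cot: "\<alpha> q \<in> ccotangent_space A q" if "q \<in> fst c" for q
    using \<alpha>(1) chart_sub[OF c(1) that] unfolding cform1_def by blast
  have aJ: "?a y (Jmat A c J y u) = \<i> * ?a y u" if "y \<in> T" for y u
  proof -
    have q: "cinv c y \<in> fst c" "snd c (cinv c y) = y" using that T(2) by auto
    show ?thesis
      using A10_iff[OF J c(1) q(1) cot[OF q(1)]] \<alpha>(2)[OF chart_sub[OF c(1) q(1)]]
        fmat_apply(1)[where \<alpha> = \<alpha>, OF c(1) q(1) cot[OF q(1)]] q(2) by simp
  qed
  define L where "L \<xi> w = ?D \<xi> (w + K x w) + ?a x (g.DK x \<xi> w)" for \<xi> w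
  have hL: "((\<lambda>y. ?a y (w + K y w)) has_derivative (\<lambda>\<xi>. L \<xi> w)) (at x)" for w
  proof -
    have "((\<lambda>y. w + K y w) has_derivative (\<lambda>\<xi>. 0 + g.DK x \<xi> w)) (at x)"
      by (intro has_derivative_add has_derivative_const has_derivative_blinfun_frechet[OF g.K_smooth x])
    from bounded_bilinear.FDERIV[OF bounded_bilinear_blinfun_apply smooth_on_has_derivative[OF sa x] this]
    show ?thesis by (simp add: L_def add.commute)
  qed
  have LJ: "L \<xi> (J0 w) = \<i> * L \<xi> w" for \<xi> w
  proof -
    have "((\<lambda>y. \<i> * ?a y (w + K y w)) has_derivative (\<lambda>\<xi>. \<i> * L \<xi> w)) (at x)"
      by (intro has_derivative_mult_right hL)
    then have "((\<lambda>y. ?a y (J0 w + K y (J0 w))) has_derivative (\<lambda>\<xi>. \<i> * L \<xi> w)) (at x)"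
      by (rule has_derivative_transform_within_open[OF _ g.T x]) (simp add: aJ g.M_K[symmetric])
    from has_derivative_unique[OF hL this] show ?thesis by (simp add: fun_eq_iff)
  qed
  have D: "?D \<xi> (w + K x w) = L \<xi> w - ?a x (g.DK x \<xi> w)" for \<xi> w by (simp add: L_def)
  have "ext_deriv X A \<alpha> p (ctvec A c p (u + K x u) (J0 u + K x (J0 u))) (ctvec A c p (w + K x w) (J0 w + K x (J0 w))) =
     cbil (dform c \<alpha> x) (u + K x u) (J0 u + K x (J0 u)) (w + K x w) (J0 w + K x (J0 w))"
    unfolding x_def by (rule ext_deriv_ctvec[OF \<alpha>(1) c])
  also have "\<dots> = - (?a x (torsion J0 K x u w) - \<i> * ?a x (J0 (torsion J0 K x u w)))"
    unfolding cbil_def dform_def D LJ torsion_def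
    by (simp add: g.DK_anti[OF x] blinfun.add_right blinfun.diff_right blinfun.minus_right g.J0_sq algebra_simps)
  also have "\<dots> = - \<alpha> p (ctvec A c p (torsion J0 K x u w) (- J0 (torsion J0 K x u w)))"
    unfolding fmat_apply(2)[where \<alpha> = \<alpha>, OF c cot[OF c(2)]] x_def by (simp add: blinfun.minus_right)
  finally show ?thesis .
qed

text \<open>A (1,0)-covector at \<open>p\<close> is a real linear map to the complex numbers that intertwines the
  structure with multiplication by \<open>\<i>\<close>.\<close>

lemma A10_of_linear:
  fixes l :: "'e \<Rightarrow>\<^sub>L complex"
  assumes J: "almost_complex_structure X A J" and c: "c \<in> A" "p \<in> fst c"
    and l: "\<And>u. l (Jmat A c J (snd c p) u) = \<i> * l u"
  obtains a where "a \<in> A10 A J p" "\<And>u w. a (ctvec A c p u w) = l u + \<i> * l w"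
proof -
  define a where "a v = (if v \<in> ctangent_space A p then l (tcoord c p (\<lambda>f. Re (v f))) + \<i> * l (tcoord c p (\<lambda>f. Im (v f))) else 0)" for v
  have av: "a (ctvec A c p u w) = l u + \<i> * l w" for u w
    using ctvec_in[OF c] c by (simp add: a_def)
  have cot: "a \<in> ccotangent_space A p"
    unfolding ccotangent_space_def
  proof (intro CollectI conjI ballI allI impI)
    fix v w s t assume "v \<in> ctangent_space A p" "w \<in> ctangent_space A p"
    then obtain u1 u2 w1 w2 where vw: "v = ctvec A c p u1 u2" "w = ctvec A c p w1 w2"
      using ctvec_ex[OF c] by metis
    show "a (\<lambda>f. s * v f + t * w f) = s * a v + t * a w"
      unfolding vw ctvec_combination[OF c] av
      by (simp add: blinfun.add_right blinfun.diff_right blinfun.scaleR_right complex_eq_iff algebra_simps)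
  qed (simp add: a_def)
  have "a \<in> A10 A J p" unfolding A10_iff[OF J c cot] av using l by simp
  then show thesis using av that by blast
qed

text \<open>Every (1,0)-covector extends to a global section: transport it with constant coefficients
  in the chart, cut off, and project to type (1,0).\<close>

lemma extend_A10:
  assumes J: "almost_complex_structure X A J" and p: "p \<in> topspace X" and a: "a \<in> A10 A J p"
  obtains \<alpha> where "cform1 X A \<alpha>" "\<And>x. x \<in> topspace X \<Longrightarrow> \<alpha> x \<in> A10 A J x" "\<alpha> p = a"
proof -
  obtain c where c: "c \<in> A" "p \<in> fst c" using chart_cover[OF p] by blast
  have a': "a \<in> ccotangent_space A p" using a by (simp add: A10_def)
  define l where "l = Blinfun (\<lambda>u. a (ctvec A c p u 0))"
  have l: "a (ctvec A c p u 0) = l u" for u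
    using form_real_linear[OF c a'] by (simp add: l_def bounded_linear_Blinfun_apply)
  let ?M = "Jmat A c J"
  obtain R where R: "R > 0" "cball (snd c p) R \<subseteq> cimg c"
    using chart(2)[OF c(1)] cmap_in[OF c(2)] open_contains_cball by blast
  obtain \<rho> :: "'e \<Rightarrow> real" where \<rho>: "smooth_on UNIV \<rho>" "\<And>y. y \<in> cball (snd c p) (R/2) \<Longrightarrow> \<rho> y = 1"
    "\<And>y. y \<notin> ball (snd c p) R \<Longrightarrow> \<rho> y = 0"
    by (rule smooth_bump_ball[of "R/2" R "snd c p"]) (use R(1) in \<open>simp, simp, blast\<close>)
  define h where "h y u = l u - \<i> * l (?M y u)" for y u
  define \<alpha> where "\<alpha> q v = (if q \<in> fst c \<and> v \<in> ctangent_space A q then complex_of_real (\<rho> (snd c q) / 2) *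
      (h (snd c q) (tcoord c q (\<lambda>f. Re (v f))) + \<i> * h (snd c q) (tcoord c q (\<lambda>f. Im (v f)))) else 0)" for q v
  have \<alpha>v: "\<alpha> q (ctvec A c q u w) = complex_of_real (\<rho> (snd c q) / 2) * (h (snd c q) u + \<i> * h (snd c q) w)" if "q \<in> fst c" for q u w
    using that ctvec_in[OF c(1) that] c by (simp add: \<alpha>_def)
  have off: "\<alpha> q v = 0" if "q \<notin> fst c" for q v using that by (simp add: \<alpha>_def)
  have cot: "\<alpha> q \<in> ccotangent_space A q" for q
  proof (cases "q \<in> fst c")
    case True
    show ?thesis unfolding ccotangent_space_def
    proof (intro CollectI conjI ballI allI impI)
      fix v w s t assume "v \<in> ctangent_space A q" "w \<in> ctangent_space A q"
      then obtain u1 u2 w1 w2 where vw: "v = ctvec A c q u1 u2" "w = ctvec A c q w1 w2"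
        using ctvec_ex[OF c(1) True] by metis
      have hl: "h y (u + w) = h y u + h y w" "h y (u - w) = h y u - h y w" "h y (r *\<^sub>R u) = of_real r * h y u" for y u w r
        by (simp_all add: h_def blinfun.add_right blinfun.diff_right blinfun.scaleR_right scaleR_conv_of_real algebra_simps)
      have id: "r * ((of_real (Re s) * a1 - of_real (Im s) * a2 + of_real (Re t) * b1 - of_real (Im t) * b2) +
          \<i> * (of_real (Re s) * a2 + of_real (Im s) * a1 + of_real (Re t) * b2 + of_real (Im t) * b1)) =
          s * (r * (a1 + \<i> * a2)) + t * (r * (b1 + \<i> * b2))" for r a1 a2 b1 b2 :: complex
        by (subst (3) complex_eq[of s], subst (3) complex_eq[of t]) (simp add: algebra_simps)
      show "\<alpha> q (\<lambda>f. s * v f + t * w f) = s * \<alpha> q v + t * \<alpha> q w"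
        unfolding vw ctvec_combination[OF c(1) True] \<alpha>v[OF True] hl by (rule id)
    qed (simp add: \<alpha>_def)
  next
    case False
    then show ?thesis by (simp add: ccotangent_space_def off)
  qed
  have A10q: "\<alpha> q \<in> A10 A J q" for q
  proof (cases "q \<in> fst c")
    case True
    have sq: "?M (snd c q) (?M (snd c q) u) = - u" for u by (rule acs_Jmat_sq[OF J c(1)]) (use True in simp)
    show ?thesis
      unfolding A10_iff[OF J c(1) True cot] \<alpha>v[OF True] h_def by (simp add: sq blinfun.minus_right algebra_simps)
  next
    case False
    then show ?thesis using cot by (simp add: A10_def off)
  qed
  have form: "cform1 X A \<alpha>"
    unfolding cform1_def
  proof (intro conjI ballI allI impI cot)
    fix V assume "cvector_field X A V"
    note V = this[unfolded cvector_field_iff]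
    let ?V1 = "vcoord c (\<lambda>p f. Re (V p f))" and ?V2 = "vcoord c (\<lambda>p f. Im (V p f))"
    let ?h = "\<lambda>y. (1/2) *\<^sub>R ((l (?V1 y) - \<i> * l (?M y (?V1 y))) + \<i> * (l (?V2 y) - \<i> * l (?M y (?V2 y))))"
    note o = chart(2)[OF c(1)]
    have s: "smooth_on (cimg c) ?V1" "smooth_on (cimg c) ?V2" using V vcoord_smooth[OF _ c(1)] by blast+
    have "smooth_on (cimg c) ?h"
      by (intro smooth_on_scaleR smooth_on_const smooth_on_add smooth_on_diff smooth_on_mult smooth_on_blinfun_apply
          s acs_Jmat_smooth[OF J c(1)] o)
    then have sc: "smooth_fun A (cut c \<rho> ?h)"
      by (intro smooth_fun_cut[OF c(1) R(2) order_refl o \<rho>(1)] \<rho>(3))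
    show "smooth_fun A (\<lambda>p. \<alpha> p (V p))"
    proof (rule smooth_fun_cong[OF sc])
      fix q assume "q \<in> topspace X"
      show "\<alpha> q (V q) = cut c \<rho> ?h q"
      proof (cases "q \<in> fst c")
        case True
        have "V q = ctvec A c q (?V1 (snd c q)) (?V2 (snd c q))"
          using tvec_vcoord[OF conjunct1[OF V] c(1) True] tvec_vcoord[OF conjunct2[OF V] c(1) True] by (simp add: ctvec_def)
        then show ?thesis using \<alpha>v[OF True] True by (simp add: cut_def h_def scaleR_conv_of_real)
      qed (simp add: off cut_def)
    qed
  qed
  have "\<alpha> p v = a v" for v
  proof (cases "v \<in> ctangent_space A p")
    case True
    obtain u w where v: "v = ctvec A c p u w" using ctvec_ex[OF c True] by metis
    have lM: "l (?M (snd c p) u) = \<i> * l u" for u using A10_iff[OF J c a'] a l by simp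
    have "\<rho> (snd c p) = 1" using \<rho>(2)[of "snd c p"] R by simp
    then show ?thesis unfolding v \<alpha>v[OF c(2)] h_def lM form_ctvec[OF c a', of u w] l by (simp add: algebra_simps)
  next
    case False
    then show ?thesis using a' by (simp add: \<alpha>_def ccotangent_space_def)
  qed
  then show thesis using that form A10q by blast
qed

text \<open>The coordinate \<open>u\<close> of the (0,1)-part \<open>W\<^sub>u\<close> of a complex tangent vector.\<close>

definition part01 :: "('a, 'e) chart \<Rightarrow> 'a \<Rightarrow> ('e \<Rightarrow>\<^sub>L 'e) \<Rightarrow> ('e \<Rightarrow>\<^sub>L 'e) \<Rightarrow> 'a ctangent \<Rightarrow> 'e" where
  "part01 c p M K v = blinfun_inv (id_blinfun + K) ((1/2) *\<^sub>R (tcoord c p (\<lambda>f. Re (v f)) - M (tcoord c p (\<lambda>f. Im (v f)))))"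

text \<open>The 2-form \<open>(v, w) \<mapsto> - a([W\<^sub>y, W\<^sub>z])\<close>, where \<open>W\<^sub>y\<close> and \<open>W\<^sub>z\<close> are the (0,1)-parts of \<open>v\<close> and \<open>w\<close>.\<close>

definition nij_form :: "('a, 'e) chart \<Rightarrow> 'a \<Rightarrow> ('e \<Rightarrow>\<^sub>L 'e) \<Rightarrow> ('e \<Rightarrow> 'e \<Rightarrow>\<^sub>L 'e) \<Rightarrow> ('e \<Rightarrow>\<^sub>L 'e) \<Rightarrow> 'a form1 \<Rightarrow> 'a form2" where
  "nij_form c p J0 K M a v w = (if v \<in> ctangent_space A p \<and> w \<in> ctangent_space A p then
     - a (ctvec A c p (torsion J0 K (snd c p) (part01 c p M (K (snd c p)) v) (part01 c p M (K (snd c p)) w))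
       (- J0 (torsion J0 K (snd c p) (part01 c p M (K (snd c p)) v) (part01 c p M (K (snd c p)) w)))) else 0)"

end

text \<open>The \<open>b k\<close> are distinct by \<open>indep\<close>, so they form a basis of \<open>S\<close> with \<open>n\<close> elements.\<close>

lemma (in vector_space) dim_eq_family:
  fixes b :: "nat \<Rightarrow> 'b"
  assumes indep: "\<And>s k. (\<Sum>k<n. s k *s b k) = 0 \<Longrightarrow> k < n \<Longrightarrow> s k = 0"
    and sub: "\<And>k. k < n \<Longrightarrow> b k \<in> S" and gen: "\<And>y. y \<in> S \<Longrightarrow> \<exists>s. y = (\<Sum>k<n. s k *s b k)"
  shows "dim S = n"
proof -
  have inj: "inj_on b {..<n}"
  proof (rule inj_onI, rule ccontr)
    fix i j assume ij: "i \<in> {..<n}" "j \<in> {..<n}" "b i = b j" "i \<noteq> j"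
    let ?s = "\<lambda>k. if k = i then 1 else if k = j then -1 else 0"
    have "(\<Sum>k<n. ?s k *s b k) = (\<Sum>k<n. (if k = i then b i else 0) - (if k = j then b j else 0))"
      by (rule sum.cong) (use ij(4) in auto)
    also have "\<dots> = 0" using ij by (simp add: sum_subtractf)
    finally show False using indep[of ?s i] ij(1) by simp
  qed
  let ?B = "b ` {..<n}"
  have ind: "independent ?B"
  proof (rule independent_if_scalars_zero)
    fix f y assume s: "(\<Sum>y\<in>?B. f y *s y) = 0" and y: "y \<in> ?B"
    obtain k where k: "k < n" "y = b k" using y by auto
    have "(\<Sum>k<n. f (b k) *s b k) = 0" using s unfolding sum.reindex[OF inj] by simp
    from indep[OF this k(1)] show "f y = 0" unfolding k(2) .
  qed simp
  have "S \<subseteq> span ?B"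
  proof
    fix y assume "y \<in> S"
    then obtain s where "y = (\<Sum>k<n. s k *s b k)" using gen by blast
    then show "y \<in> span ?B" by (simp only:) (intro span_sum span_scale span_base imageI)
  qed
  moreover have "?B \<subseteq> span S" using sub by (auto intro: span_base)
  ultimately have "span ?B = span S" by (simp add: span_eq)
  then have "dim S = card ?B" using dim_eq_card ind by blast
  then show ?thesis using card_image[OF inj] by simp
qed

locale acs_graph = smooth_mfd X A + g: graph_rep J0 K "Jmat A c J" T
  for X :: "'a topology" and A :: "('a, 'e::euclidean_space) chart set" and J c p T J0 K +
  assumes J: "almost_complex_structure X A J" and c: "c \<in> A" "p \<in> fst c" and pT: "snd c p \<in> T" and TU: "T \<subseteq> cimg c"
begin

abbreviation "x \<equiv> snd c p"
abbreviation "Mx \<equiv> Jmat A c J x"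
abbreviation "\<pi> \<equiv> part01 c p Mx (K x)"
abbreviation "nf \<equiv> nij_form c p J0 K Mx"
abbreviation "\<tau> \<equiv> torsion J0 K x"
abbreviation "cv \<equiv> ctvec A c p"

lemma Mx_sq: "Mx (Mx u) = - u" by (rule acs_Jmat_sq[OF J c(1)]) (use c in simp)

lemma invertible: "blinfun_invertible (id_blinfun + K x)"
  by (rule blinfun_invertibleI_injective, rule g.K_inj[OF pT]) (simp only: blinfun.add_left id_blinfun.rep_eq id_apply)

lemma part01_graph: "\<pi> (cv (u + K x u) (J0 u + K x (J0 u))) = u"
proof -
  have "\<pi> (cv (u + K x u) (J0 u + K x (J0 u))) = blinfun_inv (id_blinfun + K x) ((1/2) *\<^sub>R (u + K x u - Mx (J0 u + K x (J0 u))))"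
    using c by (simp add: part01_def)
  also have "Mx (J0 u + K x (J0 u)) = - (u + K x u)"
    using g.M_K[OF pT, of u] Mx_sq by metis
  also have "(1/2) *\<^sub>R (y - - y) = y" for y :: 'e by (simp add: scaleR_2[symmetric])
  finally show ?thesis using blinfun_inv(3)[OF invertible, of u] by (simp add: blinfun.add_left)
qed

lemma T01_graph: "v \<in> T01 A J p \<longleftrightarrow> (\<exists>u. v = cv (u + K x u) (J0 u + K x (J0 u)))"
proof
  assume v: "v \<in> T01 A J p"
  then have "v \<in> ctangent_space A p" by (simp add: T01_def)
  then obtain y z where yz: "v = cv y z" by (rule ctvec_ex[OF c])
  let ?u = "blinfun_inv (id_blinfun + K x) y"
  have "y = ?u + K x ?u" using blinfun_inv(4)[OF invertible, of y] by (simp add: blinfun.add_left)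
  moreover have "z = Mx y" using v yz T01_ctvec(1)[OF J c] by simp
  ultimately show "\<exists>u. v = cv (u + K x u) (J0 u + K x (J0 u))" using g.M_K[OF pT, of ?u] yz by metis
next
  assume "\<exists>u. v = cv (u + K x u) (J0 u + K x (J0 u))"
  then show "v \<in> T01 A J p" using T01_ctvec(1)[OF J c] g.M_K[OF pT] by auto
qed

lemma part01_combination:
  assumes "v \<in> ctangent_space A p" "w \<in> ctangent_space A p"
  shows "\<pi> (\<lambda>f. a * v f + b * w f) = Re a *\<^sub>R \<pi> v - Im a *\<^sub>R J0 (\<pi> v) + Re b *\<^sub>R \<pi> w - Im b *\<^sub>R J0 (\<pi> w)"
proof -
  let ?I = "blinfun_inv (id_blinfun + K x)"
  have MI: "?I (Mx y) = J0 (?I y)" for y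
  proof -
    have "y = ?I y + K x (?I y)" using blinfun_inv(4)[OF invertible, of y] by (simp add: blinfun.add_left)
    then have "Mx y = J0 (?I y) + K x (J0 (?I y))" using g.M_K[OF pT, of "?I y"] by simp
    then show ?thesis using blinfun_inv(3)[OF invertible, of "J0 (?I y)"] by (simp add: blinfun.add_left)
  qed
  obtain v1 v2 where v: "v = cv v1 v2" by (rule ctvec_ex[OF c assms(1)])
  obtain w1 w2 where w: "w = cv w1 w2" by (rule ctvec_ex[OF c assms(2)])
  have pc: "\<pi> (cv y z) = ?I ((1/2) *\<^sub>R (y - Mx z))" for y z using c by (simp add: part01_def)
  show ?thesis
    unfolding v w ctvec_combination[OF c] pc
    by (simp add: MI[symmetric] Mx_sq blinfun.add_right blinfun.diff_right blinfun.scaleR_right blinfun.minus_right algebra_simps)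
qed

lemma nf_value: "v \<in> ctangent_space A p \<Longrightarrow> w \<in> ctangent_space A p \<Longrightarrow> nf a v w = - a (cv (\<tau> (\<pi> v) (\<pi> w)) (- J0 (\<tau> (\<pi> v) (\<pi> w))))"
  by (simp add: nij_form_def)

lemma nf_graph: "nf a (cv (u + K x u) (J0 u + K x (J0 u))) (cv (w + K x w) (J0 w + K x (J0 w))) = - a (cv (\<tau> u w) (- J0 (\<tau> u w)))"
  by (subst nf_value[OF ctvec_in[OF c] ctvec_in[OF c]]) (simp only: part01_graph)

lemma nf_linear_left:
  assumes a: "a \<in> ccotangent_space A p" and v: "v \<in> ctangent_space A p" "v' \<in> ctangent_space A p" and w: "w \<in> ctangent_space A p"
  shows "nf a (\<lambda>f. s * v f + t * v' f) w = s * nf a v w + t * nf a v' w"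
proof -
  let ?y = "\<tau> (\<pi> v) (\<pi> w)" and ?z = "\<tau> (\<pi> v') (\<pi> w)"
  have z0: "\<tau> (y - z) u = \<tau> y u - \<tau> z u" "\<tau> (y + z) u = \<tau> y u + \<tau> z u" "\<tau> (r *\<^sub>R y) u = r *\<^sub>R \<tau> y u" for y z u r
    using g.torsion_linear[OF pT, of 1 y "-1" z u] g.torsion_linear[OF pT, of 1 y 1 z u] g.torsion_linear[OF pT, of r y 0 z u] by simp_all
  have "\<tau> (\<pi> (\<lambda>f. s * v f + t * v' f)) (\<pi> w) = Re s *\<^sub>R ?y + Im s *\<^sub>R J0 ?y + Re t *\<^sub>R ?z + Im t *\<^sub>R J0 ?z"
    unfolding part01_combination[OF v] by (simp add: z0 g.torsion_antilinear[OF pT])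
  moreover have "cv (Re s *\<^sub>R ?y + Im s *\<^sub>R J0 ?y + Re t *\<^sub>R ?z + Im t *\<^sub>R J0 ?z)
      (- J0 (Re s *\<^sub>R ?y + Im s *\<^sub>R J0 ?y + Re t *\<^sub>R ?z + Im t *\<^sub>R J0 ?z)) =
      (\<lambda>f. s * cv ?y (- J0 ?y) f + t * cv ?z (- J0 ?z) f)"
    unfolding ctvec_combination[OF c] by (simp add: blinfun.add_right blinfun.scaleR_right g.J0_sq algebra_simps)
  ultimately show ?thesis
    using nf_value[OF ctangent_combination[OF chart_sub[OF c] v] w, of a s t] nf_value[OF v(1) w, of a] nf_value[OF v(2) w, of a]
      form_combination[OF a ctvec_in[OF c] ctvec_in[OF c]] by simp
qed

lemma nf_swap:
  assumes a: "a \<in> ccotangent_space A p"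
  shows "nf a v w = - nf a w v"
proof (cases "v \<in> ctangent_space A p \<and> w \<in> ctangent_space A p")
  case True
  have "a (cv (- y) (- J0 (- y))) = - a (cv y (- J0 y))" for y
    using form_combination[OF a ctvec_in[OF c] ctvec_in[OF c], of "-1" y "- J0 y" 0 y y]
      ctvec_combination[OF c, of "-1" y "- J0 y" 0 y y] by (simp add: blinfun.minus_right)
  then show ?thesis
    using True nf_value[of v w a] nf_value[of w v a] g.torsion_swap[of x "\<pi> w" "\<pi> v"] by simp
qed (auto simp: nij_form_def)

lemma nf_zero_left: "v \<notin> ctangent_space A p \<Longrightarrow> nf a v w = 0" by (simp add: nij_form_def)

lemma nf_A02:
  assumes a: "a \<in> ccotangent_space A p" shows "nf a \<in> A02 A J p"
proof -
  have left: "(\<lambda>v. nf a v w) \<in> ccotangent_space A p" for w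
  proof (cases "w \<in> ctangent_space A p")
    case True
    then show ?thesis unfolding ccotangent_space_def using nf_linear_left[OF a] nf_zero_left by blast
  qed (simp add: nij_form_def ccotangent_space_def)
  have neg: "(\<lambda>v. - f v) \<in> ccotangent_space A p" if "f \<in> ccotangent_space A p" for f
    using that unfolding ccotangent_space_def by auto
  have right: "nf a v \<in> ccotangent_space A p" for v
    using neg[OF left[of v]] nf_swap[OF a, of v] by (metis (no_types, lifting) ext)
  have "nf a v w = 0" if v: "v \<in> T10 A J p" for v w
  proof (cases "w \<in> ctangent_space A p")
    case True
    have "v \<in> ctangent_space A p" using v by (simp add: T10_def)
    then obtain y z where yz: "v = cv y z" by (rule ctvec_ex[OF c])
    then have "z = - Mx y" using v T01_ctvec(2)[OF J c] by simp
    then have p0: "\<pi> v = 0" using c by (simp add: yz part01_def blinfun.minus_right Mx_sq)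
    have "\<tau> 0 u = 0" for u using g.torsion_linear[OF pT, of 0 0 0 0 u] by simp
    moreover have "a (cv 0 0) = 0"
      using form_combination[OF a ctvec_in[OF c] ctvec_in[OF c], of 0 0 0 0 0 0] ctvec_combination[OF c, of 0 0 0 0 0 0] by simp
    ultimately show ?thesis using nf_value[OF _ True, of v a] v p0 by (simp add: T10_def)
  next
    case False then show ?thesis by (simp add: nij_form_def)
  qed
  moreover have "nf a v v = 0" for v using nf_swap[OF a, of v v] by simp
  ultimately show ?thesis unfolding A02_def using left right by blast
qed

text \<open>Every complex tangent vector is the sum of a (1,0)-vector, on which such forms vanish, and a (0,1)-vector.\<close>

lemma A02_unique:
  assumes \<eta>: "\<eta> \<in> A02 A J p" and \<theta>: "\<theta> \<in> A02 A J p"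
    and eq: "\<And>v w. v \<in> T01 A J p \<Longrightarrow> w \<in> T01 A J p \<Longrightarrow> \<eta> v w = \<theta> v w"
  shows "\<eta> = \<theta>"
proof -
  have split: "\<exists>v1 v0. v1 \<in> T10 A J p \<and> v0 \<in> T01 A J p \<and> v = (\<lambda>f. 1 * v1 f + 1 * v0 f)" if v: "v \<in> ctangent_space A p" for v
  proof -
    obtain y z where yz: "v = cv y z" by (rule ctvec_ex[OF c v])
    let ?r = "(1/2) *\<^sub>R (y + Mx z)" and ?s = "(1/2) *\<^sub>R (y - Mx z)"
    have h: "(1/2) *\<^sub>R u + (1/2) *\<^sub>R u = u" for u :: 'e by (metis scaleR_half_double scaleR_add_right)
    have e1: "?r + ?s = y" using h[of y] by (simp add: scaleR_add_right scaleR_diff_right)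
    have "- Mx ?r + Mx ?s = (1/2) *\<^sub>R z + (1/2) *\<^sub>R z"
      by (simp add: blinfun.scaleR_right blinfun.add_right blinfun.diff_right Mx_sq scaleR_add_right scaleR_diff_right)
    then have e2: "- Mx ?r + Mx ?s = z" using h by simp
    have "v = (\<lambda>f. 1 * cv ?r (- Mx ?r) f + 1 * cv ?s (Mx ?s) f)"
      unfolding ctvec_combination[OF c] yz using e1 e2 by simp
    moreover have "cv ?r (- Mx ?r) \<in> T10 A J p" "cv ?s (Mx ?s) \<in> T01 A J p" using T01_ctvec[OF J c] by simp_all
    ultimately show ?thesis by blast
  qed
  have key: "\<eta> v w = \<eta> v0 w0" if "\<eta> \<in> A02 A J p" and "v1 \<in> T10 A J p" "v0 \<in> T01 A J p" "v = (\<lambda>f. 1 * v1 f + 1 * v0 f)"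
    and "w1 \<in> T10 A J p" "w0 \<in> T01 A J p" "w = (\<lambda>f. 1 * w1 f + 1 * w0 f)" for \<eta> v w v0 v1 w0 w1
  proof -
    have e: "\<And>v. \<eta> v \<in> ccotangent_space A p" "\<And>w. (\<lambda>v. \<eta> v w) \<in> ccotangent_space A p" "\<And>v. \<eta> v v = 0" "\<And>v w. v \<in> T10 A J p \<Longrightarrow> \<eta> v w = 0"
      using that(1) unfolding A02_def by blast+
    have ct: "v1 \<in> ctangent_space A p" "v0 \<in> ctangent_space A p" "w1 \<in> ctangent_space A p" "w0 \<in> ctangent_space A p"
      using that by (auto simp: T10_def T01_def)
    have lin: "\<eta> (\<lambda>f. 1 * y f + 1 * z f) u = \<eta> y u + \<eta> z u" "\<eta> u (\<lambda>f. 1 * y f + 1 * z f) = \<eta> u y + \<eta> u z"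
      if "y \<in> ctangent_space A p" "z \<in> ctangent_space A p" for y z u
      using form_combination[OF e(2)[of u] that, of 1 1] form_combination[OF e(1)[of u] that, of 1 1] by simp_all
    have "\<eta> v0 w1 = 0"
      using lin(1)[OF ct(2,3), of "\<lambda>f. 1 * v0 f + 1 * w1 f"] lin(2)[OF ct(2,3)] e(3) e(4)[OF that(5)] by simp
    then show ?thesis unfolding that(4,7) lin(1)[OF ct(1,2)] lin(2)[OF ct(3,4)] using e(4)[OF that(2)] by simp
  qed
  have "\<eta> v w = \<theta> v w" for v w
  proof (cases "v \<in> ctangent_space A p \<and> w \<in> ctangent_space A p")
    case True
    obtain v1 v0 where v: "v1 \<in> T10 A J p" "v0 \<in> T01 A J p" "v = (\<lambda>f. 1 * v1 f + 1 * v0 f)" using split True by blast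
    obtain w1 w0 where w: "w1 \<in> T10 A J p" "w0 \<in> T01 A J p" "w = (\<lambda>f. 1 * w1 f + 1 * w0 f)" using split True by blast
    show ?thesis using key[OF \<eta> v w] key[OF \<theta> v w] eq[OF v(2) w(2)] by simp
  next
    case False
    have z: "\<eta> v w = 0" if "\<eta> \<in> A02 A J p" for \<eta>
    proof -
      have e: "\<eta> v \<in> ccotangent_space A p" "(\<lambda>v. \<eta> v w) \<in> ccotangent_space A p" using that unfolding A02_def by blast+
      show ?thesis using e False unfolding ccotangent_space_def by blast
    qed
    show ?thesis using z[OF \<eta>] z[OF \<theta>] by simp
  qed
  then show ?thesis by (intro ext)
qed

text \<open>\<open>ext_deriv_on_T01\<close> computes \<open>d\<alpha>\<close> on (0,1)-vectors from \<open>\<alpha> p\<close> alone, so \<open>nf a\<close> is the (0,2)-part of \<open>d\<alpha>\<close> for every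
  extension \<open>\<alpha>\<close> of \<open>a\<close>; and an extension exists.\<close>

lemma nijenhuis_eq:
  assumes a: "a \<in> A10 A J p" shows "nijenhuis X A J p a = nf a"
proof -
  have a': "a \<in> ccotangent_space A p" using a by (simp add: A10_def)
  have pr: "pr02 A J p (ext_deriv X A \<alpha> p) = nf a"
    if \<alpha>: "cform1 X A \<alpha>" "\<forall>x\<in>topspace X. \<alpha> x \<in> A10 A J x" "\<alpha> p = a" for \<alpha>
  proof -
    have val: "nf a v w = ext_deriv X A \<alpha> p v w" if vw: "v \<in> T01 A J p" "w \<in> T01 A J p" for v w
    proof -
      obtain y z where yz: "v = cv (y + K x y) (J0 y + K x (J0 y))" "w = cv (z + K x z) (J0 z + K x (J0 z))"
        using vw T01_graph by blast
      show ?thesis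
        unfolding yz nf_graph using ext_deriv_on_T01[OF J c pT TU g.graph_rep_axioms \<alpha>(1), of y z] \<alpha>(2,3) by simp
    qed
    show ?thesis unfolding pr02_def
    proof (rule the_equality)
      show "nf a \<in> A02 A J p \<and> (\<forall>v\<in>T01 A J p. \<forall>w\<in>T01 A J p. nf a v w = ext_deriv X A \<alpha> p v w)"
        using nf_A02[OF a'] val by blast
      show "\<eta> = nf a" if "\<eta> \<in> A02 A J p \<and> (\<forall>v\<in>T01 A J p. \<forall>w\<in>T01 A J p. \<eta> v w = ext_deriv X A \<alpha> p v w)" for \<eta>
        using A02_unique[of \<eta> "nf a"] that nf_A02[OF a'] val by simp
    qed
  qed
  obtain \<alpha> where \<alpha>: "cform1 X A \<alpha>" "\<And>x. x \<in> topspace X \<Longrightarrow> \<alpha> x \<in> A10 A J x" "\<alpha> p = a"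
    by (rule extend_A10[OF J chart_sub[OF c] a]) (rule that)
  show ?thesis unfolding nijenhuis_def
  proof (rule the_equality)
    show "\<forall>\<alpha>. cform1 X A \<alpha> \<longrightarrow> (\<forall>x\<in>topspace X. \<alpha> x \<in> A10 A J x) \<longrightarrow> \<alpha> p = a \<longrightarrow> nf a = pr02 A J p (ext_deriv X A \<alpha> p)"
      using pr by simp
    fix \<omega> assume "\<forall>\<alpha>. cform1 X A \<alpha> \<longrightarrow> (\<forall>x\<in>topspace X. \<alpha> x \<in> A10 A J x) \<longrightarrow> \<alpha> p = a \<longrightarrow> \<omega> = pr02 A J p (ext_deriv X A \<alpha> p)"
    then show "\<omega> = nf a" using \<alpha> pr[of \<alpha>] by blast
  qed
qed

text \<open>If all (1,0)-covectors killed the vector \<open>t - \<i> J0 t\<close> with \<open>t = \<tau> u w\<close>, then \<open>M t + J0 t\<close> would vanish, but \<open>M + J0\<close> is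
  injective.\<close>

lemma nijenhuis_nonzero:
  assumes "\<tau> u w \<noteq> 0" shows "\<exists>a\<in>A10 A J p. nijenhuis X A J p a \<noteq> 0"
proof (rule ccontr)
  assume "\<not> ?thesis"
  then have 0: "nf a = (\<lambda>v w. 0)" if "a \<in> A10 A J p" for a using nijenhuis_eq[OF that] that by (auto simp: zero_fun_def)
  let ?t = "\<tau> u w"
  have "y \<bullet> (Mx ?t + J0 ?t) = 0" for y
  proof -
    define l where "l = Blinfun (\<lambda>u. Complex (y \<bullet> u) (- (y \<bullet> Mx u)))"
    have l: "l u = Complex (y \<bullet> u) (- (y \<bullet> Mx u))" for u
    proof -
      have "linear (\<lambda>u. Complex (y \<bullet> u) (- (y \<bullet> Mx u)))"
        by standard (auto simp: complex_eq_iff inner_add_right blinfun.add_right blinfun.scaleR_right)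
      then show ?thesis unfolding l_def by (simp add: bounded_linear_Blinfun_apply linear_conv_bounded_linear)
    qed
    have lM: "l (Mx u) = \<i> * l u" for u unfolding l by (simp add: Mx_sq complex_eq_iff)
    obtain a where a: "a \<in> A10 A J p" "\<And>u w. a (cv u w) = l u + \<i> * l w" by (rule A10_of_linear[OF J c lM]) (rule that)
    have "a (cv ?t (- J0 ?t)) = 0" using nf_graph[of a u w] 0[OF a(1)] by simp
    then have "Im (l ?t + \<i> * l (- J0 ?t)) = 0" using a(2) by simp
    then show ?thesis unfolding l by (simp add: inner_add_right)
  qed
  then have "Mx ?t + J0 ?t = 0" by (metis inner_eq_zero_iff)
  then show False using g.M_J0_inj[OF pT] assms by blast
qed

text \<open>Rank \<open>n\<close> means that \<open>a \<mapsto> nf a\<close> is injective on the \<open>n\<close>-dimensional space of (1,0)-covectors. A covector in the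
  kernel restricts to a form \<open>u \<mapsto> a(u - \<i> J0 u)\<close> that is complex linear for \<open>J0\<close> and kills all values of \<open>\<tau>\<close>, so it vanishes
  when these values span; and \<open>u \<mapsto> u - \<i> J0 u\<close> loses nothing because \<open>M + J0\<close> is onto.\<close>

lemma nijenhuis_rank:
  assumes n: "DIM('e) = 2 * n"
    and spans: "\<And>(l :: 'e \<Rightarrow>\<^sub>L complex) v. (\<And>u. l (J0 u) = \<i> * l u) \<Longrightarrow> (\<And>u w. l (\<tau> u w) = 0) \<Longrightarrow> l v = 0"
  shows "nijenhuis_rank X A J p = n"
proof -
  interpret V: vector_space form2_scale by (rule vector_space_form2)
  obtain \<zeta> :: "nat \<Rightarrow> 'e \<Rightarrow>\<^sub>L complex" and \<epsilon> where z: "\<And>k u. \<zeta> k (Mx u) = \<i> * \<zeta> k u"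
    "\<And>k l. k < n \<Longrightarrow> l < n \<Longrightarrow> \<zeta> k (\<epsilon> l) = (if k = l then 1 else 0)"
    "\<And>u. u = (\<Sum>k<n. Re (\<zeta> k u) *\<^sub>R \<epsilon> k + Im (\<zeta> k u) *\<^sub>R Mx (\<epsilon> k))"
    by (rule complex_basis[OF Mx_sq n]) (rule that)
  have "\<exists>a. a \<in> A10 A J p \<and> (\<forall>u w. a (cv u w) = \<zeta> k u + \<i> * \<zeta> k w)" for k
    by (rule A10_of_linear[OF J c z(1)]) blast
  then obtain b where b: "\<And>k. b k \<in> A10 A J p" "\<And>k u w. b k (cv u w) = \<zeta> k u + \<i> * \<zeta> k w" by metis
  have nf_eq: "nf a v w = (\<Sum>k<n. s k * nf (b k) v w)" if "\<And>y z. a (cv y z) = (\<Sum>k<n. s k * b k (cv y z))" for a s v w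
    by (cases "v \<in> ctangent_space A p \<and> w \<in> ctangent_space A p") (auto simp: nij_form_def that sum_negf)
  let ?B = "(\<lambda>k. nf (b k)) ` {..<n}"
  have sum_form: "(\<Sum>k<n. form2_scale (s k) (nf (b k))) = (\<lambda>v w. \<Sum>k<n. s k * nf (b k) v w)" for s
    by (induction n) (auto simp: fun_eq_iff)
  have indep: "s k = 0" if zero: "(\<Sum>k<n. form2_scale (s k) (nf (b k))) = 0" and k: "k < n" for s k
  proof -
    have bl: "bounded_linear (\<lambda>u. \<Sum>k<n. s k * (\<zeta> k u - \<i> * \<zeta> k (J0 u)))"
      by (intro bounded_linear_sum bounded_linear_const_mult bounded_linear_sub blinfun.bounded_linear_right
          bounded_linear_compose[OF blinfun.bounded_linear_right blinfun.bounded_linear_right, unfolded o_def])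
    define l where "l = Blinfun (\<lambda>u. \<Sum>k<n. s k * (\<zeta> k u - \<i> * \<zeta> k (J0 u)))"
    have l: "l u = (\<Sum>k<n. s k * (\<zeta> k u - \<i> * \<zeta> k (J0 u)))" for u
      unfolding l_def using bl by (simp add: bounded_linear_Blinfun_apply)
    have l0: "l v = 0" for v
    proof (rule spans)
      show "l (J0 u) = \<i> * l u" for u
        unfolding l by (simp add: g.J0_sq blinfun.minus_right sum_distrib_left algebra_simps)
      show "l (\<tau> u w) = 0" for u w
      proof -
        have "(\<Sum>k<n. s k * nf (b k) (cv (u + K x u) (J0 u + K x (J0 u))) (cv (w + K x w) (J0 w + K x (J0 w)))) = 0"
          using fun_cong[OF fun_cong[OF zero[unfolded sum_form]]] by (simp add: zero_fun_def)
        then have "(\<Sum>k<n. s k * - (\<zeta> k (\<tau> u w) + \<i> * \<zeta> k (- J0 (\<tau> u w)))) = 0" unfolding nf_graph b(2) .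
        moreover have "- l (\<tau> u w) = (\<Sum>k<n. s k * - (\<zeta> k (\<tau> u w) + \<i> * \<zeta> k (- J0 (\<tau> u w))))"
          unfolding l sum_negf[symmetric] by (rule sum.cong) (simp_all add: blinfun.minus_right algebra_simps)
        ultimately have "- l (\<tau> u w) = 0" by simp
        then show ?thesis by simp
      qed
    qed
    define m where "m u = (\<Sum>k<n. s k * \<zeta> k u)" for u
    have mM: "m (Mx u) = \<i> * m u" for u unfolding m_def z(1) by (simp add: sum_distrib_left algebra_simps)
    have mJ: "m (J0 u) = - \<i> * m u" for u
    proof -
      have "l u = m u - \<i> * m (J0 u)" unfolding l m_def by (simp add: sum_distrib_left sum_subtractf algebra_simps)
      then have "m u = \<i> * m (J0 u)" using l0[of u] by simp
      then show ?thesis by simp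
    qed
    have m_add: "m (u + w) = m u + m w" for u w unfolding m_def by (simp add: blinfun.add_right sum.distrib algebra_simps)
    obtain y where y: "\<epsilon> k = Mx y + J0 y" by (rule g.M_J0_surj[OF pT])
    have "m (\<epsilon> k) = 0" unfolding y m_add mM mJ by simp
    moreover have "m (\<epsilon> k) = (\<Sum>j<n. if j = k then s j else 0)" unfolding m_def by (rule sum.cong) (use z(2) k in auto)
    ultimately show ?thesis using k by simp
  qed
  have "V.dim (nijenhuis X A J p ` A10 A J p) = n"
  proof (rule V.dim_eq_family[where b = "\<lambda>k. nf (b k)"])
    show "s k = 0" if "(\<Sum>k<n. form2_scale (s k) (nf (b k))) = 0" "k < n" for s k by (rule indep[OF that])
    show "nf (b k) \<in> nijenhuis X A J p ` A10 A J p" for k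
      using imageI[OF b(1)[of k], of "nijenhuis X A J p"] unfolding nijenhuis_eq[OF b(1)] .
    show "\<exists>s. y = (\<Sum>k<n. form2_scale (s k) (nf (b k)))" if y: "y \<in> nijenhuis X A J p ` A10 A J p" for y
    proof -
      obtain a where a2: "y = nijenhuis X A J p a" and a1: "a \<in> A10 A J p" by (rule imageE[OF y])
      have a': "a \<in> ccotangent_space A p" using a1 by (simp add: A10_def)
      let ?a = "\<lambda>u. a (cv u 0)"
      interpret aL: bounded_linear ?a by (rule form_real_linear[OF c a'])
      have aM: "?a (Mx u) = \<i> * ?a u" for u using A10_iff[OF J c a'] a1 by blast
      have au: "?a u = (\<Sum>k<n. ?a (\<epsilon> k) * \<zeta> k u)" for u
      proof -
        have "?a u = ?a (\<Sum>k<n. Re (\<zeta> k u) *\<^sub>R \<epsilon> k + Im (\<zeta> k u) *\<^sub>R Mx (\<epsilon> k))" using z(3)[of u] by simp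
        also have "\<dots> = (\<Sum>k<n. Re (\<zeta> k u) *\<^sub>R ?a (\<epsilon> k) + Im (\<zeta> k u) *\<^sub>R (\<i> * ?a (\<epsilon> k)))"
          by (simp add: aL.sum aL.add aL.scaleR aM)
        also have "\<dots> = (\<Sum>k<n. ?a (\<epsilon> k) * \<zeta> k u)"
          by (rule sum.cong) (simp_all add: complex_eq_iff)
        finally show ?thesis .
      qed
      have "a (cv y z) = (\<Sum>k<n. ?a (\<epsilon> k) * b k (cv y z))" for y z
        unfolding form_ctvec[OF c a', of y z] b(2) au[of y] au[of z] by (simp add: sum_distrib_left sum.distrib algebra_simps)
      from nf_eq[OF this] have "nf a = (\<Sum>k<n. form2_scale (?a (\<epsilon> k)) (nf (b k)))" unfolding sum_form by (intro ext)
      then show ?thesis unfolding a2 nijenhuis_eq[OF a1] by (rule exI[of _ "\<lambda>k. ?a (\<epsilon> k)"])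
    qed
  qed
  then show ?thesis unfolding nijenhuis_rank_def .
qed

end

section \<open>Structures near a constant one\<close>

text \<open>The Cayley transform: \<open>cay J0 M\<close> is the antilinear \<open>K\<close> with \<open>M = (1 + K) J0 (1 + K)\<^sup>-\<^sup>1\<close>.\<close>

definition cay :: "('e::euclidean_space \<Rightarrow>\<^sub>L 'e) \<Rightarrow> ('e \<Rightarrow>\<^sub>L 'e) \<Rightarrow> 'e \<Rightarrow>\<^sub>L 'e" where
  "cay J0 M = blinfun_inv (M + J0) o\<^sub>L (J0 - M)"

definition conj_acs :: "('e::euclidean_space \<Rightarrow>\<^sub>L 'e) \<Rightarrow> ('e \<Rightarrow>\<^sub>L 'e) \<Rightarrow> 'e \<Rightarrow>\<^sub>L 'e" where
  "conj_acs J0 K = (id_blinfun + K) o\<^sub>L J0 o\<^sub>L blinfun_inv (id_blinfun + K)"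

text \<open>Everything follows from \<open>2 y = J0 (M - J0) y - J0 (M + J0) y\<close>: it makes \<open>M + J0\<close> injective when \<open>M\<close> is close to \<open>J0\<close>,
  and bounds the solution \<open>y\<close> of \<open>(M + J0) y = (J0 - M) u\<close>.\<close>

lemma cay:
  fixes J0 M :: "'e::euclidean_space \<Rightarrow>\<^sub>L 'e"
  assumes J0: "\<And>u. J0 (J0 u) = - u" and M: "\<And>u. M (M u) = - u" and r: "norm J0 * norm (M - J0) \<le> r" "r < 1"
  shows "blinfun_invertible (M + J0)" "norm (cay J0 M) \<le> r" "cay J0 M (J0 u) = - J0 (cay J0 M u)"
    "M (u + cay J0 M u) = J0 u + cay J0 M (J0 u)"
proof -
  have r0: "r \<ge> 0" using r(1) by (meson mult_nonneg_nonneg norm_ge_zero order_trans)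
  have small: "norm (J0 ((M - J0) y)) \<le> r * norm y" for y
  proof -
    have "norm (J0 ((M - J0) y)) \<le> norm J0 * (norm (M - J0) * norm y)"
      by (meson norm_blinfun order_trans mult_left_mono norm_ge_zero)
    also have "\<dots> \<le> r * norm y" using mult_right_mono[OF r(1) norm_ge_zero[of y]] by (simp add: mult.assoc)
    finally show ?thesis .
  qed
  have two: "2 *\<^sub>R y = J0 ((M - J0) y) - J0 ((M + J0) y)" for y
    by (simp add: blinfun.diff_left blinfun.add_left blinfun.diff_right blinfun.add_right J0 scaleR_2)
  have inj: "y = 0" if "(M + J0) y = 0" for y
  proof -
    have "2 * norm y = norm (J0 ((M - J0) y))" using two[of y] that by (metis blinfun.zero_right diff_zero norm_scaleR abs_numeral)
    then have "(2 - r) * norm y \<le> 0" using small[of y] by (simp add: algebra_simps)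
    then show "y = 0" using r(2) by (simp add: mult_le_0_iff)
  qed
  show inv: "blinfun_invertible (M + J0)" by (rule blinfun_invertibleI_injective[OF inj])
  have eq: "(M + J0) (cay J0 M u) = J0 u - M u" for u
    by (simp add: cay_def blinfun_inv(4)[OF inv] blinfun.diff_left)
  show "norm (cay J0 M) \<le> r"
  proof (rule norm_blinfun_bound[OF r0])
    fix u
    let ?y = "cay J0 M u"
    have h: "2 *\<^sub>R ?y = J0 ((M - J0) ?y) + J0 ((M - J0) u)"
      using two[of ?y] eq[of u] by (simp add: blinfun.diff_left blinfun.diff_right)
    have "2 * norm ?y = norm (2 *\<^sub>R ?y)" by simp
    also have "\<dots> \<le> norm (J0 ((M - J0) ?y)) + norm (J0 ((M - J0) u))" unfolding h by (rule norm_triangle_ineq)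
    finally have "2 * norm ?y \<le> r * norm ?y + r * norm u" using small[of ?y] small[of u] by linarith
    moreover have "r * norm ?y \<le> 1 * norm ?y" using r(2) by (intro mult_right_mono) auto
    ultimately show "norm ?y \<le> r * norm u" by simp
  qed
  show anti: "cay J0 M (J0 u) = - J0 (cay J0 M u)" for u
  proof -
    have "(M + J0) (cay J0 M (J0 u) + J0 (cay J0 M u)) = (J0 (J0 u) - M (J0 u)) + M ((M + J0) (cay J0 M u))"
      using eq[of "J0 u"] by (simp add: blinfun.add_right blinfun.add_left J0 M)
    also have "\<dots> = 0" unfolding eq by (simp add: blinfun.diff_right J0 M)
    finally show ?thesis using inj by (simp add: eq_neg_iff_add_eq_0)
  qed
  show "M (u + cay J0 M u) = J0 u + cay J0 M (J0 u)"
    unfolding anti using eq[of u] by (simp add: blinfun.add_left blinfun.add_right algebra_simps)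
qed

lemma invertible_one_plus_cay_inj:
  fixes K :: "'e::euclidean_space \<Rightarrow>\<^sub>L 'e"
  assumes "norm K < 1" "u + K u = 0" shows "u = 0"
  using blinfun_invertible_injective[OF blinfun_invertible_one_plus[OF assms(1)], of u] assms(2)
  by (simp add: blinfun.add_left)

lemma conj_acs:
  fixes J0 K :: "'e::euclidean_space \<Rightarrow>\<^sub>L 'e"
  assumes J0: "\<And>u. J0 (J0 u) = - u" and K: "\<And>u. K (J0 u) = - J0 (K u)" "norm K < 1"
  shows "conj_acs J0 K (conj_acs J0 K u) = - u" "conj_acs J0 K (u + K u) = J0 u + K (J0 u)"
    "cay J0 (conj_acs J0 K) = K"
proof -
  note inv = blinfun_invertible_one_plus[OF K(2)]
  let ?I = "blinfun_inv (id_blinfun + K)"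
  have I: "?I (u + K u) = u" "?I u + K (?I u) = u" for u
    using blinfun_inv(3,4)[OF inv, of u] by (simp_all add: blinfun.add_left)
  show 1: "conj_acs J0 K (u + K u) = J0 u + K (J0 u)" for u
    unfolding conj_acs_def by (simp add: I blinfun.add_left)
  show "conj_acs J0 K (conj_acs J0 K u) = - u"
  proof -
    have "conj_acs J0 K u = J0 (?I u) + K (J0 (?I u))" using 1[of "?I u"] I(2) by simp
    moreover have "conj_acs J0 K (J0 (?I u) + K (J0 (?I u))) = - (?I u + K (?I u))"
      unfolding 1 by (simp add: J0 blinfun.minus_right)
    ultimately show ?thesis unfolding I(2) by simp
  qed
  have eq: "(conj_acs J0 K + J0) (K u) = (J0 - conj_acs J0 K) u" for u
    using 1[of u] by (simp add: K blinfun.add_left blinfun.diff_left blinfun.add_right algebra_simps)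
  have "blinfun_invertible (conj_acs J0 K + J0)"
  proof (rule blinfun_invertibleI_injective)
    fix z assume z: "(conj_acs J0 K + J0) z = 0"
    let ?y = "?I z"
    have "(conj_acs J0 K + J0) (?y + K ?y) = conj_acs J0 K (?y + K ?y) + J0 (?y + K ?y)" by (rule blinfun.add_left)
    also have "\<dots> = 2 *\<^sub>R J0 ?y" unfolding 1 by (simp add: K blinfun.add_right scaleR_2)
    finally have "(conj_acs J0 K + J0) (?y + K ?y) = 2 *\<^sub>R J0 ?y" .
    then have "J0 ?y = 0" using z I(2)[of z] by simp
    then have "?y = 0" using J0[of ?y] by simp
    then show "z = 0" using I(2)[of z] by simp
  qed
  note ci = blinfun_inv(3)[OF this]
  show "cay J0 (conj_acs J0 K) = K"
    by (rule blinfun_eqI) (simp add: cay_def eq[symmetric] ci)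
qed

lemma conj_acs_cay:
  fixes J0 M :: "'e::euclidean_space \<Rightarrow>\<^sub>L 'e"
  assumes "\<And>u. J0 (J0 u) = - u" "\<And>u. M (M u) = - u" "norm J0 * norm (M - J0) < 1"
  shows "conj_acs J0 (cay J0 M) = M"
proof (rule blinfun_eqI)
  fix u
  note c = cay[OF assms(1,2) order_refl assms(3)]
  have n: "norm (cay J0 M) < 1" using c(2) assms(3) by linarith
  let ?I = "blinfun_inv (id_blinfun + cay J0 M)"
  have I: "?I u + cay J0 M (?I u) = u"
    using blinfun_inv(4)[OF blinfun_invertible_one_plus[OF n], of u] by (simp add: blinfun.add_left)
  show "conj_acs J0 (cay J0 M) u = M u"
    using conj_acs(2)[OF assms(1) c(3) n, of "?I u"] c(4)[of "?I u"] I by simp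
qed

lemma smooth_on_cay:
  assumes "open S" "smooth_on S F" "smooth_on S M" "\<And>x. x \<in> S \<Longrightarrow> blinfun_invertible (M x + F x)"
  shows "smooth_on S (\<lambda>x. cay (F x) (M x))"
  unfolding cay_def
  by (intro smooth_on_blinfun_compose smooth_on_blinfun_inv smooth_on_add smooth_on_diff assms)

lemma smooth_on_conj_acs:
  fixes K :: "'a::euclidean_space \<Rightarrow> 'e::euclidean_space \<Rightarrow>\<^sub>L 'e"
  assumes "open S" "smooth_on S F" "smooth_on S K" "\<And>x. x \<in> S \<Longrightarrow> norm (K x) < 1"
  shows "smooth_on S (\<lambda>x. conj_acs (F x) (K x))"
  unfolding conj_acs_def
  by (intro smooth_on_blinfun_compose smooth_on_blinfun_inv smooth_on_add smooth_on_const assms blinfun_invertible_one_plus)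

subsection \<open>Linear antilinear perturbations\<close>

text \<open>Complex coordinates for \<open>J0\<close>, and a family \<open>\<pi>\<close> of pairs \<open>j < l\<close>. Only the torsion components \<open>\<tau>(\<epsilon>\<^sub>j, \<epsilon>\<^sub>l)\<close> for these pairs
  are controlled; the number of pairs is adapted to the condition that is to be achieved.\<close>

locale complex_frame =
  fixes J0 :: "'e::euclidean_space \<Rightarrow>\<^sub>L 'e" and n :: nat and \<zeta> :: "nat \<Rightarrow> 'e \<Rightarrow>\<^sub>L complex" and \<epsilon> :: "nat \<Rightarrow> 'e"
    and \<pi> :: "'i::finite \<Rightarrow> nat \<times> nat"
  assumes J0: "J0 (J0 u) = - u" and dim: "DIM('e) = 2 * n"
    and zJ: "\<zeta> k (J0 u) = \<i> * \<zeta> k u"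
    and ze: "k < n \<Longrightarrow> l < n \<Longrightarrow> \<zeta> k (\<epsilon> l) = (if k = l then 1 else 0)"
    and expand: "u = (\<Sum>k<n. Re (\<zeta> k u) *\<^sub>R \<epsilon> k + Im (\<zeta> k u) *\<^sub>R J0 (\<epsilon> k))"
    and pi_inj: "inj \<pi>" and pi_less: "fst (\<pi> i) < snd (\<pi> i)" "snd (\<pi> i) < n"
begin

definition cf :: "'i \<Rightarrow> 'e \<Rightarrow> 'e \<Rightarrow> complex" where
  "cf i y w = cnj (\<zeta> (fst (\<pi> i)) y) * cnj (\<zeta> (snd (\<pi> i)) w) - cnj (\<zeta> (snd (\<pi> i)) y) * cnj (\<zeta> (fst (\<pi> i)) w)"

text \<open>The alternating form \<open>S\<close> that is antilinear in both arguments and satisfies \<open>S(\<epsilon>\<^sub>j, \<epsilon>\<^sub>l) = s\<^sub>i\<close> if \<open>(j, l) = \<pi> i\<close>, and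
  \<open>0\<close> for pairs \<open>j < l\<close> outside the range of \<open>\<pi>\<close>.\<close>

definition pv :: "'e^'i \<Rightarrow> 'e \<Rightarrow> 'e \<Rightarrow> 'e" where
  "pv s y w = (\<Sum>i\<in>UNIV. Re (cf i y w) *\<^sub>R s $ i + Im (cf i y w) *\<^sub>R J0 (s $ i))"

definition pert :: "'e^'i \<Rightarrow> 'e \<Rightarrow> 'e \<Rightarrow>\<^sub>L 'e" where
  "pert s y = Blinfun (pv s y)"

lemma cf_simps: "cf i (a + b) w = cf i a w + cf i b w" "cf i y (a + b) = cf i y a + cf i y b"
  "cf i (r *\<^sub>R a) w = of_real r * cf i a w" "cf i y (r *\<^sub>R a) = of_real r * cf i y a"
  "cf i (J0 y) w = - \<i> * cf i y w" "cf i y (J0 w) = - \<i> * cf i y w" "cf i w y = - cf i y w"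
  by (simp_all add: cf_def zJ blinfun.add_right blinfun.scaleR_right scaleR_conv_of_real algebra_simps)

lemma pv_simps: "pv (s + t) y w = pv s y w + pv t y w" "pv s (a + b) w = pv s a w + pv s b w" "pv s y (a + b) = pv s y a + pv s y b"
  "pv (r *\<^sub>R s) y w = r *\<^sub>R pv s y w" "pv s (r *\<^sub>R a) w = r *\<^sub>R pv s a w" "pv s y (r *\<^sub>R a) = r *\<^sub>R pv s y a"
  "pv s (J0 y) w = - J0 (pv s y w)" "pv s y (J0 w) = - J0 (pv s y w)" "pv s w y = - pv s y w"
  unfolding pv_def
  by (simp_all add: cf_simps(1-6) cf_simps(7)[of _ w y] sum.distrib[symmetric] scaleR_sum_right blinfun.sum_right sum_negf[symmetric] blinfun.add_right
      blinfun.scaleR_right J0 scaleR_add_left scaleR_add_right algebra_simps)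

lemma pert_apply: "pert s y w = pv s y w"
proof -
  have "linear (pv s y)" by standard (simp_all add: pv_simps(1-8))
  then show ?thesis by (simp add: pert_def bounded_linear_Blinfun_apply linear_conv_bounded_linear)
qed

lemma pert_bilinear: "bounded_bilinear pert"
proof -
  have "bilinear pert"
    unfolding bilinear_def
    by (intro conjI allI linearI blinfun_eqI) (simp_all add: pert_apply pv_simps(1-8) blinfun.add_left blinfun.scaleR_left)
  then show ?thesis using bilinear_conv_bounded_bilinear by blast
qed

lemma pv_frame: "pv s (\<epsilon> (fst (\<pi> i))) (\<epsilon> (snd (\<pi> i))) = s $ i"
proof -
  have "cf j (\<epsilon> (fst (\<pi> i))) (\<epsilon> (snd (\<pi> i))) = (if j = i then 1 else 0)" for j
  proof -
    have l: "fst (\<pi> j) < n" "snd (\<pi> j) < n" "fst (\<pi> i) < n" "snd (\<pi> i) < n"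
      using pi_less[of i] pi_less[of j] by auto
    have "\<pi> j = \<pi> i \<longleftrightarrow> j = i" using pi_inj by (auto dest: injD)
    moreover have "\<not> (snd (\<pi> j) = fst (\<pi> i) \<and> fst (\<pi> j) = snd (\<pi> i))" using pi_less[of i] pi_less[of j] by auto
    ultimately show ?thesis unfolding cf_def using l by (auto simp: ze prod_eq_iff)
  qed
  then have "pv s (\<epsilon> (fst (\<pi> i))) (\<epsilon> (snd (\<pi> i))) = (\<Sum>j\<in>UNIV. if j = i then s $ j else 0)"
    unfolding pv_def by (intro sum.cong) auto
  then show ?thesis by simp
qed

definition frame_torsion :: "('e \<Rightarrow> 'e \<Rightarrow>\<^sub>L 'e) \<Rightarrow> 'e \<Rightarrow> 'e^'i" where
  "frame_torsion K x = (\<chi> i. torsion J0 K x (\<epsilon> (fst (\<pi> i))) (\<epsilon> (snd (\<pi> i))))"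

definition Dnorm :: "('e \<Rightarrow> 'e \<Rightarrow>\<^sub>L 'e) \<Rightarrow> 'e \<Rightarrow> real" where
  "Dnorm K x = (\<Sum>b\<in>Basis. norm (frechet_derivative K (at x) b))"

lemma Dnorm_bound:
  fixes K :: "'e \<Rightarrow> 'e \<Rightarrow>\<^sub>L 'e"
  assumes "K differentiable (at x)"
  shows "norm (frechet_derivative K (at x) \<xi> w) \<le> Dnorm K x * norm \<xi> * norm w"
proof -
  have "norm (frechet_derivative K (at x) \<xi>) \<le> (\<Sum>b\<in>Basis. norm ((\<xi> \<bullet> b) *\<^sub>R frechet_derivative K (at x) b))"
    unfolding frechet_derivative_Basis[OF assms, of \<xi>] by (rule norm_sum)
  also have "\<dots> \<le> (\<Sum>b\<in>Basis. norm \<xi> * norm (frechet_derivative K (at x) b))"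
    by (intro sum_mono) (auto intro: mult_right_mono Basis_le_norm)
  also have "\<dots> = Dnorm K x * norm \<xi>" by (simp add: Dnorm_def sum_distrib_left mult.commute)
  finally have "norm (frechet_derivative K (at x) \<xi>) * norm w \<le> Dnorm K x * norm \<xi> * norm w" by (intro mult_right_mono) auto
  then show ?thesis using norm_blinfun order_trans by blast
qed

text \<open>The part of the change of torsion, under adding \<open>S(x - x0, \<cdot>)\<close> to \<open>K\<close>, in which \<open>K\<close> is differentiated.\<close>

definition rest :: "('e \<Rightarrow> 'e \<Rightarrow>\<^sub>L 'e) \<Rightarrow> 'e \<Rightarrow> 'e \<Rightarrow> 'e^'i \<Rightarrow> 'e^'i" where
  "rest K x y s = (\<chi> i. let u = \<epsilon> (fst (\<pi> i)); w = \<epsilon> (snd (\<pi> i)); D = frechet_derivative K (at x) in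
     blinfun_apply (D (pv s y u)) w - blinfun_apply (D (pv s y (J0 u))) (J0 w) - (blinfun_apply (D (pv s y w)) u - blinfun_apply (D (pv s y (J0 w))) (J0 u)))"

text \<open>Adding \<open>S(x - x0, \<cdot>)\<close> to \<open>K\<close> changes the torsion affinely in \<open>S\<close>: by \<open>4 S\<close> plus a remainder controlled by
  \<open>DK\<close> and the distance to \<open>x0\<close>. The terms \<open>S(K u, w)\<close> and \<open>S(S(x - x0, u), w)\<close> cancel
  because \<open>K\<close> and \<open>S\<close> are antilinear.\<close>

lemma frame_torsion_pert:
  fixes K Kt :: "'e \<Rightarrow> 'e \<Rightarrow>\<^sub>L 'e"
  assumes K: "(K has_derivative DK) (at x)" and anti: "\<And>u. K x (J0 u) = - J0 (K x u)"
    and Kt: "(Kt has_derivative (\<lambda>\<xi>. DK \<xi> + pert s \<xi>)) (at x)" "Kt x = K x + pert s (x - x0)"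
  shows "frame_torsion Kt x = frame_torsion K x + 4 *\<^sub>R s + rest K x (x - x0) s"
proof -
  have D: "frechet_derivative K (at x) = DK" "frechet_derivative Kt (at x) = (\<lambda>\<xi>. DK \<xi> + pert s \<xi>)"
    using frechet_derivative_at[OF K] frechet_derivative_at[OF Kt(1)] by simp_all
  interpret DK: linear DK using K has_derivative_linear by blast
  have m: "pv s (- y) w = - pv s y w" "pv s y (- w) = - pv s y w" for y w
    using pv_simps(5)[of s "-1" y w] pv_simps(6)[of s y "-1" w] by simp_all
  have md: "pv s (y - z) w = pv s y w - pv s z w" "pv s w (y - z) = pv s w y - pv s w z" for y z w
    using pv_simps(2)[of s y "- z" w] pv_simps(3)[of s w y "- z"] m by simp_all
  have "torsion J0 Kt x u w = torsion J0 K x u w + 4 *\<^sub>R pv s u w +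
     (DK (pv s (x - x0) u) w - DK (pv s (x - x0) (J0 u)) (J0 w) - (DK (pv s (x - x0) w) u - DK (pv s (x - x0) (J0 w)) (J0 u)))" for u w
  proof -
    have four: "4 *\<^sub>R z = z + z + z + z" for z :: 'e
      by (simp add: numeral_eq_Suc scaleR_add_left[symmetric] algebra_simps) (metis (no_types, opaque_lifting) add.commute add.assoc one_add_one scaleR_2 scaleR_add_left numeral_Bit0)
    have sw: "pv s w u = - pv s u w" by (rule pv_simps(9))
    show ?thesis
      unfolding torsion_def D Kt(2) four
      by (simp add: DK.add DK.neg DK.diff pert_apply blinfun.add_left blinfun.add_right blinfun.minus_left blinfun.minus_right
          blinfun.diff_left blinfun.diff_right pv_simps(1-8) m md sw anti J0 algebra_simps)
  qed
  then show ?thesis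
    by (simp add: frame_torsion_def rest_def vec_eq_iff D pv_frame Let_def)
qed

lemma rest_linear: "(K has_derivative DK) (at x) \<Longrightarrow> rest K x y (s - t) = rest K x y s - rest K x y t"
proof -
  assume K: "(K has_derivative DK) (at x)"
  have D: "frechet_derivative K (at x) = DK" using frechet_derivative_at[OF K] by simp
  interpret DK: linear DK using K has_derivative_linear by blast
  have "pv (s - t) y w = pv s y w - pv t y w" for w
    using pv_simps(1)[of s "- t" y w] pv_simps(4)[of "-1" t y w] by simp
  then show ?thesis by (simp add: rest_def vec_eq_iff D Let_def DK.diff blinfun.diff_left)
qed

lemma rest_bound:
  obtains C where "C > 0" "\<And>K x y s. K differentiable (at x) \<Longrightarrow> norm (rest K x y s) \<le> C * norm y * Dnorm K x * norm s"
    "\<And>y s. norm (pert s y) \<le> C * norm y * norm s"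
proof -
  obtain B where B: "B > 0" "\<And>s y. norm (pert s y) \<le> norm s * norm y * B"
    using bounded_bilinear.pos_bounded[OF pert_bilinear] by blast
  define E where "E = (\<Sum>k<n. norm (\<epsilon> k) + norm (J0 (\<epsilon> k)))"
  have E: "norm (\<epsilon> k) \<le> E" "norm (J0 (\<epsilon> k)) \<le> E" if "k < n" for k
    using member_le_sum[of k "{..<n}" "\<lambda>k. norm (\<epsilon> k) + norm (J0 (\<epsilon> k))"] that unfolding E_def
    by (smt (verit) finite_lessThan lessThan_iff norm_ge_zero)+
  define C where "C = 1 + B + real CARD('i) * (4 * (B * E * E))"
  have "E \<ge> 0" unfolding E_def by (simp add: sum_nonneg)
  then have BE: "B * E * E \<ge> 0" using B by simp
  have CC: "C > 0" "C \<ge> B" "C \<ge> real CARD('i) * (4 * (B * E * E))" unfolding C_def using B(1) BE by (auto intro: add_pos_nonneg)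
  show thesis
  proof
    show "C > 0" by (rule CC)
    show "norm (pert s y) \<le> C * norm y * norm s" for y s
    proof -
      have "norm (pert s y) \<le> B * (norm y * norm s)" using B(2)[of s y] by (simp add: mult_ac)
      also have "\<dots> \<le> C * (norm y * norm s)" using CC(2) by (intro mult_right_mono) auto
      finally show ?thesis by (simp add: mult.assoc)
    qed
    fix K :: "'e \<Rightarrow> 'e \<Rightarrow>\<^sub>L 'e" and x y s assume K: "K differentiable (at x)"
    have N0: "Dnorm K x \<ge> 0" unfolding Dnorm_def by (simp add: sum_nonneg)
    have one: "norm (frechet_derivative K (at x) (pv s y u) w) \<le> Dnorm K x * (norm s * norm y * B * E) * E"
      if "norm u \<le> E" "norm w \<le> E" for u w
    proof -
      have "norm (pv s y u) \<le> norm (pert s y) * norm u" using norm_blinfun[of "pert s y" u] by (simp add: pert_apply)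
      also have "\<dots> \<le> (norm s * norm y * B) * E" using that B by (intro mult_mono) auto
      finally have 1: "norm (pv s y u) \<le> norm s * norm y * B * E" .
      have "norm (frechet_derivative K (at x) (pv s y u) w) \<le> Dnorm K x * norm (pv s y u) * norm w" by (rule Dnorm_bound[OF K])
      also have "\<dots> \<le> Dnorm K x * (norm s * norm y * B * E) * E"
        using 1 that N0 \<open>E \<ge> 0\<close> B(1) by (intro mult_mono mult_nonneg_nonneg) auto
      finally show ?thesis .
    qed
    let ?Q = "Dnorm K x * (norm s * norm y * B * E) * E"
    have comp: "norm (rest K x y s $ i) \<le> 4 * ?Q" for i
    proof -
      have l: "fst (\<pi> i) < n" "snd (\<pi> i) < n" using pi_less[of i] by auto
      have tri: "norm (a - b - (c - d)) \<le> norm a + norm b + (norm c + norm d)" for a b c d :: 'e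
        by (meson add_mono norm_triangle_ineq4 order_trans)
      show ?thesis
        unfolding rest_def Let_def vec_lambda_beta
        by (rule order_trans[OF tri]) (use one[OF E(1)[OF l(1)] E(1)[OF l(2)]] one[OF E(2)[OF l(1)] E(2)[OF l(2)]]
            one[OF E(1)[OF l(2)] E(1)[OF l(1)]] one[OF E(2)[OF l(2)] E(2)[OF l(1)]] in linarith)
    qed
    have "norm (rest K x y s) \<le> (\<Sum>i\<in>UNIV. norm (rest K x y s $ i))" by (simp add: norm_vec_def L2_set_le_sum)
    also have "\<dots> \<le> real CARD('i) * (4 * ?Q)" using sum_bounded_above[of "UNIV :: 'i set" "\<lambda>i. norm (rest K x y s $ i)" "4 * ?Q"] comp by simp
    also have "\<dots> = (real CARD('i) * (4 * (B * E * E))) * (norm y * Dnorm K x * norm s)" by (simp add: mult_ac)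
    also have "\<dots> \<le> C * (norm y * Dnorm K x * norm s)" using CC(3) N0 by (intro mult_right_mono) auto
    finally show "norm (rest K x y s) \<le> C * norm y * Dnorm K x * norm s" by (simp add: mult.assoc)
  qed
qed

end

section \<open>Avoiding thin sets\<close>

text \<open>\<open>D\<close> is thin if it is covered by finitely many locally Lipschitz images of linear spaces whose
  dimension falls short of the ambient one by more than \<open>DIM('e)\<close>. The type arguments record the space whose
  points have to be avoided and the space that contains the parameters of the cover.\<close>

definition thin :: "'e::euclidean_space itself \<Rightarrow> 'z::euclidean_space itself \<Rightarrow> 's::euclidean_space set \<Rightarrow> bool" where
  "thin _ _ D \<longleftrightarrow> (\<exists>(m::nat) (G::nat \<Rightarrow> 'z \<Rightarrow> 's) Z. D \<subseteq> (\<Union>k<m. G k ` Z k) \<and>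
     (\<forall>k<m. subspace (Z k) \<and> dim (Z k) + DIM('e) < DIM('s) \<and>
        (\<forall>z. \<exists>e>0. \<exists>L. \<forall>y\<in>ball z e. \<forall>y'\<in>ball z e. norm (G k y - G k y') \<le> L * norm (y - y'))))"

text \<open>Move \<open>W\<close> isometrically onto a subspace of the target space, where it is negligible.\<close>

lemma negligible_Lipschitz_image_lowdim:
  fixes \<sigma> :: "'y::euclidean_space \<Rightarrow> 's::euclidean_space"
  assumes Y: "Y \<subseteq> W" "subspace W" "dim W < DIM('s)"
    and lip: "\<And>y. y \<in> Y \<Longrightarrow> \<exists>e>0. \<exists>B. \<forall>y'\<in>Y \<inter> ball y e. norm (\<sigma> y' - \<sigma> y) \<le> B * norm (y' - y)"
  shows "negligible (\<sigma> ` Y)"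
proof -
  have "dim W \<le> dim (UNIV :: 's set)" using Y(3) by simp
  then obtain V :: "'s set" where V: "subspace V" "dim V = dim W"
    using choose_subspace_of_subspace[of "dim W" "UNIV :: 's set"] by blast
  obtain f g where f: "linear f" "linear g" "f ` V = W" "g ` W = V" "\<And>x. x \<in> V \<Longrightarrow> norm (f x) = norm x"
    "\<And>x. x \<in> W \<Longrightarrow> norm (g x) = norm x" "\<And>x. x \<in> V \<Longrightarrow> g (f x) = x" "\<And>x. x \<in> W \<Longrightarrow> f (g x) = x"
    by (rule isometries_subspaces[OF V(1) Y(2) V(2)]) (rule that)
  let ?Y = "g ` Y"
  have gV: "?Y \<subseteq> V" using Y(1) f(4) by blast
  have nV: "negligible V" by (rule negligible_lowdim) (use V(2) Y(3) in simp)
  have "negligible ((\<sigma> \<circ> f) ` ?Y)"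
  proof (rule negligible_locally_Lipschitz_image)
    show "negligible ?Y" using negligible_subset[OF nV gV] .
    fix x assume "x \<in> ?Y"
    then obtain y where y: "y \<in> Y" "x = g y" by blast
    obtain e B where e: "e > 0" "\<forall>y'\<in>Y \<inter> ball y e. norm (\<sigma> y' - \<sigma> y) \<le> B * norm (y' - y)" using lip[OF y(1)] by blast
    have fg: "f (g z) = z" if "z \<in> Y" for z using f(8) Y(1) that by blast
    have dist: "norm (z - y) = norm (g z - g y)" if "z \<in> Y" for z
    proof -
      have "z - y \<in> W" using Y that y(1) by (auto intro: subspace_diff)
      then show ?thesis using f(6)[of "z - y"] linear_diff[OF f(2)] by simp
    qed
    show "\<exists>T B. open T \<and> x \<in> T \<and> (\<forall>x'\<in>?Y \<inter> T. norm ((\<sigma> \<circ> f) x' - (\<sigma> \<circ> f) x) \<le> B * norm (x' - x))"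
    proof (intro exI[of _ "ball x e"] exI[of _ B] conjI ballI)
      fix x' assume "x' \<in> ?Y \<inter> ball x e"
      then obtain z where z: "z \<in> Y" "x' = g z" "dist x x' < e" by auto
      have "z \<in> ball y e" using z dist[OF z(1)] y by (simp add: dist_norm norm_minus_commute)
      then have "norm (\<sigma> z - \<sigma> y) \<le> B * norm (z - y)" using e(2) z(1) by blast
      then show "norm ((\<sigma> \<circ> f) x' - (\<sigma> \<circ> f) x) \<le> B * norm (x' - x)"
        unfolding dist[OF z(1)] using z(1,2) y fg by simp
    qed (use e in auto)
  qed simp
  moreover have "(\<sigma> \<circ> f) ` ?Y = \<sigma> ` Y" using f(8) Y(1) by (force simp: image_iff)
  ultimately show ?thesis by simp
qed

text \<open>The transversality argument. A parameter \<open>s\<close> with \<open>F s x \<in> D\<close> is determined by \<open>x\<close> and a point of one of the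
  covering linear spaces, in a Lipschitz way, because \<open>F\<close> expands in \<open>s\<close>. So the bad parameters are a
  Lipschitz image of a set of smaller dimension.\<close>

lemma negligible_bad_parameters:
  fixes F :: "'s::euclidean_space \<Rightarrow> 'e::euclidean_space \<Rightarrow> 's"
  assumes D: "thin TYPE('e) TYPE('z::euclidean_space) D" and c: "c > 0"
    and mono: "\<And>s s' x. s \<in> S \<Longrightarrow> s' \<in> S \<Longrightarrow> x \<in> X \<Longrightarrow> c * norm (s - s') \<le> norm (F s x - F s' x)"
    and lip: "\<And>s x x'. s \<in> S \<Longrightarrow> x \<in> X \<Longrightarrow> x' \<in> X \<Longrightarrow> norm (F s x - F s x') \<le> L * norm (x - x')"
  shows "negligible {s \<in> S. \<exists>x\<in>X. F s x \<in> D}"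
proof -
  obtain m and G :: "nat \<Rightarrow> 'z \<Rightarrow> 's" and Z where cov: "D \<subseteq> (\<Union>k<m. G k ` Z k)"
    and Z: "\<And>k. k < m \<Longrightarrow> subspace (Z k)" "\<And>k. k < m \<Longrightarrow> dim (Z k) + DIM('e) < DIM('s)"
    and G: "\<And>k z. k < m \<Longrightarrow> \<exists>e>0. \<exists>L. \<forall>y\<in>ball z e. \<forall>y'\<in>ball z e. norm (G k y - G k y') \<le> L * norm (y - y')"
    using D unfolding thin_def by blast
  have "negligible {s \<in> S. \<exists>x\<in>X. \<exists>z\<in>Z k. F s x = G k z}" if k: "k < m" for k
  proof -
    define Y where "Y = {(x, z). x \<in> X \<and> z \<in> Z k \<and> (\<exists>s\<in>S. F s x = G k z)}"
    define \<sigma> where "\<sigma> y = (SOME s. s \<in> S \<and> F s (fst y) = G k (snd y))" for y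
    have \<sigma>: "\<sigma> y \<in> S" "F (\<sigma> y) (fst y) = G k (snd y)" if "y \<in> Y" for y
    proof -
      have "\<exists>s. s \<in> S \<and> F s (fst y) = G k (snd y)" using that by (auto simp: Y_def)
      from someI_ex[OF this] show "\<sigma> y \<in> S" "F (\<sigma> y) (fst y) = G k (snd y)" unfolding \<sigma>_def by blast+
    qed
    have "negligible (\<sigma> ` Y)"
    proof (rule negligible_Lipschitz_image_lowdim)
      show "Y \<subseteq> UNIV \<times> Z k" by (auto simp: Y_def)
      show "subspace ((UNIV :: 'e set) \<times> Z k)" using Z(1)[OF k] by (simp add: subspace_Times)
      show "dim ((UNIV :: 'e set) \<times> Z k) < DIM('s)"
        using dim_Times[of "UNIV :: 'e set" "Z k"] Z[OF k] by simp
      fix y assume y: "y \<in> Y"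
      obtain e LG where e: "e > 0" "\<forall>z\<in>ball (snd y) e. \<forall>z'\<in>ball (snd y) e. norm (G k z - G k z') \<le> LG * norm (z - z')"
        using G[OF k, of "snd y"] by blast
      show "\<exists>e>0. \<exists>B. \<forall>y'\<in>Y \<inter> ball y e. norm (\<sigma> y' - \<sigma> y) \<le> B * norm (y' - y)"
      proof (rule exI[of _ e], rule conjI, rule e(1), rule exI[of _ "(\<bar>LG\<bar> + \<bar>L\<bar>) / c"], rule ballI)
        fix y' assume y': "y' \<in> Y \<inter> ball y e"
        have n: "norm (fst y' - fst y) \<le> norm (y' - y)" "norm (snd y' - snd y) \<le> norm (y' - y)"
          using norm_fst_le[of "fst y' - fst y" "snd y' - snd y"] norm_snd_le[of "snd y' - snd y" "fst y' - fst y"]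
          by (simp_all add: minus_prod_def)
        have "dist (snd y) (snd y') \<le> dist y y'" using n(2) by (simp add: dist_norm norm_minus_commute)
        then have inb: "snd y' \<in> ball (snd y) e" using y' by simp
        have X: "fst y \<in> X" "fst y' \<in> X" using y y' by (auto simp: Y_def)
        have "c * norm (\<sigma> y' - \<sigma> y) \<le> norm (F (\<sigma> y') (fst y) - F (\<sigma> y) (fst y))"
          using mono[OF \<sigma>(1) \<sigma>(1)[OF y] X(1)] y' by blast
        also have "\<dots> = norm ((F (\<sigma> y') (fst y) - F (\<sigma> y') (fst y')) + (G k (snd y') - G k (snd y)))"
          using \<sigma>(2)[OF y] \<sigma>(2)[of y'] y' by simp
        also have "\<dots> \<le> norm (F (\<sigma> y') (fst y) - F (\<sigma> y') (fst y')) + norm (G k (snd y') - G k (snd y))"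
          by (rule norm_triangle_ineq)
        also have "\<dots> \<le> L * norm (fst y - fst y') + LG * norm (snd y' - snd y)"
          using lip[OF \<sigma>(1) X] e inb y' by (intro add_mono) auto
        also have "\<dots> \<le> \<bar>L\<bar> * norm (y' - y) + \<bar>LG\<bar> * norm (y' - y)"
        proof -
          have le: "r * a \<le> \<bar>r\<bar> * b" if "a \<le> b" "0 \<le> a" for r a b :: real using that by (intro mult_mono) auto
          show ?thesis using n by (intro add_mono le) (simp_all add: norm_minus_commute)
        qed
        finally show "norm (\<sigma> y' - \<sigma> y) \<le> (\<bar>LG\<bar> + \<bar>L\<bar>) / c * norm (y' - y)"
          using c by (simp add: field_simps)
      qed
    qed
    moreover have "{s \<in> S. \<exists>x\<in>X. \<exists>z\<in>Z k. F s x = G k z} \<subseteq> \<sigma> ` Y"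
    proof safe
      fix s x z assume s: "s \<in> S" "x \<in> X" "z \<in> Z k" "F s x = G k z"
      then have y: "(x, z) \<in> Y" by (auto simp: Y_def)
      have "c * norm (s - \<sigma> (x, z)) \<le> norm (F s x - F (\<sigma> (x, z)) x)" using mono[OF s(1) \<sigma>(1)[OF y] s(2)] .
      also have "\<dots> = 0" using \<sigma>(2)[OF y] s by simp
      finally have "s = \<sigma> (x, z)" using c by (simp add: mult_le_0_iff)
      then show "s \<in> \<sigma> ` Y" using y by blast
    qed
    ultimately show ?thesis using negligible_subset by blast
  qed
  then have "negligible (\<Union>k<m. {s \<in> S. \<exists>x\<in>X. \<exists>z\<in>Z k. F s x = G k z})"
    by (intro negligible_Union) auto
  moreover have "{s \<in> S. \<exists>x\<in>X. F s x \<in> D} \<subseteq> (\<Union>k<m. {s \<in> S. \<exists>x\<in>X. \<exists>z\<in>Z k. F s x = G k z})"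
    using cov by blast
  ultimately show ?thesis using negligible_subset by blast
qed

lemma thin_zero: "DIM('e::euclidean_space) < DIM('s::euclidean_space) \<Longrightarrow> thin TYPE('e) TYPE('z::euclidean_space) {0 :: 's}"
  unfolding thin_def
  by (rule exI[of _ 1], rule exI[of _ "\<lambda>_ _. 0"], rule exI[of _ "\<lambda>_. {0}"]) (auto intro!: exI[of _ "1::real"])

text \<open>For rank \<open>n\<close> in real dimension \<open>2 n\<close> the argument uses \<open>2 n\<close> torsion components. This is a type with as many elements.\<close>

typedef (overloaded) ('e::euclidean_space) basis_index = "Basis :: 'e set" using nonempty_Basis by blast

instance basis_index :: (euclidean_space) finite
proof
  have "inj (Rep_basis_index :: 'a basis_index \<Rightarrow> 'a)" by (simp add: inj_def Rep_basis_index_inject)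
  moreover have "range (Rep_basis_index :: 'a basis_index \<Rightarrow> 'a) \<subseteq> Basis" using Rep_basis_index by auto
  ultimately show "finite (UNIV :: 'a basis_index set)" by (meson finite_Basis finite_imageD finite_subset)
qed

lemma card_basis_index: "CARD('e::euclidean_space basis_index) = DIM('e)"
  by (rule type_definition.card[OF type_definition_basis_index])

text \<open>The families that do not span the complex vector space defined by \<open>J0\<close>: some real linear form kills their complex
  span. Normalising the form makes it range over a compact set, and so the condition is closed.\<close>

definition degenerate :: "('e::euclidean_space \<Rightarrow>\<^sub>L 'e) \<Rightarrow> ('e^'i) set" where
  "degenerate J0 = {t. \<exists>\<alpha>. norm \<alpha> = 1 \<and> (\<forall>i. \<alpha> \<bullet> t $ i = 0 \<and> \<alpha> \<bullet> J0 (t $ i) = 0)}"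

lemma closed_degenerate: "closed (degenerate J0 :: ('e::euclidean_space^'i::finite) set)"
proof -
  let ?T = "\<Inter>i. {z :: 'e \<times> ('e^'i). fst z \<bullet> snd z $ i = 0} \<inter> {z. fst z \<bullet> J0 (snd z $ i) = 0}"
  have "closed {z :: 'e \<times> ('e^'i). fst z \<bullet> snd z $ i = 0}" "closed {z :: 'e \<times> ('e^'i). fst z \<bullet> J0 (snd z $ i) = 0}" for i
    by (intro closed_Collect_eq continuous_intros)+
  then have "closed ?T" by (intro closed_INT ballI closed_Int)
  from closed_compact_projection[OF compact_sphere[of 0 1] this]
  have "closed {t. \<exists>\<alpha>. \<alpha> \<in> sphere (0::'e) 1 \<and> (\<alpha>, t) \<in> ?T}" .
  moreover have "{t. \<exists>\<alpha>. \<alpha> \<in> sphere (0::'e) 1 \<and> (\<alpha>, t) \<in> ?T} = degenerate J0"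
    by (auto simp: degenerate_def)
  ultimately show ?thesis by simp
qed

context complex_frame
begin

definition cscale :: "complex \<Rightarrow> 'e \<Rightarrow> 'e" where "cscale a v = Re a *\<^sub>R v + Im a *\<^sub>R J0 v"

lemma z_cscale: "\<zeta> k (cscale a v) = a * \<zeta> k v"
  by (simp add: cscale_def blinfun.add_right blinfun.scaleR_right zJ complex_eq_iff)

lemma expand': "u = (\<Sum>k<n. cscale (\<zeta> k u) (\<epsilon> k))" using expand[of u] by (simp add: cscale_def)

text \<open>For \<open>z = (\<beta>, \<eta>)\<close> in \<open>hyper_space k0\<close>: complete the vectors \<open>\<eta>\<^sub>i\<close>, whose coordinate \<open>\<zeta>\<^sub>k\<^sub>0\<close> is zero, by the coordinate
  \<open>\<zeta>\<^sub>k\<^sub>0 = - \<Sum>\<^sub>k \<beta>\<^sub>k \<zeta>\<^sub>k(\<eta>\<^sub>i)\<close>, so that they lie in the hyperplane \<open>\<zeta>\<^sub>k\<^sub>0 + \<Sum>\<^sub>k \<beta>\<^sub>k \<zeta>\<^sub>k = 0\<close>.\<close>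

definition hyper_map :: "nat \<Rightarrow> 'e \<times> ('e^'i) \<Rightarrow> 'e^'i" where
  "hyper_map k0 z = (\<chi> i. snd z $ i - cscale (\<Sum>k<n. \<zeta> k (fst z) * \<zeta> k (snd z $ i)) (\<epsilon> k0))"

definition hyper_space :: "nat \<Rightarrow> ('e \<times> ('e^'i)) set" where
  "hyper_space k0 = {z. \<zeta> k0 (fst z) = 0 \<and> (\<forall>i. \<zeta> k0 (snd z $ i) = 0)}"

lemma hyper_space_subspace: "subspace (hyper_space k0)"
  unfolding subspace_def hyper_space_def by (auto simp: blinfun.add_right blinfun.scaleR_right)

lemma hyper_space_dim:
  assumes k0: "k0 < n" shows "dim (hyper_space k0) \<le> (2 * n - 2) * (1 + CARD('i))"
proof -
  define B where "B = \<epsilon> ` ({..<n} - {k0}) \<union> (\<lambda>k. J0 (\<epsilon> k)) ` ({..<n} - {k0})"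
  have finB: "finite B" by (simp add: B_def)
  have cB: "card B \<le> 2 * n - 2"
  proof -
    have "card B \<le> card (\<epsilon> ` ({..<n} - {k0})) + card ((\<lambda>k. J0 (\<epsilon> k)) ` ({..<n} - {k0}))"
      unfolding B_def by (rule card_Un_le)
    also have "\<dots> \<le> card ({..<n} - {k0}) + card ({..<n} - {k0})" by (intro add_mono card_image_le) auto
    finally show ?thesis using k0 by simp
  qed
  have spB: "u \<in> span B" if "\<zeta> k0 u = 0" for u
  proof -
    have "cscale (\<zeta> k u) (\<epsilon> k) \<in> span B" if "k < n" for k
    proof (cases "k = k0")
      case True then show ?thesis using \<open>\<zeta> k0 u = 0\<close> by (simp add: cscale_def span_zero)
    next
      case False
      then have "\<epsilon> k \<in> B" "J0 (\<epsilon> k) \<in> B" using that by (auto simp: B_def)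
      then show ?thesis unfolding cscale_def by (intro span_add span_scale span_base)
    qed
    then have "(\<Sum>k<n. cscale (\<zeta> k u) (\<epsilon> k)) \<in> span B" by (intro span_sum) auto
    then show ?thesis using expand'[of u] by simp
  qed
  let ?S1 = "(\<lambda>b. (b, 0 :: 'e^'i)) ` B" and ?S2 = "(\<lambda>(i, b). (0 :: 'e, axis i b :: 'e^'i)) ` (UNIV \<times> B)"
  have l1: "linear (\<lambda>b. (b, 0 :: 'e^'i))" by standard auto
  have l2: "linear (\<lambda>b. (0 :: 'e, axis i b :: 'e^'i))" for i
    by standard (auto simp: vec_eq_iff axis_def)
  have "hyper_space k0 \<subseteq> span (?S1 \<union> ?S2)"
  proof
    fix z assume z: "z \<in> hyper_space k0"
    have "(fst z, 0) \<in> span ?S1"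
      using spB[of "fst z"] z linear_span_image[OF l1, of B] by (auto simp: hyper_space_def)
    then have 1: "(fst z, 0) \<in> span (?S1 \<union> ?S2)" by (meson span_mono subsetD sup_ge1)
    have 2: "(0, axis i (snd z $ i)) \<in> span (?S1 \<union> ?S2)" for i
    proof -
      have "(0, axis i (snd z $ i)) \<in> span ((\<lambda>b. (0 :: 'e, axis i b :: 'e^'i)) ` B)"
        using spB[of "snd z $ i"] z linear_span_image[OF l2, of i B] by (auto simp: hyper_space_def)
      moreover have "(\<lambda>b. (0 :: 'e, axis i b :: 'e^'i)) ` B \<subseteq> ?S1 \<union> ?S2" by force
      ultimately show ?thesis by (meson span_mono subsetD)
    qed
    have "z = (fst z, 0) + (\<Sum>i\<in>UNIV. (0, axis i (snd z $ i)))"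
      by (auto simp: prod_eq_iff fst_sum snd_sum vec_eq_iff axis_def if_distrib cong: if_cong)
    also have "\<dots> \<in> span (?S1 \<union> ?S2)" by (intro span_add span_sum 1 2)
    finally show "z \<in> span (?S1 \<union> ?S2)" .
  qed
  then have "dim (hyper_space k0) \<le> card (?S1 \<union> ?S2)" by (rule dim_le_card) (use finB in auto)
  also have "\<dots> \<le> card ?S1 + card ?S2" by (rule card_Un_le)
  also have "\<dots> \<le> card B + CARD('i) * card B"
    using card_image_le[of B "\<lambda>b. (b, 0 :: 'e^'i)"] card_image_le[of "UNIV \<times> B" "\<lambda>(i, b). (0 :: 'e, axis i b :: 'e^'i)"] finB
    by (simp add: card_cartesian_product)
  also have "\<dots> = card B * (1 + CARD('i))" by (simp add: algebra_simps)
  also have "\<dots> \<le> (2 * n - 2) * (1 + CARD('i))" using cB by (rule mult_le_mono1)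
  finally show ?thesis .
qed

lemma hyper_map_smooth: "smooth_on UNIV (hyper_map k0)"
proof (rule smooth_on_componentwise[OF open_UNIV])
  fix b :: "'e^'i" assume "b \<in> Basis"
  then obtain i c where b: "b = axis i c" by (auto simp: Basis_vec_def)
  have l: "bounded_linear (\<lambda>z :: 'e \<times> ('e^'i). snd z $ i)"
    by (rule bounded_linear_compose[OF bounded_linear_vec_nth[of i] bounded_linear_snd])
  have s: "smooth_on UNIV (\<lambda>z :: 'e \<times> ('e^'i). \<zeta> k (snd z $ i))" "smooth_on UNIV (\<lambda>z :: 'e \<times> ('e^'i). \<zeta> k (fst z))" for k
    subgoal by (rule smooth_on_linear_comp[OF blinfun.bounded_linear_right open_UNIV smooth_on_linear[OF open_UNIV l]])
    subgoal by (rule smooth_on_linear_comp[OF blinfun.bounded_linear_right open_UNIV smooth_on_linear[OF open_UNIV bounded_linear_fst]])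
    done
  have "smooth_on UNIV (\<lambda>z. (snd z $ i - cscale (\<Sum>k<n. \<zeta> k (fst z) * \<zeta> k (snd z $ i)) (\<epsilon> k0)) \<bullet> c)"
    unfolding cscale_def
    by (intro smooth_on_inner_left smooth_on_diff smooth_on_add smooth_on_scaleR smooth_on_const open_UNIV
        smooth_on_linear_comp[OF bounded_linear_Re] smooth_on_linear_comp[OF bounded_linear_Im] smooth_on_sum smooth_on_mult s
        smooth_on_linear[OF _ l])
  then show "smooth_on UNIV (\<lambda>z. hyper_map k0 z \<bullet> b)" by (simp add: b inner_axis hyper_map_def)
qed

text \<open>A degenerate family lies in a complex hyperplane \<open>\<Sum>\<^sub>k a\<^sub>k \<zeta>\<^sub>k = 0\<close>; where \<open>a\<close> has a nonzero entry \<open>k0\<close> it is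
  parametrised by the remaining \<open>a\<^sub>k\<close> and the remaining components.\<close>

lemma degenerate_cover: "degenerate J0 \<subseteq> (\<Union>k<n. hyper_map k ` hyper_space k)"
proof
  fix t :: "'e^'i" assume "t \<in> degenerate J0"
  then obtain \<alpha> where \<alpha>: "norm \<alpha> = 1" "\<And>i. \<alpha> \<bullet> t $ i = 0" "\<And>i. \<alpha> \<bullet> J0 (t $ i) = 0" by (auto simp: degenerate_def)
  define f where "f u = Complex (\<alpha> \<bullet> u) (- (\<alpha> \<bullet> J0 u))" for u
  have f_add: "f (u + w) = f u + f w" for u w by (simp add: f_def inner_add_right blinfun.add_right complex_eq_iff)
  have f_cs: "f (cscale a u) = a * f u" for a u
    by (simp add: f_def cscale_def inner_add_right inner_diff_right blinfun.add_right blinfun.scaleR_right J0 complex_eq_iff algebra_simps)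
  have f_sum: "f (\<Sum>k<m. g k) = (\<Sum>k<m. f (g k))" for g :: "nat \<Rightarrow> 'e" and m
    by (induction m) (auto simp: f_add, simp add: f_def complex_eq_iff)
  have f_exp: "f u = (\<Sum>k<n. \<zeta> k u * f (\<epsilon> k))" for u
    using arg_cong[OF expand'[of u], of f] by (simp add: f_sum f_cs)
  have "f \<alpha> \<noteq> 0" using \<alpha>(1) by (auto simp: f_def complex_eq_iff norm_eq_1)
  have "\<exists>k<n. f (\<epsilon> k) \<noteq> 0"
  proof (rule ccontr)
    assume "\<not> ?thesis"
    then have "f \<alpha> = 0" using f_exp[of \<alpha>] by simp
    then show False using \<open>f \<alpha> \<noteq> 0\<close> by simp
  qed
  then obtain k0 where k0: "k0 < n" "f (\<epsilon> k0) \<noteq> 0" by blast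
  define a where "a k = (if k = k0 then 0 else f (\<epsilon> k) / f (\<epsilon> k0))" for k
  define \<beta> where "\<beta> = (\<Sum>k<n. cscale (a k) (\<epsilon> k))"
  have z_sum: "\<zeta> l (\<Sum>k<n. cscale (b k) (\<epsilon> k)) = b l" if "l < n" for l b
  proof -
    have "\<zeta> l (\<Sum>k<n. cscale (b k) (\<epsilon> k)) = (\<Sum>k<n. if k = l then b k else 0)"
      unfolding blinfun.sum_right z_cscale by (rule sum.cong) (use that ze in auto)
    then show ?thesis using that by simp
  qed
  have z\<beta>: "\<zeta> l \<beta> = a l" if "l < n" for l unfolding \<beta>_def by (rule z_sum[OF that])
  define \<eta> where "\<eta> = (\<chi> i. t $ i - cscale (\<zeta> k0 (t $ i)) (\<epsilon> k0))"
  have \<eta>k0: "\<zeta> k0 (\<eta> $ i) = 0" for i using k0 by (simp add: \<eta>_def blinfun.diff_right z_cscale ze)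
  have \<eta>l: "\<zeta> l (\<eta> $ i) = \<zeta> l (t $ i)" if "l < n" "l \<noteq> k0" for l i
    using that k0 by (simp add: \<eta>_def blinfun.diff_right z_cscale ze)
  have eq: "(\<Sum>k<n. \<zeta> k \<beta> * \<zeta> k (\<eta> $ i)) = - \<zeta> k0 (t $ i)" for i
  proof -
    have "(\<Sum>k<n. \<zeta> k \<beta> * \<zeta> k (\<eta> $ i)) = (\<Sum>k\<in>{..<n} - {k0}. f (\<epsilon> k) / f (\<epsilon> k0) * \<zeta> k (t $ i))"
      unfolding sum.remove[OF finite_lessThan lessThan_iff[THEN iffD2, OF k0(1)]]
      using z\<beta>[OF k0(1)] by (simp add: a_def) (rule sum.cong, auto simp: z\<beta> a_def \<eta>l)
    also have "\<dots> = (\<Sum>k\<in>{..<n} - {k0}. \<zeta> k (t $ i) * f (\<epsilon> k)) / f (\<epsilon> k0)"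
      by (simp add: sum_divide_distrib mult.commute)
    also have "(\<Sum>k\<in>{..<n} - {k0}. \<zeta> k (t $ i) * f (\<epsilon> k)) = f (t $ i) - \<zeta> k0 (t $ i) * f (\<epsilon> k0)"
      unfolding f_exp[of "t $ i"] sum.remove[OF finite_lessThan lessThan_iff[THEN iffD2, OF k0(1)]] by simp
    also have "f (t $ i) = 0" using \<alpha> by (simp add: f_def complex_eq_iff)
    finally show ?thesis using k0(2) by simp
  qed
  have "t = hyper_map k0 (\<beta>, \<eta>)"
    unfolding hyper_map_def vec_eq_iff by (simp add: eq) (simp add: \<eta>_def cscale_def)
  moreover have "(\<beta>, \<eta>) \<in> hyper_space k0"
    using z\<beta>[OF k0(1)] \<eta>k0 by (simp add: hyper_space_def a_def)
  ultimately show "t \<in> (\<Union>k<n. hyper_map k ` hyper_space k)" using k0(1) by blast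
qed

text \<open>Families of \<open>2 n\<close> vectors contained in a complex hyperplane have complex codimension \<open>2 n - (n - 1) = n + 1\<close>, which is
  real codimension \<open>2 n + 2\<close>. With only \<open>n\<close> vectors it would be \<open>2\<close>, which is not enough to avoid them at all points of a \<open>2 n\<close>-manifold.\<close>

lemma thin_degenerate:
  assumes card: "CARD('i) = 2 * n"
  shows "thin TYPE('e) TYPE('e \<times> ('e^'i)) (degenerate J0 :: ('e^'i) set)"
  unfolding thin_def
proof (rule exI[of _ n], rule exI[of _ hyper_map], rule exI[of _ hyper_space], rule conjI)
  show "degenerate J0 \<subseteq> (\<Union>k<n. hyper_map k ` hyper_space k)" by (rule degenerate_cover)
  have lip: "\<exists>e>0. \<exists>L. \<forall>y\<in>ball z e. \<forall>y'\<in>ball z e. norm (hyper_map k y - hyper_map k y') \<le> L * norm (y - y')" for k and z :: "'e \<times> ('e^'i)"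
  proof -
    obtain L where "\<And>x y. x \<in> cball z 1 \<Longrightarrow> y \<in> cball z 1 \<Longrightarrow> norm (hyper_map k x - hyper_map k y) \<le> L * norm (x - y)"
      by (rule smooth_on_Lipschitz[OF open_UNIV hyper_map_smooth[of k], of "cball z 1"]) auto
    then have "\<forall>y\<in>ball z 1. \<forall>y'\<in>ball z 1. norm (hyper_map k y - hyper_map k y') \<le> L * norm (y - y')" by simp
    then show ?thesis using zero_less_one by blast
  qed
  have dims: "dim (hyper_space k :: ('e \<times> ('e^'i)) set) + DIM('e) < DIM('e^'i)" if k: "k < n" for k
  proof -
  have "(2 * n - 2) * (1 + 2 * n) + 2 * n < 2 * n * (2 * n)"
  proof -
    obtain m where "n = Suc m" using k by (cases n) auto
    then show ?thesis by (simp add: algebra_simps)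
  qed
  then show ?thesis using hyper_space_dim[OF k] by (simp add: dim card)
  qed
  show "\<forall>k<n. subspace (hyper_space k :: ('e \<times> ('e^'i)) set) \<and> dim (hyper_space k :: ('e \<times> ('e^'i)) set) + DIM('e) < DIM('e^'i) \<and>
     (\<forall>z :: 'e \<times> ('e^'i). \<exists>e>0. \<exists>L. \<forall>y\<in>ball z e. \<forall>y'\<in>ball z e. norm (hyper_map k y - hyper_map k y') \<le> L * norm (y - y'))"
    using hyper_space_subspace dims lip by blast
qed

end

section \<open>Local perturbation\<close>

lemma frechet_derivative_cong_open:
  assumes "open V" "x \<in> V" "\<And>y. y \<in> V \<Longrightarrow> f y = g y"
  shows "frechet_derivative f (at x) = frechet_derivative g (at x)"
proof -
  have "(f has_derivative D) (at x) \<longleftrightarrow> (g has_derivative D) (at x)" for D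
    using has_derivative_transform_within_open[OF _ assms(1,2), of f D UNIV g]
      has_derivative_transform_within_open[OF _ assms(1,2), of g D UNIV f] assms(3) by auto
  then show ?thesis unfolding frechet_derivative_def by simp
qed

lemma torsion_cong:
  assumes "open V" "x \<in> V" "\<And>y. y \<in> V \<Longrightarrow> K y = K' y"
  shows "torsion J0 K x u w = torsion J0 K' x u w"
  using frechet_derivative_cong_open[OF assms] assms(2,3) by (simp add: torsion_def)

lemma smooth_on_frechet_apply:
  fixes K :: "'e::euclidean_space \<Rightarrow> 'f::real_normed_vector" and g :: "'z::euclidean_space \<Rightarrow> 'e"
  assumes "open S" "open V" "smooth_on V K" "smooth_on S g" "g ` S \<subseteq> V" "smooth_on S v"
  shows "smooth_on S (\<lambda>z. frechet_derivative K (at (g z)) (v z))"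
proof -
  have "smooth_on S (\<lambda>z. \<Sum>b\<in>Basis. (v z \<bullet> b) *\<^sub>R frechet_derivative K (at (g z)) b)"
    by (intro smooth_on_sum smooth_on_scaleR smooth_on_inner_left assms
        smooth_on_compose[OF assms(1,2,5,4)] smooth_on_frechet_derivative)
  then show ?thesis
  proof (rule smooth_on_cong[OF assms(1), rotated])
    fix z assume "z \<in> S"
    then have "K differentiable (at (g z))"
      using smooth_on_has_derivative[OF assms(3), of "g z"] assms(5) unfolding differentiable_def by blast
    from frechet_derivative_Basis[OF this, of "v z"]
    show "(\<Sum>b\<in>Basis. (v z \<bullet> b) *\<^sub>R frechet_derivative K (at (g z)) b) = frechet_derivative K (at (g z)) (v z)" by simp
  qed
qed

lemma smooth_on_vec:
  fixes f :: "'z::euclidean_space \<Rightarrow> 'e::euclidean_space^'i::finite"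
  assumes "open S" "\<And>i. smooth_on S (\<lambda>z. f z $ i)" shows "smooth_on S f"
proof (rule smooth_on_componentwise[OF assms(1)])
  fix b :: "'e^'i" assume "b \<in> Basis"
  then obtain i c where b: "b = axis i c" by (auto simp: Basis_vec_def)
  show "smooth_on S (\<lambda>z. f z \<bullet> b)"
    using smooth_on_inner_left[OF assms(1) assms(2)[of i], of c] by (simp add: b inner_axis)
qed

context complex_frame
begin

text \<open>One constant that serves for all structures, points and parameters, so that \<open>tame\<close> below can refer to it.\<close>

definition pert_const :: real where
  "pert_const = (SOME C. C > 0 \<and> (\<forall>K x y s. K differentiable (at x) \<longrightarrow> norm (rest K x y s) \<le> C * norm y * Dnorm K x * norm s) \<and>
    (\<forall>y s. norm (pert s y) \<le> C * norm y * norm s))"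

lemma pert_const:
  "pert_const > 0" "K differentiable (at x) \<Longrightarrow> norm (rest K x y s) \<le> pert_const * norm y * Dnorm K x * norm s"
  "norm (pert s y) \<le> pert_const * norm y * norm s"
proof -
  let ?P = "\<lambda>C. C > 0 \<and> (\<forall>K x y s. K differentiable (at x) \<longrightarrow> norm (rest K x y s) \<le> C * norm y * Dnorm K x * norm s) \<and>
    (\<forall>y s. norm (pert s y) \<le> C * norm y * norm s)"
  have "\<exists>C. ?P C" by (rule rest_bound) blast
  then have *: "?P pert_const" unfolding pert_const_def by (rule someI_ex)
  show "pert_const > 0" "norm (pert s y) \<le> pert_const * norm y * norm s" using * by blast+
  show "norm (rest K x y s) \<le> pert_const * norm y * Dnorm K x * norm s" if "K differentiable (at x)" using * that by blast
qed

text \<open>On a tame ball the Cayley transform is defined, and the radius is so small against the derivative of the structure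
  that \<open>rest\<close> cannot compensate the term \<open>4 s\<close> in the torsion.\<close>

definition tame :: "'e \<Rightarrow> real \<Rightarrow> ('e \<Rightarrow> 'e \<Rightarrow>\<^sub>L 'e) \<Rightarrow> bool" where
  "tame x0 R M \<longleftrightarrow> (\<forall>x\<in>cball x0 R. norm J0 * norm (M x - J0) < 1 / 4 \<and>
     pert_const * R * Dnorm (\<lambda>y. cay J0 (M y)) x < 1)"

text \<open>Add \<open>\<rho>(x) S(x - x0, \<cdot>)\<close> to the Cayley transform of the structure. Where \<open>\<rho> = 1\<close> the torsion components become
  \<open>\<Phi> s x\<close>, which expands in \<open>s\<close> by a factor \<open>3\<close>, so the transversality argument applies on the half ball. The radii
  \<open>R/2 < 5R/8 < 3R/4 < R\<close> leave room between that half ball, the set where \<open>\<rho> = 1\<close>, the support of \<open>\<rho>\<close> and the tame ball.\<close>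

lemma local_perturbation:
  fixes M :: "'e \<Rightarrow> 'e \<Rightarrow>\<^sub>L 'e"
  assumes U: "open U" "smooth_on U M" "\<And>x u. x \<in> U \<Longrightarrow> M x (M x u) = - u"
    and R: "R > 0" "cball x0 R \<subseteq> U" and tame: "tame x0 R M"
    and D: "thin TYPE('e) TYPE('z::euclidean_space) (D :: ('e^'i) set)"
  obtains \<delta> :: real and F :: "'e^'i \<Rightarrow> 'e \<Rightarrow> 'e \<Rightarrow>\<^sub>L 'e" where "\<delta> > 0" "smooth_on (ball 0 \<delta> \<times> U) (\<lambda>(s, x). F s x)"
    "\<And>s x u. s \<in> ball 0 \<delta> \<Longrightarrow> x \<in> U \<Longrightarrow> F s x (F s x u) = - u"
    "\<And>s x. x \<in> U \<Longrightarrow> x \<notin> cball x0 R \<Longrightarrow> F s x = M x" "\<And>x. x \<in> U \<Longrightarrow> F 0 x = M x"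
    "negligible {s \<in> ball 0 \<delta>. \<exists>x\<in>cball x0 (R / 2). frame_torsion (\<lambda>y. cay J0 (F s y)) x \<in> D}"
proof -
  let ?C = pert_const
  define V where "V = ball x0 R"
  have V: "open V" "V \<subseteq> U" "V \<subseteq> cball x0 R" using R unfolding V_def by (auto simp: subset_iff)
  have near: "norm J0 * norm (M x - J0) \<le> 1 / 4" if "x \<in> V" for x using tame V(3) that unfolding tame_def by fastforce
  define K0 where "K0 x = cay J0 (M x)" for x
  note Mc = cay[OF J0 U(3) near, folded K0_def]
  have K0: "norm (K0 x) \<le> 1 / 4" "K0 x (J0 u) = - J0 (K0 x u)" "conj_acs J0 (K0 x) = M x" if "x \<in> V" for x u
  proof -
    have xU: "x \<in> U" using that V by blast
    show "norm (K0 x) \<le> 1 / 4" "K0 x (J0 u) = - J0 (K0 x u)" using Mc[OF xU that] by auto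
    show "conj_acs J0 (K0 x) = M x" unfolding K0_def
      by (rule conj_acs_cay[OF J0 U(3)[OF xU]]) (use near[OF that] in linarith)
  qed
  have sM: "smooth_on V M" by (rule smooth_on_subset[OF U(2) V(2)])
  have sK0: "smooth_on V K0"
    unfolding K0_def by (rule smooth_on_cay[OF V(1) smooth_on_const[OF V(1)] sM]) (use Mc(1) V(2) in auto)
  obtain \<rho> :: "'e \<Rightarrow> real" where \<rho>: "smooth_on UNIV \<rho>" "\<And>x. 0 \<le> \<rho> x" "\<And>x. \<rho> x \<le> 1"
    "\<And>x. x \<in> cball x0 (5 * R / 8) \<Longrightarrow> \<rho> x = 1" "\<And>x. x \<notin> ball x0 (3 * R / 4) \<Longrightarrow> \<rho> x = 0"
    by (rule smooth_bump[of "5 * R / 8" "3 * R / 4" x0]) (use R(1) in \<open>simp, simp, blast\<close>)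
  define K where "K s x = K0 x + \<rho> x *\<^sub>R pert s (x - x0)" for s x
  \<comment> \<open>The perturbation then has norm at most \<open>1/2\<close>, and \<open>norm (K0 x) \<le> 1/4\<close>.\<close>
  define \<delta> where "\<delta> = 1 / (2 * ?C * R)"
  have \<delta>: "\<delta> > 0" using pert_const(1) R(1) by (simp add: \<delta>_def)
  define S where "S = ball (0 :: 'e^'i) \<delta>"
  have S: "open S" by (simp add: S_def)
  have Kn: "norm (K s x) < 1" if "s \<in> S" "x \<in> V" for s x
  proof -
    have "norm (\<rho> x *\<^sub>R pert s (x - x0)) \<le> 1 * (?C * norm (x - x0) * norm s)"
      unfolding norm_scaleR using \<rho>(2,3)[of x] by (intro mult_mono pert_const(3)) auto
    also have "\<dots> \<le> 1 * (?C * R * \<delta>)"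
      using that R(1) pert_const(1) by (intro mult_left_mono mult_mono) (auto simp: S_def V_def dist_norm norm_minus_commute)
    also have "\<dots> = 1 / 2" using R(1) pert_const(1) by (simp add: \<delta>_def)
    finally have "norm (\<rho> x *\<^sub>R pert s (x - x0)) \<le> 1 / 2" .
    then show ?thesis unfolding K_def using norm_triangle_ineq[of "K0 x" "\<rho> x *\<^sub>R pert s (x - x0)"] K0(1)[OF that(2)] by linarith
  qed
  have Kanti: "K s x (J0 u) = - J0 (K s x u)" if "x \<in> V" for s x u
    using K0(2)[OF that] by (simp add: K_def blinfun.add_left blinfun.scaleR_left blinfun.add_right blinfun.scaleR_right pert_apply pv_simps(1-8))
  define F where "F s x = (if x \<in> V then conj_acs J0 (K s x) else M x)" for s x
  have F_off: "F s x = M x" if "x \<notin> ball x0 (3 * R / 4)" for s x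
    using that \<rho>(5)[OF that] K0(3) by (simp add: F_def K_def)
  have sq: "F s x (F s x u) = - u" if "s \<in> S" "x \<in> U" for s x u
    using conj_acs(1)[OF J0 Kanti Kn] U(3) that by (simp add: F_def)
  have oSV: "open (S \<times> V)" by (intro open_Times S V)
  have sfst: "smooth_on (S \<times> V) fst" "smooth_on (S \<times> V) snd"
    by (intro smooth_on_linear oSV bounded_linear_fst bounded_linear_snd)+
  have sub: "snd ` (S \<times> V) \<subseteq> V" by auto
  have sK: "smooth_on (S \<times> V) (\<lambda>z. K (fst z) (snd z))"
    unfolding K_def
    by (intro smooth_on_add smooth_on_scaleR smooth_on_bilinear[OF pert_bilinear] smooth_on_diff smooth_on_const oSV sfst
        smooth_on_compose[OF oSV V(1) sub sfst(2) sK0] smooth_on_compose[OF oSV open_UNIV _ sfst(2) \<rho>(1)] subset_UNIV)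
  have sF: "smooth_on (S \<times> U) (\<lambda>(s, x). F s x)"
  proof (rule smooth_on_local, safe)
    fix s x assume s: "s \<in> S" and x: "x \<in> U"
    show "\<exists>T. open T \<and> (s, x) \<in> T \<and> smooth_on T (\<lambda>(s, x). F s x)"
    proof (cases "x \<in> V")
      case True
      have "smooth_on (S \<times> V) (\<lambda>z. conj_acs J0 (K (fst z) (snd z)))"
        by (intro smooth_on_conj_acs oSV smooth_on_const sK) (auto intro: Kn)
      then have "smooth_on (S \<times> V) (\<lambda>(s, x). F s x)"
        by (rule smooth_on_cong[OF oSV, rotated]) (auto simp: F_def)
      then show ?thesis using oSV s True by blast
    next
      case False
      let ?W = "U - cball x0 (3 * R / 4)"
      have W: "open ?W" using U(1) by auto
      have oSW: "open (S \<times> ?W)" by (intro open_Times S W)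
      have "smooth_on (S \<times> ?W) (\<lambda>z. M (snd z))"
        by (rule smooth_on_compose[OF oSW U(1) _ smooth_on_linear[OF oSW bounded_linear_snd] U(2)]) auto
      then have "smooth_on (S \<times> ?W) (\<lambda>(s, x). F s x)"
        by (rule smooth_on_cong[OF oSW, rotated]) (auto intro!: F_off[symmetric])
      moreover have "x \<in> ?W" using False x R(1) by (auto simp: V_def)
      ultimately show ?thesis using oSW s by blast
    qed
  qed
  have F0: "F 0 x = M x" if "x \<in> U" for x
    using K0(3) bounded_bilinear.zero_left[OF pert_bilinear] by (simp add: F_def K_def)
  define B where "B = ball x0 (5 * R / 8)"
  have B: "open B" "B \<subseteq> V" "cball x0 (R / 2) \<subseteq> B" using R(1) by (auto simp: B_def V_def)
  define \<Phi> where "\<Phi> s x = frame_torsion K0 x + 4 *\<^sub>R s + rest K0 x (x - x0) s" for s x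
  have tor: "frame_torsion (\<lambda>y. cay J0 (F s y)) x = \<Phi> s x" if s: "s \<in> S" and x: "x \<in> B" for s x
  proof -
    have xV: "x \<in> V" using x B by blast
    have c: "cay J0 (F s y) = K s y" if "y \<in> V" for y
      using conj_acs(3)[OF J0 Kanti[OF that] Kn[OF s that]] that by (simp add: F_def)
    have "torsion J0 (\<lambda>y. cay J0 (F s y)) x u w = torsion J0 (K s) x u w" for u w
      by (rule torsion_cong[OF V(1) xV c])
    then have "frame_torsion (\<lambda>y. cay J0 (F s y)) x = frame_torsion (K s) x"
      unfolding frame_torsion_def by simp
    also have "\<dots> = \<Phi> s x" unfolding \<Phi>_def
    proof (rule frame_torsion_pert)
      show hK: "(K0 has_derivative frechet_derivative K0 (at x)) (at x)" by (rule smooth_on_has_derivative[OF sK0 xV])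
      show "K0 x (J0 u) = - J0 (K0 x u)" for u by (rule K0(2)[OF xV])
      have "((\<lambda>y. pert s (y - x0)) has_derivative (\<lambda>\<xi>. pert s (\<xi> - 0))) (at x)"
        by (intro bounded_linear.has_derivative[OF bounded_bilinear.bounded_linear_right[OF pert_bilinear]] derivative_intros)
      then have "((\<lambda>y. K0 y + pert s (y - x0)) has_derivative (\<lambda>\<xi>. frechet_derivative K0 (at x) \<xi> + pert s \<xi>)) (at x)"
        using has_derivative_add[OF hK] by simp
      then show "(K s has_derivative (\<lambda>\<xi>. frechet_derivative K0 (at x) \<xi> + pert s \<xi>)) (at x)"
        by (rule has_derivative_transform_within_open[OF _ B(1) x]) (use \<rho>(4) in \<open>auto simp: K_def B_def\<close>)
      show "K s x = K0 x + pert s (x - x0)" using \<rho>(4)[of x] x by (simp add: K_def B_def)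
    qed
    finally show ?thesis .
  qed
  have mono: "3 * norm (s - s') \<le> norm (\<Phi> s x - \<Phi> s' x)" if x: "x \<in> cball x0 (R / 2)" for s s' x
  proof -
    have xV: "x \<in> V" using x B by blast
    have hK: "(K0 has_derivative frechet_derivative K0 (at x)) (at x)" by (rule smooth_on_has_derivative[OF sK0 xV])
    have N0: "Dnorm K0 x \<ge> 0" unfolding Dnorm_def by (simp add: sum_nonneg)
    have "norm (rest K0 x (x - x0) (s - s')) \<le> ?C * norm (x - x0) * Dnorm K0 x * norm (s - s')"
      by (rule pert_const(2)) (use hK in \<open>auto simp: differentiable_def\<close>)
    also have "\<dots> \<le> ?C * R * Dnorm K0 x * norm (s - s')"
      using x R(1) pert_const(1) N0 by (intro mult_right_mono mult_left_mono) (auto simp: dist_norm norm_minus_commute)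
    also have "\<dots> \<le> 1 * norm (s - s')"
    proof (intro mult_right_mono)
      have "x \<in> cball x0 R" using xV V by blast
      then show "?C * R * Dnorm K0 x \<le> 1" using tame unfolding tame_def K0_def by force
    qed simp
    finally have 1: "norm (rest K0 x (x - x0) (s - s')) \<le> norm (s - s')" by simp
    have "\<Phi> s x - \<Phi> s' x = 4 *\<^sub>R (s - s') + rest K0 x (x - x0) (s - s')"
      using rest_linear[OF hK] by (simp add: \<Phi>_def algebra_simps)
    then have "norm (\<Phi> s x - \<Phi> s' x) \<ge> norm (4 *\<^sub>R (s - s')) - norm (rest K0 x (x - x0) (s - s'))"
      using norm_diff_ineq by metis
    then show ?thesis using 1 by simp
  qed
  have sp: "smooth_on (S \<times> V) (\<lambda>z. pv (fst z) (snd z - x0) u)" for u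
    unfolding pert_apply[symmetric]
    by (intro smooth_on_blinfun_apply smooth_on_bilinear[OF pert_bilinear] smooth_on_diff smooth_on_const oSV sfst)
  have sK0': "smooth_on (S \<times> V) (\<lambda>z. K0 (snd z))" by (rule smooth_on_compose[OF oSV V(1) sub sfst(2) sK0])
  have s\<Phi>: "smooth_on (S \<times> V) (\<lambda>z. \<Phi> (fst z) (snd z))"
  proof (rule smooth_on_vec[OF oSV])
    fix i
    have l: "smooth_on (S \<times> V) (\<lambda>z. fst z $ i)"
      using smooth_on_linear_comp[OF bounded_linear_vec_nth oSV sfst(1)] .
    show "smooth_on (S \<times> V) (\<lambda>z. \<Phi> (fst z) (snd z) $ i)"
      unfolding \<Phi>_def frame_torsion_def rest_def torsion_def Let_def vector_add_component vec_lambda_beta vector_scaleR_component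
      by (intro smooth_on_add smooth_on_diff smooth_on_scaleR smooth_on_const smooth_on_blinfun_apply oSV l sp sK0'
          smooth_on_frechet_apply[OF oSV V(1) sK0 sfst(2) sub])
  qed
  let ?Q = "cball (0 :: 'e^'i) (\<delta> / 2) \<times> cball x0 (R / 2)"
  obtain L where L: "\<And>y z. y \<in> ?Q \<Longrightarrow> z \<in> ?Q \<Longrightarrow> norm (\<Phi> (fst y) (snd y) - \<Phi> (fst z) (snd z)) \<le> L * norm (y - z)"
  proof (rule smooth_on_Lipschitz[OF oSV s\<Phi>, of ?Q])
    show "?Q \<subseteq> S \<times> V" using \<delta> B by (auto simp: S_def)
    show "compact ?Q" by (intro compact_Times compact_cball)
    show "convex ?Q" by (intro convex_Times convex_cball)
  qed blast
  have "negligible {s \<in> ball 0 (\<delta> / 2). \<exists>x\<in>cball x0 (R / 2). \<Phi> s x \<in> D}"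
  proof (rule negligible_bad_parameters[OF D, of 3])
    show "3 * norm (s - s') \<le> norm (\<Phi> s x - \<Phi> s' x)" if "x \<in> cball x0 (R / 2)" for s s' x using mono[OF that] .
    show "norm (\<Phi> s x - \<Phi> s x') \<le> L * norm (x - x')" if "s \<in> ball 0 (\<delta> / 2)" "x \<in> cball x0 (R / 2)" "x' \<in> cball x0 (R / 2)" for s x x'
      using L[of "(s, x)" "(s, x')"] that by (simp add: norm_Pair)
  qed simp
  moreover have "{s \<in> ball 0 (\<delta> / 2). \<exists>x\<in>cball x0 (R / 2). frame_torsion (\<lambda>y. cay J0 (F s y)) x \<in> D} =
     {s \<in> ball 0 (\<delta> / 2). \<exists>x\<in>cball x0 (R / 2). \<Phi> s x \<in> D}"
  proof -
    have "s \<in> S" if "s \<in> ball 0 (\<delta> / 2)" for s using that \<delta> by (auto simp: S_def)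
    then show ?thesis using tor B(3) by (metis (no_types, lifting) subsetD)
  qed
  ultimately have neg: "negligible {s \<in> ball 0 (\<delta> / 2). \<exists>x\<in>cball x0 (R / 2). frame_torsion (\<lambda>y. cay J0 (F s y)) x \<in> D}" by simp
  have half: "ball 0 (\<delta> / 2) \<subseteq> S" using \<delta> by (auto simp: S_def)
  show thesis
  proof (rule that[of "\<delta> / 2" F])
    show "\<delta> / 2 > 0" using \<delta> by simp
    show "smooth_on (ball 0 (\<delta> / 2) \<times> U) (\<lambda>(s, x). F s x)" by (rule smooth_on_subset[OF sF]) (use half in auto)
    show "F s x (F s x u) = - u" if "s \<in> ball 0 (\<delta> / 2)" "x \<in> U" for s x u using sq half that by blast
    show "F s x = M x" if "x \<in> U" "x \<notin> cball x0 R" for s x by (rule F_off) (use that(2) R(1) in auto)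
    show "F 0 x = M x" if "x \<in> U" for x by (rule F0[OF that])
  qed (rule neg)
qed

text \<open>Both conditions are strict and depend continuously on the 1-jet of the structure at the points of a compact ball, so the
  tube lemma applies.\<close>

lemma tame_open:
  fixes F :: "'s::euclidean_space \<Rightarrow> 'e \<Rightarrow> 'e \<Rightarrow>\<^sub>L 'e"
  assumes S: "open S" "0 \<in> S" and U: "open U" and F: "smooth_on (S \<times> U) (\<lambda>(s, x). F s x)"
    and sq: "\<And>s x u. s \<in> S \<Longrightarrow> x \<in> U \<Longrightarrow> F s x (F s x u) = - u"
    and R: "cball x0 R \<subseteq> U" "R > 0" and tame: "tame x0 R (F 0)"
  shows "\<exists>\<delta>>0. \<forall>s\<in>ball 0 \<delta>. tame x0 R (F s)"
    and "closed D \<Longrightarrow> (\<And>x. x \<in> cball x0 (R / 2) \<Longrightarrow> frame_torsion (\<lambda>y. cay J0 (F 0 y)) x \<notin> D) \<Longrightarrow>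
      \<exists>\<delta>>0. \<forall>s\<in>ball 0 \<delta>. \<forall>x\<in>cball x0 (R / 2). frame_torsion (\<lambda>y. cay J0 (F s y)) x \<notin> D"
proof -
  define N where "N z = norm J0 * norm ((\<lambda>(s, x). F s x) z - J0)" for z
  have oSU: "open (S \<times> U)" by (intro open_Times S U)
  have cN: "continuous_on (S \<times> U) N"
    unfolding N_def using smooth_on_imp_continuous_on[OF F] by (intro continuous_intros)
  define W where "W = (S \<times> U) \<inter> N -` {..<1 / 4}"
  have W: "open W" unfolding W_def by (rule continuous_open_preimage[OF cN oSU]) simp
  have WS: "W \<subseteq> S \<times> U" by (auto simp: W_def)
  define A where "A z = cay J0 (F (fst z) (snd z))" for z
  have sA: "smooth_on W A"
    unfolding A_def
  proof (rule smooth_on_cay[OF W smooth_on_const[OF W]])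
    show "smooth_on W (\<lambda>z. F (fst z) (snd z))" using smooth_on_subset[OF F WS] by (simp add: case_prod_beta')
    fix z assume "z \<in> W"
    then have z: "fst z \<in> S" "snd z \<in> U" "norm J0 * norm (F (fst z) (snd z) - J0) < 1 / 4" by (auto simp: W_def N_def)
    show "blinfun_invertible (F (fst z) (snd z) + J0)"
      by (rule cay(1)[OF J0 sq[OF z(1,2)] less_imp_le[OF z(3)]]) simp
  qed
  have part: "frechet_derivative (\<lambda>y. cay J0 (F (fst z) y)) (at (snd z)) v = frechet_derivative A (at z) (0, v)" if z: "z \<in> W" for z v
  proof -
    have "(A has_derivative frechet_derivative A (at z)) (at (fst z, snd z))" using smooth_on_has_derivative[OF sA z] by simp
    moreover have "((\<lambda>y. (fst z, y)) has_derivative (\<lambda>v. (0, v))) (at (snd z))"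
      by (intro has_derivative_Pair has_derivative_const has_derivative_ident)
    ultimately have "((\<lambda>y. A (fst z, y)) has_derivative (\<lambda>v. frechet_derivative A (at z) (0, v))) (at (snd z))"
      using has_derivative_compose[of "\<lambda>y. (fst z, y)" "\<lambda>v. (0, v)" "snd z" UNIV A "frechet_derivative A (at z)"] by simp
    from fun_cong[OF frechet_derivative_at[OF this], of v] show ?thesis unfolding A_def fst_conv snd_conv by (rule sym)
  qed
  have sid: "smooth_on W (\<lambda>z. z)" by (rule smooth_on_id[OF W])
  have in_W: "(0, x) \<in> W" if "x \<in> cball x0 R" for x
    using that tame S R(1) unfolding tame_def W_def N_def by auto
  have tube: "\<exists>\<delta>>0. \<forall>s\<in>ball 0 \<delta>. \<forall>x\<in>C. (s, x) \<in> O'" if O': "open O'" "compact C" "\<And>x. x \<in> C \<Longrightarrow> (0, x) \<in> O'" for O' :: "('s \<times> 'e) set" and C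
  proof -
    have "{0} \<times> C \<subseteq> O'" using O'(3) by auto
    then obtain X0 where X0: "(0::'s) \<in> X0" "open X0" "X0 \<times> C \<subseteq> O'" using Elementary_Topology.tube_lemma[OF O'(2,1)] by blast
    then obtain \<delta> where \<delta>: "\<delta> > 0" "ball 0 \<delta> \<subseteq> X0" using open_contains_ball by blast
    then show ?thesis using X0(3) by blast
  qed
  define Q where "Q z = pert_const * R * (\<Sum>b\<in>Basis. norm (frechet_derivative A (at z) (0, b)))" for z
  have cQ: "continuous_on W Q"
    unfolding Q_def using smooth_on_imp_continuous_on[OF smooth_on_frechet_derivative[OF sA]] by (intro continuous_intros)
  have Q: "pert_const * R * Dnorm (\<lambda>y. cay J0 (F (fst z) y)) (snd z) = Q z" if "z \<in> W" for z
    by (simp add: Q_def Dnorm_def part[OF that])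
  have oQ: "open (W \<inter> Q -` {..<1})" by (rule continuous_open_preimage[OF cQ W]) simp
  have mQ: "(0, x) \<in> W \<inter> Q -` {..<1}" if x: "x \<in> cball x0 R" for x
  proof -
    have "pert_const * R * Dnorm (\<lambda>y. cay J0 (F 0 y)) x < 1" using bspec[OF tame[unfolded tame_def] x] by blast
    then show ?thesis using in_W[OF x] Q[OF in_W[OF x]] by simp
  qed
  obtain \<delta> where \<delta>: "\<delta> > 0" "\<forall>s\<in>ball 0 \<delta>. \<forall>x\<in>cball x0 R. (s, x) \<in> W \<inter> Q -` {..<1}"
    using tube[OF oQ compact_cball mQ] by blast
  have "tame x0 R (F s)" if "s \<in> ball 0 \<delta>" for s
    unfolding tame_def
  proof
    fix x assume x: "x \<in> cball x0 R"
    have "(s, x) \<in> W" "Q (s, x) < 1" using \<delta>(2) that x by auto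
    then show "norm J0 * norm (F s x - J0) < 1 / 4 \<and> pert_const * R * Dnorm (\<lambda>y. cay J0 (F s y)) x < 1"
      using Q[of "(s, x)"] by (simp add: W_def N_def)
  qed
  then show "\<exists>\<delta>>0. \<forall>s\<in>ball 0 \<delta>. tame x0 R (F s)" using \<delta>(1) by blast
  define \<Psi> where "\<Psi> z = frame_torsion (\<lambda>y. cay J0 (F (fst z) y)) (snd z)" for z
  have "smooth_on W (\<lambda>z. \<Psi> z $ i)" for i
  proof -
    let ?u = "\<epsilon> (fst (\<pi> i))" and ?w = "\<epsilon> (snd (\<pi> i))"
    have a: "smooth_on W (\<lambda>z. frechet_derivative A (at z) (0, u + A z u) w)" for u w
    proof -
      have "smooth_on W (\<lambda>z. (0 :: 's, u + A z u))"
        by (rule smooth_on_linear_comp[OF bounded_linear_Pair[OF bounded_linear_zero bounded_linear_ident] W])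
          (intro smooth_on_add smooth_on_const smooth_on_blinfun_apply sA W)
      then show ?thesis
        by (intro smooth_on_blinfun_apply[OF W] smooth_on_const[OF W] smooth_on_frechet_apply[OF W W sA sid]) auto
    qed
    have "smooth_on W (\<lambda>z. frechet_derivative A (at z) (0, ?u + A z ?u) ?w - frechet_derivative A (at z) (0, J0 ?u + A z (J0 ?u)) (J0 ?w)
      - (frechet_derivative A (at z) (0, ?w + A z ?w) ?u - frechet_derivative A (at z) (0, J0 ?w + A z (J0 ?w)) (J0 ?u)))"
      by (intro smooth_on_diff a W)
    then show ?thesis
      by (rule smooth_on_cong[OF W, rotated]) (simp add: \<Psi>_def frame_torsion_def torsion_def part A_def[symmetric])
  qed
  then have c\<Psi>: "continuous_on W \<Psi>" by (intro smooth_on_imp_continuous_on smooth_on_vec W)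
  assume D: "closed D" and good: "\<And>x. x \<in> cball x0 (R / 2) \<Longrightarrow> frame_torsion (\<lambda>y. cay J0 (F 0 y)) x \<notin> D"
  have oD: "open (W \<inter> \<Psi> -` (- D))" by (rule continuous_open_preimage[OF c\<Psi> W]) (use D in auto)
  have mD: "(0, x) \<in> W \<inter> \<Psi> -` (- D)" if "x \<in> cball x0 (R / 2)" for x
    using in_W[of x] good[OF that] that R(2) by (simp add: \<Psi>_def)
  obtain \<delta> where "\<delta> > 0" "\<forall>s\<in>ball 0 \<delta>. \<forall>x\<in>cball x0 (R / 2). (s, x) \<in> W \<inter> \<Psi> -` (- D)"
    using tube[OF oD compact_cball mD] by blast
  then show "\<exists>\<delta>>0. \<forall>s\<in>ball 0 \<delta>. \<forall>x\<in>cball x0 (R / 2). frame_torsion (\<lambda>y. cay J0 (F s y)) x \<notin> D"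
    by (intro exI[of _ \<delta>]) (auto simp: \<Psi>_def)
qed

end

section \<open>Nearby structures are homotopic\<close>

context smooth_mfd
begin

text \<open>With \<open>K = cay J J'\<close> the path \<open>(1 + tK) J (1 + tK)\<^sup>-\<^sup>1\<close> joins \<open>J\<close> to \<open>J'\<close>. The following description of
  it does not mention charts: \<open>y = K z\<close> is the solution of \<open>(J' + J) y = (J - J') z\<close>.\<close>

definition cayley_path :: "('a \<Rightarrow> 'a tangent \<Rightarrow> 'a tangent) \<Rightarrow> ('a \<Rightarrow> 'a tangent \<Rightarrow> 'a tangent) \<Rightarrow> real \<Rightarrow> 'a \<Rightarrow> 'a tangent \<Rightarrow> 'a tangent" where
  "cayley_path J J' t p v = (THE w. \<exists>z\<in>tangent_space A p. \<exists>y\<in>tangent_space A p.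
     (\<lambda>f. J' p y f + J p y f) = (\<lambda>f. J p z f - J' p z f) \<and> v = (\<lambda>f. z f + t * y f) \<and> w = (\<lambda>f. J p z f - t * J p y f))"

lemma cayley_path_chart:
  assumes J: "almost_complex_structure X A J" and J': "almost_complex_structure X A J'" and c: "c \<in> A" "p \<in> fst c"
    and near: "norm (Jmat A c J (snd c p)) * norm (Jmat A c J' (snd c p) - Jmat A c J (snd c p)) < 1" and t: "\<bar>t\<bar> \<le> 1"
  shows "cayley_path J J' t p (tvec A c p u) =
    tvec A c p (conj_acs (Jmat A c J (snd c p)) (t *\<^sub>R cay (Jmat A c J (snd c p)) (Jmat A c J' (snd c p))) u)"
proof -
  let ?M = "Jmat A c J (snd c p)" and ?M' = "Jmat A c J' (snd c p)"
  let ?K = "cay ?M ?M'"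
  have sq: "?M (?M u) = - u" "?M' (?M' u) = - u" for u
    using acs_Jmat_sq[OF J c(1)] acs_Jmat_sq[OF J' c(1)] c by auto
  note K = cay[OF sq order_refl near]
  have Kt: "norm (t *\<^sub>R ?K) < 1"
  proof -
    have "\<bar>t\<bar> * norm ?K \<le> 1 * norm ?K" using t by (intro mult_right_mono) auto
    then show ?thesis using K(2) near by simp
  qed
  have Kta: "(t *\<^sub>R ?K) (?M u) = - ?M ((t *\<^sub>R ?K) u)" for u
    using K(3) by (simp add: blinfun.scaleR_left blinfun.scaleR_right)
  note inv = blinfun_invertible_one_plus[OF Kt]
  let ?z = "blinfun_inv (id_blinfun + t *\<^sub>R ?K) u"
  have z: "u = ?z + t *\<^sub>R ?K ?z" using blinfun_inv(4)[OF inv, of u] by (simp add: blinfun.add_left blinfun.scaleR_left)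
  have val: "conj_acs ?M (t *\<^sub>R ?K) u = ?M ?z - t *\<^sub>R ?M (?K ?z)"
    using conj_acs(2)[OF sq(1) Kta Kt, of ?z] z K(3)[of ?z] by (simp add: blinfun.scaleR_left)
  have eqK: "?M' (?K z) + ?M (?K z) = ?M z - ?M' z" for z
    using K(4)[of z] K(3)[of z] by (simp add: blinfun.add_right algebra_simps)
  note tv = tvec_add[OF c] tvec_scaleR[OF c] tvec_diff[OF c]
  show ?thesis unfolding cayley_path_def
  proof (rule the_equality)
    have e1: "(\<lambda>f. J' p (tvec A c p (?K ?z)) f + J p (tvec A c p (?K ?z)) f) = (\<lambda>f. J p (tvec A c p ?z) f - J' p (tvec A c p ?z) f)"
      unfolding acs_Jmat[OF J c] acs_Jmat[OF J' c] tv[symmetric] eqK ..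
    have e2: "tvec A c p u = (\<lambda>f. tvec A c p ?z f + t * tvec A c p (?K ?z) f)"
      unfolding tv[symmetric] z[symmetric] ..
    have e3: "tvec A c p (conj_acs ?M (t *\<^sub>R ?K) u) = (\<lambda>f. J p (tvec A c p ?z) f - t * J p (tvec A c p (?K ?z)) f)"
      unfolding acs_Jmat[OF J c] tv[symmetric] val ..
    show "\<exists>z\<in>tangent_space A p. \<exists>y\<in>tangent_space A p. (\<lambda>f. J' p y f + J p y f) = (\<lambda>f. J p z f - J' p z f) \<and>
       tvec A c p u = (\<lambda>f. z f + t * y f) \<and> tvec A c p (conj_acs ?M (t *\<^sub>R ?K) u) = (\<lambda>f. J p z f - t * J p y f)"
      using e1 e2 e3 tvec_in[OF c] by (intro bexI[of _ "tvec A c p ?z"] bexI[of _ "tvec A c p (?K ?z)"]) auto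
    fix w assume "\<exists>z\<in>tangent_space A p. \<exists>y\<in>tangent_space A p. (\<lambda>f. J' p y f + J p y f) = (\<lambda>f. J p z f - J' p z f) \<and>
       tvec A c p u = (\<lambda>f. z f + t * y f) \<and> w = (\<lambda>f. J p z f - t * J p y f)"
    then obtain zv yv where zy: "zv \<in> tangent_space A p" "yv \<in> tangent_space A p"
      "(\<lambda>f. J' p yv f + J p yv f) = (\<lambda>f. J p zv f - J' p zv f)" "tvec A c p u = (\<lambda>f. zv f + t * yv f)" "w = (\<lambda>f. J p zv f - t * J p yv f)"
      by blast
    obtain z' where z': "zv = tvec A c p z'" by (rule tangent_is_tvec[OF c zy(1)])
    obtain y' where y': "yv = tvec A c p y'" by (rule tangent_is_tvec[OF c zy(2)])
    have 1: "?M' y' + ?M y' = ?M z' - ?M' z'"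
      using zy(3) unfolding z' y' acs_Jmat[OF J c] acs_Jmat[OF J' c] tv[symmetric] by (rule tvec_inj[OF c])
    have "(?M' + ?M) y' = (?M' + ?M) (?K z')" using 1 eqK[of z'] by (simp add: blinfun.add_left)
    then have y: "y' = ?K z'" using blinfun_inv(3)[OF K(1)] by metis
    have 2: "u = z' + t *\<^sub>R y'"
      using zy(4) unfolding z' y' tv[symmetric] by (rule tvec_inj[OF c])
    have "(id_blinfun + t *\<^sub>R ?K) z' = u" using 2 y by (simp add: blinfun.add_left blinfun.scaleR_left)
    then have z: "z' = ?z" using blinfun_inv(3)[OF inv, of z'] by simp
    show "w = tvec A c p (conj_acs ?M (t *\<^sub>R ?K) u)"
      unfolding zy(5) z' y' acs_Jmat[OF J c] tv[symmetric] val y z ..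
  qed
qed

text \<open>The hypothesis makes the Cayley transform exist with norm below \<open>1\<close>, so \<open>1 + tK\<close> is invertible for \<open>0 \<le> t \<le> 1\<close>. Joint
  continuity is checked over the open sets of a cover by charts and then pasted.\<close>

lemma homotopic_of_near:
  assumes J: "almost_complex_structure X A J" and J': "almost_complex_structure X A J'"
    and near: "\<And>p. p \<in> topspace X \<Longrightarrow> \<exists>c\<in>A. p \<in> fst c \<and>
      norm (Jmat A c J (snd c p)) * norm (Jmat A c J' (snd c p) - Jmat A c J (snd c p)) < 1"
  shows "homotopic_acs X A J J'"
proof -
  let ?H = "cayley_path J J'"
  have loc: "\<exists>c\<in>A. \<exists>T. p \<in> fst c \<and> open T \<and> snd c p \<in> T \<and> T \<subseteq> cimg c \<and>
     (\<forall>x\<in>T. norm (Jmat A c J x) * norm (Jmat A c J' x - Jmat A c J x) < 1)" if "p \<in> topspace X" for p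
  proof -
    obtain c where c: "c \<in> A" "p \<in> fst c" "norm (Jmat A c J (snd c p)) * norm (Jmat A c J' (snd c p) - Jmat A c J (snd c p)) < 1"
      using near \<open>p \<in> topspace X\<close> by blast
    let ?N = "\<lambda>x. norm (Jmat A c J x) * norm (Jmat A c J' x - Jmat A c J x)"
    have "continuous_on (cimg c) ?N"
      by (intro continuous_intros smooth_on_imp_continuous_on acs_Jmat_smooth J J' c)
    then have "open (cimg c \<inter> ?N -` {..<1})" by (rule continuous_open_preimage[OF _ chart(2)[OF c(1)]]) simp
    then show ?thesis using c by (intro bexI[OF _ c(1)] exI[of _ "cimg c \<inter> ?N -` {..<1}"]) auto
  qed
  have Mc: "smooth_on T (\<lambda>x. cay (Jmat A c J x) (Jmat A c J' x))" "\<And>x. x \<in> T \<Longrightarrow> norm (cay (Jmat A c J x) (Jmat A c J' x)) < 1"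
    "\<And>x u. x \<in> T \<Longrightarrow> cay (Jmat A c J x) (Jmat A c J' x) (Jmat A c J x u) = - Jmat A c J x (cay (Jmat A c J x) (Jmat A c J' x) u)"
    if c: "c \<in> A" and T: "open T" "T \<subseteq> cimg c" and n: "\<forall>x\<in>T. norm (Jmat A c J x) * norm (Jmat A c J' x - Jmat A c J x) < 1" for c T
  proof -
    note cy = cay[OF acs_Jmat_sq[OF J c] acs_Jmat_sq[OF J' c] order_refl n[rule_format]]
    have 1: "x \<in> cimg c" if "x \<in> T" for x using T that by blast
    show "smooth_on T (\<lambda>x. cay (Jmat A c J x) (Jmat A c J' x))"
      by (rule smooth_on_cay[OF T(1) smooth_on_subset[OF acs_Jmat_smooth[OF J c] T(2)] smooth_on_subset[OF acs_Jmat_smooth[OF J' c] T(2)]])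
        (use cy(1) 1 in blast)
    show "norm (cay (Jmat A c J x) (Jmat A c J' x)) < 1" if "x \<in> T" for x
      using cy(2)[OF 1[OF that] 1[OF that] that] n that by fastforce
    show "cay (Jmat A c J x) (Jmat A c J' x) (Jmat A c J x u) = - Jmat A c J x (cay (Jmat A c J x) (Jmat A c J' x) u)" if "x \<in> T" for x u
      by (rule cy(3)[OF 1[OF that] 1[OF that] that])
  qed
  have acs: "almost_complex_structure X A (?H t)" if t: "t \<in> {0..1}" for t
  proof (rule acsI)
    fix p assume "p \<in> topspace X"
    then obtain c T where c: "c \<in> A" "p \<in> fst c" "open T" "snd c p \<in> T" "T \<subseteq> cimg c"
      and n: "\<forall>x\<in>T. norm (Jmat A c J x) * norm (Jmat A c J' x - Jmat A c J x) < 1" using loc by blast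
    note m = Mc[OF c(1,3,5) n]
    let ?M = "\<lambda>x. conj_acs (Jmat A c J x) (t *\<^sub>R cay (Jmat A c J x) (Jmat A c J' x))"
    have nt: "norm (t *\<^sub>R cay (Jmat A c J x) (Jmat A c J' x)) < 1" if "x \<in> T" for x
    proof -
      have "\<bar>t\<bar> * norm (cay (Jmat A c J x) (Jmat A c J' x)) \<le> 1 * norm (cay (Jmat A c J x) (Jmat A c J' x))"
        using t by (intro mult_right_mono) auto
      then show ?thesis using m(2)[OF that] by simp
    qed
    have "smooth_on T ?M"
      by (intro smooth_on_conj_acs smooth_on_scaleR smooth_on_const c m(1) nt smooth_on_subset[OF acs_Jmat_smooth[OF J c(1)] c(5)])
    moreover have "?M x (?M x u) = - u \<and> ?H t (cinv c x) (tvec A c (cinv c x) u) = tvec A c (cinv c x) (?M x u)" if x: "x \<in> T" for x u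
    proof
      have xc: "x \<in> cimg c" using x c by blast
      show "?M x (?M x u) = - u"
        by (rule conj_acs(1)[OF acs_Jmat_sq[OF J c(1) xc] _ nt[OF x]]) (simp add: m(3)[OF x] blinfun.scaleR_left blinfun.scaleR_right)
      show "?H t (cinv c x) (tvec A c (cinv c x) u) = tvec A c (cinv c x) (?M x u)"
        using cayley_path_chart[OF J J' c(1) cinv_in[OF xc], of t u] n x t xc by simp
    qed
    ultimately show "\<exists>c\<in>A. \<exists>T M. p \<in> fst c \<and> open T \<and> snd c p \<in> T \<and> T \<subseteq> cimg c \<and> smooth_on T M \<and>
     (\<forall>x\<in>T. \<forall>u. blinfun_apply (M x) (blinfun_apply (M x) u) = - u \<and>
        ?H t (cinv c x) (tvec A c (cinv c x) u) = tvec A c (cinv c x) (blinfun_apply (M x) u))"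
      using c by (intro bexI[OF _ c(1)] exI[of _ T] exI[of _ ?M]) blast
  qed
  have ends: "?H 0 p v = J p v \<and> ?H 1 p v = J' p v" if p: "p \<in> topspace X" and v: "v \<in> tangent_space A p" for p v
  proof -
    obtain c where c: "c \<in> A" "p \<in> fst c" "norm (Jmat A c J (snd c p)) * norm (Jmat A c J' (snd c p) - Jmat A c J (snd c p)) < 1"
      using near p by blast
    have x: "snd c p \<in> cimg c" using c by simp
    obtain u where u: "v = tvec A c p u" by (rule tangent_is_tvec[OF c(1,2) v])
    have "conj_acs (Jmat A c J (snd c p)) 0 u = Jmat A c J (snd c p) u"
      using conj_acs(2)[OF acs_Jmat_sq[OF J c(1) x], of 0 u] by simp
    then show ?thesis
      unfolding u using cayley_path_chart[OF J J' c, of 0 u] cayley_path_chart[OF J J' c, of 1 u]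
        acs_Jmat[OF J c(1,2)] acs_Jmat[OF J' c(1,2)]
        conj_acs_cay[OF acs_Jmat_sq[OF J c(1) x] acs_Jmat_sq[OF J' c(1) x] c(3)] by simp
  qed
  have cont: "continuous_map (prod_topology (top_of_set {0..1}) X) euclideanreal (\<lambda>(t, p). ?H t p (V p) f)"
    if V: "vector_field X A V" and f: "smooth_fun A f" for V f
  proof -
    have "\<exists>W. openin X W \<and> p \<in> W \<and> continuous_map (subtopology (prod_topology (top_of_set {0..1}) X) ({0..1} \<times> W)) euclideanreal (\<lambda>(t, p). ?H t p (V p) f)"
      if p: "p \<in> topspace X" for p
    proof -
      obtain c T where c: "c \<in> A" "p \<in> fst c" "open T" "snd c p \<in> T" "T \<subseteq> cimg c"
        and n: "\<forall>x\<in>T. norm (Jmat A c J x) * norm (Jmat A c J' x - Jmat A c J x) < 1" using loc[OF p] by blast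
      note m = Mc[OF c(1,3,5) n]
      let ?W = "{q \<in> fst c. snd c q \<in> T}"
      have W: "openin X ?W" "p \<in> ?W" using openin_pullback[OF c(1,3)] c by auto
      let ?K = "\<lambda>x. cay (Jmat A c J x) (Jmat A c J' x)"
      define G where "G z = (\<Sum>b\<in>Basis. (conj_acs (Jmat A c J (snd z)) (fst z *\<^sub>R ?K (snd z)) (vcoord c V (snd z)) \<bullet> b) *
         frechet_derivative (f \<circ> cinv c) (at (snd z)) b)" for z :: "real \<times> 'e"
      let ?O = "(UNIV \<times> T) \<inter> (\<lambda>z. norm (fst z *\<^sub>R ?K (snd z))) -` {..<1}"
      have oUT: "open ((UNIV :: real set) \<times> T)" by (intro open_Times open_UNIV c)
      have sK: "smooth_on ((UNIV :: real set) \<times> T) (\<lambda>z. ?K (snd z))"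
        by (rule smooth_on_compose[OF oUT c(3) _ smooth_on_linear[OF oUT bounded_linear_snd] m(1)]) auto
      have stK: "smooth_on ((UNIV :: real set) \<times> T) (\<lambda>z. fst z *\<^sub>R ?K (snd z))"
        by (intro smooth_on_scaleR oUT sK smooth_on_linear[OF _ bounded_linear_fst])
      have O: "open ?O"
        by (rule continuous_open_preimage[OF _ oUT]) (intro continuous_on_norm smooth_on_imp_continuous_on[OF stK], simp)
      have comp: "smooth_on ?O (\<lambda>z. h (snd z))" if "smooth_on T h" for h :: "'e \<Rightarrow> 'b::real_normed_vector"
        by (rule smooth_on_compose[OF O c(3) _ smooth_on_linear[OF O bounded_linear_snd] that]) auto
      have "smooth_on ?O G"
        unfolding G_def
      proof (intro smooth_on_sum smooth_on_mult smooth_on_inner_left smooth_on_blinfun_apply smooth_on_conj_acs O)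
        show "smooth_on ?O (\<lambda>z. Jmat A c J (snd z))" by (rule comp[OF smooth_on_subset[OF acs_Jmat_smooth[OF J c(1)] c(5)]])
        show "smooth_on ?O (\<lambda>z. fst z *\<^sub>R ?K (snd z))" by (rule smooth_on_subset[OF stK]) auto
        show "smooth_on ?O (\<lambda>z. vcoord c V (snd z))" by (rule comp[OF smooth_on_subset[OF vcoord_smooth[OF V c(1)] c(5)]])
        show "smooth_on ?O (\<lambda>z. frechet_derivative (f \<circ> cinv c) (at (snd z)) b)" for b
          by (rule comp[OF smooth_on_subset[OF smooth_on_frechet_derivative[OF smooth_funD[OF f c(1)]] c(5)]])
      qed auto
      then have cG: "continuous_on ({0..1} \<times> T) G"
      proof (rule continuous_on_subset[OF smooth_on_imp_continuous_on])
        show "{0..1} \<times> T \<subseteq> ?O"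
        proof
          fix z assume "z \<in> {0..1::real} \<times> T"
          then obtain t x where z: "z = (t, x)" and t: "t \<in> {0..1}" and x: "x \<in> T" by blast
          have "\<bar>t\<bar> * norm (?K x) \<le> 1 * norm (?K x)" using t by (intro mult_right_mono) auto
          then show "z \<in> ?O" using m(2)[OF x] x by (simp add: z)
        qed
      qed
      have val: "?H t q (V q) f = G (t, snd c q)" if "t \<in> {0..1}" "q \<in> ?W" for t q
      proof -
        have q: "q \<in> fst c" "snd c q \<in> T" using that by auto
        have "?H t q (V q) f = ?H t q (tvec A c q (vcoord c V (snd c q))) f" using tvec_vcoord[OF V c(1) q(1)] by simp
        also have "\<dots> = tvec A c q (conj_acs (Jmat A c J (snd c q)) (t *\<^sub>R ?K (snd c q)) (vcoord c V (snd c q))) f"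
          using cayley_path_chart[OF J J' c(1) q(1), of t] n q(2) that(1) by simp
        also have "\<dots> = G (t, snd c q)" unfolding tvec_apply_Basis[OF c(1) q(1) f] G_def by simp
        finally show ?thesis .
      qed
      let ?P = "subtopology (prod_topology (top_of_set {0..1::real}) X) ({0..1} \<times> ?W)"
      have tP: "topspace ?P = {0..1} \<times> ?W"
        using W(1)[THEN openin_subset] by auto
      have c1: "continuous_map ?P euclideanreal fst"
        by (intro continuous_map_from_subtopology) (use continuous_map_fst[of "top_of_set {0..1}" X] continuous_map_in_subtopology in blast)
      have c2: "continuous_map ?P euclidean (\<lambda>z. snd c (snd z))"
      proof -
        have "continuous_map (subtopology X (fst c)) euclidean (snd c)"
          using homeomorphic_imp_continuous_map[OF chart(3)[OF c(1)]] continuous_map_in_subtopology by blast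
        moreover have "continuous_map ?P (subtopology X (fst c)) snd"
          unfolding continuous_map_in_subtopology
          by (intro conjI continuous_map_from_subtopology continuous_map_snd) (auto simp: tP)
        ultimately show ?thesis using continuous_map_compose[of ?P _ snd] by (auto simp: o_def)
      qed
      have "continuous_map ?P (prod_topology euclideanreal euclidean) (\<lambda>z. (fst z, snd c (snd z)))"
        by (rule continuous_map_pairedI[OF c1 c2])
      then have "continuous_map ?P (top_of_set ({0..1} \<times> T)) (\<lambda>z. (fst z, snd c (snd z)))"
        by (auto simp: continuous_map_in_subtopology tP euclidean_product_topology)
      moreover have "continuous_map (top_of_set ({0..1} \<times> T)) euclideanreal G" using cG by simp
      ultimately have "continuous_map ?P euclideanreal (G \<circ> (\<lambda>z. (fst z, snd c (snd z))))" by (rule continuous_map_compose)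
      then have "continuous_map ?P euclideanreal (\<lambda>(t, p). ?H t p (V p) f)"
        by (rule continuous_map_eq) (auto simp: tP val)
      then show ?thesis using W by blast
    qed
    then have "\<exists>W. \<forall>p\<in>topspace X. openin X (W p) \<and> p \<in> W p \<and>
       continuous_map (subtopology (prod_topology (top_of_set {0..1}) X) ({0..1} \<times> W p)) euclideanreal (\<lambda>(t, p). ?H t p (V p) f)"
      by (intro bchoice ballI)
    then obtain W where "\<forall>p\<in>topspace X. openin X (W p) \<and> p \<in> W p \<and>
       continuous_map (subtopology (prod_topology (top_of_set {0..1}) X) ({0..1} \<times> W p)) euclideanreal (\<lambda>(t, p). ?H t p (V p) f)" ..
    note W = bspec[OF this]
    show ?thesis
    proof (rule pasting_lemma[where T = "\<lambda>p. {0..1} \<times> W p" and I = "topspace X" and f = "\<lambda>_. \<lambda>(t, p). ?H t p (V p) f"])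
      show "openin (prod_topology (top_of_set {0..1}) X) ({0..1} \<times> W p)" if "p \<in> topspace X" for p
        using W[OF that] openin_prod_Times_iff[of "top_of_set {0..1}" X "{0..1}" "W p"] by auto
      show "\<exists>j. j \<in> topspace X \<and> x \<in> {0..1} \<times> W j \<and> (\<lambda>(t, p). ?H t p (V p) f) x = (\<lambda>(t, p). ?H t p (V p) f) x"
        if "x \<in> topspace (prod_topology (top_of_set {0..1}) X)" for x
        using that W by (auto simp: mem_Times_iff)
    qed (use W in auto)
  qed
  show ?thesis unfolding homotopic_acs_def
    by (intro exI[of _ ?H] conjI ballI allI impI acs cont ends[THEN conjunct1] ends[THEN conjunct2])
qed

subsection \<open>Exhaustion by compact sets\<close>

text \<open>The first two sets are empty so that the shells \<open>C (m + 2) - interior (C (m + 1))\<close> cover everything from \<open>m = 0\<close> on.\<close>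

lemma exhaustion:
  obtains C :: "nat \<Rightarrow> 'a set" where "\<And>m. compactin X (C m)" "\<And>m. C m \<subseteq> X interior_of C (Suc m)"
    "topspace X = (\<Union>m. C m)" "C 0 = {}" "C 1 = {}"
proof -
  define \<U> where "\<U> = {O'. openin X O' \<and> (\<exists>K. compactin X K \<and> O' \<subseteq> K)}"
  have "\<Union>\<U> = topspace X"
  proof
    show "\<Union>\<U> \<subseteq> topspace X" unfolding \<U>_def using openin_subset by fastforce
    show "topspace X \<subseteq> \<Union>\<U>"
    proof
      fix p assume p: "p \<in> topspace X"
      obtain c where c: "c \<in> A" "p \<in> fst c" using chart_cover[OF p] by blast
      obtain R where R: "R > 0" "cball (snd c p) R \<subseteq> cimg c" using chart(2)[OF c(1)] cmap_in[OF c(2)] open_contains_cball by blast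
      let ?O = "{q \<in> fst c. snd c q \<in> ball (snd c p) R}"
      have "?O \<subseteq> cinv c ` cball (snd c p) R" using mem_cinv_image[OF c(1) R(2)] by auto
      then have "?O \<in> \<U>"
        unfolding \<U>_def using openin_pullback[OF c(1) open_ball] compactin_cinv[OF c(1) compact_cball R(2)] by blast
      moreover have "p \<in> ?O" using c R by simp
      ultimately show "p \<in> \<Union>\<U>" by blast
    qed
  qed
  moreover have "Lindelof_space X" using second_countable second_countable_imp_Lindelof_space by blast
  ultimately obtain \<V> where \<V>: "countable \<V>" "\<V> \<subseteq> \<U>" "\<Union>\<V> = topspace X"
    unfolding Lindelof_space_def using \<U>_def by (metis (no_types, lifting) mem_Collect_eq)
  define O' where "O' = from_nat_into (insert {} \<V>)"
  have ran: "range O' = insert {} \<V>" unfolding O'_def by (rule range_from_nat_into) (use \<V>(1) in auto)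
  have "O' i \<in> \<U>" for i
  proof -
    have "O' i \<in> insert {} \<V>" using ran by blast
    moreover have "{} \<in> \<U>" unfolding \<U>_def by (rule CollectI, rule conjI[OF openin_empty], rule exI[of _ "{}"]) simp
    ultimately show ?thesis using \<V>(2) by auto
  qed
  then have "\<forall>i. \<exists>K. openin X (O' i) \<and> compactin X K \<and> O' i \<subseteq> K" unfolding \<U>_def by blast
  then obtain K where K: "\<And>i. openin X (O' i)" "\<And>i. compactin X (K i)" "\<And>i. O' i \<subseteq> K i" by metis
  have cov: "topspace X = (\<Union>i. O' i)" using ran \<V>(3) by auto
  define P where "P N = (\<Union>i\<le>N. K i)" for N :: nat
  have P: "compactin X (P N)" for N unfolding P_def by (rule compactin_Union) (use K(2) in auto)
  have next_ex: "\<exists>N'>N. P N \<subseteq> (\<Union>i\<le>N'. O' i)" for N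
  proof -
    have "P N \<subseteq> \<Union>(range O')" using compactin_subset_topspace[OF P[of N]] cov by simp
    then obtain \<F> where F: "finite \<F>" "\<F> \<subseteq> range O'" "P N \<subseteq> \<Union>\<F>"
      using compactinD[OF P[of N], of "range O'"] K(1) by blast
    obtain I where I: "finite I" "\<F> = O' ` I" using finite_subset_image[OF F(1,2)] by blast
    obtain k where k: "\<forall>i\<in>I. i \<le> k" using I(1) finite_nat_set_iff_bounded_le by blast
    have "\<Union>\<F> \<subseteq> (\<Union>i\<le>max k (Suc N). O' i)" unfolding I(2)
    proof (rule UN_mono)
      show "I \<subseteq> {..max k (Suc N)}" using k by (simp add: subset_iff le_max_iff_disj)
    qed simp
    then have "P N \<subseteq> (\<Union>i\<le>max k (Suc N). O' i)" using F(3) by (rule order_trans[rotated])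
    then show ?thesis by (intro exI[of _ "max k (Suc N)"]) auto
  qed
  have "\<exists>g :: nat \<Rightarrow> nat. \<forall>m. True \<and> (g m < g (Suc m) \<and> P (g m) \<subseteq> (\<Union>i\<le>g (Suc m). O' i))"
    by (rule dependent_nat_choice) (use next_ex in auto)
  then obtain g where g: "\<And>m. g m < g (Suc m)" "\<And>m. P (g m) \<subseteq> (\<Union>i\<le>g (Suc m). O' i)" by blast
  have "strict_mono g" using g(1) by (simp add: strict_mono_Suc_iff)
  then have ge: "m \<le> g m" for m by (rule strict_mono_imp_increasing)
  define C where "C m = (if m < 2 then {} else P (g (m - 2)))" for m
  show thesis
  proof (rule that[of C])
    show "compactin X (C m)" for m using P compactin_empty by (simp add: C_def)
    show "C m \<subseteq> X interior_of C (Suc m)" for m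
    proof (cases "m < 2")
      case False
      then have e: "Suc m - 2 = Suc (m - 2)" by simp
      have "(\<Union>i\<le>g (Suc (m - 2)). O' i) \<subseteq> X interior_of P (g (Suc (m - 2)))"
      proof (rule interior_of_maximal)
        show "(\<Union>i\<le>g (Suc (m - 2)). O' i) \<subseteq> P (g (Suc (m - 2)))" unfolding P_def using K(3) by blast
        show "openin X (\<Union>i\<le>g (Suc (m - 2)). O' i)" using K(1) by blast
      qed
      moreover have "C m = P (g (m - 2))" using False by (simp add: C_def)
      moreover have "C (Suc m) = P (g (Suc (m - 2)))" unfolding C_def e using False by simp
      ultimately show ?thesis using g(2)[of "m - 2"] by (metis order_trans)
    qed (simp add: C_def)
    show "topspace X = (\<Union>m. C m)"
    proof
      show "(\<Union>m. C m) \<subseteq> topspace X" using compactin_subset_topspace[OF P] by (auto simp: C_def)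
      show "topspace X \<subseteq> (\<Union>m. C m)"
      proof
        fix p assume "p \<in> topspace X"
        then obtain i where i: "p \<in> O' i" using cov by blast
        then have "p \<in> P (g i)" unfolding P_def using K(3) ge[of i] by blast
        then have "p \<in> C (i + 2)" by (simp add: C_def)
        then show "p \<in> (\<Union>m. C m)" by blast
      qed
    qed
  qed (simp_all add: C_def)
qed

end

section \<open>Perturbing over the whole manifold\<close>

context complex_frame
begin

lemma Dnorm_cong: "open V \<Longrightarrow> x \<in> V \<Longrightarrow> (\<And>y. y \<in> V \<Longrightarrow> K y = K' y) \<Longrightarrow> Dnorm K x = Dnorm K' x"
  unfolding Dnorm_def using frechet_derivative_cong_open[of V x K K'] by simp

lemma tame_cong:
  assumes "open V" "cball x0 R \<subseteq> V" "\<And>x. x \<in> V \<Longrightarrow> M x = M' x"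
  shows "tame x0 R M \<longleftrightarrow> tame x0 R M'"
proof -
  have "Dnorm (\<lambda>y. cay J0 (M y)) x = Dnorm (\<lambda>y. cay J0 (M' y)) x" if "x \<in> cball x0 R" for x
    by (rule Dnorm_cong[OF assms(1)]) (use assms that in auto)
  moreover have "M x = M' x" if "x \<in> cball x0 R" for x using assms that by blast
  ultimately show ?thesis unfolding tame_def by auto
qed

lemma frame_torsion_cong:
  assumes "open V" "x \<in> V" "\<And>x. x \<in> V \<Longrightarrow> M x = M' x"
  shows "frame_torsion (\<lambda>y. cay J0 (M y)) x = frame_torsion (\<lambda>y. cay J0 (M' y)) x"
  unfolding frame_torsion_def using torsion_cong[OF assms(1,2), of "\<lambda>y. cay J0 (M y)" "\<lambda>y. cay J0 (M' y)" J0] assms(3)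
  by (simp add: vec_eq_iff)

text \<open>As the radius shrinks, \<open>M\<close> tends to \<open>J0\<close> while its derivative stays bounded.\<close>

lemma tame_small_ball:
  fixes M :: "'e \<Rightarrow> 'e \<Rightarrow>\<^sub>L 'e"
  assumes U: "open U" "smooth_on U M" "\<And>x u. x \<in> U \<Longrightarrow> M x (M x u) = - u" and x0: "x0 \<in> U" "M x0 = J0"
  shows "\<exists>R>0. \<forall>r. 0 < r \<longrightarrow> r \<le> R \<longrightarrow> tame x0 r M"
proof -
  let ?N = "\<lambda>x. norm J0 * norm (M x - J0)"
  have "continuous_on U ?N" using smooth_on_imp_continuous_on[OF U(2)] by (intro continuous_intros)
  then have oW: "open (U \<inter> ?N -` {..<1 / 4})" by (rule continuous_open_preimage[OF _ U(1)]) simp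
  define W where "W = U \<inter> ?N -` {..<1 / 4}"
  have W: "open W" "x0 \<in> W" "W \<subseteq> U" "\<And>x. x \<in> W \<Longrightarrow> ?N x < 1 / 4" using oW x0 by (auto simp: W_def)
  have sA: "smooth_on W (\<lambda>x. cay J0 (M x))"
  proof (rule smooth_on_cay[OF W(1) smooth_on_const[OF W(1)] smooth_on_subset[OF U(2) W(3)]])
    fix x assume x: "x \<in> W"
    show "blinfun_invertible (M x + J0)"
      by (rule cay(1)[OF J0 U(3)[OF subsetD[OF W(3) x]] less_imp_le[OF W(4)[OF x]]]) simp
  qed
  obtain R1 where R1: "R1 > 0" "cball x0 R1 \<subseteq> W" using W open_contains_cball by blast
  let ?D = "Dnorm (\<lambda>y. cay J0 (M y))"
  have "continuous_on (cball x0 R1) ?D"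
    unfolding Dnorm_def
    by (intro continuous_intros continuous_on_subset[OF smooth_on_imp_continuous_on[OF smooth_on_frechet_derivative[OF sA]] R1(2)])
  then have "bounded (?D ` cball x0 R1)" using compact_continuous_image compact_cball compact_imp_bounded by blast
  then obtain B where B: "\<forall>y\<in>?D ` cball x0 R1. norm y \<le> B" unfolding bounded_iff by blast
  have B': "?D x \<le> \<bar>B\<bar>" if "x \<in> cball x0 R1" for x
  proof -
    have "norm (?D x) \<le> B" using B that by blast
    then show ?thesis by simp
  qed
  define R where "R = min R1 (1 / (2 * pert_const * (\<bar>B\<bar> + 1)))"
  have c: "pert_const > 0" by (rule pert_const(1))
  have "tame x0 r M" if r: "0 < r" "r \<le> R" for r
    unfolding tame_def
  proof
    fix x assume x: "x \<in> cball x0 r"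
    then have x1: "x \<in> cball x0 R1" using r by (auto simp: R_def)
    have "pert_const * r * ?D x \<le> pert_const * r * (\<bar>B\<bar> + 1)" using B'[OF x1] c r by (intro mult_left_mono) auto
    also have "\<dots> \<le> pert_const * (1 / (2 * pert_const * (\<bar>B\<bar> + 1))) * (\<bar>B\<bar> + 1)"
      using r c by (intro mult_right_mono mult_left_mono) (auto simp: R_def)
    also have "\<dots> = 1 / 2"
    proof -
      have "a * (1 / (2 * a * b)) * b = 1 / 2" if "a > 0" "b > 0" for a b :: real using that by (simp add: field_simps)
      from this[OF c, of "\<bar>B\<bar> + 1"] show ?thesis by simp
    qed
    finally show "?N x < 1 / 4 \<and> pert_const * r * ?D x < 1" using W(4) R1(2) x1 by auto
  qed
  moreover have "R > 0" using R1(1) c by (simp add: R_def)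
  ultimately show ?thesis by blast
qed

end

text \<open>A chart, a closed ball in it given by centre and radius, and the constant structure with which the almost complex
  structure is compared there. The structure is to be tame on the whole ball, which makes perturbation possible, and its
  torsion is to avoid the bad set on the half ball.\<close>

type_synonym ('a, 'e) test_ball = "('a, 'e) chart \<times> 'e \<times> real \<times> ('e \<Rightarrow>\<^sub>L 'e)"

text \<open>\<open>D\<close> is the set of torsion components to be avoided: the degenerate families for maximal rank, the origin for nonvanishing.\<close>

locale generic_scheme = smooth_mfd X A
  for X :: "'a topology" and A :: "('a, 'e::euclidean_space) chart set" +
  fixes n :: nat and \<pi> :: "'i::finite \<Rightarrow> nat \<times> nat" and D :: "('e \<Rightarrow>\<^sub>L 'e) \<Rightarrow> ('e^'i) set"
  assumes dim: "DIM('e) = 2 * n" and pi: "inj \<pi>" "fst (\<pi> i) < snd (\<pi> i)" "snd (\<pi> i) < n"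
    and closed_D: "closed (D J0)"
    and thin_D: "complex_frame J0 n \<zeta> \<epsilon> \<pi> \<Longrightarrow> thin TYPE('e) TYPE('e \<times> ('e^'i)) (D J0)"
begin

text \<open>One frame is chosen for each \<open>J0\<close>, so that the conditions on a test ball are determined by the ball.\<close>

definition zeta :: "('e \<Rightarrow>\<^sub>L 'e) \<Rightarrow> nat \<Rightarrow> 'e \<Rightarrow>\<^sub>L complex" where
  "zeta J0 = (SOME \<zeta>. \<exists>\<epsilon>. complex_frame J0 n \<zeta> \<epsilon> \<pi>)"

definition eps :: "('e \<Rightarrow>\<^sub>L 'e) \<Rightarrow> nat \<Rightarrow> 'e" where
  "eps J0 = (SOME \<epsilon>. complex_frame J0 n (zeta J0) \<epsilon> \<pi>)"

lemma frame:
  fixes J0 :: "'e \<Rightarrow>\<^sub>L 'e"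
  assumes "\<And>u. J0 (J0 u) = - u"
  shows "complex_frame J0 n (zeta J0) (eps J0) \<pi>"
proof -
  obtain \<zeta> :: "nat \<Rightarrow> 'e \<Rightarrow>\<^sub>L complex" and \<epsilon> where z: "\<And>k u. \<zeta> k (J0 u) = \<i> * \<zeta> k u"
    "\<And>k l. k < n \<Longrightarrow> l < n \<Longrightarrow> \<zeta> k (\<epsilon> l) = (if k = l then 1 else 0)"
    "\<And>u. u = (\<Sum>k<n. Re (\<zeta> k u) *\<^sub>R \<epsilon> k + Im (\<zeta> k u) *\<^sub>R J0 (\<epsilon> k))"
    by (rule complex_basis[OF assms dim]) (rule that)
  have "complex_frame J0 n \<zeta> \<epsilon> \<pi>"
    unfolding complex_frame_def using assms dim z(1) z(2) pi z(3) by (intro conjI allI impI) auto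
  then have "\<exists>\<zeta> \<epsilon>. complex_frame J0 n \<zeta> \<epsilon> \<pi>" by blast
  from someI_ex[OF this] have "\<exists>\<epsilon>. complex_frame J0 n (zeta J0) \<epsilon> \<pi>" unfolding zeta_def .
  from someI_ex[OF this] show ?thesis unfolding eps_def .
qed

definition valid :: "('a, 'e) test_ball \<Rightarrow> bool" where
  "valid = (\<lambda>(c, x0, R, J0). c \<in> A \<and> R > 0 \<and> cball x0 R \<subseteq> cimg c \<and> (\<forall>u. J0 (J0 u) = - u))"

definition bset :: "('a, 'e) test_ball \<Rightarrow> 'a set" where
  "bset = (\<lambda>(c, x0, R, J0). cinv c ` cball x0 R)"

definition core :: "('a, 'e) test_ball \<Rightarrow> 'a set" where
  "core = (\<lambda>(c, x0, R, J0). {q \<in> fst c. snd c q \<in> ball x0 (R / 2)})"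

definition btame :: "('a, 'e) test_ball \<Rightarrow> ('a \<Rightarrow> 'a tangent \<Rightarrow> 'a tangent) \<Rightarrow> bool" where
  "btame = (\<lambda>(c, x0, R, J0) J. complex_frame.tame J0 (zeta J0) (eps J0) \<pi> x0 R (Jmat A c J))"

definition bgood :: "('a, 'e) test_ball \<Rightarrow> ('a \<Rightarrow> 'a tangent \<Rightarrow> 'a tangent) \<Rightarrow> bool" where
  "bgood = (\<lambda>(c, x0, R, J0) J. \<forall>x\<in>cball x0 (R / 2).
     complex_frame.frame_torsion J0 (eps J0) \<pi> (\<lambda>y. cay J0 (Jmat A c J y)) x \<notin> D J0)"

lemma Jmat_cong_tangent:
  assumes "c \<in> A" "x \<in> cimg c" "\<And>v. v \<in> tangent_space A (cinv c x) \<Longrightarrow> J (cinv c x) v = J' (cinv c x) v"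
  shows "Jmat A c J x = Jmat A c J' x"
  using assms(3)[OF tvec_in[OF assms(1) cinv_in[OF assms(2)]]] by (simp add: Jmat_def)

text \<open>The conditions involve derivatives, so agreement of the structures on an open neighbourhood of the ball is required.\<close>

lemma ball_cong:
  assumes b: "valid b" and W: "openin X W" "bset b \<subseteq> W" "\<And>q. q \<in> W \<Longrightarrow> J q = J' q"
  shows "btame b J \<longleftrightarrow> btame b J'" "bgood b J \<longleftrightarrow> bgood b J'"
proof -
  obtain c x0 R J0 where e: "b = (c, x0, R, J0)" by (cases b)
  have v: "c \<in> A" "R > 0" "cball x0 R \<subseteq> cimg c" "\<And>u. J0 (J0 u) = - u" using b by (auto simp: valid_def e)
  interpret f: complex_frame J0 n "zeta J0" "eps J0" \<pi> by (rule frame[OF v(4)])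
  let ?T = "snd c ` (fst c \<inter> W)"
  have T: "open ?T" by (rule open_image[OF v(1) W(1)])
  have sub: "cball x0 R \<subseteq> ?T"
  proof
    fix x assume x: "x \<in> cball x0 R"
    then have "cinv c x \<in> W" "x \<in> cimg c" using W(2) v(3) by (auto simp: bset_def e)
    then show "x \<in> ?T" by (auto intro!: image_eqI[of _ _ "cinv c x"])
  qed
  have eq: "Jmat A c J x = Jmat A c J' x" if "x \<in> ?T" for x
    by (rule Jmat_cong) (use that W(3) v(1) in auto)
  show "btame b J \<longleftrightarrow> btame b J'" using f.tame_cong[OF T sub eq] by (simp add: btame_def e)
  have "x \<in> ?T" if "x \<in> cball x0 (R / 2)" for x using that sub v(2) by (auto simp: subset_iff)
  then show "bgood b J \<longleftrightarrow> bgood b J'" using f.frame_torsion_cong[OF T _ eq] by (simp add: bgood_def e)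
qed

lemma ex_test_ball:
  assumes J: "almost_complex_structure X A J" and p: "p \<in> topspace X" "openin X W" "p \<in> W"
  obtains b where "valid b" "btame b J" "bset b \<subseteq> W" "p \<in> core b"
proof -
  obtain c where c: "c \<in> A" "p \<in> fst c" using chart_cover[OF p(1)] by blast
  let ?x = "snd c p" let ?J0 = "Jmat A c J ?x"
  have J0: "?J0 (?J0 u) = - u" for u by (rule acs_Jmat_sq[OF J c(1)]) (use c in simp)
  interpret f: complex_frame ?J0 n "zeta ?J0" "eps ?J0" \<pi> by (rule frame[OF J0])
  obtain R1 where R1: "R1 > 0" "\<forall>r. 0 < r \<longrightarrow> r \<le> R1 \<longrightarrow> f.tame ?x r (Jmat A c J)"
    using f.tame_small_ball[OF chart(2)[OF c(1)] acs_Jmat_smooth[OF J c(1)] acs_Jmat_sq[OF J c(1)] cmap_in[OF c(2)] refl] by blast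
  obtain R2 where R2: "R2 > 0" "cball ?x R2 \<subseteq> cimg c" "\<And>q. q \<in> fst c \<Longrightarrow> snd c q \<in> cball ?x R2 \<Longrightarrow> q \<in> W"
    by (rule chart_ball[OF c p(2,3)]) (rule that)
  let ?R = "min R1 R2"
  have sub: "cball ?x ?R \<subseteq> cball ?x R2" by auto
  show thesis
  proof (rule that[of "(c, ?x, ?R, ?J0)"])
    show "valid (c, ?x, ?R, ?J0)" using c R1 R2 sub J0 by (auto simp: valid_def)
    show "btame (c, ?x, ?R, ?J0) J" using R1 R2(1) by (simp add: btame_def)
    show "bset (c, ?x, ?R, ?J0) \<subseteq> W"
    proof
      fix q assume "q \<in> bset (c, ?x, ?R, ?J0)"
      then have q: "q \<in> cinv c ` cball ?x ?R" by (simp add: bset_def)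
      have "q \<in> fst c \<and> snd c q \<in> cball ?x ?R" using mem_cinv_image[OF c(1) order_trans[OF sub R2(2)]] q by blast
      then show "q \<in> W" using R2(3) sub by blast
    qed
    show "p \<in> core (c, ?x, ?R, ?J0)" using c R1(1) R2(1) by (simp add: core_def)
  qed
qed

text \<open>Small parameters keep the finitely many conditions already achieved, because these are open; and the bad parameters for the
  new ball are negligible. So some small parameter is good.\<close>

lemma perturb_step:
  assumes J: "almost_complex_structure X A J" and b: "valid b" "btame b J"
    and \<B>: "finite \<B>" "\<And>b'. b' \<in> \<B> \<Longrightarrow> valid b' \<and> btame b' J" and \<G>: "\<G> \<subseteq> \<B>" "\<And>b'. b' \<in> \<G> \<Longrightarrow> bgood b' J"
  shows "\<exists>J'. almost_complex_structure X A J' \<and> (\<forall>p. p \<notin> bset b \<longrightarrow> J' p = J p) \<and>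
     (\<forall>b'\<in>\<B>. btame b' J') \<and> (\<forall>b'\<in>\<G>. bgood b' J') \<and> bgood b J'"
proof -
  obtain c x0 R J0 where e: "b = (c, x0, R, J0)" by (cases b)
  have v: "c \<in> A" "R > 0" "cball x0 R \<subseteq> cimg c" "\<And>u. J0 (J0 u) = - u" using b by (auto simp: valid_def e)
  interpret f: complex_frame J0 n "zeta J0" "eps J0" \<pi> by (rule frame[OF v(4)])
  let ?M = "Jmat A c J"
  have t: "f.tame x0 R ?M" using b(2) by (simp add: btame_def e)
  obtain \<delta> :: real and F :: "'e^'i \<Rightarrow> 'e \<Rightarrow> 'e \<Rightarrow>\<^sub>L 'e" where \<delta>: "\<delta> > 0" and F: "smooth_on (ball 0 \<delta> \<times> cimg c) (\<lambda>(s, x). F s x)"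
    "\<And>s x u. s \<in> ball 0 \<delta> \<Longrightarrow> x \<in> cimg c \<Longrightarrow> F s x (F s x u) = - u"
    "\<And>s x. x \<in> cimg c \<Longrightarrow> x \<notin> cball x0 R \<Longrightarrow> F s x = ?M x" "\<And>x. x \<in> cimg c \<Longrightarrow> F 0 x = ?M x"
    and neg: "negligible {s \<in> ball 0 \<delta>. \<exists>x\<in>cball x0 (R / 2). f.frame_torsion (\<lambda>y. cay J0 (F s y)) x \<in> D J0}"
  proof (rule f.local_perturbation[OF chart(2)[OF v(1)] acs_Jmat_smooth[OF J v(1)] _ v(2,3) t thin_D[OF f.complex_frame_axioms]])
    fix x u assume "x \<in> cimg c" then show "?M x (?M x u) = - u" by (rule acs_Jmat_sq[OF J v(1)])
  qed (rule that)
  let ?S = "ball (0 :: 'e^'i) \<delta>"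
  define H where "H s = replace_acs c (cball x0 R) (F s) J" for s
  have Fs: "smooth_on (cimg c) (F s)" if s: "s \<in> ?S" for s
  proof -
    have "smooth_on (cimg c) (\<lambda>x. (\<lambda>(s, x). F s x) (s, x))"
      by (rule smooth_on_compose[OF chart(2)[OF v(1)] _ _ smooth_on_Pair[OF chart(2)[OF v(1)] smooth_on_const[OF chart(2)[OF v(1)]] smooth_on_id[OF chart(2)[OF v(1)]]] F(1)])
        (use s chart(2)[OF v(1)] in \<open>auto intro!: open_Times\<close>)
    then show ?thesis by simp
  qed
  have H: "almost_complex_structure X A (H s)" "\<And>x. x \<in> cimg c \<Longrightarrow> Jmat A c (H s) x = F s x" if "s \<in> ?S" for s
    unfolding H_def using replace_acs[OF J v(1) compact_cball v(3) Fs[OF that] F(2)[OF that] F(3)] by blast+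
  have Hoff: "H s p = J p" if "p \<notin> cinv c ` cball x0 R" for s p unfolding H_def by (rule replace_acs_off[OF that])
  have sc: "smooth_on (?S \<times> cimg c) (\<lambda>(s, x). Jmat A c (H s) x)"
    by (rule smooth_on_cong[OF _ _ F(1)]) (use H(2) chart(2)[OF v(1)] in \<open>auto intro!: open_Times\<close>)
  have fam: "smooth_on (?S \<times> cimg d) (\<lambda>(s, y). Jmat A d (H s) y)" if "d \<in> A" for d
    by (rule family_smooth_all_charts[OF open_ball H(1) J v(1) compact_cball v(3) sc Hoff that])
  have 0: "(0 :: 'e^'i) \<in> ?S" using \<delta> by simp
  have H0: "Jmat A d (H 0) y = Jmat A d J y" if d: "d \<in> A" "y \<in> cimg d" for d y
  proof (rule Jmat_cong_tangent[OF d])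
    fix w assume w: "w \<in> tangent_space A (cinv d y)"
    show "H 0 (cinv d y) w = J (cinv d y) w"
    proof (cases "cinv d y \<in> cinv c ` cball x0 R")
      case True
      then have q: "cinv d y \<in> fst c" "snd c (cinv d y) \<in> cimg c" using mem_cinv_image[OF v(1,3)] by auto
      have "H 0 (cinv d y) w = tvec A c (cinv d y) (?M (snd c (cinv d y)) (tcoord c (cinv d y) w))"
        using True F(4)[OF q(2)] by (simp add: H_def replace_acs_def)
      then show ?thesis using acs_Jmat[OF J v(1) q(1), of "tcoord c (cinv d y) w"] tvec_tcoord[OF v(1) q(1) w] by simp
    qed (simp add: Hoff)
  qed
  have ev: "\<forall>\<^sub>F s in nhds 0. btame b' (H s)" "b' \<in> \<G> \<Longrightarrow> \<forall>\<^sub>F s in nhds 0. bgood b' (H s)" if b': "b' \<in> \<B>" for b'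
  proof -
    obtain d y0 r K0 where e': "b' = (d, y0, r, K0)" by (cases b')
    have v': "d \<in> A" "r > 0" "cball y0 r \<subseteq> cimg d" "\<And>u. K0 (K0 u) = - u" using \<B>(2)[OF b'] by (auto simp: valid_def e')
    interpret f': complex_frame K0 n "zeta K0" "eps K0" \<pi> by (rule frame[OF v'(4)])
    have t0: "f'.tame y0 r (Jmat A d (H 0))"
      using \<B>(2)[OF b'] f'.tame_cong[OF chart(2)[OF v'(1)] v'(3) H0[OF v'(1)]] by (simp add: btame_def e')
    have op1: "\<exists>\<delta>>0. \<forall>s\<in>ball 0 \<delta>. f'.tame y0 r (Jmat A d (H s))"
      by (rule f'.tame_open(1)[OF open_ball 0 chart(2)[OF v'(1)] fam[OF v'(1)] _ v'(3,2) t0]) (rule acs_Jmat_sq[OF H(1) v'(1)])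
    have nh: "\<forall>\<^sub>F s in nhds (0::'e^'i). P s" if "\<exists>\<delta>>0. \<forall>s\<in>ball 0 \<delta>. P s" for P
      using that unfolding eventually_nhds_metric by (auto simp: dist_commute)
    show "\<forall>\<^sub>F s in nhds 0. btame b' (H s)"
      by (rule nh) (use op1 in \<open>simp add: btame_def e'\<close>)
    assume g: "b' \<in> \<G>"
    have g0: "f'.frame_torsion (\<lambda>y. cay K0 (Jmat A d (H 0) y)) x \<notin> D K0" if x: "x \<in> cball y0 (r / 2)" for x
    proof -
      have "x \<in> cimg d" using x v'(2,3) by (auto simp: subset_iff)
      then show ?thesis
        using f'.frame_torsion_cong[OF chart(2)[OF v'(1)] _ H0[OF v'(1)]] \<G>(2)[OF g] x by (simp add: bgood_def e')
    qed
    have "\<exists>\<delta>>0. \<forall>s\<in>ball 0 \<delta>. \<forall>x\<in>cball y0 (r / 2). f'.frame_torsion (\<lambda>y. cay K0 (Jmat A d (H s) y)) x \<notin> D K0"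
      by (rule f'.tame_open(2)[OF open_ball 0 chart(2)[OF v'(1)] fam[OF v'(1)] _ v'(3,2) t0 closed_D])
        (rule acs_Jmat_sq[OF H(1) v'(1)], assumption, assumption, rule g0)
    then show "\<forall>\<^sub>F s in nhds 0. bgood b' (H s)"
      by (intro nh) (simp add: bgood_def e')
  qed
  have "\<forall>\<^sub>F s in nhds 0. (\<forall>b'\<in>\<B>. btame b' (H s)) \<and> (\<forall>b'\<in>\<G>. bgood b' (H s)) \<and> s \<in> ?S"
  proof (intro eventually_conj)
    show "\<forall>\<^sub>F s in nhds 0. \<forall>b'\<in>\<B>. btame b' (H s)" by (rule eventually_ball_finite[OF \<B>(1)]) (use ev(1) in blast)
    show "\<forall>\<^sub>F s in nhds 0. \<forall>b'\<in>\<G>. bgood b' (H s)"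
      by (rule eventually_ball_finite[OF finite_subset[OF \<G>(1) \<B>(1)]]) (use ev(2) \<G>(1) in blast)
    show "\<forall>\<^sub>F s in nhds 0. s \<in> ?S" by (rule eventually_nhds_in_open[OF open_ball 0])
  qed
  then obtain O' where O': "open O'" "(0::'e^'i) \<in> O'"
    "\<And>s. s \<in> O' \<Longrightarrow> (\<forall>b'\<in>\<B>. btame b' (H s)) \<and> (\<forall>b'\<in>\<G>. bgood b' (H s)) \<and> s \<in> ?S"
    unfolding eventually_nhds by blast
  have "\<not> negligible O'" using open_not_negligible[OF O'(1)] O'(2) by blast
  then have "\<not> O' \<subseteq> {s \<in> ?S. \<exists>x\<in>cball x0 (R / 2). f.frame_torsion (\<lambda>y. cay J0 (F s y)) x \<in> D J0}"
    using negligible_subset[OF neg] by blast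
  then obtain s where s: "s \<in> O'" "\<And>x. x \<in> cball x0 (R / 2) \<Longrightarrow> f.frame_torsion (\<lambda>y. cay J0 (F s y)) x \<notin> D J0"
    using O'(3) by blast
  have sS: "s \<in> ?S" using O'(3)[OF s(1)] by blast
  have "bgood b (H s)"
  proof -
    have "f.frame_torsion (\<lambda>y. cay J0 (Jmat A c (H s) y)) x \<notin> D J0" if x: "x \<in> cball x0 (R / 2)" for x
    proof -
      have "x \<in> cimg c" using x v(2,3) by (auto simp: subset_iff)
      then show ?thesis using f.frame_torsion_cong[OF chart(2)[OF v(1)] _ H(2)[OF sS]] s(2)[OF x] by simp
    qed
    then show ?thesis by (simp add: bgood_def e)
  qed
  moreover have "\<forall>p. p \<notin> bset b \<longrightarrow> H s p = J p" using Hoff by (simp add: bset_def e)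
  ultimately show ?thesis using H(1)[OF sS] O'(3)[OF s(1)] by blast
qed

lemma perturb_finite:
  assumes J: "almost_complex_structure X A J" and F: "finite \<F>" "\<F> \<subseteq> \<B>"
    and \<B>: "finite \<B>" "\<And>b'. b' \<in> \<B> \<Longrightarrow> valid b' \<and> btame b' J" and \<G>: "\<G> \<subseteq> \<B>" "\<And>b'. b' \<in> \<G> \<Longrightarrow> bgood b' J"
  shows "\<exists>J'. almost_complex_structure X A J' \<and> (\<forall>p. p \<notin> (\<Union>b\<in>\<F>. bset b) \<longrightarrow> J' p = J p) \<and>
     (\<forall>b'\<in>\<B>. btame b' J') \<and> (\<forall>b'\<in>\<G> \<union> \<F>. bgood b' J')"
  using F
proof (induction \<F> rule: finite_induct)
  case empty
  then show ?case using J \<B>(2) \<G>(2) by (intro exI[of _ J]) auto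
next
  case (insert b \<F>)
  then obtain J1 where J1: "almost_complex_structure X A J1" "\<And>p. p \<notin> (\<Union>b\<in>\<F>. bset b) \<Longrightarrow> J1 p = J p"
     "\<And>b'. b' \<in> \<B> \<Longrightarrow> btame b' J1" "\<And>b'. b' \<in> \<G> \<union> \<F> \<Longrightarrow> bgood b' J1" by auto
  have b: "b \<in> \<B>" using insert.prems by blast
  have "\<exists>J'. almost_complex_structure X A J' \<and> (\<forall>p. p \<notin> bset b \<longrightarrow> J' p = J1 p) \<and>
     (\<forall>b'\<in>\<B>. btame b' J') \<and> (\<forall>b'\<in>\<G> \<union> \<F>. bgood b' J') \<and> bgood b J'"
    by (rule perturb_step[OF J1(1) _ J1(3)[OF b] \<B>(1)]) (use b \<B>(2) J1(3,4) \<G>(1) insert.prems in auto)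
  then obtain J2 where J2: "almost_complex_structure X A J2" "\<And>p. p \<notin> bset b \<Longrightarrow> J2 p = J1 p"
     "\<And>b'. b' \<in> \<B> \<Longrightarrow> btame b' J2" "\<And>b'. b' \<in> \<G> \<union> \<F> \<Longrightarrow> bgood b' J2" "bgood b J2" by blast
  show ?case by (rule exI[of _ J2]) (use J1(2) J2 in auto)
qed

text \<open>The balls treated at stage \<open>m\<close> cover a shell of the exhaustion and avoid \<open>C m\<close>. So the structure is final on \<open>C m\<close>
  from stage \<open>m\<close> on, and the limit exists and inherits everything from the finite stages. All test balls are chosen in
  advance, with respect to \<open>J\<close>, and the later structures stay tame on them; this keeps the limit so close to \<open>J\<close> that it is
  homotopic to it.\<close>

theorem generic_perturbation:
  assumes J: "almost_complex_structure X A J"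
  obtains J' where "almost_complex_structure X A J'" "homotopic_acs X A J J'"
    "\<And>p. p \<in> topspace X \<Longrightarrow> \<exists>b. valid b \<and> btame b J' \<and> bgood b J' \<and> p \<in> core b"
proof -
  obtain C :: "nat \<Rightarrow> 'a set" where C: "\<And>m. compactin X (C m)" "\<And>m. C m \<subseteq> X interior_of C (Suc m)"
    "topspace X = (\<Union>m. C m)" "C 0 = {}" "C 1 = {}" by (rule exhaustion) (rule that)
  have C_mono: "C m \<subseteq> C m'" if "m \<le> m'" for m m'
    using that by (induction rule: dec_induct) (use C(2) interior_of_subset in fastforce)+
  have C_int: "C m \<subseteq> X interior_of C m'" if "m < m'" for m m'
    using C(2)[of m] interior_of_mono[OF C_mono[of "Suc m" m'], of X] that by (meson Suc_leI order_trans)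
  have Ccl: "closedin X (C m)" for m using compactin_imp_closedin[OF hausdorff C(1)] .
  have ex_F: "\<exists>F. finite F \<and> (\<forall>b\<in>F. valid b \<and> btame b J \<and> bset b \<subseteq> X interior_of C (m + 3) - C m) \<and>
      C (m + 2) - X interior_of C (m + 1) \<subseteq> (\<Union>b\<in>F. core b)" for m
  proof -
    let ?Q = "C (m + 2) - X interior_of C (m + 1)" and ?W = "X interior_of C (m + 3) - C m"
    have "?Q = (topspace X - X interior_of C (m + 1)) \<inter> C (m + 2)" using C(3) by blast
    moreover have "closedin X (topspace X - X interior_of C (m + 1))" by (intro closedin_diff) auto
    ultimately have Q: "compactin X ?Q" using closed_Int_compactin[OF _ C(1)] by simp
    have W: "openin X ?W" using Ccl by (intro openin_diff) auto
    have "\<exists>b. valid b \<and> btame b J \<and> bset b \<subseteq> ?W \<and> p \<in> core b" if p: "p \<in> ?Q" for p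
    proof -
      have pW: "p \<in> ?W" using p C_int[of "m + 2" "m + 3"] C_int[of m "m + 1"] by auto
      have pX: "p \<in> topspace X" using p C(3) by blast
      show ?thesis by (rule ex_test_ball[OF J pX W pW]) blast
    qed
    then have "\<exists>g. \<forall>p\<in>?Q. valid (g p) \<and> btame (g p) J \<and> bset (g p) \<subseteq> ?W \<and> p \<in> core (g p)" by (intro bchoice ballI)
    then obtain g where "\<forall>p\<in>?Q. valid (g p) \<and> btame (g p) J \<and> bset (g p) \<subseteq> ?W \<and> p \<in> core (g p)" ..
    note g = bspec[OF this]
    have op: "openin X (core (g p))" if "p \<in> ?Q" for p
    proof -
      obtain c x0 R J0 where e: "g p = (c, x0, R, J0)" by (cases "g p")
      have "c \<in> A" using g[OF that] by (auto simp: valid_def e)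
      from openin_pullback[OF this open_ball, of x0 "R / 2"] show ?thesis by (simp add: core_def e)
    qed
    have "\<exists>\<F>. finite \<F> \<and> \<F> \<subseteq> (\<lambda>p. core (g p)) ` ?Q \<and> ?Q \<subseteq> \<Union>\<F>"
      by (rule compactinD[OF Q]) (use op g in auto)
    then obtain \<F> where \<F>: "finite \<F>" "\<F> \<subseteq> (\<lambda>p. core (g p)) ` ?Q" "?Q \<subseteq> \<Union>\<F>" by blast
    obtain I where I: "I \<subseteq> ?Q" "finite I" "\<F> = (\<lambda>p. core (g p)) ` I" using finite_subset_image[OF \<F>(1,2)] by blast
    show ?thesis
      by (rule exI[of _ "g ` I"]) (use I g \<F>(3) in auto)
  qed
  have "\<exists>F. \<forall>m. finite (F m) \<and> (\<forall>b\<in>F m. valid b \<and> btame b J \<and> bset b \<subseteq> X interior_of C (m + 3) - C m) \<and>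
      C (m + 2) - X interior_of C (m + 1) \<subseteq> (\<Union>b\<in>F m. core b)"
    by (intro choice allI ex_F)
  then obtain F where "\<forall>m. finite (F m) \<and> (\<forall>b\<in>F m. valid b \<and> btame b J \<and> bset b \<subseteq> X interior_of C (m + 3) - C m) \<and>
      C (m + 2) - X interior_of C (m + 1) \<subseteq> (\<Union>b\<in>F m. core b)" ..
  then have F: "\<And>m. finite (F m)" "\<And>m b. b \<in> F m \<Longrightarrow> valid b \<and> btame b J \<and> bset b \<subseteq> X interior_of C (m + 3) - C m"
    "\<And>m. C (m + 2) - X interior_of C (m + 1) \<subseteq> (\<Union>b\<in>F m. core b)" by simp_all
  define P where "P m J' \<longleftrightarrow> almost_complex_structure X A J' \<and> (\<forall>k. \<forall>b\<in>F k. btame b J') \<and> (\<forall>k<m. \<forall>b\<in>F k. bgood b J')" for m :: nat and J'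
  define Q where "Q m J1 J2 \<longleftrightarrow> (\<forall>p. p \<notin> X interior_of C (m + 3) - C m \<longrightarrow> J2 p = J1 p)" for m :: nat and J1 J2 :: "'a \<Rightarrow> 'a tangent \<Rightarrow> 'a tangent"
  have step: "\<exists>J2. P (Suc m) J2 \<and> Q m J1 J2" if J1: "P m J1" for m J1
  proof -
    \<comment> \<open>Balls of stage \<open>m + 3\<close> or later avoid \<open>C (m + 3)\<close>, whose complement is left unchanged at stage \<open>m\<close>.\<close>
    let ?\<B> = "\<Union>k<m + 3. F k" and ?\<G> = "\<Union>k<m. F k"
    have "\<exists>J'. almost_complex_structure X A J' \<and> (\<forall>p. p \<notin> (\<Union>b\<in>F m. bset b) \<longrightarrow> J' p = J1 p) \<and>
       (\<forall>b'\<in>?\<B>. btame b' J') \<and> (\<forall>b'\<in>?\<G> \<union> F m. bgood b' J')"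
    proof (rule perturb_finite)
      show "almost_complex_structure X A J1" using J1 by (simp add: P_def)
      show "F m \<subseteq> ?\<B>" by (rule UN_upper) simp
      show "?\<G> \<subseteq> ?\<B>" by (rule UN_mono) auto
      show "valid b' \<and> btame b' J1" if "b' \<in> ?\<B>" for b' using that F(2) J1 unfolding P_def by blast
      show "bgood b' J1" if "b' \<in> ?\<G>" for b' using that J1 unfolding P_def by blast
    qed (use F(1) in simp_all)
    then obtain J2 where J2_all: "almost_complex_structure X A J2 \<and> (\<forall>p. p \<notin> (\<Union>b\<in>F m. bset b) \<longrightarrow> J2 p = J1 p) \<and>
       (\<forall>b'\<in>?\<B>. btame b' J2) \<and> (\<forall>b'\<in>?\<G> \<union> F m. bgood b' J2)" ..
    note J2 = J2_all[THEN conjunct1] J2_all[THEN conjunct2, THEN conjunct1, THEN spec, THEN mp]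
      J2_all[THEN conjunct2, THEN conjunct2, THEN conjunct1, THEN bspec]
      J2_all[THEN conjunct2, THEN conjunct2, THEN conjunct2, THEN bspec]
    have q: "Q m J1 J2" unfolding Q_def using J2(2) F(2) by blast
    have "btame b J2" if b: "b \<in> F k" for k b
    proof (cases "k < m + 3")
      case True then show ?thesis using J2(3) b by blast
    next
      case False
      have "bset b \<subseteq> topspace X - C (m + 3)"
        using F(2)[OF b] C_mono[of "m + 3" k] False interior_of_subset_topspace[of X "C (k + 3)"] by auto
      moreover have "openin X (topspace X - C (m + 3))" using Ccl by (simp add: closedin_def)
      moreover have "J1 q = J2 q" if "q \<in> topspace X - C (m + 3)" for q
        using q that interior_of_subset[of X "C (m + 3)"] unfolding Q_def by auto
      ultimately show ?thesis using ball_cong(1)[of b "topspace X - C (m + 3)" J1 J2] F(2)[OF b] J1 b by (auto simp: P_def)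
    qed
    moreover have "bgood b J2" if "k < Suc m" "b \<in> F k" for k b
    proof -
      have "b \<in> ?\<G> \<union> F m" using that less_Suc_eq by blast
      then show ?thesis by (rule J2(4))
    qed
    ultimately have "P (Suc m) J2" using J2(1) by (auto simp: P_def)
    then show ?thesis using q by blast
  qed
  have "\<exists>f. \<forall>m. P m (f m) \<and> Q m (f m) (f (Suc m)) \<and> (m = 0 \<longrightarrow> f m = J)"
  proof -
    have "\<exists>f. \<forall>m. (P m (f m) \<and> (m = 0 \<longrightarrow> f m = J)) \<and> Q m (f m) (f (Suc m))"
    proof (rule dependent_nat_choice)
      show "\<exists>x. P 0 x \<and> (0 = (0::nat) \<longrightarrow> x = J)" using J F(2) by (auto simp: P_def)
      show "\<exists>y. (P (Suc m) y \<and> (Suc m = 0 \<longrightarrow> y = J)) \<and> Q m x y" if "P m x \<and> (m = 0 \<longrightarrow> x = J)" for x m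
        using step[of m x] that by auto
    qed
    then show ?thesis by blast
  qed
  then obtain f where f: "\<And>m. P m (f m)" "\<And>m. Q m (f m) (f (Suc m))" by blast
  have stable: "f m p = f k p" if "p \<in> C k" "k \<le> m" for p k m
    using that(2)
  proof (induction m rule: dec_induct)
    case (step m)
    have "p \<in> C m" using C_mono[OF step.hyps(1)] that(1) by blast
    then have "f (Suc m) p = f m p" using f(2)[of m] unfolding Q_def by blast
    then show ?case using step.IH by simp
  qed simp
  define J' where "J' p = f (LEAST k. p \<in> C k) p" for p
  have J'_eq: "J' p = f m p" if "p \<in> C m" for p m
    unfolding J'_def using stable[of p "LEAST k. p \<in> C k" m] LeastI[of "\<lambda>k. p \<in> C k", OF that] Least_le[of "\<lambda>k. p \<in> C k", OF that] by simp
  have J'_int: "J' q = f m q" if "q \<in> X interior_of C m" for q m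
    using J'_eq that interior_of_subset by fastforce
  have acs: "almost_complex_structure X A J'"
  proof (rule acs_local)
    fix p assume "p \<in> topspace X"
    then obtain m where m: "p \<in> C m" using C(3) by blast
    show "\<exists>W J''. openin X W \<and> p \<in> W \<and> almost_complex_structure X A J'' \<and> (\<forall>q\<in>W. J' q = J'' q)"
      by (rule exI[of _ "X interior_of C (Suc m)"], rule exI[of _ "f (Suc m)"])
        (use m C(2) f(1)[of "Suc m"] J'_int in \<open>auto simp: P_def\<close>)
  qed
  have tests: "valid b \<and> btame b J' \<and> bgood b J'" if b: "b \<in> F m" for b m
  proof -
    have vb: "valid b" "bset b \<subseteq> X interior_of C (m + 3)" using F(2)[OF b] by auto
    have "btame b J' \<longleftrightarrow> btame b (f (m + 3))" "bgood b J' \<longleftrightarrow> bgood b (f (m + 3))"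
      by (rule ball_cong[OF vb(1) openin_interior_of vb(2) J'_int]; simp)+
    moreover have t3: "\<forall>k. \<forall>b\<in>F k. btame b (f (m + 3))" and g3: "\<forall>k<m + 3. \<forall>b\<in>F k. bgood b (f (m + 3))"
      using f(1)[of "m + 3"] unfolding P_def by blast+
    have "m < m + 3" by simp
    note bspec[OF t3[THEN spec] b] bspec[OF g3[THEN spec, THEN mp, OF this] b]
    ultimately show ?thesis using vb(1) by simp
  qed
  have cover: "\<exists>m b. b \<in> F m \<and> p \<in> core b" if p: "p \<in> topspace X" for p
  proof -
    let ?k = "LEAST k. p \<in> C k"
    have k: "p \<in> C ?k" using p C(3) by (metis (mono_tags, lifting) LeastI UN_E)
    then have "?k \<noteq> 0" "?k \<noteq> 1" using C(4,5) by (metis empty_iff)+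
    then obtain m where m: "?k = m + 2" by (metis One_nat_def add_2_eq_Suc' not0_implies_Suc)
    have "p \<notin> C (m + 1)" using not_less_Least[of "m + 1" "\<lambda>k. p \<in> C k"] m by simp
    then have "p \<notin> X interior_of C (m + 1)" using interior_of_subset[of X "C (m + 1)"] by blast
    then have "p \<in> (\<Union>b\<in>F m. core b)" using F(3)[of m] k m by auto
    then show ?thesis by blast
  qed
  have near: "\<exists>c\<in>A. p \<in> fst c \<and> norm (Jmat A c J (snd c p)) * norm (Jmat A c J' (snd c p) - Jmat A c J (snd c p)) < 1"
    if p: "p \<in> topspace X" for p
  proof -
    obtain m b where b: "b \<in> F m" "p \<in> core b" using cover[OF p] by blast
    obtain c x0 R J0 where e: "b = (c, x0, R, J0)" by (cases b)
    have v: "c \<in> A" "R > 0" "cball x0 R \<subseteq> cimg c" "\<And>u. J0 (J0 u) = - u" using tests[OF b(1)] by (auto simp: valid_def e)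
    interpret f: complex_frame J0 n "zeta J0" "eps J0" \<pi> by (rule frame[OF v(4)])
    have pc: "p \<in> fst c" "snd c p \<in> cball x0 R" using b(2) v(2) by (auto simp: core_def e)
    let ?x = "snd c p"
    have 1: "norm J0 * norm (Jmat A c J ?x - J0) < 1 / 4"
    proof -
      have "f.tame x0 R (Jmat A c J)" using F(2)[OF b(1)] by (simp add: btame_def e)
      from bspec[OF this[unfolded f.tame_def] pc(2)] show ?thesis by blast
    qed
    have 2: "norm J0 * norm (Jmat A c J' ?x - J0) < 1 / 4"
    proof -
      have "f.tame x0 R (Jmat A c J')" using tests[OF b(1)] by (simp add: btame_def e)
      from bspec[OF this[unfolded f.tame_def] pc(2)] show ?thesis by blast
    qed
    have j1: "norm J0 \<ge> 1"
    proof (rule ccontr)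
      assume lt: "\<not> ?thesis"
      obtain u :: 'e where u: "norm u = 1" using vector_choose_size[of 1] by auto
      have "norm (J0 (J0 u)) \<le> norm J0 * (norm J0 * norm u)"
        by (meson norm_blinfun order_trans mult_left_mono norm_ge_zero)
      also have "\<dots> \<le> norm J0 * 1" using lt u by (intro mult_left_mono) auto
      finally show False using lt u v(4) by simp
    qed
    let ?a = "norm (Jmat A c J ?x - J0)" and ?b = "norm (Jmat A c J' ?x - J0)"
    have ab: "?a \<le> norm J0 * ?a" "?b \<le> norm J0 * ?b" using mult_right_mono[OF j1 norm_ge_zero, of "Jmat A c J ?x - J0"]
        mult_right_mono[OF j1 norm_ge_zero, of "Jmat A c J' ?x - J0"] by simp_all
    have n1: "norm (Jmat A c J ?x) \<le> norm J0 + ?a" using norm_triangle_sub by blast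
    have n2: "norm (Jmat A c J' ?x - Jmat A c J ?x) \<le> ?a + ?b"
      using norm_triangle_ineq4[of "Jmat A c J' ?x - J0" "Jmat A c J ?x - J0"] by simp
    have "norm (Jmat A c J ?x) * norm (Jmat A c J' ?x - Jmat A c J ?x) \<le> (norm J0 + ?a) * (?a + ?b)"
      by (intro mult_mono n1 n2) auto
    also have "\<dots> = norm J0 * ?a + norm J0 * ?b + ?a * (?a + ?b)" by (simp add: algebra_simps)
    also have "\<dots> \<le> 1 / 4 + 1 / 4 + (1 / 4) * (1 / 4 + 1 / 4)"
      using 1 2 ab by (intro add_mono mult_mono) auto
    also have "\<dots> < 1" by simp
    finally show ?thesis using v(1) pc(1) by blast
  qed
  show thesis
    by (rule that[OF acs homotopic_of_near[OF J acs near]]) (use tests cover in blast)+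
qed

text \<open>Tameness gives the Cayley transform on the ball, and with it the formula for the Nijenhuis tensor.\<close>

lemma acs_graph_of_test_ball:
  assumes J: "almost_complex_structure X A J" and b: "valid (c, x0, R, J0)" "btame (c, x0, R, J0) J" and p: "p \<in> core (c, x0, R, J0)"
  shows "acs_graph X A J c p (ball x0 R) J0 (\<lambda>y. cay J0 (Jmat A c J y))"
proof -
  have v: "c \<in> A" "R > 0" "cball x0 R \<subseteq> cimg c" "\<And>u. J0 (J0 u) = - u" using b by (auto simp: valid_def)
  interpret f: complex_frame J0 n "zeta J0" "eps J0" \<pi> by (rule frame[OF v(4)])
  have near: "norm J0 * norm (Jmat A c J x - J0) \<le> 1 / 4" if "x \<in> ball x0 R" for x
  proof -
    have t: "f.tame x0 R (Jmat A c J)" using b(2) by (simp add: btame_def)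
    have "x \<in> cball x0 R" using that by simp
    from bspec[OF t[unfolded f.tame_def] this] show ?thesis by linarith
  qed
  have sub: "ball x0 R \<subseteq> cimg c" using v(3) by auto
  note cy = cay[OF v(4) acs_Jmat_sq[OF J v(1) subsetD[OF sub]] near]
  have sM: "smooth_on (ball x0 R) (Jmat A c J)" by (rule smooth_on_subset[OF acs_Jmat_smooth[OF J v(1)] sub])
  have "graph_rep J0 (\<lambda>y. cay J0 (Jmat A c J y)) (Jmat A c J) (ball x0 R)"
  proof
    show "smooth_on (ball x0 R) (\<lambda>y. cay J0 (Jmat A c J y))"
      by (rule smooth_on_cay[OF open_ball smooth_on_const[OF open_ball] sM]) (use cy(1) in auto)
    show "cay J0 (Jmat A c J x) (J0 u) = - J0 (cay J0 (Jmat A c J x) u)" if "x \<in> ball x0 R" for x u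
      by (rule cy(3)[OF that that]) simp
    show "Jmat A c J x (u + cay J0 (Jmat A c J x) u) = J0 u + cay J0 (Jmat A c J x) (J0 u)" if "x \<in> ball x0 R" for x u
      by (rule cy(4)[OF that that]) simp
    show "u = 0" if "x \<in> ball x0 R" "u + cay J0 (Jmat A c J x) u = 0" for x u
    proof (rule invertible_one_plus_cay_inj[OF _ that(2)])
      have "norm (cay J0 (Jmat A c J x)) \<le> 1 / 4" by (rule cy(2)[OF that(1) that(1)]) simp
      then show "norm (cay J0 (Jmat A c J x)) < 1" by simp
    qed
  qed (simp_all add: v(4))
  then show ?thesis
    unfolding acs_graph_def acs_graph_axioms_def
    using J v(1) sub p v(2) smooth_mfd_axioms by (auto simp: core_def)
qed

end

section \<open>Generic structures are non-integrable\<close>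

text \<open>This is used with \<open>2 n\<close> pairs, which exist for \<open>n \<ge> 5\<close>, and with two pairs, which exist for \<open>n \<ge> 3\<close>.\<close>

lemma ex_pairs:
  assumes "CARD('i::finite) \<le> n choose 2"
  obtains \<pi> :: "'i::finite \<Rightarrow> nat \<times> nat" where "inj \<pi>" "\<And>i. fst (\<pi> i) < snd (\<pi> i)" "\<And>i. snd (\<pi> i) < n"
proof -
  let ?P = "{(j, l). j < l \<and> l < n}"
  have fin: "finite ?P" by (rule finite_subset[of _ "{..<n} \<times> {..<n}"]) auto
  have "card ?P = n choose 2"
  proof (induction n)
    case (Suc n)
    have e: "{(j, l). j < l \<and> l < Suc n} = {(j, l). j < l \<and> l < n} \<union> (\<lambda>j. (j, n)) ` {..<n}" by (auto simp: less_Suc_eq)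
    have "finite {(j, l). j < l \<and> l < n}" by (rule finite_subset[of _ "{..<n} \<times> {..<n}"]) auto
    then have "card {(j, l). j < l \<and> l < Suc n} = card {(j, l). j < l \<and> l < n} + card ((\<lambda>j. (j, n)) ` {..<n})"
      unfolding e by (intro card_Un_disjoint) auto
    also have "card ((\<lambda>j. (j, n)) ` {..<n}) = n" by (subst card_image) (auto simp: inj_on_def)
    finally show ?case using Suc by (simp add: numeral_2_eq_2)
  qed simp
  then have "card (UNIV :: 'i set) \<le> card ?P" using assms by simp
  then obtain \<pi> :: "'i \<Rightarrow> nat \<times> nat" where "inj \<pi>" "range \<pi> \<subseteq> ?P" using card_le_inj[of "UNIV :: 'i set" ?P] fin by auto
  then show thesis by (intro that[of \<pi>]) (auto simp: image_subset_iff split_beta)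
qed

theorem corollary1p1:
  fixes X :: "'a topology"
    and A :: "('a, 'e::euclidean_space) chart set"
    and n :: nat
  assumes "smooth_manifold X A"
    and "DIM('e) = 2 * n"
  shows "(2 * n \<ge> 10 \<longrightarrow>
           (\<forall>J. almost_complex_structure X A J \<longrightarrow>
             (\<exists>J'. almost_complex_structure X A J' \<and> maximally_non_integrable n X A J' \<and>
                   homotopic_acs X A J J'))) \<and>
         (2 * n \<ge> 6 \<longrightarrow>
           (\<forall>J. almost_complex_structure X A J \<longrightarrow>
             (\<exists>J'. almost_complex_structure X A J' \<and> everywhere_non_integrable X A J' \<and>
                   homotopic_acs X A J J')))"
proof (intro conjI impI allI)
  fix J assume n: "2 * n \<ge> 10" and J: "almost_complex_structure X A J"
  have c2: "2 * n \<le> n choose 2"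
  proof -
    have "4 * n \<le> n * (n - 1)" using n by (simp add: mult.commute[of 4])
    then have "4 * n div 2 \<le> n * (n - 1) div 2" by (rule div_le_mono)
    then show ?thesis by (simp only: choose_two)
  qed
  have "CARD('e basis_index) \<le> n choose 2" using c2 assms(2) by (simp add: card_basis_index)
  then obtain \<pi> :: "'e basis_index \<Rightarrow> nat \<times> nat" where \<pi>: "inj \<pi>" "\<And>i. fst (\<pi> i) < snd (\<pi> i)" "\<And>i. snd (\<pi> i) < n"
    by (rule ex_pairs) (rule that)
  interpret G: generic_scheme X A n \<pi> degenerate
  proof
    show "thin TYPE('e) TYPE('e \<times> ('e^'e basis_index)) (degenerate J0 :: ('e^'e basis_index) set)"
      if "complex_frame J0 n \<zeta> \<epsilon> \<pi>" for J0 \<zeta> \<epsilon>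
      by (rule complex_frame.thin_degenerate[OF that]) (use assms(2) in \<open>simp add: card_basis_index\<close>)
  qed (use assms \<pi> closed_degenerate in auto)
  obtain J' where J': "almost_complex_structure X A J'" "homotopic_acs X A J J'"
    "\<And>p. p \<in> topspace X \<Longrightarrow> \<exists>b. G.valid b \<and> G.btame b J' \<and> G.bgood b J' \<and> p \<in> G.core b"
    by (rule G.generic_perturbation[OF J]) (rule that)
  have "nijenhuis_rank X A J' p = n" if p: "p \<in> topspace X" for p
  proof -
    obtain c x0 R J0 where b: "G.valid (c, x0, R, J0)" "G.btame (c, x0, R, J0) J'" "G.bgood (c, x0, R, J0) J'" "p \<in> G.core (c, x0, R, J0)"
      using J'(3)[OF p] by (metis prod_cases4)
    have v: "c \<in> A" "R > 0" "\<And>u. J0 (J0 u) = - u" using b(1) by (auto simp: G.valid_def)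
    interpret f: complex_frame J0 n "G.zeta J0" "G.eps J0" \<pi> by (rule G.frame[OF v(3)])
    let ?K = "\<lambda>y. cay J0 (Jmat A c J' y)"
    interpret a: acs_graph X A J' c p "ball x0 R" J0 ?K by (rule G.acs_graph_of_test_ball[OF J'(1) b(1,2,4)])
    have "snd c p \<in> cball x0 (R / 2)" using b(4) by (auto simp: G.core_def)
    then have nd: "f.frame_torsion ?K (snd c p) \<notin> degenerate J0" using b(3) by (simp add: G.bgood_def)
    show ?thesis
    proof (rule a.nijenhuis_rank[OF assms(2)])
      fix l :: "'e \<Rightarrow>\<^sub>L complex" and v
      assume lJ: "\<And>u. l (J0 u) = \<i> * l u" and l0: "\<And>u w. l (torsion J0 ?K (snd c p) u w) = 0"
      let ?\<alpha> = "adjoint (\<lambda>u. Re (l u)) 1"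
      have lin: "linear (\<lambda>u. Re (l u))"
        by standard (simp_all add: blinfun.add_right blinfun.scaleR_right)
      have \<alpha>: "?\<alpha> \<bullet> u = Re (l u)" for u using adjoint_works[OF lin, of u 1] by (simp add: inner_commute)
      have "?\<alpha> = 0"
      proof (rule ccontr)
        assume a0: "?\<alpha> \<noteq> 0"
        let ?\<beta> = "(1 / norm ?\<alpha>) *\<^sub>R ?\<alpha>"
        have "norm ?\<beta> = 1" using a0 by simp
        moreover have "?\<beta> \<bullet> f.frame_torsion ?K (snd c p) $ i = 0 \<and> ?\<beta> \<bullet> J0 (f.frame_torsion ?K (snd c p) $ i) = 0" for i
          by (simp add: f.frame_torsion_def \<alpha> lJ l0)
        ultimately show False using nd unfolding degenerate_def by blast
      qed
      then have "Re (l u) = 0" for u using \<alpha>[of u] by simp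
      from this[of v] this[of "J0 v"] show "l v = 0" by (simp add: lJ complex_eq_iff)
    qed
  qed
  moreover have "min n (n choose 2) = n" using c2 by simp
  ultimately show "\<exists>J'. almost_complex_structure X A J' \<and> maximally_non_integrable n X A J' \<and> homotopic_acs X A J J'"
    using J' unfolding maximally_non_integrable_def by auto
next
  fix J assume n: "2 * n \<ge> 6" and J: "almost_complex_structure X A J"
  have "CARD(bool) \<le> n choose 2"
  proof -
    have "2 * 2 \<le> n * (n - 1)" using n mult_le_mono[of 2 n 2 "n - 1"] by simp
    then show ?thesis by (simp add: choose_two)
  qed
  then obtain \<pi> :: "bool \<Rightarrow> nat \<times> nat" where \<pi>: "inj \<pi>" "\<And>i. fst (\<pi> i) < snd (\<pi> i)" "\<And>i. snd (\<pi> i) < n"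
    by (rule ex_pairs) (rule that)
  interpret G: generic_scheme X A n \<pi> "\<lambda>_. {0}"
  proof
    show "thin TYPE('e) TYPE('e \<times> ('e^bool)) {0 :: 'e^bool}" by (rule thin_zero) simp
  qed (use assms \<pi> in auto)
  obtain J' where J': "almost_complex_structure X A J'" "homotopic_acs X A J J'"
    "\<And>p. p \<in> topspace X \<Longrightarrow> \<exists>b. G.valid b \<and> G.btame b J' \<and> G.bgood b J' \<and> p \<in> G.core b"
    by (rule G.generic_perturbation[OF J]) (rule that)
  have "\<exists>\<alpha>\<in>A10 A J' p. nijenhuis X A J' p \<alpha> \<noteq> 0" if p: "p \<in> topspace X" for p
  proof -
    obtain c x0 R J0 where b: "G.valid (c, x0, R, J0)" "G.btame (c, x0, R, J0) J'" "G.bgood (c, x0, R, J0) J'" "p \<in> G.core (c, x0, R, J0)"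
      using J'(3)[OF p] by (metis prod_cases4)
    have v: "c \<in> A" "R > 0" "\<And>u. J0 (J0 u) = - u" using b(1) by (auto simp: G.valid_def)
    interpret f: complex_frame J0 n "G.zeta J0" "G.eps J0" \<pi> by (rule G.frame[OF v(3)])
    let ?K = "\<lambda>y. cay J0 (Jmat A c J' y)"
    interpret a: acs_graph X A J' c p "ball x0 R" J0 ?K by (rule G.acs_graph_of_test_ball[OF J'(1) b(1,2,4)])
    have "snd c p \<in> cball x0 (R / 2)" using b(4) by (auto simp: G.core_def)
    then have "f.frame_torsion ?K (snd c p) \<noteq> 0" using b(3) by (simp add: G.bgood_def)
    then obtain i where "torsion J0 ?K (snd c p) (G.eps J0 (fst (\<pi> i))) (G.eps J0 (snd (\<pi> i))) \<noteq> 0"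
      by (auto simp: f.frame_torsion_def vec_eq_iff)
    then show ?thesis by (rule a.nijenhuis_nonzero)
  qed
  then show "\<exists>J'. almost_complex_structure X A J' \<and> everywhere_non_integrable X A J' \<and> homotopic_acs X A J J'"
    using J' unfolding everywhere_non_integrable_def by blast
qed

end
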